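(* Let $\Sigma\subset\mathbb{H}^2$ be an open half-space and $S\subset\mathbb{H}^2$ a connected closed smooth hypersurface of $\Sigma$. Assume that $\Sigma\setminus S$ splits into two connected components $D$ and $W$, with $D$ bounded. Let $f:S\to\mathbb{H}$ be a smooth admissible function. Then $f$ extends to $D$ by an $\mathbb{H}$-holomorphic function $F$ which is smooth up to $S$ (i.e. $F$ is $\mathbb{H}$-holomorphic in $D$, extends smoothly to $D\cup S$, and $F|_S=f$).
   Context: Smooth means $C^\infty$. $\mathbb{H}$ is the quaternion algebra with real basis $\mathsf{i}_0=1,\mathsf{i}_1=\mathsf{i},\mathsf{i}_2=\mathsf{j},\mathsf{i}_3=\mathsf{k}$. Points of $\mathbb{H}^2\simeq\mathbb{R}^8$ are $(q_1,q_2)$, $q_1=\sum_{\alpha=0}^3 x_\alpha\mathsf{i}_\alpha$, $q_2=\sum_{\alpha=0}^3 y_\alpha\mathsf{i}_\alpha$. For a $C^1$ $\mathbb{H}$-valued function $F$ put $\frac{\partial F}{\partial\bar q_1}=\sum_\alpha\mathsf{i}_\alpha\frac{\partial F}{\partial x_\alpha}$, $\frac{\partial F}{\partial\bar q_2}=\sum_\alpha\mathsf{i}_\alpha\frac{\partial F}{\partial y_\alpha}$, $\overline{\mathfrak D}F=\big(\frac{\partial F}{\partial\bar q_1},\frac{\partial F}{\partial\bar q_2}\big)$. A $C^1$ function $F$ is (left) $\mathbb{H}$-holomorphic if $\overline{\mathfrak D}F=0$. Half-spaces are with respect to the real structure $\mathbb{R}^8$; "closed" means closed in $\Sigma$. CRF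 functions: let $S=\{\rho=0\}$ be an orientable smooth real hypersurface, where $\rho$ is a smooth real function on an open set containing $S$ with $\nabla\rho\neq0$ on $S$. A smooth $f:S\to\mathbb{H}$ is a CRF function if it has a smooth extension $F$ to a neighborhood of $S$ with $\overline{\mathfrak D}F=\rho A+\overline{\mathfrak D}\rho\cdot B$, $A$ ($\mathbb{H}^2$-valued) and $B$ ($\mathbb{H}$-valued) smooth, where $\overline{\mathfrak D}\rho\cdot B=\big(\frac{\partial\rho}{\partial\bar q_1}B,\frac{\partial\rho}{\partial\bar q_2}B\big)$ (the condition is independent of $F$ and $\rho$). Admissible functions: let $dq_1=\sum\mathsf{i}_\alpha dx_\alpha$, $\overline{dq}_1=\sum\bar{\mathsf{i}}_\alpha dx_\alpha$, $dq_2=\sum\mathsf{i}_\alpha dy_\alpha$, $\overline{dq}_2=\sum\bar{\mathsf{i}}_\alpha dy_\alpha$, $dx=dx_0\wedge\dots\wedge dx_3$, $dy=dy_0\wedge\dots\wedge dy_3$ (in wedge products of $\mathbb{H}$-valued forms the coefficients are multiplied in the written order). Let $\nu$ be a unit normal field of $S$ and $\omega$ the volume form of $S$ with $\omega=-\iota_\nu(dx\wedge dy)|_S$. For smooth $f:S\to\mathbb{H}$ define $f^\perp:S\to\mathbb{H}$ by $$-\tfrac12\big(\overline{dq}_1\wedge dq_1\wedge dy+dx\wedge\overline{dq}_2\wedge dq_2\big)\big|_S\wedge df=f^\perp\,\omega .$$ Let $\tau_{x_\alpha},\tau_{y_\alpha}$ be the components of $\frac{\partial}{\partial x_\alpha},\frac{\partial}{\partial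 y_\alpha}$ tangential to $S$, and $f_{(x_\alpha)}=\tau_{x_\alpha}(f)+(\frac{\partial}{\partial x_\alpha},\nu)f^\perp$, $f_{(y_\alpha)}=\tau_{y_\alpha}(f)+(\frac{\partial}{\partial y_\alpha},\nu)f^\perp$, with $(\cdot,\cdot)$ the Euclidean scalar product of $\mathbb{R}^8$. These do not depend on the choice of $\nu$. A smooth CRF function $f$ is admissible if all $f_{(x_\alpha)},f_{(y_\alpha)}$, $\alpha=0,1,2,3$, are CRF functions. *)

theory Defs
  imports "HOL-Analysis.Analysis"
begin

section \<open>Quaternions\<close>

codatatype quat = Quat (qRe: real) (qIm1: real) (qIm2: real) (qIm3: real)

lemma quat_eq_iff:
  "x = y \<longleftrightarrow> qRe x = qRe y \<and> qIm1 x = qIm1 y \<and> qIm2 x = qIm2 y \<and> qIm3 x = qIm3 y"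
  by (auto intro: quat.expand)

instantiation quat :: ring_1
begin

primcorec zero_quat where
  "qRe 0 = 0" | "qIm1 0 = 0" | "qIm2 0 = 0" | "qIm3 0 = 0"

primcorec one_quat where
  "qRe 1 = 1" | "qIm1 1 = 0" | "qIm2 1 = 0" | "qIm3 1 = 0"

primcorec plus_quat where
  "qRe (x + y) = qRe x + qRe y"
| "qIm1 (x + y) = qIm1 x + qIm1 y"
| "qIm2 (x + y) = qIm2 x + qIm2 y"
| "qIm3 (x + y) = qIm3 x + qIm3 y"

primcorec uminus_quat where
  "qRe (- x) = - qRe x"
| "qIm1 (- x) = - qIm1 x"
| "qIm2 (- x) = - qIm2 x"
| "qIm3 (- x) = - qIm3 x"

primcorec minus_quat where
  "qRe (x - y) = qRe x - qRe y"
| "qIm1 (x - y) = qIm1 x - qIm1 y"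
| "qIm2 (x - y) = qIm2 x - qIm2 y"
| "qIm3 (x - y) = qIm3 x - qIm3 y"

primcorec times_quat where
  "qRe (x * y) = qRe x * qRe y - qIm1 x * qIm1 y - qIm2 x * qIm2 y - qIm3 x * qIm3 y"
| "qIm1 (x * y) = qRe x * qIm1 y + qIm1 x * qRe y + qIm2 x * qIm3 y - qIm3 x * qIm2 y"
| "qIm2 (x * y) = qRe x * qIm2 y - qIm1 x * qIm3 y + qIm2 x * qRe y + qIm3 x * qIm1 y"
| "qIm3 (x * y) = qRe x * qIm3 y + qIm1 x * qIm2 y - qIm2 x * qIm1 y + qIm3 x * qRe y"

instance
  by standard (auto simp: quat_eq_iff algebra_simps)

end

instantiation quat :: real_algebra_1
begin

primcorec scaleR_quat where
  "qRe (scaleR r x) = r * qRe x"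
| "qIm1 (scaleR r x) = r * qIm1 x"
| "qIm2 (scaleR r x) = r * qIm2 x"
| "qIm3 (scaleR r x) = r * qIm3 x"

instance
  by standard (auto simp: quat_eq_iff algebra_simps)

end

instantiation quat :: real_inner
begin

definition inner_quat :: "quat \<Rightarrow> quat \<Rightarrow> real" where
  "inner_quat x y = qRe x * qRe y + qIm1 x * qIm1 y + qIm2 x * qIm2 y + qIm3 x * qIm3 y"

definition norm_quat :: "quat \<Rightarrow> real" where
  "norm_quat x = sqrt (inner x x)"

definition sgn_quat :: "quat \<Rightarrow> quat" where
  "sgn_quat x = x /\<^sub>R norm x"

definition dist_quat :: "quat \<Rightarrow> quat \<Rightarrow> real" where
  "dist_quat x y = norm (x - y)"

definition uniformity_quat :: "(quat \<times> quat) filter" where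
  "uniformity_quat = (INF e\<in>{0 <..}. principal {(x, y). dist x y < e})"

definition open_quat :: "quat set \<Rightarrow> bool" where
  "open_quat U \<longleftrightarrow> (\<forall>x\<in>U. eventually (\<lambda>(x', y). x' = x \<longrightarrow> y \<in> U) uniformity)"

instance
proof
  fix x y z :: quat and r :: real and U :: "quat set"
  show "dist x y = norm (x - y)" by (rule dist_quat_def)
  show "sgn x = x /\<^sub>R norm x" by (rule sgn_quat_def)
  show "(uniformity :: (quat \<times> quat) filter) = (INF e\<in>{0 <..}. principal {(x, y). dist x y < e})"
    by (rule uniformity_quat_def)
  show "open U \<longleftrightarrow> (\<forall>x\<in>U. eventually (\<lambda>(x', y). x' = x \<longrightarrow> y \<in> U) uniformity)"
    by (rule open_quat_def)
  show "norm x = sqrt (inner x x)" by (rule norm_quat_def)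
  show "inner x y = inner y x" by (simp add: inner_quat_def mult.commute)
  show "inner (x + y) z = inner x z + inner y z" by (simp add: inner_quat_def algebra_simps)
  show "inner (scaleR r x) y = r * inner x y" by (simp add: inner_quat_def algebra_simps)
  show "0 \<le> inner x x" by (simp add: inner_quat_def)
  show "inner x x = 0 \<longleftrightarrow> x = 0"
    unfolding inner_quat_def quat_eq_iff zero_quat.sel
    by (smt (verit) mult_eq_0_iff zero_le_square)
qed

end

lemma norm_quat_mult: "norm (x * y) = norm x * norm (y :: quat)"
proof -
  have "inner (x * y) (x * y) = inner x x * inner y y"
    unfolding inner_quat_def times_quat.sel by algebra
  then show ?thesis by (simp add: norm_quat_def real_sqrt_mult)
qed

instance quat :: real_normed_algebra_1
proof
  show "norm (1 :: quat) = 1" by (simp add: norm_quat_def inner_quat_def)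
qed (simp add: norm_quat_mult)

definition qunit :: "nat \<Rightarrow> quat" where
  "qunit \<alpha> = [Quat 1 0 0 0, Quat 0 1 0 0, Quat 0 0 1 0, Quat 0 0 0 1] ! \<alpha>"

instantiation quat :: euclidean_space
begin

definition Basis_quat :: "quat set" where
  "Basis_quat = {Quat 1 0 0 0, Quat 0 1 0 0, Quat 0 0 1 0, Quat 0 0 0 1}"

instance
proof
  fix u v x :: quat
  show "(Basis :: quat set) \<noteq> {}" "finite (Basis :: quat set)"
    unfolding Basis_quat_def by blast+
  show "inner u v = (if u = v then 1 else 0)" if "u \<in> Basis" "v \<in> Basis"
    using that unfolding Basis_quat_def inner_quat_def
    by (elim insertE emptyE; hypsubst; simp only: quat.sel quat.inject; simp)
  have "(\<forall>u\<in>Basis. inner x u = 0) \<longleftrightarrow> qRe x = 0 \<and> qIm1 x = 0 \<and> qIm2 x = 0 \<and> qIm3 x = 0"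
    unfolding Basis_quat_def inner_quat_def ball_simps quat.sel by simp
  then show "(\<forall>u\<in>Basis. inner x u = 0) \<longleftrightarrow> x = 0"
    unfolding quat_eq_iff zero_quat.sel .
qed

end

primcorec qcnj :: "quat \<Rightarrow> quat" where
  "qRe (qcnj x) = qRe x"
| "qIm1 (qcnj x) = - qIm1 x"
| "qIm2 (qcnj x) = - qIm2 x"
| "qIm3 (qcnj x) = - qIm3 x"

type_synonym quat2 = "quat \<times> quat"

definition e_x :: "nat \<Rightarrow> quat2" where "e_x \<alpha> = (qunit \<alpha>, 0)"
definition e_y :: "nat \<Rightarrow> quat2" where "e_y \<alpha> = (0, qunit \<alpha>)"


section \<open>Smoothness\<close>

text \<open>\<open>Ck_on\<close> and \<open>smooth_on\<close> are meant for open \<open>U\<close>, as they use the derivative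
  at a point without restriction to \<open>U\<close>; \<open>smooth_map_on\<close> is for arbitrary subsets.\<close>

primrec Ck_on ::
  "nat \<Rightarrow> ('a::euclidean_space \<Rightarrow> 'b::euclidean_space) \<Rightarrow> 'a set \<Rightarrow> bool" where
  "Ck_on 0 F U \<longleftrightarrow> continuous_on U F"
| "Ck_on (Suc k) F U \<longleftrightarrow>
     (\<forall>z\<in>U. F differentiable (at z)) \<and> (\<forall>v. Ck_on k (\<lambda>z. frechet_derivative F (at z) v) U)"

definition smooth_on ::
  "('a::euclidean_space \<Rightarrow> 'b::euclidean_space) \<Rightarrow> 'a set \<Rightarrow> bool" where
  "smooth_on F U \<longleftrightarrow> (\<forall>k. Ck_on k F U)"

text \<open>Smoothness on a subset of Euclidean space (below: a hypersurface, or an open set together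
  with a smooth part of its boundary) is the existence of smooth local extensions.\<close>

definition smooth_map_on ::
  "('a::euclidean_space \<Rightarrow> 'b::euclidean_space) \<Rightarrow> 'a set \<Rightarrow> bool" where
  "smooth_map_on f X \<longleftrightarrow>
     (\<forall>p\<in>X. \<exists>U G. open U \<and> p \<in> U \<and> smooth_on G U \<and> (\<forall>z\<in>U \<inter> X. G z = f z))"


section \<open>Hypersurfaces\<close>

definition defining_function :: "quat2 set \<Rightarrow> quat2 set \<Rightarrow> (quat2 \<Rightarrow> real) \<Rightarrow> bool" where
  "defining_function S U \<rho> \<longleftrightarrow> open U \<and> smooth_on \<rho> U \<and> S = {z \<in> U. \<rho> z = 0} \<and>
     (\<forall>z\<in>S. \<exists>v. frechet_derivative \<rho> (at z) v \<noteq> 0)"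

definition smooth_hypersurface :: "quat2 set \<Rightarrow> bool" where
  "smooth_hypersurface S \<longleftrightarrow> (\<forall>p\<in>S. \<exists>U \<rho>. p \<in> U \<and> defining_function (S \<inter> U) U \<rho>)"

definition tangent_space :: "quat2 set \<Rightarrow> quat2 \<Rightarrow> quat2 set" where
  "tangent_space S z = {v. \<exists>\<epsilon> \<gamma>. 0 < \<epsilon> \<and> smooth_on \<gamma> {-\<epsilon><..<\<epsilon>} \<and> \<gamma> ` {-\<epsilon><..<\<epsilon>} \<subseteq> S \<and>
     \<gamma> 0 = z \<and> (\<gamma> has_vector_derivative v) (at (0::real))}"

definition unit_normal_field :: "quat2 set \<Rightarrow> (quat2 \<Rightarrow> quat2) \<Rightarrow> bool" where
  "unit_normal_field S \<nu> \<longleftrightarrow> smooth_map_on \<nu> S \<and>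
     (\<forall>z\<in>S. norm (\<nu> z) = 1 \<and> (\<forall>v\<in>tangent_space S z. \<nu> z \<bullet> v = 0))"


section \<open>Holomorphic and CRF functions\<close>

definition dbar :: "(quat2 \<Rightarrow> quat) \<Rightarrow> quat2 \<Rightarrow> quat2" where
  "dbar F z = (\<Sum>\<alpha><4. qunit \<alpha> * frechet_derivative F (at z) (e_x \<alpha>),
               \<Sum>\<alpha><4. qunit \<alpha> * frechet_derivative F (at z) (e_y \<alpha>))"

definition H_holomorphic_on :: "(quat2 \<Rightarrow> quat) \<Rightarrow> quat2 set \<Rightarrow> bool" where
  "H_holomorphic_on F U \<longleftrightarrow> Ck_on 1 F U \<and> (\<forall>z\<in>U. dbar F z = 0)"

text \<open>The condition does not depend on the choice of the defining function, so \<open>\<rho>\<close> is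
  quantified existentially; the functions \<open>\<rho>, F, A, B\<close> may be restricted to a common
  neighbourhood \<open>U\<close> of \<open>S\<close>.\<close>

definition CRF :: "quat2 set \<Rightarrow> (quat2 \<Rightarrow> quat) \<Rightarrow> bool" where
  "CRF S f \<longleftrightarrow> smooth_map_on f S \<and>
     (\<exists>U \<rho> F A B. defining_function S U \<rho> \<and>
        smooth_on F U \<and> smooth_on A U \<and> smooth_on B U \<and> (\<forall>z\<in>S. F z = f z) \<and>
        (\<forall>z\<in>U. dbar F z = \<rho> z *\<^sub>R A z +
           (fst (dbar (\<lambda>w. of_real (\<rho> w)) z) * B z, snd (dbar (\<lambda>w. of_real (\<rho> w)) z) * B z)))"


section \<open>Quaternion-valued forms and admissible functions\<close>

text \<open>The wedge product of a list of quaternion-valued one-forms on a vector space, with the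
  coefficients multiplied in the written order:
  \<open>(\<theta>\<^sub>1 \<and> \<dots> \<and> \<theta>\<^sub>n)(v\<^sub>1, \<dots>, v\<^sub>n) = \<Sum>\<^sub>\<sigma> sgn \<sigma> \<cdot> \<theta>\<^sub>1 v\<^bsub>\<sigma> 1\<^esub> \<cdots> \<theta>\<^sub>n v\<^bsub>\<sigma> n\<^esub>\<close>.\<close>

definition wedge :: "('v \<Rightarrow> quat) list \<Rightarrow> 'v list \<Rightarrow> quat" where
  "wedge \<theta>s vs = (\<Sum>\<sigma> | \<sigma> permutes {..<length \<theta>s}.
     of_int (sign \<sigma>) * prod_list (map (\<lambda>i. (\<theta>s ! i) (vs ! \<sigma> i)) [0..<length \<theta>s]))"

definition dx :: "nat \<Rightarrow> quat2 \<Rightarrow> quat" where "dx \<alpha> v = of_real (v \<bullet> e_x \<alpha>)"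
definition dy :: "nat \<Rightarrow> quat2 \<Rightarrow> quat" where "dy \<alpha> v = of_real (v \<bullet> e_y \<alpha>)"

definition dq1 :: "quat2 \<Rightarrow> quat" where "dq1 v = (\<Sum>\<alpha><4. qunit \<alpha> * dx \<alpha> v)"
definition dq2 :: "quat2 \<Rightarrow> quat" where "dq2 v = (\<Sum>\<alpha><4. qunit \<alpha> * dy \<alpha> v)"
definition dq1_bar :: "quat2 \<Rightarrow> quat" where "dq1_bar v = (\<Sum>\<alpha><4. qcnj (qunit \<alpha>) * dx \<alpha> v)"
definition dq2_bar :: "quat2 \<Rightarrow> quat" where "dq2_bar v = (\<Sum>\<alpha><4. qcnj (qunit \<alpha>) * dy \<alpha> v)"

definition dxs :: "(quat2 \<Rightarrow> quat) list" where "dxs = map dx [0..<4]"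
definition dys :: "(quat2 \<Rightarrow> quat) list" where "dys = map dy [0..<4]"

text \<open>The differential of \<open>f : S \<rightarrow> \<bbbH>\<close> at \<open>z\<close>. The derivative within \<open>S\<close> is determined
  on the tangent space of \<open>S\<close> only, and \<open>surf_diff\<close> is used only for tangent vectors.\<close>

definition surf_diff :: "quat2 set \<Rightarrow> (quat2 \<Rightarrow> quat) \<Rightarrow> quat2 \<Rightarrow> quat2 \<Rightarrow> quat" where
  "surf_diff S f z = frechet_derivative f (at z within S)"

text \<open>\<open>\<omega> = - \<iota>\<^sub>\<nu> (dx \<and> dy)\<close>\<close>

definition vol_form :: "(quat2 \<Rightarrow> quat2) \<Rightarrow> quat2 \<Rightarrow> quat2 list \<Rightarrow> quat" where
  "vol_form \<nu> z vs = - wedge (dxs @ dys) (\<nu> z # vs)"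

text \<open>Both sides of the defining equation are 7-forms on the 7-dimensional space
  \<open>tangent_space S z\<close>, and \<open>\<omega>\<close> is real and does not vanish there.\<close>

definition f_perp :: "quat2 set \<Rightarrow> (quat2 \<Rightarrow> quat2) \<Rightarrow> (quat2 \<Rightarrow> quat) \<Rightarrow> quat2 \<Rightarrow> quat" where
  "f_perp S \<nu> f z = (THE c. \<forall>vs. length vs = 7 \<and> set vs \<subseteq> tangent_space S z \<longrightarrow>
     - (1/2) *\<^sub>R (wedge ([dq1_bar, dq1] @ dys @ [surf_diff S f z]) vs +
                wedge (dxs @ [dq2_bar, dq2] @ [surf_diff S f z]) vs)
     = c * vol_form \<nu> z vs)"

text \<open>\<open>f_comp S \<nu> f (e_x \<alpha>)\<close> and \<open>f_comp S \<nu> f (e_y \<alpha>)\<close> are the functions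
  \<open>f\<^bsub>(x\<alpha>)\<^esub>\<close> and \<open>f\<^bsub>(y\<alpha>)\<^esub>\<close>; the argument of \<open>surf_diff\<close> is the tangential
  component of \<open>e\<close>.\<close>

definition f_comp ::
  "quat2 set \<Rightarrow> (quat2 \<Rightarrow> quat2) \<Rightarrow> (quat2 \<Rightarrow> quat) \<Rightarrow> quat2 \<Rightarrow> quat2 \<Rightarrow> quat" where
  "f_comp S \<nu> f e z =
     surf_diff S f z (e - (e \<bullet> \<nu> z) *\<^sub>R \<nu> z) + (e \<bullet> \<nu> z) *\<^sub>R f_perp S \<nu> f z"

text \<open>The functions \<open>f_comp S \<nu> f e\<close> on \<open>S\<close> do not depend on the choice of \<open>\<nu>\<close>.\<close>

definition admissible :: "quat2 set \<Rightarrow> (quat2 \<Rightarrow> quat) \<Rightarrow> bool" where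
  "admissible S f \<longleftrightarrow> CRF S f \<and>
     (\<exists>\<nu>. unit_normal_field S \<nu> \<and>
        (\<forall>\<alpha><4. CRF S (f_comp S \<nu> f (e_x \<alpha>)) \<and> CRF S (f_comp S \<nu> f (e_y \<alpha>))))"

end

(* A smooth extension of f can be modified by a Borel series in rho so that the component of its
   dbar along the normal direction vanishes to infinite order on S. The CRF conditions for f and
   for the f_comp (which are the derivatives of the extension, because f_perp is its normal
   derivative) then make the whole dbar vanish to second order, and the compatibility condition
   D1 D2^* G2 = Lap2 G1 of the overdetermined system dbar F = G propagates this to infinite order.
   So g, equal to dbar F on D and to 0 outside, is smooth on the half-space. A compactly supported
   compatible g is dbar of a potential u, obtained from the Newton kernel 1/|w|^2 on the quaternionic
   lines parallel to the boundary of the half-space. This u vanishes far from the boundary and is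
   harmonic on W, hence u = 0 on W by unique continuation and u = 0 on S by continuity; the
   extension is F - u. *)
theory Submission
  imports Defs "Jordan_Normal_Form.Determinant"
begin

section \<open>Smooth functions\<close>

text \<open>For the complex \<open>dbar\<close> the compatibility condition has first order, and the
  CR condition alone starts the induction. Here it has second order: it becomes an algebraic
  relation on the hypersurface only once \<open>dbar F\<close> vanishes there together with its
  first derivatives. These first derivatives are what admissibility supplies, and this is why
  \<open>f_comp\<close>, built from data on \<open>S\<close>, must be identified with derivatives of
  an extension. The second obstacle is that \<open>D\<close> may reach the bounding hyperplane of
  the half-space. The support of \<open>g\<close> is then bounded but not compact in the half-space,
  and a kernel on the whole of R^8 would need data beyond the hyperplane. A real hyperplane of H^2
  always contains a quaternionic line, and inversion along this one line solves both equations: if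
  D_c is the Fueter operator of the line and H is its conjugate applied to the component of
  \<open>g\<close> along the line, then compatibility says that D_i H is the Laplacian along the
  line of g_i, so convolution of H with the Newton kernel returns g_i under D_i, up to a
  constant.\<close>

definition pd :: "'a::euclidean_space \<Rightarrow> ('a \<Rightarrow> 'b::euclidean_space) \<Rightarrow> 'a \<Rightarrow> 'b" where
  "pd v F z = frechet_derivative F (at z) v"

lemma pd_eqI: "(F has_derivative F') (at z) \<Longrightarrow> pd v F z = F' v"
  unfolding pd_def by (metis frechet_derivative_at)

lemma pd_works: "F differentiable (at z) \<Longrightarrow> (F has_derivative (\<lambda>v. pd v F z)) (at z)"
  unfolding pd_def by (simp add: frechet_derivative_works)

lemma pd_linear: "F differentiable (at z) \<Longrightarrow> linear (\<lambda>v. pd v F z)"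
  using pd_works has_derivative_linear by blast

lemma pd_expand:
  assumes "F differentiable (at z)"
  shows "pd v F z = (\<Sum>b\<in>Basis. (v \<bullet> b) *\<^sub>R pd b F z)"
proof -
  interpret linear "\<lambda>v. pd v F z" by (rule pd_linear[OF assms])
  have "pd v F z = pd (\<Sum>b\<in>Basis. (v \<bullet> b) *\<^sub>R b) F z" by (simp add: euclidean_representation)
  then show ?thesis by (simp add: sum scale)
qed

lemma has_derivative_cong_open:
  assumes "open U" "z \<in> U" "\<And>w. w \<in> U \<Longrightarrow> F w = G w"
  shows "(F has_derivative F') (at z) \<longleftrightarrow> (G has_derivative F') (at z)"
  using assms by (metis has_derivative_transform_within_open)

lemma pd_cong:
  assumes "open U" "z \<in> U" "\<And>w. w \<in> U \<Longrightarrow> F w = G w"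
  shows "pd v F z = pd v G z"
  unfolding pd_def frechet_derivative_def using has_derivative_cong_open[OF assms] by simp

lemma differentiable_cong_open:
  assumes "open U" "z \<in> U" "\<And>w. w \<in> U \<Longrightarrow> F w = G w"
  shows "F differentiable (at z) \<longleftrightarrow> G differentiable (at z)"
  unfolding differentiable_def using has_derivative_cong_open[OF assms] by simp

lemma Ck_on_Suc:
  "Ck_on (Suc k) F U \<longleftrightarrow> (\<forall>z\<in>U. F differentiable (at z)) \<and> (\<forall>v. Ck_on k (pd v F) U)"
  by (simp add: pd_def[abs_def])

declare Ck_on.simps(2)[simp del]

lemma Ck_on_cong:
  assumes "open U" "\<And>w. w \<in> U \<Longrightarrow> F w = G w"
  shows "Ck_on k F U \<longleftrightarrow> Ck_on k G U"
  using assms(2)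
proof (induction k arbitrary: F G)
  case 0
  then show ?case by (simp cong: continuous_on_cong)
next
  case (Suc k)
  have "Ck_on k (pd v F) U \<longleftrightarrow> Ck_on k (pd v G) U" for v
    by (rule Suc.IH) (rule pd_cong[OF assms(1) _ Suc.prems], auto)
  moreover have "F differentiable (at z) \<longleftrightarrow> G differentiable (at z)" if "z \<in> U" for z
    using differentiable_cong_open[OF assms(1) that Suc.prems] .
  ultimately show ?case unfolding Ck_on_Suc by simp
qed

lemma Ck_on_subset: "Ck_on k F U \<Longrightarrow> V \<subseteq> U \<Longrightarrow> Ck_on k F V"
  by (induction k arbitrary: F) (auto simp: Ck_on_Suc intro: continuous_on_subset)

lemma Ck_on_SucD: "Ck_on (Suc k) F U \<Longrightarrow> Ck_on k F U"
proof (induction k arbitrary: F)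
  case 0
  then show ?case
    by (auto simp: Ck_on_Suc intro!: continuous_at_imp_continuous_on differentiable_imp_continuous_within)
next
  case (Suc k)
  then show ?case unfolding Ck_on_Suc[of "Suc k"] by (auto simp: Ck_on_Suc[of k])
qed

lemma Ck_on_local:
  assumes "\<And>z. z \<in> U \<Longrightarrow> \<exists>V. open V \<and> z \<in> V \<and> Ck_on k F V"
  shows "Ck_on k F U"
  using assms
proof (induction k arbitrary: F)
  case 0
  have "isCont F z" if "z \<in> U" for z
    using 0[OF that] by (auto simp: continuous_on_eq_continuous_at)
  then show ?case by (simp add: continuous_at_imp_continuous_on)
next
  case (Suc k)
  show ?case unfolding Ck_on_Suc
  proof (intro conjI ballI allI)
    show "F differentiable at z" if "z \<in> U" for z
      using Suc.prems[OF that] unfolding Ck_on_Suc by blast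
    show "Ck_on k (pd v F) U" for v
      by (rule Suc.IH) (use Suc.prems in \<open>metis Ck_on_Suc\<close>)
  qed
qed

lemma Ck_on_const: "Ck_on k (\<lambda>z. c) U"
proof (induction k arbitrary: c)
  case (Suc k)
  have "pd v (\<lambda>z. c) = (\<lambda>z. 0)" for v :: 'a by (auto simp: pd_def)
  then show ?case unfolding Ck_on_Suc using Suc by simp
qed simp

lemma Ck_on_bounded_linear_comp:
  assumes "bounded_linear f" "open U"
  shows "Ck_on k F U \<Longrightarrow> Ck_on k (\<lambda>z. f (F z)) U"
proof (induction k arbitrary: F)
  case 0
  then show ?case using assms bounded_linear.continuous_on by auto
next
  case (Suc k)
  have *: "((\<lambda>z. f (F z)) has_derivative (\<lambda>v. f (pd v F z))) (at z)" if "z \<in> U" for z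
    using Suc.prems that unfolding Ck_on_Suc
    by (intro bounded_linear.has_derivative[OF assms(1)] pd_works) auto
  have "Ck_on k (pd v (\<lambda>z. f (F z))) U" for v
  proof -
    have "Ck_on k (\<lambda>z. f (pd v F z)) U" using Suc unfolding Ck_on_Suc[of k] by blast
    then show ?thesis by (subst Ck_on_cong[OF assms(2)]) (use pd_eqI[OF *] in auto)
  qed
  then show ?case unfolding Ck_on_Suc using * differentiable_def by blast
qed

lemma Ck_on_linear: "bounded_linear f \<Longrightarrow> Ck_on k f U"
proof (induction k)
  case 0 then show ?case by (simp add: linear_continuous_on)
next
  case (Suc k)
  have *: "(f has_derivative f) (at z)" for z
    using Suc.prems by (simp add: bounded_linear_imp_has_derivative)
  then have "pd v f = (\<lambda>z. f v)" for v by (auto intro: pd_eqI)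
  then show ?case unfolding Ck_on_Suc using * Ck_on_const by (auto simp: differentiable_def)
qed

lemma Ck_on_add:
  assumes "open U"
  shows "Ck_on k F U \<Longrightarrow> Ck_on k G U \<Longrightarrow> Ck_on k (\<lambda>z. F z + G z) U"
proof (induction k arbitrary: F G)
  case 0
  then show ?case by (auto intro: continuous_intros)
next
  case (Suc k)
  have *: "((\<lambda>z. F z + G z) has_derivative (\<lambda>v. pd v F z + pd v G z)) (at z)" if "z \<in> U" for z
    using Suc.prems that unfolding Ck_on_Suc by (intro has_derivative_add pd_works) auto
  have "Ck_on k (pd v (\<lambda>z. F z + G z)) U" for v
  proof -
    have "Ck_on k (\<lambda>z. pd v F z + pd v G z) U" using Suc unfolding Ck_on_Suc[of k] by blast
    then show ?thesis by (subst Ck_on_cong[OF assms]) (use pd_eqI[OF *] in auto)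
  qed
  then show ?case unfolding Ck_on_Suc using * differentiable_def by blast
qed

lemma Ck_on_sum:
  assumes "open U" "\<And>i. i \<in> I \<Longrightarrow> Ck_on k (F i) U"
  shows "Ck_on k (\<lambda>z. \<Sum>i\<in>I. F i z) U"
  using assms(2) by (induction I rule: infinite_finite_induct) (auto intro: Ck_on_const Ck_on_add assms(1))

lemma Ck_on_bilinear:
  assumes "bounded_bilinear op" "open U"
  shows "Ck_on k F U \<Longrightarrow> Ck_on k G U \<Longrightarrow> Ck_on k (\<lambda>z. op (F z) (G z)) U"
proof (induction k arbitrary: F G)
  case 0
  then show ?case using bounded_bilinear.continuous_on[OF assms(1)] by auto
next
  case (Suc k)
  have *: "((\<lambda>z. op (F z) (G z)) has_derivative (\<lambda>v. op (F z) (pd v G z) + op (pd v F z) (G z))) (at z)"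
    if "z \<in> U" for z
    using Suc.prems that unfolding Ck_on_Suc
    by (intro bounded_bilinear.FDERIV[OF assms(1)] pd_works) auto
  have "Ck_on k (pd v (\<lambda>z. op (F z) (G z))) U" for v
  proof -
    have "Ck_on k (\<lambda>z. op (F z) (pd v G z) + op (pd v F z) (G z)) U"
      using Suc.prems Suc.prems[THEN Ck_on_SucD]
      by (intro Ck_on_add assms Suc.IH) (auto simp: Ck_on_Suc)
    then show ?thesis by (subst Ck_on_cong[OF assms(2)]) (use pd_eqI[OF *] in auto)
  qed
  then show ?case unfolding Ck_on_Suc using * differentiable_def by blast
qed

text \<open>The chain rule gives \<open>pd (pd v F z) G (F z)\<close>, whose direction depends on
  \<open>z\<close>. Expanding this direction in a basis of the middle space leaves products of
  scalar coefficients with \<open>pd b G (F z)\<close>, to which the induction hypothesis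
  applies.\<close>

lemma Ck_on_compose:
  assumes "open U" "open V" "F ` U \<subseteq> V"
  shows "Ck_on k G V \<Longrightarrow> Ck_on k F U \<Longrightarrow> Ck_on k (\<lambda>z. G (F z)) U"
proof (induction k arbitrary: G)
  case 0
  then show ?case using assms(3) continuous_on_compose2 by fastforce
next
  case (Suc k)
  have dF: "(F has_derivative (\<lambda>v. pd v F z)) (at z)" if "z \<in> U" for z
    using Suc.prems that unfolding Ck_on_Suc by (intro pd_works) auto
  have dG: "(G has_derivative (\<lambda>v. pd v G z)) (at z)" if "z \<in> V" for z
    using Suc.prems that unfolding Ck_on_Suc by (intro pd_works) auto
  have *: "((\<lambda>z. G (F z)) has_derivative (\<lambda>v. pd (pd v F z) G (F z))) (at z)" if "z \<in> U" for z
    using diff_chain_at[OF dF[OF that] dG[of "F z"]] assms(3) that by (auto simp: o_def)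
  have "Ck_on k (pd v (\<lambda>z. G (F z))) U" for v
  proof -
    have eq: "pd v (\<lambda>z. G (F z)) z = (\<Sum>b\<in>Basis. (pd v F z \<bullet> b) *\<^sub>R pd b G (F z))" if "z \<in> U" for z
      unfolding pd_eqI[OF *[OF that]] using Suc.prems that assms(3) unfolding Ck_on_Suc
      by (intro pd_expand) auto
    have "Ck_on k (\<lambda>z. \<Sum>b\<in>Basis. (pd v F z \<bullet> b) *\<^sub>R pd b G (F z)) U"
    proof (intro Ck_on_sum Ck_on_bilinear[OF bounded_bilinear_scaleR] assms)
      fix b :: 'b
      show "Ck_on k (\<lambda>z. pd v F z \<bullet> b) U"
        using Suc.prems(2) unfolding Ck_on_Suc
        by (intro Ck_on_bounded_linear_comp[OF bounded_linear_inner_left assms(1)]) auto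
      show "Ck_on k (\<lambda>z. pd b G (F z)) U"
        using Suc.prems(1) Ck_on_SucD[OF Suc.prems(2)] by (intro Suc.IH) (auto simp: Ck_on_Suc)
    qed
    then show ?thesis by (subst Ck_on_cong[OF assms(1)]) (use eq in auto)
  qed
  then show ?case unfolding Ck_on_Suc using * differentiable_def by blast
qed

lemma smooth_on_iff:
  "smooth_on F U \<longleftrightarrow> (\<forall>z\<in>U. F differentiable (at z)) \<and> (\<forall>v. smooth_on (pd v F) U)"
  unfolding smooth_on_def by (metis Ck_on_Suc Ck_on_SucD)

lemma smooth_on_differentiable: "smooth_on F U \<Longrightarrow> z \<in> U \<Longrightarrow> F differentiable (at z)"
  using smooth_on_iff by blast
lemma smooth_on_pd: "smooth_on F U \<Longrightarrow> smooth_on (pd v F) U"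
  using smooth_on_iff by blast
lemma smooth_on_has_derivative:
  "smooth_on F U \<Longrightarrow> z \<in> U \<Longrightarrow> (F has_derivative (\<lambda>v. pd v F z)) (at z)"
  by (simp add: pd_works smooth_on_differentiable)
lemma smooth_on_continuous_on: "smooth_on F U \<Longrightarrow> continuous_on U F"
  unfolding smooth_on_def by (metis Ck_on.simps(1))

text \<open>Reduces smoothness to exhibiting a class of differentiable functions that is stable
  under every \<open>pd v\<close>; no formula for higher derivatives has to be tracked.\<close>

lemma smooth_onI_closed:
  assumes "P F"
    and "\<And>F z. P F \<Longrightarrow> z \<in> U \<Longrightarrow> F differentiable (at z)"
    and "\<And>F v. P F \<Longrightarrow> P (pd v F)"
  shows "smooth_on F U"
proof -
  have "Ck_on k F U" for k
    using assms(1)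
  proof (induction k arbitrary: F)
    case 0
    then show ?case using assms(2) Ck_on.simps(1)
      by (metis continuous_at_imp_continuous_on differentiable_imp_continuous_within)
  next
    case (Suc k)
    then show ?case unfolding Ck_on_Suc using assms by blast
  qed
  then show ?thesis by (simp add: smooth_on_def)
qed

lemma smooth_on_cong:
  "open U \<Longrightarrow> (\<And>w. w \<in> U \<Longrightarrow> F w = G w) \<Longrightarrow> smooth_on F U \<longleftrightarrow> smooth_on G U"
  unfolding smooth_on_def using Ck_on_cong by blast
lemma smooth_on_subset: "smooth_on F U \<Longrightarrow> V \<subseteq> U \<Longrightarrow> smooth_on F V"
  unfolding smooth_on_def using Ck_on_subset by blast
lemma smooth_on_local:
  "(\<And>z. z \<in> U \<Longrightarrow> \<exists>V. open V \<and> z \<in> V \<and> smooth_on F V) \<Longrightarrow> smooth_on F U"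
  unfolding smooth_on_def using Ck_on_local by metis
lemma smooth_on_local_cong:
  assumes "\<And>z. z \<in> U \<Longrightarrow> \<exists>V G. open V \<and> z \<in> V \<and> smooth_on G V \<and> (\<forall>w\<in>V. F w = G w)"
  shows "smooth_on F U"
  by (rule smooth_on_local) (use assms smooth_on_cong in metis)
lemma smooth_on_const: "smooth_on (\<lambda>z. c) U"
  by (simp add: smooth_on_def Ck_on_const)
lemma smooth_on_linear: "bounded_linear f \<Longrightarrow> smooth_on f U"
  by (simp add: smooth_on_def Ck_on_linear)
lemma smooth_on_linear_comp:
  "bounded_linear f \<Longrightarrow> open U \<Longrightarrow> smooth_on F U \<Longrightarrow> smooth_on (\<lambda>z. f (F z)) U"
  by (simp add: smooth_on_def Ck_on_bounded_linear_comp)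
lemma smooth_on_add: "open U \<Longrightarrow> smooth_on F U \<Longrightarrow> smooth_on G U \<Longrightarrow> smooth_on (\<lambda>z. F z + G z) U"
  by (simp add: smooth_on_def Ck_on_add)
lemma smooth_on_sum: "open U \<Longrightarrow> (\<And>i. i \<in> I \<Longrightarrow> smooth_on (F i) U) \<Longrightarrow> smooth_on (\<lambda>z. \<Sum>i\<in>I. F i z) U"
  by (simp add: smooth_on_def Ck_on_sum)
lemma smooth_on_bilinear:
  "bounded_bilinear op \<Longrightarrow> open U \<Longrightarrow> smooth_on F U \<Longrightarrow> smooth_on G U \<Longrightarrow> smooth_on (\<lambda>z. op (F z) (G z)) U"
  by (simp add: smooth_on_def Ck_on_bilinear)
lemma smooth_on_compose:
  "smooth_on G V \<Longrightarrow> smooth_on F U \<Longrightarrow> open U \<Longrightarrow> open V \<Longrightarrow> F ` U \<subseteq> V \<Longrightarrow> smooth_on (\<lambda>z. G (F z)) U"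
  by (simp add: smooth_on_def Ck_on_compose)

lemmas smooth_on_scaleR = smooth_on_bilinear[OF bounded_bilinear_scaleR]
lemmas smooth_on_mult = smooth_on_bilinear[OF bounded_bilinear_mult]
lemmas smooth_on_inner = smooth_on_bilinear[OF bounded_bilinear_inner]
lemmas smooth_on_ident = smooth_on_linear[OF bounded_linear_ident]

lemma smooth_on_uminus: "open U \<Longrightarrow> smooth_on F U \<Longrightarrow> smooth_on (\<lambda>z. - F z) U"
  by (rule smooth_on_linear_comp[OF bounded_linear_minus[OF bounded_linear_ident]])

lemma smooth_on_diff:
  "open U \<Longrightarrow> smooth_on F U \<Longrightarrow> smooth_on G U \<Longrightarrow> smooth_on (\<lambda>z. F z - G z) U"
  using smooth_on_add[of U F "\<lambda>z. - G z"] smooth_on_uminus[of U G] by simp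

lemma smooth_on_power:
  fixes F :: "'a::euclidean_space \<Rightarrow> 'b::{euclidean_space,real_normed_algebra_1}"
  shows "open U \<Longrightarrow> smooth_on F U \<Longrightarrow> smooth_on (\<lambda>z. F z ^ n) U"
  by (induction n) (auto intro: smooth_on_const smooth_on_mult)

lemma smooth_on_inverse_real: "smooth_on (inverse :: real \<Rightarrow> real) (- {0})"
proof -
  \<comment> \<open>The multiples of powers of \<open>inverse t\<close> form such a stable
    class.\<close>
  define P where "P = (\<lambda>F::real\<Rightarrow>real. \<exists>c n. \<forall>t\<in>-{0}. F t = c * inverse t ^ n)"
  have d: "(F has_derivative (\<lambda>v. - (real n * c * v) * inverse t ^ Suc n)) (at t)"
    if "\<forall>t\<in>-{0}. F t = c * inverse t ^ n" "t \<noteq> 0" for F c n and t :: real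
  proof -
    have "((\<lambda>t. inverse t ^ n) has_real_derivative
        of_nat n * (- (inverse t ^ Suc (Suc 0)) * inverse t ^ (n - Suc 0))) (at t)"
      using DERIV_power[OF DERIV_inverse[OF \<open>t \<noteq> 0\<close>, of UNIV], of n] by simp
    from DERIV_cmult[OF this, of c]
    have "((\<lambda>t. c * inverse t ^ n) has_real_derivative - (real n * c) * inverse t ^ Suc n) (at t)"
      by (cases n) (auto simp: mult_ac)
    then have "((\<lambda>t. c * inverse t ^ n) has_derivative (\<lambda>v. - (real n * c * v) * inverse t ^ Suc n)) (at t)"
      unfolding has_field_derivative_def by (rule has_derivative_eq_rhs) (auto simp: fun_eq_iff)
    then show ?thesis using that
      by (subst has_derivative_cong_open[of "-{0}"]) auto
  qed
  show ?thesis
  proof (rule smooth_onI_closed[of P])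
    show "P inverse" unfolding P_def by (rule exI[of _ 1], rule exI[of _ 1]) auto
    show "F differentiable at z" if "P F" "z \<in> -{0}" for F z
      using that d unfolding P_def differentiable_def by blast
    show "P (pd v F)" if PF: "P F" for F v
    proof -
      obtain c n where F: "\<forall>t\<in>-{0}. F t = c * inverse t ^ n" using PF unfolding P_def by blast
      have "\<forall>t\<in>-{0}. pd v F t = - (real n * c * v) * inverse t ^ Suc n"
        using pd_eqI[OF d[OF F]] by auto
      then show ?thesis unfolding P_def by blast
    qed
  qed
qed

lemma smooth_on_inverse:
  fixes F :: "'a::euclidean_space \<Rightarrow> real"
  assumes "open U" "smooth_on F U" "\<And>z. z \<in> U \<Longrightarrow> F z \<noteq> 0"
  shows "smooth_on (\<lambda>z. inverse (F z)) U"
  by (rule smooth_on_compose[OF smooth_on_inverse_real assms(2,1)]) (use assms(3) in auto)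

lemma pd_add: "F differentiable (at z) \<Longrightarrow> G differentiable (at z) \<Longrightarrow>
   pd v (\<lambda>z. F z + G z) z = pd v F z + pd v G z"
  by (rule pd_eqI) (intro has_derivative_add pd_works)
lemma pd_diff: "F differentiable (at z) \<Longrightarrow> G differentiable (at z) \<Longrightarrow>
   pd v (\<lambda>z. F z - G z) z = pd v F z - pd v G z"
  by (rule pd_eqI) (intro has_derivative_diff pd_works)
lemma pd_sum: "(\<And>i. i \<in> I \<Longrightarrow> F i differentiable (at z)) \<Longrightarrow>
   pd v (\<lambda>z. \<Sum>i\<in>I. F i z) z = (\<Sum>i\<in>I. pd v (F i) z)"
  by (rule pd_eqI) (intro has_derivative_sum pd_works)
lemma pd_bilinear: "bounded_bilinear op \<Longrightarrow> F differentiable (at z) \<Longrightarrow> G differentiable (at z) \<Longrightarrow>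
   pd v (\<lambda>z. op (F z) (G z)) z = op (F z) (pd v G z) + op (pd v F z) (G z)"
  by (rule pd_eqI) (intro bounded_bilinear.FDERIV pd_works)
lemma pd_linear_comp: "bounded_linear f \<Longrightarrow> F differentiable (at z) \<Longrightarrow>
   pd v (\<lambda>z. f (F z)) z = f (pd v F z)"
  by (rule pd_eqI[OF bounded_linear.has_derivative[OF _ pd_works]])
lemma pd_const: "pd v (\<lambda>z. c) z = 0"
  by (simp add: pd_def)
lemmas pd_scaleR = pd_bilinear[OF bounded_bilinear_scaleR]
lemmas pd_mult = pd_bilinear[OF bounded_bilinear_mult]
lemmas pd_inner = pd_bilinear[OF bounded_bilinear_inner]
lemmas pd_cmult = pd_linear_comp[OF bounded_linear_mult_right]

section \<open>Symmetry of second derivatives\<close>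

lemma has_derivative_along_line:
  assumes "(F has_derivative F') (at (p + s *\<^sub>R u + q))"
  shows "((\<lambda>s. F (p + s *\<^sub>R u + q)) has_derivative (\<lambda>d. F' (d *\<^sub>R u))) (at s)"
proof -
  have "((\<lambda>s. p + s *\<^sub>R u + q) has_derivative (\<lambda>d. d *\<^sub>R u)) (at s)"
    by (auto intro!: derivative_eq_intros)
  from diff_chain_at[OF this assms] show ?thesis by (simp add: o_def)
qed

text \<open>The second difference of \<open>F\<close> over the parallelogram spanned by
  \<open>h u\<close> and \<open>h v\<close> is symmetric in \<open>u\<close> and \<open>v\<close>.
  Two applications of the mean value theorem write it as h^2 times either mixed derivative at a
  point close to \<open>z\<close>, and continuity of both forces equality.\<close>

lemma pd_symmetric_real:
  fixes F :: "'a::euclidean_space \<Rightarrow> real"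
  assumes U: "open U" "z \<in> U" and F: "Ck_on 2 F U"
  shows "pd u (pd v F) z = pd v (pd u F) z"
proof -
  have dF: "(F has_derivative (\<lambda>v. pd v F w)) (at w)" if "w \<in> U" for w
    using F that by (auto simp: numeral_2_eq_2 Ck_on_Suc intro: pd_works)
  have ddF: "(pd v F has_derivative (\<lambda>u. pd u (pd v F) w)) (at w)" if "w \<in> U" for w v
    using F that by (auto simp: numeral_2_eq_2 Ck_on_Suc intro: pd_works)
  have cddF: "isCont (pd u (pd v F)) z" for u v
    using F U by (auto simp: numeral_2_eq_2 Ck_on_Suc continuous_on_eq_continuous_at)
  have key: "\<exists>w. norm (w - z) \<le> h * (norm u + norm v) \<and>
      F (z + h *\<^sub>R u + h *\<^sub>R v) - F (z + h *\<^sub>R u) - F (z + h *\<^sub>R v) + F z = h\<^sup>2 * pd v (pd u F) w"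
    if h: "h > 0" and cb: "cball z (h * (norm u + norm v)) \<subseteq> U" for h u v
  proof -
    have inU: "z + s *\<^sub>R u + t *\<^sub>R v \<in> U" if "0 \<le> s" "s \<le> h" "0 \<le> t" "t \<le> h" for s t
    proof -
      have "norm (s *\<^sub>R u + t *\<^sub>R v) \<le> s * norm u + t * norm v"
        using that by (metis abs_of_nonneg norm_scaleR norm_triangle_ineq)
      also have "\<dots> \<le> h * (norm u + norm v)"
        using that h by (simp add: distrib_left add_mono mult_right_mono)
      finally have "z + (s *\<^sub>R u + t *\<^sub>R v) \<in> cball z (h * (norm u + norm v))"
        by (metis add_diff_cancel_left' dist_commute dist_norm mem_cball)
      then show ?thesis using cb by (auto simp: add.assoc)
    qed
    have lin: "linear (\<lambda>v. pd v F w)" if "w \<in> U" for w using dF[OF that] has_derivative_linear by blast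
    define g where "g s = F (z + s *\<^sub>R u + h *\<^sub>R v) - F (z + s *\<^sub>R u)" for s
    have dg: "(g has_derivative (\<lambda>d. d * (pd u F (z + s *\<^sub>R u + h *\<^sub>R v) - pd u F (z + s *\<^sub>R u)))) (at s)"
      if "0 \<le> s" "s \<le> h" for s
    proof -
      have 1: "((\<lambda>s. F (z + s *\<^sub>R u + h *\<^sub>R v)) has_derivative (\<lambda>d. pd (d *\<^sub>R u) F (z + s *\<^sub>R u + h *\<^sub>R v))) (at s)"
        using h that by (intro has_derivative_along_line dF inU) auto
      have 2: "((\<lambda>s. F (z + s *\<^sub>R u)) has_derivative (\<lambda>d. pd (d *\<^sub>R u) F (z + s *\<^sub>R u))) (at s)"
        using has_derivative_along_line[of F _ z s u 0] dF[OF inU[of s 0]] h that by simp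
      show ?thesis unfolding g_def
        using has_derivative_diff[OF 1 2] linear_scale[OF lin[OF inU[of s h]], of _ u]
          linear_scale[OF lin[OF inU[of s 0]], of _ u] h that by (simp add: right_diff_distrib)
    qed
    have "\<exists>s\<in>{0<..<h}. g h - g 0 = h * (pd u F (z + s *\<^sub>R u + h *\<^sub>R v) - pd u F (z + s *\<^sub>R u))"
      using mvt_simple[OF h has_derivative_at_withinI[OF dg]] by simp
    then obtain s where s: "0 < s" "s < h" and
      gs: "g h - g 0 = h * (pd u F (z + s *\<^sub>R u + h *\<^sub>R v) - pd u F (z + s *\<^sub>R u))" by auto
    define k where "k t = pd u F (z + s *\<^sub>R u + t *\<^sub>R v)" for t
    have dk: "(k has_derivative (\<lambda>d. d * pd v (pd u F) (z + s *\<^sub>R u + t *\<^sub>R v))) (at t)"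
      if "0 \<le> t" "t \<le> h" for t
    proof -
      have m: "z + s *\<^sub>R u + t *\<^sub>R v \<in> U" using inU[of s t] s that by simp
      have D: "(pd u F has_derivative (\<lambda>d. pd d (pd u F) (z + s *\<^sub>R u + t *\<^sub>R v))) (at (z + s *\<^sub>R u + t *\<^sub>R v))"
        by (rule ddF[OF m])
      have 1: "(k has_derivative (\<lambda>d. pd (d *\<^sub>R v) (pd u F) (z + s *\<^sub>R u + t *\<^sub>R v))) (at t)"
        unfolding k_def
        using has_derivative_along_line[of "pd u F" "\<lambda>d. pd d (pd u F) (z + s *\<^sub>R u + t *\<^sub>R v)"
            "z + s *\<^sub>R u" t v 0] D by simp
      have "linear (\<lambda>d. pd d (pd u F) (z + s *\<^sub>R u + t *\<^sub>R v))"
        by (rule has_derivative_linear[OF D])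
      from linear_scale[OF this, of _ v] show ?thesis using 1 by simp
    qed
    have "\<exists>t\<in>{0<..<h}. k h - k 0 = h * pd v (pd u F) (z + s *\<^sub>R u + t *\<^sub>R v)"
      using mvt_simple[OF h has_derivative_at_withinI[OF dk]] by simp
    then obtain t where t: "0 < t" "t < h" and
      kt: "k h - k 0 = h * pd v (pd u F) (z + s *\<^sub>R u + t *\<^sub>R v)" by auto
    have "norm (s *\<^sub>R u + t *\<^sub>R v) \<le> s * norm u + t * norm v"
      using s t by (metis abs_of_nonneg less_eq_real_def norm_scaleR norm_triangle_ineq)
    also have "\<dots> \<le> h * (norm u + norm v)"
      using s t h by (simp add: distrib_left add_mono mult_right_mono)
    finally have "norm (z + s *\<^sub>R u + t *\<^sub>R v - z) \<le> h * (norm u + norm v)" by (simp add: algebra_simps)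
    moreover have "F (z + h *\<^sub>R u + h *\<^sub>R v) - F (z + h *\<^sub>R u) - F (z + h *\<^sub>R v) + F z = g h - g 0"
      by (simp add: g_def)
    ultimately show ?thesis
      using gs kt by (intro exI[of _ "z + s *\<^sub>R u + t *\<^sub>R v"]) (simp add: k_def power2_eq_square)
  qed
  obtain r where r: "r > 0" "cball z r \<subseteq> U" using U open_contains_cball by blast
  show ?thesis
  proof (rule ccontr)
    let ?a = "pd u (pd v F) z" and ?b = "pd v (pd u F) z"
    assume "?a \<noteq> ?b"
    define e where "e = \<bar>?a - ?b\<bar> / 2"
    have e: "e > 0" using \<open>?a \<noteq> ?b\<close> by (simp add: e_def)
    obtain d1 where d1: "d1 > 0" "\<And>w. dist w z < d1 \<Longrightarrow> dist (pd u (pd v F) w) ?a < e"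
      using cddF[of u v] e unfolding continuous_at_eps_delta by blast
    obtain d2 where d2: "d2 > 0" "\<And>w. dist w z < d2 \<Longrightarrow> dist (pd v (pd u F) w) ?b < e"
      using cddF[of v u] e unfolding continuous_at_eps_delta by blast
    define m where "m = Min {d1, d2, r}"
    have m: "m > 0" "m \<le> d1" "m \<le> d2" "m \<le> r" using d1 d2 r by (auto simp: m_def)
    \<comment> \<open>All points involved then lie within \<open>m / 2\<close> of \<open>z\<close>,
      hence in \<open>U\<close> and in both neighbourhoods of continuity; the summand 1 excludes a
      zero denominator.\<close>
    define h where "h = m / (2 * (norm u + norm v + 1))"
    have nn: "norm u + norm v + 1 > 0" by (simp add: add_nonneg_pos)
    have h: "h > 0" unfolding h_def using m nn by (simp add: add_pos_nonneg)
    have "h * (norm u + norm v) \<le> h * (norm u + norm v + 1)" using h by (simp add: mult_left_mono)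
    also have "\<dots> = m / 2" unfolding h_def using nn by (simp add: field_simps)
    finally have hm: "h * (norm u + norm v) < m" using m by simp
    have cb: "cball z (h * (norm u + norm v)) \<subseteq> U" using hm m r(2) by (meson dual_order.trans less_imp_le subset_cball)
    obtain w1 where w1: "norm (w1 - z) \<le> h * (norm u + norm v)"
      "F (z + h *\<^sub>R u + h *\<^sub>R v) - F (z + h *\<^sub>R u) - F (z + h *\<^sub>R v) + F z = h\<^sup>2 * pd v (pd u F) w1"
      using key[OF h cb] by blast
    obtain w2 where w2: "norm (w2 - z) \<le> h * (norm v + norm u)"
      "F (z + h *\<^sub>R v + h *\<^sub>R u) - F (z + h *\<^sub>R v) - F (z + h *\<^sub>R u) + F z = h\<^sup>2 * pd u (pd v F) w2"
      using key[OF h, of v u] cb by (auto simp: add.commute)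
    have "h\<^sup>2 * pd v (pd u F) w1 = h\<^sup>2 * pd u (pd v F) w2"
      using w1(2) w2(2) by (simp add: algebra_simps)
    then have eq: "pd v (pd u F) w1 = pd u (pd v F) w2" using h by simp
    have "dist (pd v (pd u F) w1) ?b < e" using w1(1) hm m by (intro d2) (simp add: dist_norm)
    moreover have "dist (pd u (pd v F) w2) ?a < e" using w2(1) hm m by (intro d1) (simp add: dist_norm add.commute)
    ultimately have "\<bar>?a - ?b\<bar> < 2 * e" using eq by (simp add: dist_real_def)
    then show False by (simp add: e_def)
  qed
qed

lemma pd_symmetric:
  fixes F :: "'a::euclidean_space \<Rightarrow> 'b::euclidean_space"
  assumes U: "open U" "z \<in> U" and F: "smooth_on F U"
  shows "pd u (pd v F) z = pd v (pd u F) z"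
proof (rule euclidean_eqI)
  fix b :: 'b assume "b \<in> Basis"
  note bl = bounded_linear_inner_left[of b]
  have s: "smooth_on (\<lambda>z. F z \<bullet> b) U" by (rule smooth_on_linear_comp[OF bl U(1) F])
  have c: "pd v (\<lambda>z. F z \<bullet> b) w = pd v F w \<bullet> b" if "w \<in> U" for v w
    using pd_linear_comp[OF bl smooth_on_differentiable[OF F that]] .
  have cc: "pd u (pd v (\<lambda>z. F z \<bullet> b)) z = pd u (pd v F) z \<bullet> b" for u v
  proof -
    have "pd u (pd v (\<lambda>z. F z \<bullet> b)) z = pd u (\<lambda>w. pd v F w \<bullet> b) z" by (rule pd_cong[OF U c])
    also have "\<dots> = pd u (pd v F) z \<bullet> b"
      by (rule pd_linear_comp[OF bl smooth_on_differentiable[OF smooth_on_pd[OF F] U(2)]])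
    finally show ?thesis .
  qed
  show "pd u (pd v F) z \<bullet> b = pd v (pd u F) z \<bullet> b"
    using pd_symmetric_real[OF U, of "\<lambda>z. F z \<bullet> b" u v] s cc by (metis smooth_on_def)
qed

section \<open>Tangent spaces and order of vanishing\<close>

text \<open>The implicit function theorem in the plane through \<open>z\<close> spanned by
  \<open>v\<close> and a transversal direction \<open>n\<close>. In the parameters of
  \<open>c\<close> the map \<open>f\<close> replaces the second coordinate by the value of
  \<open>\<rho>\<close>. It is injective because \<open>\<rho>\<close> increases along
  \<open>n\<close>, hence open by invariance of domain, and its inverse along the first axis yields
  the curve.\<close>

lemma kernel_subset_tangent_space:
  assumes def: "defining_function S U \<rho>" and z: "z \<in> S" and v: "pd v \<rho> z = 0"
  shows "v \<in> tangent_space S z"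
proof -
  have U: "open U" "smooth_on \<rho> U" and S: "S = {z \<in> U. \<rho> z = 0}"
    using def unfolding defining_function_def by auto
  have zU: "z \<in> U" "\<rho> z = 0" using z S by auto
  obtain n0 where n0: "pd n0 \<rho> z \<noteq> 0" using def z unfolding defining_function_def pd_def by blast
  have lin: "linear (\<lambda>v. pd v \<rho> w)" if "w \<in> U" for w
    using U(2) smooth_on_differentiable[OF _ that] pd_linear by blast
  define n where "n = (if pd n0 \<rho> z > 0 then n0 else - n0)"
  have n: "pd n \<rho> z > 0" using n0 linear_neg[OF lin[OF zU(1)]] by (auto simp: n_def)
  have "isCont (pd n \<rho>) z"
    using smooth_on_continuous_on[OF smooth_on_pd[OF U(2)]] U(1) zU continuous_on_eq_continuous_at by blast
  then have "\<forall>\<^sub>F w in nhds z. pd n \<rho> w > 0"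
    using order_tendstoD(1)[OF _ n] by (simp add: isCont_def eventually_nhds_conv_at n)
  moreover have "\<forall>\<^sub>F w in nhds z. w \<in> U" using U(1) zU(1) by (simp add: eventually_nhds_in_open)
  ultimately have "\<forall>\<^sub>F w in nhds z. w \<in> U \<and> pd n \<rho> w > 0" by eventually_elim simp
  then obtain r0 where r0: "r0 > 0" "\<And>w. dist w z < r0 \<Longrightarrow> w \<in> U \<and> pd n \<rho> w > 0"
    unfolding eventually_nhds_metric by blast
  define r where "r = r0 / (norm v + norm n + 1)"
  have r: "r > 0" using r0 by (simp add: r_def add_nonneg_pos)
  define c where "c = (\<lambda>(t, s). z + t *\<^sub>R v + s *\<^sub>R n)"
  define Q where "Q = {-r<..<r} \<times> {-r<..<r}"
  have Qo: "open Q" unfolding Q_def by (intro open_Times) auto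
  have cQ: "c p \<in> U \<and> pd n \<rho> (c p) > 0" if "p \<in> Q" for p
  proof (rule r0(2))
    obtain t s where p: "p = (t, s)" by force
    have "\<bar>t\<bar> < r" "\<bar>s\<bar> < r" using that p by (auto simp: Q_def)
    then have "norm (t *\<^sub>R v + s *\<^sub>R n) \<le> r * norm v + r * norm n"
      by (intro order_trans[OF norm_triangle_ineq] add_mono) (auto intro: mult_right_mono)
    also have "\<dots> < r * (norm v + norm n + 1)" using r by (simp add: distrib_left)
    also have "\<dots> = r0" unfolding r_def
      by (simp add: add_nonneg_pos[THEN less_imp_neq, THEN not_sym])
    finally show "dist (c p) z < r0" by (simp add: c_def p dist_norm add.assoc)
  qed
  have dc: "(c has_derivative (\<lambda>(t, s). t *\<^sub>R v + s *\<^sub>R n)) (at p)" for p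
    unfolding c_def split_beta by (auto intro!: derivative_eq_intros)
  define f where "f p = (fst p, \<rho> (c p))" for p
  have df: "(f has_derivative (\<lambda>q. (fst q, fst q * pd v \<rho> (c p) + snd q * pd n \<rho> (c p)))) (at p)"
    if "p \<in> Q" for p
  proof -
    have cp: "c p \<in> U" using cQ[OF that] by simp
    have "((\<lambda>p. \<rho> (c p)) has_derivative (\<lambda>q. pd (case q of (t, s) \<Rightarrow> t *\<^sub>R v + s *\<^sub>R n) \<rho> (c p))) (at p)"
      using diff_chain_at[OF dc smooth_on_has_derivative[OF U(2) cp]] by (simp add: o_def)
    then have "((\<lambda>p. \<rho> (c p)) has_derivative (\<lambda>q. fst q * pd v \<rho> (c p) + snd q * pd n \<rho> (c p))) (at p)"
      by (simp add: split_beta linear_add[OF lin[OF cp]] linear_scale[OF lin[OF cp]])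
    then show ?thesis unfolding f_def by (auto intro!: derivative_eq_intros)
  qed
  have contf: "continuous_on Q f"
    using df by (meson continuous_at_imp_continuous_on has_derivative_continuous)
  have inj: "inj_on f Q"
  proof (rule inj_onI)
    fix p q assume pq: "p \<in> Q" "q \<in> Q" "f p = f q"
    obtain t s s' where p: "p = (t, s)" and q: "q = (t, s')"
      using pq(3) by (metis f_def fst_conv prod.collapse)
    have *: False if s12: "s1 < s2" and "(t, s1) \<in> Q" and "(t, s2) \<in> Q" and eq12: "\<rho> (c (t, s1)) = \<rho> (c (t, s2))" for s1 s2
    proof -
      have d: "((\<lambda>s. \<rho> (c (t, s))) has_derivative (\<lambda>d. pd (d *\<^sub>R n) \<rho> (c (t, s)))) (at s within {s1..s2})"
        if "s1 \<le> s" "s \<le> s2" for s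
      proof -
        have "c (t, s) \<in> U" using cQ[of "(t, s)"] that \<open>(t, s1) \<in> Q\<close> \<open>(t, s2) \<in> Q\<close> by (auto simp: Q_def)
        then show ?thesis
          using has_derivative_along_line[of \<rho> "\<lambda>d. pd d \<rho> (c (t, s))" "z + t *\<^sub>R v" s n 0]
            smooth_on_has_derivative[OF U(2), of "c (t, s)"]
          by (simp add: c_def has_derivative_at_withinI)
      qed
      obtain s where s: "s \<in> {s1<..<s2}" "0 = pd ((s2 - s1) *\<^sub>R n) \<rho> (c (t, s))"
        using mvt_simple[OF s12, of "\<lambda>s. \<rho> (c (t, s))", OF d] eq12 by auto
      have "(t, s) \<in> Q" using s \<open>(t, s1) \<in> Q\<close> \<open>(t, s2) \<in> Q\<close> by (auto simp: Q_def)
      then have "pd n \<rho> (c (t, s)) > 0" "c (t, s) \<in> U" using cQ by auto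
      then show False using s s12 linear_scale[OF lin, of "c (t, s)"] by simp
    qed
    have "\<rho> (c (t, s)) = \<rho> (c (t, s'))" using pq(3) by (simp add: f_def p q)
    then have "s = s'" using *[of s s'] *[of s' s] pq p q by (metis linorder_neqE_linordered_idom)
    then show "p = q" by (simp add: p q)
  qed
  define g where "g = inv_into Q f"
  have gf: "g (f p) = p" if "p \<in> Q" for p using inj that by (simp add: g_def inv_into_f_f)
  have fQ: "open (f ` Q)" by (rule invariance_of_domain[OF contf Qo inj])
  have z0: "(0, 0) \<in> Q" using r by (simp add: Q_def)
  have f0: "f (0, 0) = (0, 0)" using zU by (simp add: f_def c_def)
  then have "(0, 0) \<in> f ` Q" using z0 by (metis imageI)
  then obtain \<epsilon>0 where e0: "\<epsilon>0 > 0" "\<And>y. dist y (0,0) < \<epsilon>0 \<Longrightarrow> y \<in> f ` Q"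
    using fQ unfolding open_dist by blast
  define I where "I = {-\<epsilon>0<..<\<epsilon>0}"
  have Iin: "(t, 0) \<in> f ` Q" if "t \<in> I" for t
    using that by (intro e0(2)) (auto simp: I_def dist_Pair_Pair)
  define s where "s t = snd (g (t, 0))" for t
  have gs: "g (t, 0) = (t, s t)" and gQ: "(t, s t) \<in> Q" and gz: "\<rho> (c (t, s t)) = 0" if tI: "t \<in> I" for t
  proof -
    obtain p where p: "p \<in> Q" "(t, 0) = f p" using Iin[OF tI] by blast
    then have g: "g (t, 0) = p" by (simp add: gf)
    moreover have "fst p = t" "\<rho> (c p) = 0" using p by (auto simp: f_def)
    ultimately show "g (t, 0) = (t, s t)" "(t, s t) \<in> Q" "\<rho> (c (t, s t)) = 0"
      using p by (auto simp: s_def)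
  qed
  define \<gamma> where "\<gamma> t = c (t, s t)" for t
  \<comment> \<open>The slope obtained by differentiating the identity
    \<open>\<rho> (\<gamma> t) = 0\<close>.\<close>
  define s' where "s' t = - pd v \<rho> (\<gamma> t) * inverse (pd n \<rho> (\<gamma> t))" for t
  have ds: "(s has_derivative (\<lambda>d. d * s' t)) (at t)" if tI: "t \<in> I" for t
  proof -
    let ?a = "pd v \<rho> (\<gamma> t)" and ?b = "pd n \<rho> (\<gamma> t)"
    have b: "?b > 0" using cQ gQ tI unfolding \<gamma>_def by blast
    have "(g has_derivative (\<lambda>q. (fst q, (snd q - fst q * ?a) / ?b))) (at (f (t, s t)))"
    proof (rule has_derivative_inverse_strong[OF Qo gQ[OF tI] contf gf df[OF gQ[OF tI]]])
      show "(\<lambda>q. (fst q, fst q * pd v \<rho> (c (t, s t)) + snd q * pd n \<rho> (c (t, s t)))) \<circ>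
          (\<lambda>q. (fst q, (snd q - fst q * ?a) / ?b)) = id"
        using b by (auto simp: \<gamma>_def)
    qed
    moreover have "f (t, s t) = (t, 0)" using gz[OF tI] by (simp add: f_def)
    ultimately have dg: "(g has_derivative (\<lambda>q. (fst q, (snd q - fst q * ?a) / ?b))) (at (t, 0))" by simp
    have "((\<lambda>t. (t, 0::real)) has_derivative (\<lambda>d. (d, 0))) (at t)"
      by (auto intro!: derivative_eq_intros)
    from has_derivative_snd[OF diff_chain_at[OF this dg]]
    show ?thesis unfolding s_def o_def s'_def by (rule has_derivative_eq_rhs) (auto simp: field_simps)
  qed
  have d\<gamma>: "(\<gamma> has_derivative (\<lambda>d. d *\<^sub>R (v + s' t *\<^sub>R n))) (at t)" if "t \<in> I" for t
    unfolding \<gamma>_def c_def split_beta fst_conv snd_conv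
    using ds[OF that] by (auto intro!: derivative_eq_intros simp: algebra_simps)
  have Io: "open I" by (simp add: I_def)
  have \<gamma>U: "\<gamma> ` I \<subseteq> U" using cQ gQ unfolding \<gamma>_def by blast
  have bnz: "pd n \<rho> (\<gamma> t) \<noteq> 0" if "t \<in> I" for t using cQ gQ that unfolding \<gamma>_def by force
  \<comment> \<open>Bootstrapping: the derivative of \<open>\<gamma>\<close> is an expression in
    \<open>\<gamma>\<close> itself and smooth functions, so each order of regularity yields the next
    one.\<close>
  have "Ck_on k \<gamma> I" for k
  proof (induction k)
    case 0
    have "continuous_on I \<gamma>" using d\<gamma> by (meson continuous_at_imp_continuous_on has_derivative_continuous)
    then show ?case by simp
  next
    case (Suc k)
    have 1: "Ck_on k (\<lambda>t. pd w \<rho> (\<gamma> t)) I" for w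
      using Ck_on_compose[OF Io U(1) \<gamma>U _ Suc, of "pd w \<rho>"] smooth_on_pd[OF U(2)] unfolding smooth_on_def
      by blast
    have "(\<lambda>t. pd n \<rho> (\<gamma> t)) ` I \<subseteq> -{0}" using bnz by fastforce
    then have 2: "Ck_on k (\<lambda>t. inverse (pd n \<rho> (\<gamma> t))) I"
      using smooth_on_inverse_real unfolding smooth_on_def
      by (intro Ck_on_compose[OF Io open_Compl[OF closed_singleton[of 0]] _ _ 1]) auto
    have 3: "Ck_on k (\<lambda>t. - pd v \<rho> (\<gamma> t)) I"
      by (rule Ck_on_bounded_linear_comp[OF bounded_linear_minus[OF bounded_linear_ident] Io 1])
    have s'k: "Ck_on k s' I" unfolding s'_def
      by (rule Ck_on_bilinear[OF bounded_bilinear_mult Io 3 2])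
    have "Ck_on k (\<lambda>t. v + s' t *\<^sub>R n) I"
      by (intro Ck_on_add Io Ck_on_const Ck_on_bilinear[OF bounded_bilinear_scaleR] s'k)
    then have "Ck_on k (\<lambda>t. d *\<^sub>R (v + s' t *\<^sub>R n)) I" for d
      by (intro Ck_on_bilinear[OF bounded_bilinear_scaleR] Io Ck_on_const)
    then have "Ck_on k (pd d \<gamma>) I" for d
      by (subst Ck_on_cong[OF Io]) (use pd_eqI[OF d\<gamma>] in auto)
    then show ?case unfolding Ck_on_Suc using d\<gamma> differentiable_def by blast
  qed
  moreover have "\<gamma> ` I \<subseteq> S" unfolding S using \<gamma>U gz by (auto simp: \<gamma>_def)
  moreover have "0 \<in> I" using e0 by (simp add: I_def)
  moreover have \<gamma>0: "\<gamma> 0 = z" using gf[OF z0] f0 by (simp add: \<gamma>_def s_def c_def)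
  moreover have "(\<gamma> has_vector_derivative v) (at 0)"
    using d\<gamma>[OF \<open>0 \<in> I\<close>] v \<gamma>0 by (simp add: has_vector_derivative_def s'_def)
  ultimately show ?thesis unfolding tangent_space_def using e0(1) by (auto simp: I_def smooth_on_def)
qed

lemma tangent_derivative_eq:
  assumes "v \<in> tangent_space S z" "F differentiable (at z)" "G differentiable (at z)"
    "\<And>w. w \<in> S \<Longrightarrow> F w = G w"
  shows "pd v F z = pd v G z"
proof -
  obtain \<epsilon> \<gamma> where g: "0 < \<epsilon>" "\<gamma> ` {-\<epsilon><..<\<epsilon>} \<subseteq> S" "\<gamma> 0 = z" "(\<gamma> has_vector_derivative v) (at 0)"
    using assms(1) unfolding tangent_space_def by auto
  have *: "((\<lambda>t. F (\<gamma> t)) has_derivative (\<lambda>d. pd (d *\<^sub>R v) F z)) (at 0)"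
    if "F differentiable (at z)" for F :: "quat2 \<Rightarrow> 'a"
    using diff_chain_at[OF g(4)[unfolded has_vector_derivative_def], of F "\<lambda>d. pd d F z"] pd_works[OF that] g(3)
    by (simp add: o_def)
  have eq: "F (\<gamma> t) = G (\<gamma> t)" if "t \<in> {-\<epsilon><..<\<epsilon>}" for t
    using g(2) assms(4) that by blast
  have "((\<lambda>t. F (\<gamma> t)) has_derivative (\<lambda>d. pd (d *\<^sub>R v) G z)) (at 0)"
    by (rule iffD2[OF has_derivative_cong_open[OF open_greaterThanLessThan[of "-\<epsilon>" \<epsilon>] _ eq] *[OF assms(3)]])
      (use g(1) in auto)
  from has_derivative_unique[OF this *[OF assms(2)]] show ?thesis by (metis scaleR_one)
qed

lemma tangent_space_eq_kernel:
  assumes def: "defining_function S U \<rho>" and z: "z \<in> S"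
  shows "tangent_space S z = {v. pd v \<rho> z = 0}"
proof -
  have "\<rho> differentiable (at z)"
    using def z unfolding defining_function_def by (auto intro: smooth_on_differentiable)
  moreover have "\<rho> w = 0" if "w \<in> S" for w using def that unfolding defining_function_def by auto
  ultimately have "pd v \<rho> z = 0" if "v \<in> tangent_space S z" for v
    using tangent_derivative_eq[OF that, of \<rho> "\<lambda>_. 0"] by (simp add: pd_const)
  then show ?thesis using kernel_subset_tangent_space[OF def z] by blast
qed

text \<open>The combination \<open>w\<close> of \<open>u\<close> and \<open>v\<close> is annihilated
  by the differential of \<open>\<rho>\<close>, hence tangent, and \<open>h\<close> is constant
  along \<open>S\<close>. The cross-multiplied form says that the differential of \<open>h\<close>
  is a multiple of that of \<open>\<rho>\<close> without choosing a transversal direction.\<close>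

lemma pd_proportional:
  fixes h :: "quat2 \<Rightarrow> 'b::euclidean_space"
  assumes def: "defining_function S U \<rho>" and z: "z \<in> S"
    and h: "h differentiable (at z)" "\<And>w. w \<in> S \<Longrightarrow> h w = 0"
  shows "pd u \<rho> z *\<^sub>R pd v h z = pd v \<rho> z *\<^sub>R pd u h z"
proof -
  have dr: "\<rho> differentiable (at z)"
    using def z unfolding defining_function_def by (auto intro: smooth_on_differentiable)
  define w where "w = pd u \<rho> z *\<^sub>R v - pd v \<rho> z *\<^sub>R u"
  have "pd w \<rho> z = 0" unfolding w_def using linear_diff[OF pd_linear[OF dr]] linear_scale[OF pd_linear[OF dr]]
    by simp
  then have "w \<in> tangent_space S z" by (simp add: tangent_space_eq_kernel[OF def z])
  then have "pd w h z = 0"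
    using tangent_derivative_eq[of w S z h "\<lambda>_. 0"] h by (simp add: pd_const)
  then show ?thesis unfolding w_def using linear_diff[OF pd_linear[OF h(1)]] linear_scale[OF pd_linear[OF h(1)]]
    by simp
qed

text \<open>Vanishing of all derivatives of order less than \<open>k\<close>: \<open>k\<close> is one more than the order of contact.\<close>

primrec van :: "nat \<Rightarrow> 'a set \<Rightarrow> ('a::euclidean_space \<Rightarrow> 'b::euclidean_space) \<Rightarrow> bool" where
  "van 0 S F \<longleftrightarrow> True"
| "van (Suc k) S F \<longleftrightarrow> (\<forall>z\<in>S. F z = 0) \<and> (\<forall>v. van k S (pd v F))"

lemma van_cong:
  assumes "open U" "S \<subseteq> U" "\<And>w. w \<in> U \<Longrightarrow> F w = G w"
  shows "van k S F \<longleftrightarrow> van k S G"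
  using assms(3)
proof (induction k arbitrary: F G)
  case (Suc k)
  have "van k S (pd v F) \<longleftrightarrow> van k S (pd v G)" for v
    by (rule Suc.IH) (rule pd_cong[OF assms(1) _ Suc.prems], auto)
  moreover have "F z = G z" if "z \<in> S" for z using Suc.prems assms(2) that by auto
  ultimately show ?case by auto
qed simp

lemma van_eq:
  "van k S G \<Longrightarrow> open U \<Longrightarrow> S \<subseteq> U \<Longrightarrow> (\<And>w. w \<in> U \<Longrightarrow> F w = G w) \<Longrightarrow> van k S F"
  using van_cong by blast

lemma van_SucD: "van (Suc k) S F \<Longrightarrow> van k S F"
  by (induction k arbitrary: F) auto

lemma van_le: "van k S F \<Longrightarrow> j \<le> k \<Longrightarrow> van j S F"
  by (induction k) (auto simp: le_Suc_eq simp del: van.simps(2) dest: van_SucD)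

lemma van_zero: "van k S (\<lambda>z. 0)"
proof (induction k)
  case (Suc k)
  have "pd v (\<lambda>z. 0 :: 'b) = (\<lambda>z. 0)" for v :: 'a by (auto simp: pd_const)
  then show ?case using Suc by simp
qed simp

lemma van_add:
  assumes "open U" "S \<subseteq> U"
  shows "smooth_on F U \<Longrightarrow> smooth_on G U \<Longrightarrow> van k S F \<Longrightarrow> van k S G \<Longrightarrow> van k S (\<lambda>z. F z + G z)"
proof (induction k arbitrary: F G)
  case (Suc k)
  have "van k S (\<lambda>z. pd v F z + pd v G z)" for v
    using Suc.prems by (intro Suc.IH) (auto intro: smooth_on_pd)
  then have "van k S (pd v (\<lambda>z. F z + G z))" for v
    by (rule van_eq[OF _ assms]) (use Suc.prems in \<open>auto intro: pd_add smooth_on_differentiable\<close>)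
  then show ?case using Suc.prems by auto
qed simp

lemma van_linear_comp:
  assumes "bounded_linear f" "open U" "S \<subseteq> U"
  shows "smooth_on F U \<Longrightarrow> van k S F \<Longrightarrow> van k S (\<lambda>z. f (F z))"
proof (induction k arbitrary: F)
  case (Suc k)
  have "van k S (\<lambda>z. f (pd v F z))" for v
    using Suc.prems by (intro Suc.IH) (auto intro: smooth_on_pd)
  then have "van k S (pd v (\<lambda>z. f (F z)))" for v
    by (rule van_eq[OF _ assms(2,3)])
      (use Suc.prems in \<open>auto intro: pd_linear_comp[OF assms(1)] smooth_on_differentiable\<close>)
  then show ?case using Suc.prems linear_simps(3)[OF assms(1)] by auto
qed simp

lemma van_diff:
  assumes "open U" "S \<subseteq> U" "smooth_on F U" "smooth_on G U" "van k S F" "van k S G"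
  shows "van k S (\<lambda>z. F z - G z)"
  using van_add[OF assms(1,2,3) smooth_on_uminus[OF assms(1,4)] assms(5)
      van_linear_comp[OF bounded_linear_minus[OF bounded_linear_ident] assms(1,2,4,6)]] by simp

lemma van_sum:
  assumes "open U" "S \<subseteq> U" "\<And>i. i \<in> I \<Longrightarrow> smooth_on (F i) U" "\<And>i. i \<in> I \<Longrightarrow> van k S (F i)"
  shows "van k S (\<lambda>z. \<Sum>i\<in>I. F i z)"
  using assms(3,4)
  by (induction I rule: infinite_finite_induct)
    (auto intro!: van_zero van_add[OF assms(1,2)] smooth_on_sum assms(1))

lemma van_bilinear:
  assumes op: "bounded_bilinear op" and U: "open U" "S \<subseteq> U"
  shows "smooth_on F U \<Longrightarrow> smooth_on G U \<Longrightarrow> van k S F \<Longrightarrow> van k S (\<lambda>z. op (F z) (G z))"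
proof (induction k arbitrary: F G)
  case (Suc k)
  have "van k S (\<lambda>z. op (F z) (pd v G z) + op (pd v F z) (G z))" for v
    using Suc.prems Suc.prems(3)[THEN van_SucD]
    by (intro van_add[OF U] smooth_on_bilinear[OF op U(1)] Suc.IH) (auto intro: smooth_on_pd)
  then have "van k S (pd v (\<lambda>z. op (F z) (G z)))" for v
    by (rule van_eq[OF _ U])
      (use Suc.prems in \<open>auto intro: pd_bilinear[OF op] smooth_on_differentiable\<close>)
  then show ?case using Suc.prems bounded_bilinear.zero_left[OF op] by auto
qed simp

lemma van_bilinear':
  assumes op: "bounded_bilinear op" and U: "open U" "S \<subseteq> U"
    "smooth_on F U" "smooth_on G U" "van k S G"
  shows "van k S (\<lambda>z. op (F z) (G z))"
  by (rule van_bilinear[OF bounded_bilinear.flip[OF op] U(1,2,4,3,5)])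

text \<open>Multiplication by \<open>\<rho>\<close> gains one order: in the product rule one term
  keeps the factor \<open>\<rho>\<close>, so that induction applies, and the other contains
  \<open>F\<close> undifferentiated.\<close>

lemma van_scaleR_Suc:
  assumes U: "open U" "S \<subseteq> U" "smooth_on \<rho> U" "\<And>z. z \<in> S \<Longrightarrow> \<rho> z = 0"
  shows "smooth_on F U \<Longrightarrow> van k S F \<Longrightarrow> van (Suc k) S (\<lambda>z. \<rho> z *\<^sub>R F z)"
proof (induction k arbitrary: F)
  case 0 then show ?case using U(4) by simp
next
  case (Suc k)
  have "van (Suc k) S (\<lambda>z. \<rho> z *\<^sub>R pd v F z + pd v \<rho> z *\<^sub>R F z)" for v
  proof (rule van_add[OF U(1,2)])
    show "van (Suc k) S (\<lambda>z. \<rho> z *\<^sub>R pd v F z)"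
      using Suc.prems by (intro Suc.IH smooth_on_pd) auto
    show "van (Suc k) S (\<lambda>z. pd v \<rho> z *\<^sub>R F z)"
      by (rule van_bilinear'[OF bounded_bilinear_scaleR U(1,2) smooth_on_pd[OF U(3)] Suc.prems])
  qed (use Suc.prems U in \<open>auto intro!: smooth_on_scaleR smooth_on_pd\<close>)
  then have "van (Suc k) S (pd v (\<lambda>z. \<rho> z *\<^sub>R F z))" for v
    by (rule van_eq[OF _ U(1,2)])
      (use Suc.prems U in \<open>auto intro: pd_scaleR smooth_on_differentiable\<close>)
  then show ?case unfolding van.simps(2)[of "Suc k"] using U(4) by auto
qed

lemma van_power_scaleR:
  assumes "open U" "S \<subseteq> U" "smooth_on \<rho> U" "\<And>z. z \<in> S \<Longrightarrow> \<rho> z = 0" "smooth_on F U"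
  shows "van k S (\<lambda>z. \<rho> z ^ k *\<^sub>R F z)"
proof (induction k)
  case (Suc k)
  show ?case
    using van_scaleR_Suc[OF assms(1-4) _ Suc] assms
    by (simp del: van.simps add: smooth_on_scaleR smooth_on_power)
qed simp

lemma van_near_zero:
  assumes "open V" "S \<subseteq> V" "\<And>z. z \<in> V \<Longrightarrow> F z = 0"
  shows "van k S F"
  using van_cong[OF assms(1,2), of F "\<lambda>_. 0"] assms(3) van_zero by blast

text \<open>The operator is tangential to the level sets of \<open>\<rho>\<close>, so it loses no
  order of vanishing, whereas a general derivative loses one. Its commutator with
  \<open>pd w\<close> contains only first derivatives of \<open>F\<close>, which still vanish to
  order \<open>k\<close>.\<close>

lemma van_cross:
  fixes F :: "quat2 \<Rightarrow> 'b::euclidean_space"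
  assumes def: "defining_function S U \<rho>"
  shows "smooth_on F U \<Longrightarrow> van k S F \<Longrightarrow> van k S (\<lambda>z. pd u \<rho> z *\<^sub>R pd v F z - pd v \<rho> z *\<^sub>R pd u F z)"
proof (induction k arbitrary: F)
  case (Suc k)
  have U: "open U" "smooth_on \<rho> U" "S \<subseteq> U" using def unfolding defining_function_def by auto
  note d = smooth_on_differentiable
  let ?T = "\<lambda>F z. pd u \<rho> z *\<^sub>R pd v F z - pd v \<rho> z *\<^sub>R pd u F z"
  have s [intro]: "smooth_on (pd a \<rho>) U" "smooth_on (pd a (pd b \<rho>)) U" "smooth_on (pd a F) U"
    "smooth_on (pd a (pd b F)) U" for a b
    using U Suc.prems by (auto intro: smooth_on_pd)
  note si [intro!] = smooth_on_scaleR[OF U(1)] smooth_on_diff[OF U(1)] smooth_on_add[OF U(1)]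
  have "van k S (pd w (?T F))" for w
  proof -
    have vF: "van k S (pd a F)" for a using Suc.prems(2) by (metis van.simps(2))
    have eq: "pd w (?T F) z = ?T (pd w F) z + (pd w (pd u \<rho>) z *\<^sub>R pd v F z - pd w (pd v \<rho>) z *\<^sub>R pd u F z)"
      if "z \<in> U" for z
    proof -
      have dd: "pd a \<rho> differentiable at z" "pd a F differentiable at z" for a using d that s by blast+
      have "pd w (?T F) z = pd w (\<lambda>z. pd u \<rho> z *\<^sub>R pd v F z) z - pd w (\<lambda>z. pd v \<rho> z *\<^sub>R pd u F z) z"
        by (intro pd_diff d[OF _ that]) auto
      then show ?thesis
        using pd_symmetric[OF U(1) that Suc.prems(1), of w] by (simp add: pd_scaleR[OF dd] algebra_simps)
    qed
    have "van k S (\<lambda>z. ?T (pd w F) z + (pd w (pd u \<rho>) z *\<^sub>R pd v F z - pd w (pd v \<rho>) z *\<^sub>R pd u F z))"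
      by (intro van_add[OF U(1,3)] van_diff[OF U(1,3)] Suc.IH van_bilinear'[OF bounded_bilinear_scaleR U(1,3)] vF) auto
    then show ?thesis by (rule van_eq[OF _ U(1,3) eq])
  qed
  moreover have "?T F z = 0" if "z \<in> S" for z
    using pd_proportional[OF def that, of F u v] Suc.prems that U(3) by (auto intro: d)
  ultimately show ?case by simp
qed simp

no_notation scalar_prod (infix "\<bullet>" 70)
hide_const (open) Determinant.det Matrix.mat Matrix.vec

section \<open>The seven-forms defining \<open>f_perp\<close>\<close>

definition coord :: "nat \<Rightarrow> quat2" where
  "coord k = (if k < 4 then e_x k else e_y (k - 4))"

lemma qunit_simps: "qunit 0 = 1" "qunit (Suc 0) = Quat 0 1 0 0" "qunit 2 = Quat 0 0 1 0" "qunit 3 = Quat 0 0 0 1"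
  by (simp_all add: qunit_def quat_eq_iff)

lemma inner_coord: "v \<bullet> coord 0 = qRe (fst v)" "v \<bullet> coord (Suc 0) = qIm1 (fst v)" "v \<bullet> coord 2 = qIm2 (fst v)"
  "v \<bullet> coord 3 = qIm3 (fst v)" "v \<bullet> coord 4 = qRe (snd v)" "v \<bullet> coord 5 = qIm1 (snd v)"
  "v \<bullet> coord 6 = qIm2 (snd v)" "v \<bullet> coord 7 = qIm3 (snd v)"
  by (simp_all add: coord_def e_x_def e_y_def inner_prod_def inner_quat_def qunit_def)

lemma lessThan_8: "{..<8::nat} = {0, Suc 0, 2, 3, 4, 5, 6, 7}"
  by auto

lemma lessThan_4: "{..<4::nat} = {0, Suc 0, 2, 3}"
  by auto

lemma coord_expand: "v = (\<Sum>k<8. (v \<bullet> coord k) *\<^sub>R coord k)"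
  unfolding lessThan_8
  by (simp add: inner_coord prod_eq_iff quat_eq_iff) (simp add: coord_def e_x_def e_y_def qunit_def)

lemma inner_expand_coord: "v \<bullet> w = (\<Sum>k<8. (v \<bullet> coord k) * (w \<bullet> coord k))"
proof -
  have "v \<bullet> w = v \<bullet> (\<Sum>k<8. (w \<bullet> coord k) *\<^sub>R coord k)" by (simp flip: coord_expand)
  then show ?thesis by (simp add: inner_sum_right mult.commute)
qed

lemma coord_inner_coord: "i < 8 \<Longrightarrow> j < 8 \<Longrightarrow> coord i \<bullet> coord j = (if i = j then 1 else 0)"
proof -
  have "\<forall>i\<in>{0, Suc 0, 2, 3, 4, 5, 6, 7}. \<forall>j\<in>{0, Suc 0, 2, 3, 4, 5, 6, 7}.
    coord i \<bullet> coord j = (if i = j then 1 else 0)"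
    by (simp add: inner_coord) (simp add: coord_def e_x_def e_y_def qunit_def)
  then show "i < 8 \<Longrightarrow> j < 8 \<Longrightarrow> ?thesis" unfolding lessThan_8[symmetric] by simp
qed

section \<open>Real coordinate forms as determinants\<close>

definition rmat :: "nat list \<Rightarrow> quat2 list \<Rightarrow> real Matrix.mat" where
  "rmat js vs = Matrix.mat (length js) (length js) (\<lambda>(i, j). vs ! j \<bullet> coord (js ! i))"

text \<open>The value on \<open>vs\<close> of the wedge product, in the order of \<open>js\<close>,
  of the real coordinate one-forms with these indices.\<close>

definition rdet :: "nat list \<Rightarrow> quat2 list \<Rightarrow> real" where
  "rdet js vs = Determinant.det (rmat js vs)"

lemma rmat_carrier: "rmat js vs \<in> carrier_mat (length js) (length js)"
  by (simp add: rmat_def)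

lemma rdet_altdef:
  "rdet js vs = (\<Sum>\<sigma> | \<sigma> permutes {..<length js}.
     of_int (sign \<sigma>) * (\<Prod>i<length js. vs ! \<sigma> i \<bullet> coord (js ! i)))"
  unfolding rdet_def Determinant.det_def rmat_def atLeast0LessThan
  by (auto intro!: sum.cong prod.cong arg_cong2[of _ _ _ _ times] simp: permutes_in_image[THEN iffD2] sign_def
      dest: permutes_in_image simp: lessThan_iff[symmetric] simp del: lessThan_iff)

lemma rdet_dup:
  assumes "i < length js" "j < length js" "i \<noteq> j" "js ! i = js ! j"
  shows "rdet js vs = 0"
  unfolding rdet_def
  by (rule det_identical_rows[OF rmat_carrier assms(3,1,2)]) (use assms in \<open>auto simp: rmat_def\<close>)

lemma rdet_swap:
  assumes "i < length js" "j < length js" "i \<noteq> j"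
  shows "rdet (js[i := js ! j, j := js ! i]) vs = - rdet js vs"
proof -
  have "rmat (js[i := js ! j, j := js ! i]) vs = swaprows i j (rmat js vs)"
    using assms by (intro eq_matI) (auto simp: rmat_def nth_list_update)
  then show ?thesis unfolding rdet_def using det_swaprows[OF assms rmat_carrier] by simp
qed

text \<open>A kernel vector of the transposed matrix is the coordinate vector of a \<open>u\<close>
  orthogonal to all of \<open>ws\<close>, so non-degeneracy becomes a statement about scalar
  products.\<close>

lemma rdet_8_eq_0_iff: "rdet [0..<8] ws = 0 \<longleftrightarrow> (\<exists>u\<noteq>0. \<forall>j<8. ws ! j \<bullet> u = 0)"
proof -
  let ?A = "transpose_mat (rmat [0..<8] ws)"
  have A: "?A \<in> carrier_mat 8 8" using rmat_carrier[of "[0..<8]" ws] by simp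
  have "rdet [0..<8] ws = Determinant.det ?A"
    unfolding rdet_def using det_transpose[OF rmat_carrier[of "[0..<8]" ws]] by simp
  also have "\<dots> = 0 \<longleftrightarrow> (\<exists>v. v \<in> carrier_vec 8 \<and> v \<noteq> 0\<^sub>v 8 \<and> ?A *\<^sub>v v = 0\<^sub>v 8)"
    by (rule det_0_iff_vec_prod_zero[OF A])
  also have "\<dots> \<longleftrightarrow> (\<exists>u\<noteq>0. \<forall>j<8. ws ! j \<bullet> u = 0)"
  proof -
    have key: "?A *\<^sub>v v = 0\<^sub>v 8 \<longleftrightarrow> (\<forall>j<8. ws ! j \<bullet> u = 0)"
      if "v \<in> carrier_vec 8" "\<And>k. k < 8 \<Longrightarrow> vec_index v k = u \<bullet> coord k" for v u
    proof -
      have "vec_index (?A *\<^sub>v v) j = ws ! j \<bullet> u" if j: "j < 8" for j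
      proof -
        have "vec_index (?A *\<^sub>v v) j = (\<Sum>k<8. (ws ! j \<bullet> coord k) * (u \<bullet> coord k))"
          using that(1) j \<open>v \<in> carrier_vec 8\<close> \<open>\<And>k. k < 8 \<Longrightarrow> vec_index v k = u \<bullet> coord k\<close>
          by (simp add: scalar_prod_def rmat_def atLeast0LessThan del: upt_rec_numeral)
        then show ?thesis by (simp only: inner_expand_coord[of "ws ! j" u])
      qed
      then show ?thesis by (auto simp: Matrix.vec_eq_iff rmat_def)
    qed
    show ?thesis
    proof
      assume "\<exists>v. v \<in> carrier_vec 8 \<and> v \<noteq> 0\<^sub>v 8 \<and> ?A *\<^sub>v v = 0\<^sub>v 8"
      then obtain v where v: "v \<in> carrier_vec 8" "v \<noteq> 0\<^sub>v 8" "?A *\<^sub>v v = 0\<^sub>v 8" by blast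
      define u where "u = (\<Sum>k<8. vec_index v k *\<^sub>R coord k)"
      have uk: "vec_index v k = u \<bullet> coord k" if "k < 8" for k
      proof -
        have "u \<bullet> coord k = (\<Sum>j<8. vec_index v j * (if j = k then 1 else 0))"
          unfolding u_def inner_sum_left using that by (intro sum.cong) (auto simp: coord_inner_coord)
        then show ?thesis using that by (simp add: if_distrib cong: if_cong)
      qed
      have "u \<noteq> 0"
      proof
        assume "u = 0"
        then have "v = 0\<^sub>v 8" using v(1) uk by (intro eq_vecI) auto
        then show False using v(2) by blast
      qed
      then show "\<exists>u\<noteq>0. \<forall>j<8. ws ! j \<bullet> u = 0" using key[OF v(1) uk] v(3) by blast
    next
      assume "\<exists>u\<noteq>0. \<forall>j<8. ws ! j \<bullet> u = 0"
      then obtain u where u: "u \<noteq> 0" "\<forall>j<8. ws ! j \<bullet> u = 0" by blast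
      define v where "v = Matrix.vec 8 (\<lambda>k. u \<bullet> coord k)"
      have "v \<noteq> 0\<^sub>v 8"
      proof
        assume "v = 0\<^sub>v 8"
        then have "u \<bullet> coord k = 0" if "k < 8" for k
          using that by (metis index_vec index_zero_vec(1) v_def)
        then have "u = 0" using coord_expand[of u] by simp
        then show False using u(1) by blast
      qed
      moreover have "?A *\<^sub>v v = 0\<^sub>v 8" by (rule iffD2[OF key u(2)]) (auto simp: v_def)
      ultimately show "\<exists>v. v \<in> carrier_vec 8 \<and> v \<noteq> 0\<^sub>v 8 \<and> ?A *\<^sub>v v = 0\<^sub>v 8"
        by (intro exI[of _ v]) (auto simp: v_def)
    qed
  qed
  finally show ?thesis .
qed

text \<open>\<open>insert_index k\<close> enumerates the indices different from \<open>k\<close>, so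
  this is the seven-form in all coordinates but the one with index \<open>k\<close>.\<close>

definition minor :: "quat2 list \<Rightarrow> nat \<Rightarrow> real" where
  "minor vs k = rdet (map (insert_index k) [0..<7]) vs"

lemma rdet_laplace: "rdet [0..<8] (w # vs) = (\<Sum>k<8. (w \<bullet> coord k) * ((-1) ^ k * minor vs k))"
proof -
  let ?A = "rmat [0..<8] (w # vs)"
  have "rdet [0..<8] (w # vs) = (\<Sum>k<8. ?A $$ (k, 0) * cofactor ?A k 0)"
    unfolding rdet_def using laplace_expansion_column[OF rmat_carrier, of 0 "[0..<8]" "w # vs"] by simp
  also have "\<dots> = (\<Sum>k<8. (w \<bullet> coord k) * ((-1) ^ k * minor vs k))"
  proof (intro sum.cong refl arg_cong2[of _ _ _ _ times])
    fix k :: nat assume "k \<in> {..<8}"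
    then have k: "k < 8" by simp
    show "?A $$ (k, 0) = w \<bullet> coord k" using k by (simp add: rmat_def)
    have "mat_delete ?A k 0 = rmat (map (insert_index k) [0..<7]) vs"
    proof (rule eq_matI)
      fix i j assume "i < dim_row (rmat (map (insert_index k) [0..<7]) vs)"
        "j < dim_col (rmat (map (insert_index k) [0..<7]) vs)"
      then have ij: "i < 7" "j < 7" by (auto simp: rmat_def)
      then show "mat_delete ?A k 0 $$ (i, j) = rmat (map (insert_index k) [0..<7]) vs $$ (i, j)"
        using k by (simp add: mat_delete_def rmat_def insert_index_def del: upt_rec_numeral)
    qed (auto simp: rmat_def mat_delete_def)
    then show "cofactor ?A k 0 = (-1) ^ k * minor vs k"
      by (simp add: cofactor_def minor_def rdet_def)
  qed
  finally show ?thesis .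
qed

text \<open>The signed minors are the coordinates of a vector orthogonal to \<open>vs\<close>, hence a multiple of \<open>\<nu>\<close>.\<close>

lemma minor_eq:
  assumes \<nu>: "norm \<nu> = 1" and vs: "length vs = 7" "\<forall>v\<in>set vs. \<nu> \<bullet> v = 0" and k: "k < 8"
  shows "(-1) ^ k * minor vs k = (\<nu> \<bullet> coord k) * rdet [0..<8] (\<nu> # vs)"
proof -
  define m where "m = (\<Sum>k<8. ((-1) ^ k * minor vs k) *\<^sub>R coord k)"
  have wm: "w \<bullet> m = rdet [0..<8] (w # vs)" for w
    unfolding m_def rdet_laplace inner_sum_right by (intro sum.cong) auto
  have 0: "w \<bullet> m = 0" if "w \<bullet> \<nu> = 0" for w
  proof -
    have "(w # vs) ! j \<bullet> \<nu> = 0" if "j < 8" for j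
      using \<open>w \<bullet> \<nu> = 0\<close> vs that by (cases j) (auto simp: inner_commute)
    moreover have "\<nu> \<noteq> 0" using \<nu> by auto
    ultimately show ?thesis unfolding wm rdet_8_eq_0_iff by blast
  qed
  have "(coord k - (\<nu> \<bullet> coord k) *\<^sub>R \<nu>) \<bullet> m = 0"
    by (rule 0) (use \<nu> in \<open>simp add: inner_diff_left norm_eq_1 inner_commute[of \<nu> "coord k"]\<close>)
  then have "coord k \<bullet> m = (\<nu> \<bullet> coord k) * (\<nu> \<bullet> m)" by (simp add: inner_diff_left)
  moreover have "coord k \<bullet> m = (\<Sum>j<8. ((-1) ^ j * minor vs j) * (if k = j then 1 else 0))"
    unfolding m_def inner_sum_right using k by (intro sum.cong) (auto simp: coord_inner_coord)
  ultimately show ?thesis using k wm[of \<nu>] by (simp add: if_distrib cong: if_cong)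
qed

text \<open>Gives uniqueness in the definition of \<open>f_perp\<close>: the volume form does not
  vanish identically on the tangent space. If \<open>\<nu>\<close> has a non-zero coordinate with
  index \<open>k\<close>, the tangential projections of the other seven coordinate vectors together
  with \<open>\<nu>\<close> admit no common orthogonal vector.\<close>

lemma exists_nonzero_rdet:
  assumes "norm \<nu> = 1"
  shows "\<exists>vs. length vs = 7 \<and> (\<forall>v\<in>set vs. \<nu> \<bullet> v = 0) \<and> rdet [0..<8] (\<nu> # vs) \<noteq> 0"
proof -
  have "\<exists>k<8. \<nu> \<bullet> coord k \<noteq> 0"
  proof (rule ccontr)
    assume "\<not> ?thesis"
    then have "\<nu> = 0" using coord_expand[of \<nu>] by simp
    then show False using assms by simp
  qed
  then obtain k where k: "k < 8" "\<nu> \<bullet> coord k \<noteq> 0" by blast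
  define vs where "vs = map (\<lambda>i. coord (insert_index k i) - (\<nu> \<bullet> coord (insert_index k i)) *\<^sub>R \<nu>) [0..<7]"
  have l: "length vs = 7" by (simp add: vs_def)
  have o: "\<forall>v\<in>set vs. \<nu> \<bullet> v = 0" using assms by (auto simp: vs_def inner_diff_right norm_eq_1)
  have "rdet [0..<8] (\<nu> # vs) \<noteq> 0"
  proof
    assume "rdet [0..<8] (\<nu> # vs) = 0"
    then obtain u where u: "u \<noteq> 0" "\<And>j. j < 8 \<Longrightarrow> (\<nu> # vs) ! j \<bullet> u = 0" unfolding rdet_8_eq_0_iff by blast
    have \<nu>u: "\<nu> \<bullet> u = 0" using u(2)[of 0] by simp
    have uj: "u \<bullet> coord j = 0" if "j < 8" "j \<noteq> k" for j
    proof -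
      define i where "i = (if j < k then j else j - 1)"
      have i: "i < 7" "insert_index k i = j" using that k by (auto simp: i_def insert_index_def)
      have "vs ! i \<bullet> u = 0" using u(2)[of "Suc i"] i by simp
      moreover have "vs ! i = coord j - (\<nu> \<bullet> coord j) *\<^sub>R \<nu>" using i by (simp add: vs_def del: upt_rec_numeral)
      ultimately show ?thesis using \<nu>u by (simp add: inner_diff_left inner_commute[of u "coord j"])
    qed
    have "0 = (\<Sum>j<8. (\<nu> \<bullet> coord j) * (u \<bullet> coord j))" using \<nu>u inner_expand_coord by metis
    also have "\<dots> = (\<Sum>j<8. if j = k then (\<nu> \<bullet> coord k) * (u \<bullet> coord k) else 0)"
      by (intro sum.cong) (use uj in auto)
    also have "\<dots> = (\<nu> \<bullet> coord k) * (u \<bullet> coord k)" using k by simp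
    finally have "u \<bullet> coord k = 0" using k by simp
    then have "u \<bullet> coord j = 0" if "j < 8" for j using uj that by (cases "j = k") auto
    then have "u = 0" using coord_expand[of u] by simp
    then show False using u by blast
  qed
  then show ?thesis using l o by blast
qed

lemma prod_list_of_real:
  "prod_list (map (\<lambda>i. of_real (h i)) [0..<n]) = (of_real (\<Prod>i<n. h i) :: quat)"
  by (induction n) (simp_all add: mult.commute flip: of_real_mult)

lemma vol_form_eq: "vol_form \<nu> z vs = - of_real (rdet [0..<8] (\<nu> z # vs))"
proof -
  have l: "length (dxs @ dys) = 8" by (simp add: dxs_def dys_def)
  have n: "(dxs @ dys) ! i = (\<lambda>v. of_real (v \<bullet> coord i))" if "i < 8" for i
    using that by (auto simp: dxs_def dys_def nth_append dx_def dy_def coord_def simp del: upt_rec_numeral)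
  have "prod_list (map (\<lambda>i. ((dxs @ dys) ! i) ((\<nu> z # vs) ! \<sigma> i)) [0..<8]) =
      of_real (\<Prod>i<8. (\<nu> z # vs) ! \<sigma> i \<bullet> coord ([0..<8] ! i))" for \<sigma>
  proof -
    have "prod_list (map (\<lambda>i. ((dxs @ dys) ! i) ((\<nu> z # vs) ! \<sigma> i)) [0..<8]) =
        prod_list (map (\<lambda>i. of_real ((\<nu> z # vs) ! \<sigma> i \<bullet> coord i)) [0..<8])"
      by (rule arg_cong[OF map_cong[OF refl]]) (use n in \<open>auto simp del: upt_rec_numeral\<close>)
    also have "\<dots> = of_real (\<Prod>i<8. (\<nu> z # vs) ! \<sigma> i \<bullet> coord i)" by (rule prod_list_of_real)
    also have "\<dots> = of_real (\<Prod>i<8. (\<nu> z # vs) ! \<sigma> i \<bullet> coord ([0..<8] ! i))"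
      by (intro arg_cong[of _ _ of_real] prod.cong) (auto simp del: upt_rec_numeral)
    finally show ?thesis .
  qed
  then show ?thesis
    unfolding vol_form_def wedge_def rdet_altdef l by (simp del: upt_rec_numeral)
qed

section \<open>Quaternionic wedge products in real coordinates\<close>

lemma linear_coord_expand:
  assumes "linear T"
  shows "T v = (\<Sum>k<8. (v \<bullet> coord k) *\<^sub>R T (coord k))"
  by (subst coord_expand[of v]) (simp add: linear_sum[OF assms] linear_scale[OF assms] o_def)

lemma dq_coord:
  "dq1 v = (\<Sum>k<4. (v \<bullet> coord k) *\<^sub>R qunit k)"
  "dq1_bar v = (\<Sum>k<4. (v \<bullet> coord k) *\<^sub>R qcnj (qunit k))"
  "dq2 v = (\<Sum>k<4. (v \<bullet> coord (k + 4)) *\<^sub>R qunit k)"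
  "dq2_bar v = (\<Sum>k<4. (v \<bullet> coord (k + 4)) *\<^sub>R qcnj (qunit k))"
  by (auto simp: dq1_def dq1_bar_def dq2_def dq2_bar_def dx_def dy_def coord_def of_real_def intro!: sum.cong)

lemma of_int_times_quat: "of_int s * (q :: quat) = of_int s *\<^sub>R q"
  by (simp add: scaleR_conv_of_real)

text \<open>Permutations act on the argument vectors only. After multilinear expansion the
  quaternionic coefficient \<open>C a b c\<close>, with its factors in the written order, therefore
  leaves the sum over permutations, and what remains is a real determinant.\<close>

lemma wedge_expand_aux:
  assumes l: "length \<theta>s = 7"
    and pr: "\<And>w. prod_list (map (\<lambda>i. (\<theta>s ! i) (w i)) [0..<7]) =
      (\<Sum>a<4. \<Sum>b<4. \<Sum>c<8. (\<Prod>i<7. w i \<bullet> coord (J a b c ! i)) *\<^sub>R C a b c)"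
    and J: "\<And>a b c :: nat. length (J a b c) = 7"
  shows "wedge \<theta>s vs = (\<Sum>a<4. \<Sum>b<4. \<Sum>c<8. rdet (J a b c) vs *\<^sub>R C a b c)"
proof -
  let ?P = "{\<sigma>. \<sigma> permutes {..<7::nat}}"
  let ?g = "\<lambda>\<sigma> a b c. (\<Prod>i<7. vs ! \<sigma> i \<bullet> coord (J a b c ! i))"
  have "wedge \<theta>s vs = (\<Sum>\<sigma>\<in>?P. \<Sum>a<4. \<Sum>b<4. \<Sum>c<8. (of_int (sign \<sigma>) * ?g \<sigma> a b c) *\<^sub>R C a b c)"
    unfolding wedge_def l pr of_int_times_quat scaleR_sum_right scaleR_scaleR ..
  also have "\<dots> = (\<Sum>a<4. \<Sum>b<4. \<Sum>c<8. \<Sum>\<sigma>\<in>?P. (of_int (sign \<sigma>) * ?g \<sigma> a b c) *\<^sub>R C a b c)"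
    by (subst sum.swap, rule sum.cong[OF refl], subst sum.swap, rule sum.cong[OF refl], rule sum.swap)
  finally show ?thesis by (simp add: rdet_altdef scaleR_sum_left J)
qed

lemma upt_7: "[0..<7] = [0, Suc 0, 2, 3, 4, 5, 6]"
  by (simp add: upt_rec)

lemma prod_7: "(\<Prod>i<7. g i) = g 0 * g (Suc 0) * g 2 * g 3 * g 4 * g 5 * (g 6 :: real)"
proof -
  have "{..<7::nat} = {0, Suc 0, 2, 3, 4, 5, 6}" by auto
  then show ?thesis by (simp add: mult_ac)
qed

lemma sum_reverse: "(\<Sum>x\<in>A. \<Sum>y\<in>B. \<Sum>z\<in>C. f x y z) = (\<Sum>z\<in>C. \<Sum>y\<in>B. \<Sum>x\<in>A. f x y z)"
proof -
  have "(\<Sum>x\<in>A. \<Sum>y\<in>B. \<Sum>z\<in>C. f x y z) = (\<Sum>x\<in>A. \<Sum>z\<in>C. \<Sum>y\<in>B. f x y z)"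
    by (intro sum.cong refl sum.swap)
  also have "\<dots> = (\<Sum>z\<in>C. \<Sum>x\<in>A. \<Sum>y\<in>B. f x y z)" by (rule sum.swap)
  also have "\<dots> = (\<Sum>z\<in>C. \<Sum>y\<in>B. \<Sum>x\<in>A. f x y z)" by (intro sum.cong refl sum.swap)
  finally show ?thesis .
qed

lemma wedge_expand1:
  assumes T: "linear T"
  shows "wedge ([dq1_bar, dq1] @ dys @ [T]) vs =
    (\<Sum>a<4. \<Sum>b<4. \<Sum>c<8. rdet [a, b, 4, 5, 6, 7, c] vs *\<^sub>R (qcnj (qunit a) * qunit b * T (coord c)))"
proof (rule wedge_expand_aux)
  fix w :: "nat \<Rightarrow> quat2"
  have "prod_list (map (\<lambda>i. (([dq1_bar, dq1] @ dys @ [T]) ! i) (w i)) [0..<7]) =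
     ((w 2 \<bullet> coord 4) * (w 3 \<bullet> coord 5) * (w 4 \<bullet> coord 6) * (w 5 \<bullet> coord 7)) *\<^sub>R
     (dq1_bar (w 0) * dq1 (w (Suc 0)) * T (w 6))"
    unfolding upt_7
    by (simp add: dys_def upt_rec dy_def coord_def of_real_def mult_ac nth_Cons' numeral_2_eq_2 numeral_3_eq_3)
  also have "\<dots> = (\<Sum>a<4. \<Sum>b<4. \<Sum>c<8. (\<Prod>i<7. w i \<bullet> coord ([a, b, 4, 5, 6, 7, c] ! i)) *\<^sub>R
      (qcnj (qunit a) * qunit b * T (coord c)))"
    unfolding linear_coord_expand[OF T, of "w 6"] dq_coord prod_7
    by (simp add: sum_product sum_distrib_left sum_distrib_right scaleR_sum_right mult_ac) (rule sum_reverse)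
  finally show "prod_list (map (\<lambda>i. (([dq1_bar, dq1] @ dys @ [T]) ! i) (w i)) [0..<7]) = \<dots>" .
qed (simp_all add: dys_def)

lemma wedge_expand2:
  assumes T: "linear T"
  shows "wedge (dxs @ [dq2_bar, dq2] @ [T]) vs =
    (\<Sum>a<4. \<Sum>b<4. \<Sum>c<8. rdet [0, Suc 0, 2, 3, a + 4, b + 4, c] vs *\<^sub>R (qcnj (qunit a) * qunit b * T (coord c)))"
proof (rule wedge_expand_aux)
  fix w :: "nat \<Rightarrow> quat2"
  have "prod_list (map (\<lambda>i. ((dxs @ [dq2_bar, dq2] @ [T]) ! i) (w i)) [0..<7]) =
     ((w 0 \<bullet> coord 0) * (w (Suc 0) \<bullet> coord (Suc 0)) * (w 2 \<bullet> coord 2) * (w 3 \<bullet> coord 3)) *\<^sub>R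
     (dq2_bar (w 4) * dq2 (w 5) * T (w 6))"
    unfolding upt_7
    by (simp add: dxs_def upt_rec dx_def coord_def of_real_def mult_ac nth_Cons' numeral_2_eq_2 numeral_3_eq_3)
  also have "\<dots> = (\<Sum>a<4. \<Sum>b<4. \<Sum>c<8. (\<Prod>i<7. w i \<bullet> coord ([0, Suc 0, 2, 3, a + 4, b + 4, c] ! i)) *\<^sub>R
      (qcnj (qunit a) * qunit b * T (coord c)))"
    unfolding linear_coord_expand[OF T, of "w 6"] dq_coord prod_7
    by (simp add: sum_product sum_distrib_left sum_distrib_right scaleR_sum_right mult_ac) (rule sum_reverse)
  finally show "prod_list (map (\<lambda>i. ((dxs @ [dq2_bar, dq2] @ [T]) ! i) (w i)) [0..<7]) = \<dots>" .
qed (simp_all add: dxs_def)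

text \<open>By antisymmetry only triples of distinct indices contribute; they are collected
  according to the one index among 0, 1, 2, 3 that is left out.\<close>

lemma alternating_sum:
  fixes d :: "nat \<Rightarrow> nat \<Rightarrow> nat \<Rightarrow> real" and C :: "nat \<Rightarrow> nat \<Rightarrow> nat \<Rightarrow> quat"
  assumes s1: "\<And>a b c. d b a c = - d a b c" and s2: "\<And>a b c. d a c b = - d a b c"
  shows "(\<Sum>a<4. \<Sum>b<4. \<Sum>c<4. d a b c *\<^sub>R C a b c) =
    d (Suc 0) 2 3 *\<^sub>R (C 1 2 3 + C 2 3 1 + C 3 1 2 - C 2 1 3 - C 1 3 2 - C 3 2 1) +
    d 0 2 3 *\<^sub>R (C 0 2 3 + C 2 3 0 + C 3 0 2 - C 2 0 3 - C 0 3 2 - C 3 2 0) +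
    d 0 (Suc 0) 3 *\<^sub>R (C 0 1 3 + C 1 3 0 + C 3 0 1 - C 1 0 3 - C 0 3 1 - C 3 1 0) +
    d 0 (Suc 0) 2 *\<^sub>R (C 0 1 2 + C 1 2 0 + C 2 0 1 - C 1 0 2 - C 0 2 1 - C 2 1 0)"
proof -
  have z: "d a a c = 0" "d a c c = 0" "d a c a = 0" for a c
    using s1[of a a c] s2[of a c c] s1[of a c a] s2[of c a a] by linarith+
  have p: "d b a c = - d a b c" "d a c b = - d a b c" "d c b a = - d a b c" "d b c a = d a b c" "d c a b = d a b c"
    for a b c
    using s1[of a b c] s2[of a b c] s1[of b c a] s2[of b a c] s1[of a c b] by linarith+
  note q = p[where a=1 and b=2 and c=3] p[where a=0 and b=2 and c=3] p[where a=0 and b=1 and c=3]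
    p[where a=0 and b=1 and c=2]
  show ?thesis unfolding lessThan_4
    by (simp add: z q[unfolded One_nat_def] scaleR_add_right scaleR_diff_right)
qed

text \<open>This is where the Fueter equation enters. In the first identity, antisymmetrising
  \<open>qcnj (qunit a) * qunit b\<close> over two imaginary units yields twice the third unit up to
  sign, so the sum is -2 (i t1 + j t2 + k t3), which the equation turns into 2 t0. The other three
  identities work in the same way and isolate the value with the missing index.\<close>

lemma fueter_alternating:
  assumes "qunit 0 * t 0 + qunit (Suc 0) * t (Suc 0) + qunit 2 * t 2 + qunit 3 * t 3 = 0"
  defines "C \<equiv> \<lambda>a b c. qcnj (qunit a) * qunit b * t c"
  shows "C 1 2 3 + C 2 3 1 + C 3 1 2 - C 2 1 3 - C 1 3 2 - C 3 2 1 = 2 *\<^sub>R t 0"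
    "C 0 2 3 + C 2 3 0 + C 3 0 2 - C 2 0 3 - C 0 3 2 - C 3 2 0 = - 2 *\<^sub>R t 1"
    "C 0 1 3 + C 1 3 0 + C 3 0 1 - C 1 0 3 - C 0 3 1 - C 3 1 0 = 2 *\<^sub>R t 2"
    "C 0 1 2 + C 1 2 0 + C 2 0 1 - C 1 0 2 - C 0 2 1 - C 2 1 0 = - 2 *\<^sub>R t 3"
  using assms(1) unfolding C_def by (simp_all add: qunit_simps quat_eq_iff)

lemma rdet_alternating:
  "rdet [b, a, c, 4, 5, 6, 7] vs = - rdet [a, b, c, 4, 5, 6, 7] vs"
  "rdet [a, c, b, 4, 5, 6, 7] vs = - rdet [a, b, c, 4, 5, 6, 7] vs"
  "rdet [0, Suc 0, 2, 3, b + 4, a + 4, c + 4] vs = - rdet [0, Suc 0, 2, 3, a + 4, b + 4, c + 4] vs"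
  "rdet [0, Suc 0, 2, 3, a + 4, c + 4, b + 4] vs = - rdet [0, Suc 0, 2, 3, a + 4, b + 4, c + 4] vs"
  "rdet [a, b, 4, 5, 6, 7, c] vs = rdet [a, b, c, 4, 5, 6, 7] vs"
  using rdet_swap[of 0 "[a, b, c, 4, 5, 6, 7]" 1 vs] rdet_swap[of 1 "[a, b, c, 4, 5, 6, 7]" 2 vs]
    rdet_swap[of 4 "[0, Suc 0, 2, 3, a + 4, b + 4, c + 4]" 5 vs]
    rdet_swap[of 5 "[0, Suc 0, 2, 3, a + 4, b + 4, c + 4]" 6 vs]
    rdet_swap[of 5 "[a, b, 4, 5, 6, 7, c]" 6 vs] rdet_swap[of 4 "[a, b, 4, 5, 6, c, 7]" 5 vs]
    rdet_swap[of 3 "[a, b, 4, 5, c, 6, 7]" 4 vs] rdet_swap[of 2 "[a, b, 4, c, 5, 6, 7]" 3 vs]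
  by (simp_all add: numeral_eq_Suc)

lemma minor_lists:
  "rdet [Suc 0, 2, 3, 4, 5, 6, 7] vs = minor vs 0"
  "rdet [0, 2, 3, 4, 5, 6, 7] vs = minor vs 1"
  "rdet [0, Suc 0, 3, 4, 5, 6, 7] vs = minor vs 2"
  "rdet [0, Suc 0, 2, 4, 5, 6, 7] vs = minor vs 3"
  "rdet [0, Suc 0, 2, 3, 5, 6, 7] vs = minor vs 4"
  "rdet [0, Suc 0, 2, 3, 4, 6, 7] vs = minor vs 5"
  "rdet [0, Suc 0, 2, 3, 4, 5, 7] vs = minor vs 6"
  "rdet [0, Suc 0, 2, 3, 4, 5, 6] vs = minor vs 7"
  unfolding minor_def upt_7 by (simp_all add: insert_index_def numeral_eq_Suc)

text \<open>The two wedge products add up to twice the alternating sum of \<open>minor vs k\<close>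
  times \<open>T (coord k)\<close>. The signed minors are the coordinates of \<open>\<nu> z\<close>
  times the determinant \<open>V\<close>, so the sum is \<open>2 V T (\<nu> z)\<close>. The factor
  -1/2 then matches the sign of \<open>vol_form\<close>, which equals \<open>- V\<close>.\<close>

lemma wedge_normal:
  assumes T: "linear T" and tx: "(\<Sum>a<4. qunit a * T (e_x a)) = 0" and ty: "(\<Sum>a<4. qunit a * T (e_y a)) = 0"
    and \<nu>: "norm (\<nu> z) = 1" and vs: "length vs = 7" "\<forall>v\<in>set vs. \<nu> z \<bullet> v = 0"
  shows "- (1/2) *\<^sub>R (wedge ([dq1_bar, dq1] @ dys @ [T]) vs + wedge (dxs @ [dq2_bar, dq2] @ [T]) vs) =
    T (\<nu> z) * vol_form \<nu> z vs"
proof -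
  define V where "V = rdet [0..<8] (\<nu> z # vs)"
  define n where "n k = \<nu> z \<bullet> coord k" for k
  have m: "minor vs k = (-1) ^ k * n k * V" if "k < 8" for k
  proof -
    have "minor vs k = (-1) ^ k * ((-1) ^ k * minor vs k)" by (simp flip: mult.assoc power_add)
    then show ?thesis using minor_eq[OF \<nu> vs that] by (simp add: n_def V_def)
  qed
  have l8: "(\<Sum>c<8. g c) = (\<Sum>c<4. g c)" if "g 4 = 0" "g 5 = 0" "g 6 = 0" "g 7 = 0" for g :: "nat \<Rightarrow> quat"
    using that unfolding lessThan_8 lessThan_4 by simp
  have l8': "(\<Sum>c<8. g c) = (\<Sum>c<4. g (c + 4))" if "g 0 = 0" "g (Suc 0) = 0" "g 2 = 0" "g 3 = 0"
    for g :: "nat \<Rightarrow> quat"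
    using that unfolding lessThan_8 lessThan_4 by (simp add: add_ac)
  have z1: "rdet [a, b, 4, 5, 6, 7, c] vs = 0" if "c \<in> {4, 5, 6, 7}" for a b c
    using that rdet_dup[of 2 "[a, b, 4, 5, 6, 7, 4]" 6 vs] rdet_dup[of 3 "[a, b, 4, 5, 6, 7, 5]" 6 vs]
      rdet_dup[of 4 "[a, b, 4, 5, 6, 7, 6]" 6 vs] rdet_dup[of 5 "[a, b, 4, 5, 6, 7, 7]" 6 vs] by auto
  have z2: "rdet [0, Suc 0, 2, 3, a, b, c] vs = 0" if "c \<in> {0, Suc 0, 2, 3}" for a b c
    using that rdet_dup[of 0 "[0, Suc 0, 2, 3, a, b, 0]" 6 vs] rdet_dup[of 1 "[0, Suc 0, 2, 3, a, b, Suc 0]" 6 vs]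
      rdet_dup[of 2 "[0, Suc 0, 2, 3, a, b, 2]" 6 vs] rdet_dup[of 3 "[0, Suc 0, 2, 3, a, b, 3]" 6 vs] by auto
  let ?C = "\<lambda>t a b c. qcnj (qunit a) * qunit b * (t c :: quat)"
  have t: "qunit 0 * T (coord 0) + qunit (Suc 0) * T (coord (Suc 0)) + qunit 2 * T (coord 2) + qunit 3 * T (coord 3) = 0"
    using tx unfolding lessThan_4 by (simp add: coord_def add_ac)
  have t': "qunit 0 * T (coord (0 + 4)) + qunit (Suc 0) * T (coord (Suc 0 + 4)) + qunit 2 * T (coord (2 + 4)) +
      qunit 3 * T (coord (3 + 4)) = 0"
    using ty unfolding lessThan_4 by (simp add: coord_def add_ac)
  have "wedge ([dq1_bar, dq1] @ dys @ [T]) vs =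
      (\<Sum>a<4. \<Sum>b<4. \<Sum>c<4. rdet [a, b, 4, 5, 6, 7, c] vs *\<^sub>R ?C (\<lambda>c. T (coord c)) a b c)"
    unfolding wedge_expand1[OF T] by (intro sum.cong refl l8) (simp_all add: z1)
  also have "\<dots> =
      (\<Sum>a<4. \<Sum>b<4. \<Sum>c<4. rdet [a, b, c, 4, 5, 6, 7] vs *\<^sub>R ?C (\<lambda>c. T (coord c)) a b c)"
    by (simp add: rdet_alternating(5))
  also have "\<dots> = minor vs 0 *\<^sub>R (2 *\<^sub>R T (coord 0)) + minor vs 1 *\<^sub>R (- 2 *\<^sub>R T (coord 1)) +
      minor vs 2 *\<^sub>R (2 *\<^sub>R T (coord 2)) + minor vs 3 *\<^sub>R (- 2 *\<^sub>R T (coord 3))"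
    using alternating_sum[of "\<lambda>a b c. rdet [a, b, c, 4, 5, 6, 7] vs"
        "\<lambda>a b c. qcnj (qunit a) * qunit b * T (coord (c))", OF rdet_alternating(1,2)]
    unfolding fueter_alternating[of "\<lambda>c. T (coord (c))", OF t]
    by (simp add: minor_lists)
  finally have w1: "wedge ([dq1_bar, dq1] @ dys @ [T]) vs = \<dots>" .
  have "wedge (dxs @ [dq2_bar, dq2] @ [T]) vs =
      (\<Sum>a<4. \<Sum>b<4. \<Sum>c<4. rdet [0, Suc 0, 2, 3, a + 4, b + 4, c + 4] vs *\<^sub>R ?C (\<lambda>c. T (coord (c + 4))) a b c)"
    unfolding wedge_expand2[OF T] by (subst l8') (simp_all add: z2)
  also have "\<dots> = minor vs 4 *\<^sub>R (2 *\<^sub>R T (coord 4)) + minor vs 5 *\<^sub>R (- 2 *\<^sub>R T (coord 5)) +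
      minor vs 6 *\<^sub>R (2 *\<^sub>R T (coord 6)) + minor vs 7 *\<^sub>R (- 2 *\<^sub>R T (coord 7))"
    using alternating_sum[of "\<lambda>a b c. rdet [0, Suc 0, 2, 3, a + 4, b + 4, c + 4] vs"
        "\<lambda>a b c. qcnj (qunit a) * qunit b * T (coord (c + 4))", OF rdet_alternating(3,4)]
    unfolding fueter_alternating[of "\<lambda>c. T (coord (c + 4))", OF t']
    by (simp add: minor_lists)
  finally have w2: "wedge (dxs @ [dq2_bar, dq2] @ [T]) vs = \<dots>" .
  have "T (\<nu> z) = (\<Sum>k<8. n k *\<^sub>R T (coord k))" unfolding n_def by (rule linear_coord_expand[OF T])
  then have "T (\<nu> z) * vol_form \<nu> z vs = - V *\<^sub>R (\<Sum>k<8. n k *\<^sub>R T (coord k))"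
    by (simp add: vol_form_eq V_def[symmetric] of_real_def)
  also have "\<dots> = - (1/2) *\<^sub>R (wedge ([dq1_bar, dq1] @ dys @ [T]) vs + wedge (dxs @ [dq2_bar, dq2] @ [T]) vs)"
    unfolding w1 w2 lessThan_8 by (simp add: m scaleR_add_right mult_ac)
  finally show ?thesis by simp
qed

section \<open>Admissible functions and flatness of \<open>dbar\<close>\<close>

lemma dbar_pd: "dbar F z = (\<Sum>\<alpha><4. qunit \<alpha> * pd (e_x \<alpha>) F z, \<Sum>\<alpha><4. qunit \<alpha> * pd (e_y \<alpha>) F z)"
  by (simp add: dbar_def pd_def)

text \<open>A derivative within \<open>S\<close> is not unique, and
  \<open>frechet_derivative\<close> selects an arbitrary one. Composition with a curve in
  \<open>S\<close> shows that every choice agrees with the derivative of an extension on tangent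
  vectors.\<close>

lemma surf_diff_tangent:
  assumes v: "v \<in> tangent_space S z" and z: "z \<in> S"
    and F: "F differentiable (at z)" "\<And>w. w \<in> S \<Longrightarrow> F w = f w"
  shows "surf_diff S f z v = pd v F z"
proof -
  have "(F has_derivative (\<lambda>v. pd v F z)) (at z within S)"
    by (rule has_derivative_at_withinI[OF pd_works[OF F(1)]])
  then have "(f has_derivative (\<lambda>v. pd v F z)) (at z within S)"
    by (rule has_derivative_transform[OF z, rotated]) (simp add: F(2))
  then have L: "(f has_derivative surf_diff S f z) (at z within S)"
    unfolding surf_diff_def using frechet_derivative_works differentiable_def by blast
  obtain \<epsilon> \<gamma> where g: "0 < \<epsilon>" "\<gamma> ` {-\<epsilon><..<\<epsilon>} \<subseteq> S" "\<gamma> 0 = z" "(\<gamma> has_vector_derivative v) (at 0)"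
    using v unfolding tangent_space_def by auto
  let ?I = "{-\<epsilon><..<\<epsilon>}"
  have I: "at 0 within ?I = at 0" using g(1) by (intro at_within_open) auto
  have d\<gamma>: "(\<gamma> has_derivative (\<lambda>d. d *\<^sub>R v)) (at 0 within ?I)"
    using g(4) unfolding has_vector_derivative_def by (rule has_derivative_at_withinI)
  have "((\<lambda>t. f (\<gamma> t)) has_derivative (\<lambda>d. surf_diff S f z (d *\<^sub>R v))) (at 0 within ?I)"
    by (rule has_derivative_in_compose[OF d\<gamma>]) (use has_derivative_subset[OF L g(2)] g(3) in simp)
  then have 1: "((\<lambda>t. f (\<gamma> t)) has_derivative (\<lambda>d. surf_diff S f z (d *\<^sub>R v))) (at 0)" by (simp add: I)
  have "((\<lambda>t. F (\<gamma> t)) has_derivative (\<lambda>d. pd (d *\<^sub>R v) F z)) (at 0)"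
    using diff_chain_at[OF g(4)[unfolded has_vector_derivative_def], of F "\<lambda>d. pd d F z"] pd_works[OF F(1)] g(3)
    by (simp add: o_def)
  moreover have "F (\<gamma> t) = f (\<gamma> t)" if "t \<in> ?I" for t using that g(2) F(2) by blast
  ultimately have 2: "((\<lambda>t. f (\<gamma> t)) has_derivative (\<lambda>d. pd (d *\<^sub>R v) F z)) (at 0)"
    by (subst (asm) has_derivative_cong_open[OF open_greaterThanLessThan[of "-\<epsilon>" \<epsilon>]]) (use g(1) in auto)
  from has_derivative_unique[OF 1 2] show ?thesis by (metis scaleR_one)
qed

text \<open>A unit normal is only required to be orthogonal to the tangent space. Since the latter
  is the full orthogonal complement of the gradient of \<open>\<rho>\<close>, the part of
  \<open>\<nu> z\<close> orthogonal to the gradient is tangent and therefore zero.\<close>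

lemma tangent_space_normal:
  assumes def: "defining_function S U \<rho>" and z: "z \<in> S" and \<nu>: "unit_normal_field S \<nu>"
  shows "tangent_space S z = {v. \<nu> z \<bullet> v = 0}"
proof -
  have n: "norm (\<nu> z) = 1" "\<And>v. v \<in> tangent_space S z \<Longrightarrow> \<nu> z \<bullet> v = 0"
    using \<nu> z unfolding unit_normal_field_def by auto
  have dr: "\<rho> differentiable (at z)"
    using def z unfolding defining_function_def by (auto intro: smooth_on_differentiable)
  define g where "g = (\<Sum>b\<in>Basis. pd b \<rho> z *\<^sub>R b)"
  have pg: "pd v \<rho> z = g \<bullet> v" for v
    unfolding pd_expand[OF dr, of v] g_def inner_sum_left
    by (intro sum.cong refl) (simp add: inner_commute[of v] mult.commute)
  have T: "tangent_space S z = {v. g \<bullet> v = 0}" using tangent_space_eq_kernel[OF def z] pg by simp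
  obtain v where "pd v \<rho> z \<noteq> 0" using def z unfolding defining_function_def pd_def by blast
  then have "g \<noteq> 0" using pg by auto
  define c where "c = (g \<bullet> \<nu> z) / (g \<bullet> g)"
  define w where "w = \<nu> z - c *\<^sub>R g"
  have "g \<bullet> w = 0" using \<open>g \<noteq> 0\<close> by (simp add: w_def c_def inner_diff_right)
  then have "\<nu> z \<bullet> w = 0" using n(2) T by blast
  then have "w \<bullet> w = 0" using \<open>g \<bullet> w = 0\<close> by (simp add: w_def inner_diff_left)
  then have \<nu>g: "\<nu> z = c *\<^sub>R g" by (simp add: w_def)
  then have "c \<noteq> 0" using n(1) by auto
  then show ?thesis unfolding T \<nu>g by simp
qed

lemma wedge_last_cong:
  assumes "length vs = Suc (length \<theta>s)" "\<And>v. v \<in> set vs \<Longrightarrow> \<theta> v = \<theta>' v"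
  shows "wedge (\<theta>s @ [\<theta>]) vs = wedge (\<theta>s @ [\<theta>']) vs"
proof -
  have "map (\<lambda>i. ((\<theta>s @ [\<theta>]) ! i) (vs ! \<sigma> i)) [0..<Suc (length \<theta>s)] =
      map (\<lambda>i. ((\<theta>s @ [\<theta>']) ! i) (vs ! \<sigma> i)) [0..<Suc (length \<theta>s)]"
    if "\<sigma> permutes {..<Suc (length \<theta>s)}" for \<sigma>
  proof (rule map_cong[OF refl])
    fix i assume "i \<in> set [0..<Suc (length \<theta>s)]"
    then have i: "i < Suc (length \<theta>s)" by (simp del: upt_Suc)
    then have "\<sigma> i < length vs" using permutes_in_image[OF that, of i] assms(1) by simp
    then have "vs ! \<sigma> i \<in> set vs" by simp
    then show "((\<theta>s @ [\<theta>]) ! i) (vs ! \<sigma> i) = ((\<theta>s @ [\<theta>']) ! i) (vs ! \<sigma> i)"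
      using assms(2) i by (cases "i = length \<theta>s") (auto simp: nth_append)
  qed
  moreover have "length (\<theta>s @ [x]) = Suc (length \<theta>s)" for x by simp
  ultimately show ?thesis unfolding wedge_def by (intro sum.cong) (simp_all only: mem_Collect_eq)
qed

text \<open>The functions \<open>f_comp\<close> reconstruct the full differential of an extension
  from data on \<open>S\<close>. Where \<open>dbar F\<close> vanishes, \<open>wedge_normal\<close>
  identifies \<open>f_perp\<close> with the normal derivative of \<open>F\<close>; adding the
  tangential part of \<open>e\<close> gives the derivative along \<open>e\<close>.\<close>

lemma f_comp_eq_pd:
  assumes def: "defining_function S U \<rho>" and z: "z \<in> S" and \<nu>: "unit_normal_field S \<nu>"
    and F: "F differentiable (at z)" "\<And>w. w \<in> S \<Longrightarrow> F w = f w" and hol: "dbar F z = 0"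
  shows "f_comp S \<nu> f e z = pd e F z"
proof -
  define T where "T v = pd v F z" for v
  have T: "linear T" unfolding T_def by (rule pd_linear[OF F(1)])
  have tx: "(\<Sum>a<4. qunit a * T (e_x a)) = 0" "(\<Sum>a<4. qunit a * T (e_y a)) = 0"
    using hol unfolding dbar_pd T_def by (auto simp: zero_prod_def)
  have n: "norm (\<nu> z) = 1" using \<nu> z unfolding unit_normal_field_def by auto
  note TS = tangent_space_normal[OF def z \<nu>]
  have sd: "surf_diff S f z v = T v" if "v \<in> tangent_space S z" for v
    unfolding T_def by (rule surf_diff_tangent[OF that z F])
  have w: "- (1/2) *\<^sub>R (wedge ([dq1_bar, dq1] @ dys @ [surf_diff S f z]) vs +
      wedge (dxs @ [dq2_bar, dq2] @ [surf_diff S f z]) vs) = T (\<nu> z) * vol_form \<nu> z vs"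
    if vs: "length vs = 7" "set vs \<subseteq> tangent_space S z" for vs
  proof -
    have s: "surf_diff S f z v = T v" if "v \<in> set vs" for v using sd vs(2) that by blast
    have "wedge ([dq1_bar, dq1] @ dys @ [surf_diff S f z]) vs = wedge ([dq1_bar, dq1] @ dys @ [T]) vs"
      using wedge_last_cong[of vs "[dq1_bar, dq1] @ dys", OF _ s] vs(1) by (simp add: dys_def)
    moreover have "wedge (dxs @ [dq2_bar, dq2] @ [surf_diff S f z]) vs = wedge (dxs @ [dq2_bar, dq2] @ [T]) vs"
      using wedge_last_cong[of vs "dxs @ [dq2_bar, dq2]", OF _ s] vs(1) by (simp add: dxs_def)
    ultimately show ?thesis
      using wedge_normal[where T = T and \<nu> = \<nu> and z = z, OF T tx n vs(1)] vs(2) TS by auto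
  qed
  have "f_perp S \<nu> f z = T (\<nu> z)"
    unfolding f_perp_def
  proof (rule the_equality)
    show "\<forall>vs. length vs = 7 \<and> set vs \<subseteq> tangent_space S z \<longrightarrow>
      - (1/2) *\<^sub>R (wedge ([dq1_bar, dq1] @ dys @ [surf_diff S f z]) vs +
      wedge (dxs @ [dq2_bar, dq2] @ [surf_diff S f z]) vs) = T (\<nu> z) * vol_form \<nu> z vs"
      using w by blast
    fix c assume c: "\<forall>vs. length vs = 7 \<and> set vs \<subseteq> tangent_space S z \<longrightarrow>
      - (1/2) *\<^sub>R (wedge ([dq1_bar, dq1] @ dys @ [surf_diff S f z]) vs +
      wedge (dxs @ [dq2_bar, dq2] @ [surf_diff S f z]) vs) = c * vol_form \<nu> z vs"
    obtain vs where vs: "length vs = 7" "\<forall>v\<in>set vs. \<nu> z \<bullet> v = 0" "rdet [0..<8] (\<nu> z # vs) \<noteq> 0"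
      using exists_nonzero_rdet[OF n] by blast
    then have s: "set vs \<subseteq> tangent_space S z" using TS by blast
    have "c * vol_form \<nu> z vs = T (\<nu> z) * vol_form \<nu> z vs" using c w[OF vs(1) s] vs(1) s by metis
    then have "rdet [0..<8] (\<nu> z # vs) *\<^sub>R c = rdet [0..<8] (\<nu> z # vs) *\<^sub>R T (\<nu> z)"
      unfolding vol_form_eq by (simp add: of_real_def)
    then show "c = T (\<nu> z)" using vs(3) by simp
  qed
  moreover have "e - (e \<bullet> \<nu> z) *\<^sub>R \<nu> z \<in> tangent_space S z"
    using n unfolding TS by (simp add: inner_diff_right norm_eq_1 inner_commute[of e])
  ultimately have "f_comp S \<nu> f e z = T (e - (e \<bullet> \<nu> z) *\<^sub>R \<nu> z) + (e \<bullet> \<nu> z) *\<^sub>R T (\<nu> z)"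
    unfolding f_comp_def by (simp add: sd)
  also have "\<dots> = T e" by (simp add: linear_diff[OF T] linear_scale[OF T])
  finally show ?thesis by (simp add: T_def)
qed

section \<open>Fueter operators, their Laplacians and the compatibility condition\<close>

definition dop :: "(nat \<Rightarrow> quat) \<Rightarrow> (nat \<Rightarrow> quat2) \<Rightarrow> (quat2 \<Rightarrow> quat) \<Rightarrow> quat2 \<Rightarrow> quat" where
  "dop c e F z = (\<Sum>\<alpha><4. c \<alpha> * pd (e \<alpha>) F z)"

definition lap :: "(nat \<Rightarrow> quat2) \<Rightarrow> (quat2 \<Rightarrow> quat) \<Rightarrow> quat2 \<Rightarrow> quat" where
  "lap e F z = (\<Sum>\<alpha><4. pd (e \<alpha>) (pd (e \<alpha>) F) z)"

definition cunit :: "nat \<Rightarrow> quat" where "cunit \<alpha> = qcnj (qunit \<alpha>)"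

lemma dbar_dop: "dbar F z = (dop qunit e_x F z, dop qunit e_y F z)"
  by (simp add: dbar_pd dop_def)

lemma smooth_on_dop: "open U \<Longrightarrow> smooth_on F U \<Longrightarrow> smooth_on (dop c e F) U"
  unfolding dop_def by (intro smooth_on_sum smooth_on_mult smooth_on_const smooth_on_pd)

lemma smooth_on_lap: "open U \<Longrightarrow> smooth_on F U \<Longrightarrow> smooth_on (lap e F) U"
  unfolding lap_def by (intro smooth_on_sum smooth_on_pd)

lemma dop_cong: "open U \<Longrightarrow> z \<in> U \<Longrightarrow> (\<And>w. w \<in> U \<Longrightarrow> F w = G w) \<Longrightarrow> dop c e F z = dop c e G z"
  unfolding dop_def by (intro sum.cong refl arg_cong2[of _ _ _ _ times] pd_cong)

lemma pd_dop:
  "open U \<Longrightarrow> smooth_on F U \<Longrightarrow> z \<in> U \<Longrightarrow> pd v (dop c e F) z = (\<Sum>\<alpha><4. c \<alpha> * pd v (pd (e \<alpha>) F) z)"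
  unfolding dop_def[abs_def]
  by (subst pd_sum) (auto intro!: sum.cong pd_cmult smooth_on_differentiable smooth_on_pd smooth_on_mult smooth_on_const)

text \<open>For different indices the products of conjugate units are antisymmetric and second
  derivatives are symmetric, so the mixed terms cancel.\<close>

lemma dop_cunit_qunit:
  assumes "open U" "smooth_on F U" "z \<in> U"
  shows "dop cunit e (dop qunit e F) z = lap e F z"
proof -
  define H where "H a b = pd (e a) (pd (e b) F) z" for a b
  have sym: "H b a = H a b" for a b unfolding H_def by (rule pd_symmetric[OF assms(1,3,2)])
  have "dop cunit e (dop qunit e F) z = (\<Sum>a<4. cunit a * (\<Sum>b<4. qunit b * H a b))"
    unfolding dop_def[of cunit] pd_dop[OF assms] H_def ..
  also have "\<dots> = (\<Sum>a<4. H a a)"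
    unfolding lessThan_4 cunit_def
    by (simp add: qunit_simps quat_eq_iff sym[of 0 "Suc 0"] sym[of 0 2] sym[of 0 3] sym[of "Suc 0" 2]
        sym[of "Suc 0" 3] sym[of 2 3])
  finally show ?thesis by (simp add: lap_def H_def)
qed

lemma pd_lap:
  assumes "open U" "smooth_on F U" "z \<in> U"
  shows "pd v (lap e F) z = lap e (pd v F) z"
proof -
  have "pd v (lap e F) z = (\<Sum>\<alpha><4. pd v (pd (e \<alpha>) (pd (e \<alpha>) F)) z)"
    unfolding lap_def[abs_def] using assms by (intro pd_sum) (auto intro!: smooth_on_differentiable smooth_on_pd)
  also have "\<dots> = (\<Sum>\<alpha><4. pd (e \<alpha>) (pd (e \<alpha>) (pd v F)) z)"
  proof (intro sum.cong refl)
    fix a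
    have "pd v (pd (e a) (pd (e a) F)) z = pd (e a) (pd v (pd (e a) F)) z"
      by (rule pd_symmetric[OF assms(1,3) smooth_on_pd[OF assms(2)]])
    also have "\<dots> = pd (e a) (pd (e a) (pd v F)) z"
      by (rule pd_cong[OF assms(1,3) pd_symmetric[OF assms(1) _ assms(2)]])
    finally show "pd v (pd (e a) (pd (e a) F)) z = pd (e a) (pd (e a) (pd v F)) z" .
  qed
  finally show ?thesis by (simp add: lap_def)
qed

lemma lap_dop:
  assumes "open U" "smooth_on F U" "z \<in> U"
  shows "lap e' (dop c e F) z = dop c e (lap e' F) z"
proof -
  have "lap e' (dop c e F) z = (\<Sum>\<beta><4. pd (e' \<beta>) (\<lambda>z. \<Sum>\<alpha><4. c \<alpha> * pd (e' \<beta>) (pd (e \<alpha>) F) z) z)"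
    unfolding lap_def by (intro sum.cong refl pd_cong[OF assms(1,3)] pd_dop[OF assms(1,2)])
  also have "\<dots> = (\<Sum>\<beta><4. \<Sum>\<alpha><4. c \<alpha> * pd (e' \<beta>) (pd (e' \<beta>) (pd (e \<alpha>) F)) z)"
    using assms by (subst pd_sum)
      (auto intro!: sum.cong pd_cmult smooth_on_differentiable smooth_on_pd smooth_on_mult smooth_on_const)
  also have "\<dots> = (\<Sum>\<alpha><4. c \<alpha> * lap e' (pd (e \<alpha>) F) z)"
    unfolding lap_def sum_distrib_left by (rule sum.swap)
  finally show ?thesis by (simp add: dop_def pd_lap[OF assms])
qed

text \<open>The Fueter operators for different variables do not commute with each other, but the
  Laplacian \<open>lap e'\<close> has real coefficients and commutes with both. Applying
  \<open>dop cunit e'\<close> first produces this Laplacian, which is then moved past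
  \<open>dop qunit e\<close>.\<close>

lemma fueter_compatibility:
  assumes "open U" "smooth_on F U" "z \<in> U"
  shows "dop qunit e (dop cunit e' (dop qunit e' F)) z = lap e' (dop qunit e F) z"
proof -
  have "dop qunit e (dop cunit e' (dop qunit e' F)) z = dop qunit e (lap e' F) z"
    by (rule dop_cong[OF assms(1,3) dop_cunit_qunit[OF assms(1,2)]])
  then show ?thesis by (simp add: lap_dop[OF assms])
qed

text \<open>One component of \<open>dbar \<rho>\<close> for a real function, and at the same time
  the principal symbol of \<open>dop qunit e\<close> at the differential of
  \<open>\<rho>\<close>.\<close>

definition grad_q :: "(quat2 \<Rightarrow> real) \<Rightarrow> (nat \<Rightarrow> quat2) \<Rightarrow> quat2 \<Rightarrow> quat" where
  "grad_q \<rho> e z = (\<Sum>\<alpha><4. pd (e \<alpha>) \<rho> z *\<^sub>R qunit \<alpha>)"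

lemma dop_of_real:
  assumes "\<rho> differentiable (at z)"
  shows "dop qunit e (\<lambda>w. of_real (\<rho> w)) z = grad_q \<rho> e z"
  unfolding dop_def grad_q_def of_real_def
  using pd_linear_comp[OF bounded_linear_scaleR_left assms, of _ "1::quat"] by simp

lemma smooth_on_grad_q: "open U \<Longrightarrow> smooth_on \<rho> U \<Longrightarrow> smooth_on (grad_q \<rho> e) U"
  unfolding grad_q_def by (intro smooth_on_sum smooth_on_scaleR smooth_on_const smooth_on_pd)

lemma bounded_linear_qcnj: "bounded_linear qcnj"
  by (rule linear_conv_bounded_linear[THEN iffD1]) (auto intro!: linearI simp: quat_eq_iff)

lemma qcnj_mult_self: "qcnj q * q = of_real ((norm q)\<^sup>2)" "q * qcnj q = of_real ((norm q)\<^sup>2)"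
  by (simp_all add: quat_eq_iff norm_quat_def inner_quat_def power2_eq_square of_real_def)

lemma norm_grad_q: "(norm (grad_q \<rho> e z))\<^sup>2 = (\<Sum>\<alpha><4. (pd (e \<alpha>) \<rho> z)\<^sup>2)"
  unfolding grad_q_def lessThan_4 norm_quat_def
  by (simp add: qunit_simps inner_quat_def power2_eq_square)

section \<open>Propagation of the order of vanishing of \<open>dbar F\<close>\<close>

context
  fixes S U :: "quat2 set" and \<rho> :: "quat2 \<Rightarrow> real"
  assumes def: "defining_function S U \<rho>"
begin

lemma def_open: "open U" and def_smooth: "smooth_on \<rho> U" and def_sub: "S \<subseteq> U"
  using def unfolding defining_function_def by auto

text \<open>To leading order the Hessian of a function vanishing along \<open>S\<close> is a
  multiple of the square of the differential of \<open>\<rho>\<close>. The tangential operator of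
  \<open>van_cross\<close> is applied once to \<open>G\<close> and then differentiated, and once to
  \<open>pd a G\<close>; the product rule contributes only first derivatives of
  \<open>G\<close>.\<close>

lemma second_derivative_van:
  fixes G :: "quat2 \<Rightarrow> 'b::euclidean_space"
  assumes G: "smooth_on G U" "van (Suc m) S G"
  shows "van m S (\<lambda>z. (pd a \<rho> z * pd b \<rho> z) *\<^sub>R pd u (pd v G) z - (pd u \<rho> z * pd v \<rho> z) *\<^sub>R pd a (pd b G) z)"
proof -
  note U = def_open def_sub
  note si = smooth_on_scaleR[OF U(1)] smooth_on_diff[OF U(1)] smooth_on_add[OF U(1)] smooth_on_mult[OF U(1)]
  have s: "smooth_on (pd a \<rho>) U" "smooth_on (pd a (pd b \<rho>)) U" "smooth_on (pd a G) U"
    "smooth_on (pd a (pd b G)) U" for a b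
    using def_smooth G(1) by (auto intro: smooth_on_pd)
  have vG: "van m S (pd a G)" for a using G(2) by (metis van.simps(2))
  let ?T = "\<lambda>z. pd a \<rho> z *\<^sub>R pd v G z - pd v \<rho> z *\<^sub>R pd a G z"
  have "van (Suc m) S ?T" by (rule van_cross[OF def G])
  then have 1: "van m S (pd u ?T)" by (metis van.simps(2))
  let ?A = "\<lambda>z. pd a \<rho> z *\<^sub>R pd u (pd v G) z - pd v \<rho> z *\<^sub>R pd u (pd a G) z"
  have 2: "van m S ?A"
  proof (rule van_eq[OF _ U])
    show "van m S (\<lambda>z. pd u ?T z - (pd u (pd a \<rho>) z *\<^sub>R pd v G z - pd u (pd v \<rho>) z *\<^sub>R pd a G z))"
      by (intro van_diff[OF U] van_bilinear'[OF bounded_bilinear_scaleR U] 1 vG si s smooth_on_pd)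
    fix z assume z: "z \<in> U"
    have d: "pd a \<rho> differentiable at z" "pd a G differentiable at z" for a
      using s z smooth_on_differentiable by blast+
    have "pd u ?T z = pd u (\<lambda>z. pd a \<rho> z *\<^sub>R pd v G z) z - pd u (\<lambda>z. pd v \<rho> z *\<^sub>R pd a G z) z"
      by (intro pd_diff smooth_on_differentiable[OF _ z] si s)
    then show "?A z = pd u ?T z - (pd u (pd a \<rho>) z *\<^sub>R pd v G z - pd u (pd v \<rho>) z *\<^sub>R pd a G z)"
      by (simp add: pd_scaleR[OF d])
  qed
  have 3: "van m S (\<lambda>z. pd b \<rho> z *\<^sub>R pd u (pd a G) z - pd u \<rho> z *\<^sub>R pd b (pd a G) z)"
    by (rule van_cross[OF def s(3) vG])
  have 4: "van m S (\<lambda>z. pd b \<rho> z *\<^sub>R ?A z + pd v \<rho> z *\<^sub>R (pd b \<rho> z *\<^sub>R pd u (pd a G) z - pd u \<rho> z *\<^sub>R pd b (pd a G) z))"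
    by (intro van_add[OF U] van_bilinear'[OF bounded_bilinear_scaleR U] 2 3 si s)
  show ?thesis
  proof (rule van_eq[OF 4 U])
    fix z assume z: "z \<in> U"
    have "pd b (pd a G) z = pd a (pd b G) z" by (rule pd_symmetric[OF U(1) z G(1)])
    then show "(pd a \<rho> z * pd b \<rho> z) *\<^sub>R pd u (pd v G) z - (pd u \<rho> z * pd v \<rho> z) *\<^sub>R pd a (pd b G) z =
      pd b \<rho> z *\<^sub>R ?A z + pd v \<rho> z *\<^sub>R (pd b \<rho> z *\<^sub>R pd u (pd a G) z - pd u \<rho> z *\<^sub>R pd b (pd a G) z)"
      by (simp add: scaleR_diff_right mult_ac)
  qed
qed

text \<open>All second derivatives are expressed, modulo higher order, through the single one
  \<open>pd a (pd b _)\<close>. The compatibility condition thereby turns into multiplication by its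
  principal symbol.\<close>

lemma compatibility_van:
  assumes G: "smooth_on G U" "van (Suc m) S G" and G': "smooth_on G' U" "van (Suc m) S G'"
    and comp: "\<And>z. z \<in> U \<Longrightarrow> dop qunit e (dop cunit e' G') z = lap e' G z"
  shows "van m S (\<lambda>z. grad_q \<rho> e z * qcnj (grad_q \<rho> e' z) * pd a (pd b G') z -
      (norm (grad_q \<rho> e' z))\<^sup>2 *\<^sub>R pd a (pd b G) z)"
proof -
  note U = def_open def_sub
  note si = smooth_on_scaleR[OF U(1)] smooth_on_diff[OF U(1)] smooth_on_add[OF U(1)] smooth_on_mult[OF U(1)]
    smooth_on_sum[OF U(1)] smooth_on_const
  have s: "smooth_on (pd a \<rho>) U" "smooth_on (pd a (pd b G)) U" "smooth_on (pd a (pd b G')) U" for a b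
    using def_smooth G(1) G'(1) by (auto intro: smooth_on_pd)
  let ?r = "\<lambda>z. pd a \<rho> z * pd b \<rho> z"
  let ?E = "\<lambda>(G :: quat2 \<Rightarrow> quat) u v z. ?r z *\<^sub>R pd u (pd v G) z - (pd u \<rho> z * pd v \<rho> z) *\<^sub>R pd a (pd b G) z"
  have E: "van m S (?E G u v)" "van m S (?E G' u v)" for u v
    by (rule second_derivative_van[OF G], rule second_derivative_van[OF G'])
  have sE: "smooth_on (?E G u v) U" "smooth_on (?E G' u v) U" for u v
    by (intro si s)+
  have 1: "van m S (\<lambda>z. (\<Sum>\<beta><4. ?E G (e' \<beta>) (e' \<beta>) z) -
      (\<Sum>\<alpha><4. \<Sum>\<beta><4. (qunit \<alpha> * cunit \<beta>) * ?E G' (e \<alpha>) (e' \<beta>) z))"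
    by (intro van_diff[OF U] van_sum[OF U] van_bilinear'[OF bounded_bilinear_mult U] E sE si)
  show ?thesis
  proof (rule van_eq[OF 1 U])
    fix z assume z: "z \<in> U"
    have "dop qunit e (dop cunit e' G') z = (\<Sum>\<alpha><4. \<Sum>\<beta><4. (qunit \<alpha> * cunit \<beta>) * pd (e \<alpha>) (pd (e' \<beta>) G') z)"
      unfolding dop_def[of qunit] pd_dop[OF U(1) G'(1) z] by (simp add: sum_distrib_left mult.assoc)
    then have c: "?r z *\<^sub>R (\<Sum>\<alpha><4. \<Sum>\<beta><4. (qunit \<alpha> * cunit \<beta>) * pd (e \<alpha>) (pd (e' \<beta>) G') z) =
        ?r z *\<^sub>R (\<Sum>\<beta><4. pd (e' \<beta>) (pd (e' \<beta>) G) z)"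
      using comp[OF z] by (simp add: lap_def)
    have n: "grad_q \<rho> e z * qcnj (grad_q \<rho> e' z) =
        (\<Sum>\<alpha><4. \<Sum>\<beta><4. (pd (e \<alpha>) \<rho> z * pd (e' \<beta>) \<rho> z) *\<^sub>R (qunit \<alpha> * cunit \<beta>))"
      unfolding grad_q_def cunit_def
      by (simp add: bounded_linear.linear[OF bounded_linear_qcnj, THEN linear_sum]
          bounded_linear.linear[OF bounded_linear_qcnj, THEN linear_scale] sum_product mult_ac)
    show "grad_q \<rho> e z * qcnj (grad_q \<rho> e' z) * pd a (pd b G') z - (norm (grad_q \<rho> e' z))\<^sup>2 *\<^sub>R pd a (pd b G) z =
      (\<Sum>\<beta><4. ?E G (e' \<beta>) (e' \<beta>) z) - (\<Sum>\<alpha><4. \<Sum>\<beta><4. (qunit \<alpha> * cunit \<beta>) * ?E G' (e \<alpha>) (e' \<beta>) z)"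
      unfolding n norm_grad_q
      using c by (simp add: sum_subtractf scaleR_sum_right scaleR_sum_left sum_distrib_right right_diff_distrib
          power2_eq_square)
  qed
qed

lemma pd_pd_mult_van:
  fixes A G :: "quat2 \<Rightarrow> quat"
  assumes A: "smooth_on A U" and G: "smooth_on G U" "van (Suc m) S G"
  shows "van m S (\<lambda>z. pd a (pd b (\<lambda>z. A z * G z)) z - A z * pd a (pd b G) z)"
proof -
  note U = def_open def_sub
  have vG: "van m S (pd a G)" for a using G(2) by (metis van.simps(2))
  have 1: "van m S (\<lambda>z. pd a (pd b A) z * G z + (pd b A z * pd a G z + pd a A z * pd b G z))"
    by (intro van_add[OF U] van_bilinear'[OF bounded_bilinear_mult U] vG van_SucD[OF G(2)]
        smooth_on_add[OF U(1)] smooth_on_mult[OF U(1)] smooth_on_pd A G)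
  show ?thesis
  proof (rule van_eq[OF 1 U])
    fix z assume z: "z \<in> U"
    have d: "A differentiable at w" "G differentiable at w" "pd b A differentiable at w" "pd b G differentiable at w"
      if "w \<in> U" for w using A G that smooth_on_differentiable smooth_on_pd by blast+
    have "pd a (pd b (\<lambda>z. A z * G z)) z = pd a (\<lambda>z. A z * pd b G z + pd b A z * G z) z"
      by (rule pd_cong[OF U(1) z]) (rule pd_mult[OF d(1,2)])
    also have "\<dots> = pd a (\<lambda>z. A z * pd b G z) z + pd a (\<lambda>z. pd b A z * G z) z"
      by (intro pd_add smooth_on_differentiable[OF _ z] smooth_on_mult[OF U(1)] smooth_on_pd A G)
    finally show "pd a (pd b (\<lambda>z. A z * G z)) z - A z * pd a (pd b G) z =
        pd a (pd b A) z * G z + (pd b A z * pd a G z + pd a A z * pd b G z)"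
      by (simp add: pd_mult[OF d(1) d(4)[OF z]] pd_mult[OF d(3)[OF z] d(2)] z)
  qed
qed

text \<open>On \<open>S\<close>, the second derivatives of two functions vanishing to order \<open>m\<close> are determined by their
  normal derivatives, so the compatibility condition \<open>D\<^sub>i D\<^sub>j\<^sup>* G\<^sub>j = \<Delta>\<^sub>j G\<^sub>i\<close> of \<open>G = dbar F\<close> becomes linear algebra
  in the quaternions: modulo higher order, \<open>G\<close> is proportional to the quaternionic gradient of
  \<open>\<rho>\<close>, and \<open>N\<close> excludes this.\<close>

lemma flat_step:
  assumes F: "smooth_on F U"
    and nz: "\<And>z. z \<in> U \<Longrightarrow> (norm (grad_q \<rho> e z))\<^sup>2 + (norm (grad_q \<rho> e' z))\<^sup>2 \<noteq> 0"
    and G: "van (Suc (Suc m)) S (dop qunit e F)" "van (Suc (Suc m)) S (dop qunit e' F)"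
    and N: "\<And>k. van k S (\<lambda>z. qcnj (grad_q \<rho> e z) * dop qunit e F z + qcnj (grad_q \<rho> e' z) * dop qunit e' F z)"
  shows "van (Suc (Suc (Suc m))) S (dop qunit e F)"
proof -
  note U = def_open def_sub
  note si = smooth_on_scaleR[OF U(1)] smooth_on_diff[OF U(1)] smooth_on_add[OF U(1)] smooth_on_mult[OF U(1)]
  let ?n = "grad_q \<rho> e" and ?n' = "grad_q \<rho> e'" and ?G = "dop qunit e F" and ?G' = "dop qunit e' F"
  have sG: "smooth_on ?G U" "smooth_on ?G' U" by (intro smooth_on_dop U F)+
  have sn: "smooth_on ?n U" "smooth_on ?n' U" by (intro smooth_on_grad_q U def_smooth)+
  have scn: "smooth_on (\<lambda>z. qcnj (?n z)) U" "smooth_on (\<lambda>z. qcnj (?n' z)) U"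
    by (intro smooth_on_linear_comp[OF bounded_linear_qcnj U(1)] sn)+
  let ?X = "\<lambda>a b. pd a (pd b ?G)" and ?X' = "\<lambda>a b. pd a (pd b ?G')"
  have sX: "smooth_on (?X a b) U" "smooth_on (?X' a b) U" for a b by (intro smooth_on_pd sG)+
  have vX: "van (Suc m) S (?X a b)" for a b
  proof -
    have 1: "van (Suc m) S (\<lambda>z. ?n z * qcnj (?n' z) * ?X' a b z - (norm (?n' z))\<^sup>2 *\<^sub>R ?X a b z)"
      by (rule compatibility_van[OF sG(1) G(1) sG(2) G(2)]) (rule fueter_compatibility[OF U(1) F])
    have "van (Suc m) S (pd a (pd b (\<lambda>z. qcnj (?n z) * ?G z + qcnj (?n' z) * ?G' z)))"
      using N[of "Suc (Suc (Suc m))"] by (metis van.simps(2))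
    then have "van (Suc m) S (\<lambda>z. pd a (pd b (\<lambda>z. qcnj (?n z) * ?G z)) z + pd a (pd b (\<lambda>z. qcnj (?n' z) * ?G' z)) z)"
    proof (rule van_eq[OF _ U])
      fix z assume z: "z \<in> U"
      have "pd a (pd b (\<lambda>z. qcnj (?n z) * ?G z + qcnj (?n' z) * ?G' z)) z =
          pd a (\<lambda>z. pd b (\<lambda>z. qcnj (?n z) * ?G z) z + pd b (\<lambda>z. qcnj (?n' z) * ?G' z) z) z"
        by (rule pd_cong[OF U(1) z], rule pd_add) (intro smooth_on_differentiable[of _ U] si scn sG; assumption)+
      also have "\<dots> = pd a (pd b (\<lambda>z. qcnj (?n z) * ?G z)) z + pd a (pd b (\<lambda>z. qcnj (?n' z) * ?G' z)) z"
        by (intro pd_add smooth_on_differentiable[OF _ z] si scn sG smooth_on_pd)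
      finally show "pd a (pd b (\<lambda>z. qcnj (?n z) * ?G z)) z + pd a (pd b (\<lambda>z. qcnj (?n' z) * ?G' z)) z =
        pd a (pd b (\<lambda>z. qcnj (?n z) * ?G z + qcnj (?n' z) * ?G' z)) z" by simp
    qed
    from van_diff[OF U _ _ this van_add[OF U _ _ pd_pd_mult_van[OF scn(1) sG(1) G(1)]
          pd_pd_mult_van[OF scn(2) sG(2) G(2)]], of a b a b]
    have 2: "van (Suc m) S (\<lambda>z. qcnj (?n z) * ?X a b z + qcnj (?n' z) * ?X' a b z)"
      by (simp add: si scn sG sX smooth_on_pd add.commute del: van.simps)
    \<comment> \<open>Multiplying relation \<open>2\<close> by \<open>?n\<close> on the left and
      subtracting relation \<open>1\<close> eliminates \<open>?X'\<close>. What is left is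
      \<open>?X\<close> times the sum of the two squared norms, which is non-zero on
      \<open>U\<close>.\<close>
    have 3: "van (Suc m) S (\<lambda>z. inverse ((norm (?n z))\<^sup>2 + (norm (?n' z))\<^sup>2) *\<^sub>R
        (?n z * (qcnj (?n z) * ?X a b z + qcnj (?n' z) * ?X' a b z) -
         (?n z * qcnj (?n' z) * ?X' a b z - (norm (?n' z))\<^sup>2 *\<^sub>R ?X a b z)))"
    proof -
      have sN: "smooth_on (\<lambda>z. (norm (grad_q \<rho> e z))\<^sup>2) U" for e
        unfolding norm_grad_q by (intro smooth_on_sum smooth_on_power smooth_on_pd U def_smooth)
      show ?thesis
        by (intro van_bilinear'[OF bounded_bilinear_scaleR U] van_diff[OF U] van_bilinear'[OF bounded_bilinear_mult U]
            1 2 si scn sG sX sn sN smooth_on_inverse[OF U(1)] nz)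
    qed
    show ?thesis
    proof (rule van_eq[OF 3 U])
      fix z assume z: "z \<in> U"
      have "?n z * (qcnj (?n z) * ?X a b z) = (norm (?n z))\<^sup>2 *\<^sub>R ?X a b z"
        by (simp add: qcnj_mult_self scaleR_conv_of_real flip: mult.assoc)
      then have "?n z * (qcnj (?n z) * ?X a b z + qcnj (?n' z) * ?X' a b z) -
         (?n z * qcnj (?n' z) * ?X' a b z - (norm (?n' z))\<^sup>2 *\<^sub>R ?X a b z) =
         ((norm (?n z))\<^sup>2 + (norm (?n' z))\<^sup>2) *\<^sub>R ?X a b z"
        by (simp add: distrib_left scaleR_left_distrib mult.assoc)
      then show "?X a b z = inverse ((norm (?n z))\<^sup>2 + (norm (?n' z))\<^sup>2) *\<^sub>R
        (?n z * (qcnj (?n z) * ?X a b z + qcnj (?n' z) * ?X' a b z) -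
         (?n z * qcnj (?n' z) * ?X' a b z - (norm (?n' z))\<^sup>2 *\<^sub>R ?X a b z))"
        using nz[OF z] by simp
    qed
  qed
  have z: "\<forall>z\<in>S. pd b ?G z = 0" for b using G(1) by (metis van.simps(2))
  have "van (Suc (Suc m)) S (pd b ?G)" for b using z vX by (metis van.simps(2))
  moreover have "\<forall>z\<in>S. ?G z = 0" using G(1) by (metis van.simps(2))
  ultimately show ?thesis by (metis van.simps(2))
qed

lemma dbar_flat:
  assumes F: "smooth_on F U"
    and nz: "\<And>z. z \<in> U \<Longrightarrow> (norm (grad_q \<rho> e_x z))\<^sup>2 + (norm (grad_q \<rho> e_y z))\<^sup>2 \<noteq> 0"
    and G: "van 2 S (dop qunit e_x F)" "van 2 S (dop qunit e_y F)"
    and N: "\<And>k. van k S (\<lambda>z. qcnj (grad_q \<rho> e_x z) * dop qunit e_x F z + qcnj (grad_q \<rho> e_y z) * dop qunit e_y F z)"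
  shows "van k S (dop qunit e_x F) \<and> van k S (dop qunit e_y F)"
proof -
  \<comment> \<open>The step needs both components at the same order, so they are carried along
    together; the second one is obtained by exchanging \<open>e_x\<close> and
    \<open>e_y\<close>.\<close>
  have "van (Suc (Suc m)) S (dop qunit e_x F) \<and> van (Suc (Suc m)) S (dop qunit e_y F)" for m
  proof (induction m)
    case 0
    then show ?case using G by (simp add: numeral_2_eq_2)
  next
    case (Suc m)
    show ?case
      using flat_step[OF F nz, of m] flat_step[OF F _ , of e_y e_x m] nz N Suc
      by (simp add: add.commute del: van.simps)
  qed
  then show ?thesis using van_le[of "Suc (Suc k)"] by (meson le_Suc_eq order_refl)
qed

end

text \<open>Independence of the CRF condition from the choices in it, in the form used on
  \<open>S\<close>. Two defining functions have proportional differentials on \<open>S\<close>, and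
  two extensions differ by a function vanishing on \<open>S\<close>, whose differential is a
  multiple of that of \<open>\<rho>\<close>. Differentiability of \<open>G\<close> on
  \<open>S\<close> suffices, so \<open>G\<close> may be a derivative of an extension.\<close>

lemma CRF_normal:
  assumes def: "defining_function S U \<rho>" and crf: "CRF S g" and G: "\<And>z. z \<in> S \<Longrightarrow> G differentiable (at z)"
    "\<And>z. z \<in> S \<Longrightarrow> G z = g z" and z: "z \<in> S"
  shows "\<exists>c. dop qunit e_x G z = grad_q \<rho> e_x z * c \<and> dop qunit e_y G z = grad_q \<rho> e_y z * c"
proof -
  obtain U' \<rho>' F A B where def': "defining_function S U' \<rho>'" and F: "smooth_on F U'" "\<forall>z\<in>S. F z = g z"
    and db: "\<forall>z\<in>U'. dbar F z = \<rho>' z *\<^sub>R A z +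
       (fst (dbar (\<lambda>w. of_real (\<rho>' w)) z) * B z, snd (dbar (\<lambda>w. of_real (\<rho>' w)) z) * B z)"
    using crf unfolding CRF_def by blast
  have zU': "z \<in> U'" "\<rho>' z = 0" "\<rho>' differentiable at z" "F differentiable at z"
    using def' F z unfolding defining_function_def by (auto intro: smooth_on_differentiable)
  have dr: "\<rho> differentiable (at z)"
    using def z unfolding defining_function_def by (auto intro: smooth_on_differentiable)
  obtain u where u: "pd u \<rho> z \<noteq> 0" using def z unfolding defining_function_def pd_def by blast
  have pr: "pd v h z = pd v \<rho> z *\<^sub>R (pd u h z /\<^sub>R pd u \<rho> z)"
    if "h differentiable (at z)" "\<And>w. w \<in> S \<Longrightarrow> h w = 0" for h :: "quat2 \<Rightarrow> 'b::euclidean_space" and v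
  proof -
    have "pd v h z = inverse (pd u \<rho> z) *\<^sub>R (pd u \<rho> z *\<^sub>R pd v h z)" using u by simp
    also have "\<dots> = inverse (pd u \<rho> z) *\<^sub>R (pd v \<rho> z *\<^sub>R pd u h z)"
      using pd_proportional[OF def z that, of u v] by simp
    finally show ?thesis by (simp add: mult.commute)
  qed
  define k where "k = pd u \<rho>' z / pd u \<rho> z"
  have k: "pd v \<rho>' z = k * pd v \<rho> z" for v
    using pr[of \<rho>' v] zU'(3) def' unfolding defining_function_def by (auto simp: k_def field_simps)
  define h where "h w = G w - F w" for w
  define c where "c = pd u h z /\<^sub>R pd u \<rho> z"
  have hd: "h differentiable (at z)" unfolding h_def using G(1)[OF z] zU'(4) by (rule differentiable_diff)
  have h: "pd v h z = pd v \<rho> z *\<^sub>R c" for v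
    unfolding c_def by (rule pr[OF hd]) (use G(2) F(2) in \<open>auto simp: h_def\<close>)
  have Gv: "pd v G z = pd v F z + pd v \<rho> z *\<^sub>R c" for v
    using h[of v] pd_diff[OF G(1)[OF z] zU'(4), of v] by (simp add: h_def[abs_def] algebra_simps)
  have gk: "grad_q \<rho>' e z = k *\<^sub>R grad_q \<rho> e z" for e
    unfolding grad_q_def by (simp add: k scaleR_sum_right)
  have dF: "dop qunit e_x F z = grad_q \<rho>' e_x z * B z" "dop qunit e_y F z = grad_q \<rho>' e_y z * B z"
    using bspec[OF db zU'(1)] unfolding dbar_dop fst_conv snd_conv dop_of_real[OF zU'(3)]
    by (simp_all add: zU'(2))
  have dG: "dop qunit e G z = dop qunit e F z + grad_q \<rho> e z * c" for e
    unfolding dop_def grad_q_def Gv by (simp add: distrib_left sum.distrib sum_distrib_right)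
  show ?thesis
    by (rule exI[of _ "k *\<^sub>R B z + c"]) (simp add: dG dF gk distrib_left)
qed

text \<open>On \<open>S\<close> the CRF condition makes \<open>dbar F\<close> equal to the
  quaternionic gradient of \<open>\<rho>\<close> times some \<open>c\<close>, and the normalisation
  \<open>N\<close> forces \<open>c = 0\<close>. Hence the \<open>f_comp\<close> are restrictions of
  the derivatives of \<open>F\<close>, and the same argument applied to each of these, with
  \<open>N\<close> differentiated once, removes the first derivatives of
  \<open>dbar F\<close>.\<close>

lemma admissible_dbar_van_2:
  assumes def: "defining_function S U \<rho>" and adm: "admissible S f"
    and F: "smooth_on F U" "\<And>z. z \<in> S \<Longrightarrow> F z = f z"
    and nz: "\<And>z. z \<in> U \<Longrightarrow> (norm (grad_q \<rho> e_x z))\<^sup>2 + (norm (grad_q \<rho> e_y z))\<^sup>2 \<noteq> 0"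
    and N: "van 2 S (\<lambda>z. qcnj (grad_q \<rho> e_x z) * dop qunit e_x F z + qcnj (grad_q \<rho> e_y z) * dop qunit e_y F z)"
  shows "van 2 S (dop qunit e_x F)" "van 2 S (dop qunit e_y F)"
proof -
  let ?n = "grad_q \<rho> e_x" and ?n' = "grad_q \<rho> e_y"
  have U: "open U" "S \<subseteq> U" "smooth_on \<rho> U" using def unfolding defining_function_def by auto
  obtain \<nu> where \<nu>: "unit_normal_field S \<nu>" and crf: "CRF S f"
    "\<And>\<alpha>. \<alpha> < 4 \<Longrightarrow> CRF S (f_comp S \<nu> f (e_x \<alpha>)) \<and> CRF S (f_comp S \<nu> f (e_y \<alpha>))"
    using adm unfolding admissible_def by blast
  have dF: "F differentiable at z" "pd v F differentiable at z" if "z \<in> S" for z v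
    using F(1) U that by (auto intro: smooth_on_differentiable smooth_on_pd)
  have cancel: "c = 0" if "z \<in> S" "qcnj (?n z) * (?n z * c) + qcnj (?n' z) * (?n' z * c) = 0" for z c
  proof -
    have "((norm (?n z))\<^sup>2 + (norm (?n' z))\<^sup>2) *\<^sub>R c = 0"
      using that(2) by (simp add: qcnj_mult_self scaleR_conv_of_real distrib_right flip: mult.assoc)
    then show ?thesis using nz[of z] U(2) that(1) by auto
  qed
  have G0: "dop qunit e_x F z = 0 \<and> dop qunit e_y F z = 0" if z: "z \<in> S" for z
  proof -
    obtain c where c: "dop qunit e_x F z = ?n z * c" "dop qunit e_y F z = ?n' z * c"
      using CRF_normal[OF def crf(1) dF(1) F(2) z] by blast
    have "qcnj (?n z) * dop qunit e_x F z + qcnj (?n' z) * dop qunit e_y F z = 0"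
      using N z by (simp add: numeral_2_eq_2)
    then have "c = 0" using cancel[OF z] c by metis
    then show ?thesis using c by simp
  qed
  have comp: "f_comp S \<nu> f e z = pd e F z" if "z \<in> S" for e z
    by (rule f_comp_eq_pd[OF def that \<nu> dF(1)[OF that] F(2)]) (use G0[OF that] in \<open>auto simp: dbar_dop zero_prod_def\<close>)
  have sG: "smooth_on (dop qunit e F) U" for e by (rule smooth_on_dop[OF U(1) F(1)])
  have key: "pd v (dop qunit e_x F) z = 0 \<and> pd v (dop qunit e_y F) z = 0"
    if z: "z \<in> S" and v: "v = e_x \<alpha> \<or> v = e_y \<alpha>" "\<alpha> < 4" for v \<alpha> z
  proof -
    have zU: "z \<in> U" using z U(2) by blast
    have "CRF S (f_comp S \<nu> f v)" using crf(2) v by blast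
    then obtain c where c: "dop qunit e_x (pd v F) z = ?n z * c" "dop qunit e_y (pd v F) z = ?n' z * c"
      \<comment> \<open>\<open>pd v F\<close> is an extension of \<open>f_comp S \<nu> f v\<close>
        because \<open>dbar F\<close> is already known to vanish on \<open>S\<close>.\<close>
      using CRF_normal[OF def _ dF(2) comp[symmetric] z] by blast
    have sw: "pd v (dop qunit e F) z = dop qunit e (pd v F) z" for e
      unfolding pd_dop[OF U(1) F(1) zU] unfolding dop_def
      by (intro sum.cong refl arg_cong2[of _ _ _ _ times] pd_symmetric[OF U(1) zU F(1)])
    have "pd v (\<lambda>z. qcnj (?n z) * dop qunit e_x F z + qcnj (?n' z) * dop qunit e_y F z) z = 0"
    proof -
      have "van (Suc 0) S (pd v (\<lambda>z. qcnj (?n z) * dop qunit e_x F z + qcnj (?n' z) * dop qunit e_y F z))"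
        using N unfolding numeral_2_eq_2 van.simps(2)[of "Suc 0"] by blast
      then show ?thesis using z unfolding van.simps(2)[of 0] by blast
    qed
    moreover have "pd v (\<lambda>z. qcnj (?n z) * dop qunit e_x F z + qcnj (?n' z) * dop qunit e_y F z) z =
        qcnj (?n z) * pd v (dop qunit e_x F) z + qcnj (?n' z) * pd v (dop qunit e_y F) z"
    proof -
      have sn: "smooth_on (\<lambda>z. qcnj (grad_q \<rho> e z)) U" for e
        by (intro smooth_on_linear_comp[OF bounded_linear_qcnj U(1)] smooth_on_grad_q U)
      have d: "(\<lambda>z. qcnj (grad_q \<rho> e z)) differentiable at z" "dop qunit e F differentiable at z" for e
        using sn sG zU smooth_on_differentiable by blast+
      have "pd v (\<lambda>z. qcnj (?n z) * dop qunit e_x F z + qcnj (?n' z) * dop qunit e_y F z) z =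
         pd v (\<lambda>z. qcnj (?n z) * dop qunit e_x F z) z + pd v (\<lambda>z. qcnj (?n' z) * dop qunit e_y F z) z"
        by (intro pd_add smooth_on_differentiable[OF _ zU] smooth_on_mult U(1) sn sG)
      then show ?thesis using G0[OF z] by (simp add: pd_mult[OF d])
    qed
    ultimately have "c = 0" using cancel[OF z, of c] c by (simp add: sw)
    then show ?thesis using c sw by simp
  qed
  have "pd v (dop qunit e F) z = 0" if z: "z \<in> S" and e: "e = e_x \<or> e = e_y" for v e z
  proof -
    have lin: "linear (\<lambda>v. pd v (dop qunit e F) z)"
      using pd_linear smooth_on_differentiable[OF sG] U(2) z by blast
    have "pd (coord k) (dop qunit e F) z = 0" if "k < 8" for k
    proof (cases "k < 4")
      case True then show ?thesis using key[OF z, of "coord k" k] e by (auto simp: coord_def)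
    next
      case False then show ?thesis using key[OF z, of "coord k" "k - 4"] e that by (auto simp: coord_def)
    qed
    then have "(\<Sum>k<8. (v \<bullet> coord k) *\<^sub>R pd (coord k) (dop qunit e F) z) = 0" by simp
    moreover have "pd v (dop qunit e F) z = (\<Sum>k<8. (v \<bullet> coord k) *\<^sub>R pd (coord k) (dop qunit e F) z)"
      by (subst coord_expand[of v]) (simp add: linear_sum[OF lin] linear_scale[OF lin] o_def)
    ultimately show ?thesis by simp
  qed
  then show "van 2 S (dop qunit e_x F)" "van 2 S (dop qunit e_y F)"
    using G0 by (auto simp: numeral_2_eq_2)
qed

section \<open>Borel summation along a hypersurface\<close>

primrec ipd :: "'a list \<Rightarrow> ('a::euclidean_space \<Rightarrow> 'b::euclidean_space) \<Rightarrow> 'a \<Rightarrow> 'b" where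
  "ipd [] F = F"
| "ipd (v # vs) F = ipd vs (pd v F)"

lemma smooth_on_ipd: "smooth_on F U \<Longrightarrow> smooth_on (ipd vs F) U"
  by (induction vs arbitrary: F) (auto intro: smooth_on_pd)

lemma ipd_cong:
  assumes "open U"
  shows "(\<And>w. w \<in> U \<Longrightarrow> F w = G w) \<Longrightarrow> z \<in> U \<Longrightarrow> ipd vs F z = ipd vs G z"
proof (induction vs arbitrary: F G)
  case (Cons v vs)
  show ?case unfolding ipd.simps by (rule Cons.IH[OF pd_cong[OF assms _ Cons.prems(1)] Cons.prems(2)])
qed simp

lemma ipd_linear_comp:
  assumes "open U" "bounded_linear f"
  shows "smooth_on F U \<Longrightarrow> z \<in> U \<Longrightarrow> ipd vs (\<lambda>z. f (F z)) z = f (ipd vs F z)"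
proof (induction vs arbitrary: F)
  case (Cons v vs)
  have "ipd vs (pd v (\<lambda>z. f (F z))) z = ipd vs (\<lambda>z. f (pd v F z)) z"
    using Cons.prems by (intro ipd_cong[OF assms(1)] pd_linear_comp[OF assms(2)] smooth_on_differentiable)
  then show ?case using Cons by (simp add: smooth_on_pd)
qed simp

lemma ipd_add:
  assumes "open U"
  shows "smooth_on F U \<Longrightarrow> smooth_on G U \<Longrightarrow> z \<in> U \<Longrightarrow> ipd vs (\<lambda>z. F z + G z) z = ipd vs F z + ipd vs G z"
proof (induction vs arbitrary: F G)
  case (Cons v vs)
  have "ipd vs (pd v (\<lambda>z. F z + G z)) z = ipd vs (\<lambda>z. pd v F z + pd v G z) z"
    using Cons.prems by (intro ipd_cong[OF assms(1)] pd_add smooth_on_differentiable)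
  then show ?case using Cons by (simp add: smooth_on_pd)
qed simp

text \<open>Normal convergence on compact sets of all iterated derivatives. Only basis directions
  occur, so that each order involves finitely many bounds.\<close>

definition smoothly_summable :: "(nat \<Rightarrow> 'a::euclidean_space \<Rightarrow> 'b::euclidean_space) \<Rightarrow> 'a set \<Rightarrow> bool" where
  "smoothly_summable f U \<longleftrightarrow> (\<forall>n. smooth_on (f n) U) \<and> (\<forall>K vs. compact K \<and> K \<subseteq> U \<and> set vs \<subseteq> Basis \<longrightarrow>
     (\<exists>M. summable M \<and> (\<forall>n. \<forall>z\<in>K. norm (ipd vs (f n) z) \<le> M n)))"

lemma smoothly_summable_pd:
  assumes "smoothly_summable f U" "b \<in> Basis"
  shows "smoothly_summable (\<lambda>n. pd b (f n)) U"
  unfolding smoothly_summable_def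
proof (intro conjI allI impI)
  show "smooth_on (pd b (f n)) U" for n using assms by (auto simp: smoothly_summable_def intro: smooth_on_pd)
  fix K :: "'a set" and vs :: "'a list" assume "compact K \<and> K \<subseteq> U \<and> set vs \<subseteq> Basis"
  then have "\<exists>M. summable M \<and> (\<forall>n. \<forall>z\<in>K. norm (ipd (b # vs) (f n) z) \<le> M n)"
    using assms unfolding smoothly_summable_def by (metis insert_subset list.simps(15))
  then show "\<exists>M. summable M \<and> (\<forall>n. \<forall>z\<in>K. norm (ipd vs (pd b (f n)) z) \<le> M n)" by simp
qed

lemma smoothly_summable_bound:
  assumes "smoothly_summable f U" "compact K" "K \<subseteq> U"
  shows "\<exists>M. summable M \<and> (\<forall>n. \<forall>z\<in>K. norm (f n z) \<le> M n)"
proof -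
  from assms(1) have "\<forall>K vs. compact K \<and> K \<subseteq> U \<and> set vs \<subseteq> Basis \<longrightarrow>
     (\<exists>M. summable M \<and> (\<forall>n. \<forall>z\<in>K. norm (ipd vs (f n) z) \<le> M n))" unfolding smoothly_summable_def by (rule conjunct2)
  from this[THEN spec[of _ K], THEN spec[of _ "[]"]]
  show ?thesis using assms(2,3) by simp
qed

lemma smoothly_summable_summable:
  assumes "smoothly_summable f U" "z \<in> U"
  shows "summable (\<lambda>n. f n z)"
proof -
  have K: "compact {z}" "{z} \<subseteq> U" using assms(2) by auto
  obtain M where M: "summable M" "\<forall>n. \<forall>w\<in>{z}. norm (f n w) \<le> M n"
    using smoothly_summable_bound[OF assms(1) K] by (elim exE conjE)
  show ?thesis by (rule summable_comparison_test'[OF M(1), of 0]) (use M(2) in simp)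
qed

lemma smoothly_summable_has_derivative:
  fixes f :: "nat \<Rightarrow> 'a::euclidean_space \<Rightarrow> 'b::euclidean_space"
  assumes f: "smoothly_summable f U" and U: "open U" "z \<in> U"
  shows "((\<lambda>z. \<Sum>n. f n z) has_derivative (\<lambda>v. \<Sum>b\<in>Basis. (v \<bullet> b) *\<^sub>R (\<Sum>n. pd b (f n) z))) (at z)"
proof -
  obtain r where r: "r > 0" "cball z r \<subseteq> U" using U open_contains_cball by blast
  define S where "S = ball z r"
  have SU: "S \<subseteq> U" using r ball_subset_cball unfolding S_def by blast
  define g' where "g' x v = (\<Sum>b\<in>Basis. (v \<bullet> b) *\<^sub>R (\<Sum>n. pd b (f n) x))" for x v
  have sm: "smooth_on (f n) U" for n using f by (simp add: smoothly_summable_def)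
  have "\<exists>g. \<forall>x\<in>S. (\<lambda>n. f n x) sums g x \<and> (g has_derivative g' x) (at x within S)"
  proof (rule has_derivative_series[where x = z])
    show "convex S" by (simp add: S_def)
    show "(f n has_derivative (\<lambda>v. pd v (f n) x)) (at x within S)" if "x \<in> S" for n x
      using smooth_on_has_derivative[OF sm] SU that by (auto intro: has_derivative_at_withinI)
    show "z \<in> S" using r by (simp add: S_def)
    show "(\<lambda>n. f n z) sums (\<Sum>n. f n z)" using smoothly_summable_summable[OF f U(2)] by (rule summable_sums)
    fix e :: real assume e: "e > 0"
    define d where "d = e / real DIM('a)"
    have d: "d > 0" using e by (simp add: d_def)
    have "\<forall>\<^sub>F n in sequentially. \<forall>x\<in>S. norm ((\<Sum>i<n. pd b (f i) x) - (\<Sum>i. pd b (f i) x)) < d"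
      if b: "b \<in> Basis" for b
    proof -
      obtain M where M: "summable M" "\<forall>n. \<forall>x\<in>cball z r. norm (pd b (f n) x) \<le> M n"
        using smoothly_summable_bound[OF smoothly_summable_pd[OF f b] compact_cball r(2)] by (elim exE conjE)
      have "uniform_limit S (\<lambda>n x. \<Sum>i<n. pd b (f i) x) (\<lambda>x. \<Sum>i. pd b (f i) x) sequentially"
        by (rule Weierstrass_m_test[OF _ M(1)]) (use M(2) ball_subset_cball in \<open>auto simp: S_def\<close>)
      from uniform_limitD[OF this d] show ?thesis by (simp add: dist_norm)
    qed
    then have "\<forall>\<^sub>F n in sequentially. \<forall>b\<in>Basis. \<forall>x\<in>S. norm ((\<Sum>i<n. pd b (f i) x) - (\<Sum>i. pd b (f i) x)) < d"
      by (intro eventually_ball_finite) auto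
    then show "\<forall>\<^sub>F n in sequentially. \<forall>x\<in>S. \<forall>h. norm ((\<Sum>i<n. pd h (f i) x) - g' x h) \<le> e * norm h"
    proof eventually_elim
      case (elim n)
      show ?case
      proof (intro ballI allI)
        fix x h assume x: "x \<in> S"
        have "(\<Sum>i<n. pd h (f i) x) = (\<Sum>i<n. \<Sum>b\<in>Basis. (h \<bullet> b) *\<^sub>R pd b (f i) x)"
          by (intro sum.cong refl pd_expand smooth_on_differentiable[OF sm]) (use x SU in auto)
        also have "\<dots> = (\<Sum>b\<in>Basis. (h \<bullet> b) *\<^sub>R (\<Sum>i<n. pd b (f i) x))"
          by (subst sum.swap) (simp add: scaleR_sum_right)
        finally have "(\<Sum>i<n. pd h (f i) x) - g' x h =
            (\<Sum>b\<in>Basis. (h \<bullet> b) *\<^sub>R ((\<Sum>i<n. pd b (f i) x) - (\<Sum>i. pd b (f i) x)))"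
          by (simp add: g'_def sum_subtractf scaleR_diff_right)
        also have "norm \<dots> \<le> (\<Sum>b\<in>(Basis::'a set). norm h * d)"
        proof (rule sum_norm_le)
          fix b :: 'a assume b: "b \<in> Basis"
          show "norm ((h \<bullet> b) *\<^sub>R ((\<Sum>i<n. pd b (f i) x) - (\<Sum>i. pd b (f i) x))) \<le> norm h * d"
            unfolding norm_scaleR using elim b x by (intro mult_mono) (auto simp: Basis_le_norm less_imp_le)
        qed
        also have "\<dots> = e * norm h" by (simp add: d_def)
        finally show "norm ((\<Sum>i<n. pd h (f i) x) - g' x h) \<le> e * norm h" .
      qed
    qed
  qed
  then obtain g where g: "\<And>x. x \<in> S \<Longrightarrow> (\<lambda>n. f n x) sums g x" "\<And>x. x \<in> S \<Longrightarrow> (g has_derivative g' x) (at x within S)"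
    by blast
  have So: "open S" "z \<in> S" using r by (auto simp: S_def)
  have "(g has_derivative g' z) (at z)" using g(2)[OF So(2)] at_within_open[OF So(2,1)] by simp
  then have "((\<lambda>z. \<Sum>n. f n z) has_derivative g' z) (at z)"
    using g(1) has_derivative_cong_open[OF So, of g "\<lambda>z. \<Sum>n. f n z"] sums_unique by blast
  then show ?thesis by (simp add: g'_def[abs_def])
qed

lemma Ck_on_eq: "Ck_on k G U \<Longrightarrow> open U \<Longrightarrow> (\<And>w. w \<in> U \<Longrightarrow> F w = G w) \<Longrightarrow> Ck_on k F U"
  using Ck_on_cong by blast

lemma smoothly_summable_smooth:
  assumes "smoothly_summable f U" "open U"
  shows "smooth_on (\<lambda>z. \<Sum>n. f n z) U"
proof -
  have "Ck_on k (\<lambda>z. \<Sum>n. f n z) U" for k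
    using assms(1)
  proof (induction k arbitrary: f)
    case 0
    then show ?case using smoothly_summable_has_derivative[OF 0 assms(2)]
      by (auto intro!: continuous_at_imp_continuous_on has_derivative_continuous)
  next
    case (Suc k)
    have "Ck_on k (\<lambda>z. \<Sum>b\<in>Basis. (v \<bullet> b) *\<^sub>R (\<Sum>n. pd b (f n) z)) U" for v
      by (intro Ck_on_sum Ck_on_bilinear[OF bounded_bilinear_scaleR] Ck_on_const assms(2)
          Suc.IH[OF smoothly_summable_pd[OF Suc.prems]])
    then have "Ck_on k (pd v (\<lambda>z. \<Sum>n. f n z)) U" for v
      by (rule Ck_on_eq[OF _ assms(2)]) (rule pd_eqI[OF smoothly_summable_has_derivative[OF Suc.prems assms(2)]])
    then show ?case unfolding Ck_on_Suc
      using smoothly_summable_has_derivative[OF Suc.prems assms(2)] differentiable_def by blast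
  qed
  then show ?thesis by (simp add: smooth_on_def)
qed

lemma smoothly_summable_van:
  assumes "open U" "S \<subseteq> U"
  shows "smoothly_summable f U \<Longrightarrow> (\<And>n. van k S (f n)) \<Longrightarrow> van k S (\<lambda>z. \<Sum>n. f n z)"
proof (induction k arbitrary: f)
  case (Suc k)
  have vp: "van k S (pd b (f n))" for b n using Suc.prems(2)[of n] by (metis van.simps(2))
  have "van k S (\<lambda>z. \<Sum>b\<in>Basis. (v \<bullet> b) *\<^sub>R (\<Sum>n. pd b (f n) z))" for v
    by (intro van_sum[OF assms] van_linear_comp[OF bounded_linear_scaleR_right assms] smooth_on_scaleR assms(1)
        smooth_on_const smoothly_summable_smooth smoothly_summable_pd Suc.prems(1) Suc.IH[OF smoothly_summable_pd[OF Suc.prems(1)] vp])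
  then have "van k S (pd v (\<lambda>z. \<Sum>n. f n z))" for v
    by (rule van_eq[OF _ assms]) (rule pd_eqI[OF smoothly_summable_has_derivative[OF Suc.prems(1) assms(1)]])
  moreover have "\<forall>z\<in>S. f n z = 0" for n using Suc.prems(2)[of n] by (metis van.simps(2))
  ultimately show ?case by auto
qed simp

lemma smoothly_summable_shift:
  assumes f: "smoothly_summable f U"
  shows "smoothly_summable (\<lambda>n. f (n + k)) U"
  unfolding smoothly_summable_def
proof (intro conjI allI impI)
  fix K :: "'a set" and vs :: "'a list"
  assume A: "compact K \<and> K \<subseteq> U \<and> set vs \<subseteq> Basis"
  from f have "\<forall>K vs. compact K \<and> K \<subseteq> U \<and> set vs \<subseteq> Basis \<longrightarrow>
     (\<exists>M. summable M \<and> (\<forall>n. \<forall>z\<in>K. norm (ipd vs (f n) z) \<le> M n))" unfolding smoothly_summable_def by (rule conjunct2)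
  from this[rule_format, OF A]
  obtain M where M: "summable M" "\<forall>n. \<forall>z\<in>K. norm (ipd vs (f n) z) \<le> M n" by (elim exE conjE)
  have "\<forall>n. \<forall>z\<in>K. norm (ipd vs (f (n + k)) z) \<le> M (n + k)" using M(2) by simp
  then show "\<exists>M. summable M \<and> (\<forall>n. \<forall>z\<in>K. norm (ipd vs (f (n + k)) z) \<le> M n)"
    using summable_ignore_initial_segment[OF M(1), of k] by (intro exI[of _ "\<lambda>n. M (n + k)"] conjI)
next
  show "smooth_on (f (n + k)) U" for n using f unfolding smoothly_summable_def by simp
qed

text \<open>A diagonal choice: along an exhaustion \<open>C n\<close> by compact sets,
  \<open>l n\<close> is taken so large that on \<open>C n\<close> all derivatives of order less than
  \<open>n\<close> of the term \<open>n\<close> are at most 2^(-n). For a fixed compact set and a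
  fixed order this covers all but finitely many terms.\<close>

lemma smoothly_summable_choice:
  fixes f :: "nat \<Rightarrow> real \<Rightarrow> 'a::euclidean_space \<Rightarrow> 'b::euclidean_space"
  assumes U: "open U" and sm: "\<And>n l. smooth_on (f n l) U"
    and ev: "\<And>n K vs. compact K \<Longrightarrow> K \<subseteq> U \<Longrightarrow> length vs < n \<Longrightarrow>
      \<forall>\<^sub>F l in at_top. \<forall>z\<in>K. norm (ipd vs (f n l) z) \<le> (1/2) ^ n"
  shows "\<exists>l. (\<forall>n. l n \<ge> 1) \<and> smoothly_summable (\<lambda>n. f n (l n)) U"
proof -
  obtain C where C: "\<And>n. compact (C n)" "\<And>n. C n \<subseteq> U" "\<And>n. C n \<subseteq> interior (C (Suc n))"
    "\<Union> (range C) = U" "\<And>K. \<lbrakk>compact K; K \<subseteq> U\<rbrakk> \<Longrightarrow> \<exists>N. \<forall>n\<ge>N. K \<subseteq> C n"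
    using open_Union_compact_subsets[OF U] by blast
  have "\<exists>l\<ge>1. \<forall>vs\<in>{vs. set vs \<subseteq> (Basis::'a set) \<and> length vs < n}. \<forall>z\<in>C n. norm (ipd vs (f n l) z) \<le> (1/2) ^ n" for n
  proof -
    have "finite {vs. set vs \<subseteq> (Basis::'a set) \<and> length vs < n}"
      by (rule finite_subset[OF _ finite_lists_length_le[OF finite_Basis, of n]]) auto
    then have "\<forall>\<^sub>F l in at_top. \<forall>vs\<in>{vs. set vs \<subseteq> (Basis::'a set) \<and> length vs < n}. \<forall>z\<in>C n.
        norm (ipd vs (f n l) z) \<le> (1/2) ^ n"
      using ev[OF C(1,2)] by (intro eventually_ball_finite) auto
    moreover have "\<forall>\<^sub>F l in at_top. l \<ge> (1::real)" by (rule eventually_ge_at_top)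
    ultimately have "\<forall>\<^sub>F l in at_top. l \<ge> 1 \<and> (\<forall>vs\<in>{vs. set vs \<subseteq> (Basis::'a set) \<and> length vs < n}. \<forall>z\<in>C n.
        norm (ipd vs (f n l) z) \<le> (1/2) ^ n)" by eventually_elim simp
    then show ?thesis by (metis (no_types, lifting) eventually_at_top_linorder order_refl)
  qed
  then obtain l where l: "\<And>n. l n \<ge> 1"
    "\<And>n vs z. set vs \<subseteq> (Basis::'a set) \<Longrightarrow> length vs < n \<Longrightarrow> z \<in> C n \<Longrightarrow> norm (ipd vs (f n (l n)) z) \<le> (1/2) ^ n"
    by (metis (mono_tags, lifting) mem_Collect_eq)
  have "smoothly_summable (\<lambda>n. f n (l n)) U" unfolding smoothly_summable_def
  proof (intro conjI allI impI)
    fix K :: "'a set" and vs :: "'a list" assume A: "compact K \<and> K \<subseteq> U \<and> set vs \<subseteq> Basis"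
    obtain N0 where N0: "\<And>n. n \<ge> N0 \<Longrightarrow> K \<subseteq> C n" using C(5) A by blast
    define N where "N = max N0 (Suc (length vs))"
    have "\<exists>B. \<forall>z\<in>K. norm (ipd vs (f n (l n)) z) \<le> B" for n
    proof -
      have "continuous_on K (ipd vs (f n (l n)))"
        using smooth_on_continuous_on[OF smooth_on_ipd[OF sm]] A continuous_on_subset by blast
      then have "bounded (ipd vs (f n (l n)) ` K)" using A compact_continuous_image compact_imp_bounded by blast
      then show ?thesis by (auto simp: bounded_iff)
    qed
    then obtain B where B: "\<And>n z. z \<in> K \<Longrightarrow> norm (ipd vs (f n (l n)) z) \<le> B n" by metis
    \<comment> \<open>The finitely many initial terms are bounded by continuity on the compact
      set.\<close>
    define M where "M n = (if n < N then B n else (1/2::real) ^ n)" for n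
    have "summable (\<lambda>n. (1/2::real) ^ n)" by (rule summable_geometric) simp
    then have "summable M"
      by (rule summable_comparison_test'[where N = N]) (simp add: M_def)
    moreover have "norm (ipd vs (f n (l n)) z) \<le> M n" if "z \<in> K" for n z
    proof (cases "n < N")
      case False
      then have n: "N0 \<le> n" "length vs < n" by (auto simp: N_def)
      then have "z \<in> C n" using N0 that by blast
      then show ?thesis using l(2) A False n by (simp add: M_def)
    qed (use B that in \<open>simp add: M_def\<close>)
    ultimately show "\<exists>M. summable M \<and> (\<forall>n. \<forall>z\<in>K. norm (ipd vs (f n (l n)) z) \<le> M n)" by blast
  qed (rule sm)
  then show ?thesis using l(1) by blast
qed

section \<open>Smooth cut-off functions\<close>

definition expinv :: "nat \<Rightarrow> real \<Rightarrow> real" where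
  "expinv j t = (if t > 0 then inverse t ^ j * exp (- inverse t) else 0)"

lemma expinv_over_self: "((\<lambda>t. expinv j t / t) \<longlongrightarrow> 0) (at 0)"
proof -
  have "((\<lambda>t::real. inverse t ^ Suc j / exp (inverse t)) \<longlongrightarrow> 0) (at_right 0)"
    by (rule filterlim_compose[OF tendsto_power_div_exp_0 filterlim_inverse_at_top_right])
  then have 1: "((\<lambda>t. expinv j t / t) \<longlongrightarrow> 0) (at_right 0)"
    by (rule Lim_transform_eventually)
      (auto simp: eventually_at_right_less eventually_at_filter expinv_def exp_minus field_simps)
  have "((\<lambda>t. 0::real) \<longlongrightarrow> 0) (at_left 0)" by simp
  then have 2: "((\<lambda>t. expinv j t / t) \<longlongrightarrow> 0) (at_left 0)"
    by (rule Lim_transform_eventually) (auto simp: eventually_at_filter expinv_def)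
  show ?thesis using 1 2 by (simp add: filterlim_at_split)
qed

text \<open>The powers of \<open>inverse t\<close> are built into \<open>expinv\<close> so that
  derivatives are combinations of members of the same family; at 0 the exponential beats every
  power.\<close>

lemma expinv_has_derivative:
  "(expinv j has_derivative (\<lambda>d. d *\<^sub>R (- real j * expinv (Suc j) t + expinv (Suc (Suc j)) t))) (at t)"
proof -
  consider "t > 0" | "t < 0" | "t = 0" by linarith
  then show ?thesis
  proof cases
    case 1
    have d1: "((\<lambda>t. inverse t ^ j) has_real_derivative
        of_nat j * (- (inverse t ^ Suc (Suc 0)) * inverse t ^ (j - Suc 0))) (at t)"
      using DERIV_power[OF DERIV_inverse[of t UNIV], of j] 1 by simp
    have d2: "((\<lambda>t. exp (- inverse t)) has_real_derivative exp (- inverse t) * (inverse t ^ Suc (Suc 0))) (at t)"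
      using 1 by (auto intro!: derivative_eq_intros)
    have "((\<lambda>t. inverse t ^ j * exp (- inverse t)) has_real_derivative
        - real j * expinv (Suc j) t + expinv (Suc (Suc j)) t) (at t)"
      by (rule DERIV_cong[OF DERIV_mult[OF d1 d2]]) (use 1 in \<open>cases j; simp add: expinv_def algebra_simps\<close>)
    then have "((\<lambda>t. inverse t ^ j * exp (- inverse t)) has_derivative
       (\<lambda>d. d *\<^sub>R (- real j * expinv (Suc j) t + expinv (Suc (Suc j)) t))) (at t)"
      unfolding has_field_derivative_def by (rule has_derivative_eq_rhs) (auto simp: fun_eq_iff)
    then show ?thesis
      using 1 by (subst has_derivative_cong_open[of "{0<..}"]) (auto simp: expinv_def)
  next
    case 2
    then show ?thesis
      by (subst has_derivative_cong_open[of "{..<0}" _ _ "\<lambda>_. 0"]) (auto simp: expinv_def)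
  next
    case 3
    have "(expinv j has_real_derivative 0) (at 0)"
      using expinv_over_self[of j] by (simp add: has_field_derivative_iff expinv_def[of j 0])
    then show ?thesis unfolding has_field_derivative_def 3
      by (rule has_derivative_eq_rhs) (auto simp: fun_eq_iff expinv_def)
  qed
qed

lemma smooth_on_expinv: "smooth_on (expinv j) UNIV"
proof -
  have "Ck_on k (expinv j) UNIV" for k
  proof (induction k arbitrary: j)
    case 0
    then show ?case using expinv_has_derivative
      by (auto intro!: continuous_at_imp_continuous_on has_derivative_continuous)
  next
    case (Suc k)
    have "pd v (expinv j) = (\<lambda>t. v *\<^sub>R (- real j * expinv (Suc j) t + expinv (Suc (Suc j)) t))" for v
      using pd_eqI[OF expinv_has_derivative] by blast
    moreover have "Ck_on k (\<lambda>t. v *\<^sub>R (- real j * expinv (Suc j) t + expinv (Suc (Suc j)) t)) UNIV" for v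
      using Suc by (intro Ck_on_bilinear[OF bounded_bilinear_scaleR] Ck_on_bilinear[OF bounded_bilinear_mult]
          Ck_on_add Ck_on_const open_UNIV)
    moreover have "expinv j differentiable (at t)" for t
      using expinv_has_derivative unfolding differentiable_def by blast
    ultimately show ?case unfolding Ck_on_Suc by simp
  qed
  then show ?thesis by (simp add: smooth_on_def)
qed

lemma expinv_0_pos: "expinv 0 t > 0 \<longleftrightarrow> t > 0" and expinv_0_nonneg: "expinv 0 t \<ge> 0"
  by (auto simp: expinv_def)

text \<open>The usual partition quotient. The denominator never vanishes because
  \<open>1 - t\<^sup>2\<close> or \<open>t\<^sup>2 - 1/4\<close> is positive for each
  \<open>t\<close>.\<close>

definition bump :: "real \<Rightarrow> real" where
  "bump t = expinv 0 (1 - t\<^sup>2) * inverse (expinv 0 (1 - t\<^sup>2) + expinv 0 (t\<^sup>2 - 1/4))"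

lemma bump_eq_1: "\<bar>t\<bar> \<le> 1/2 \<Longrightarrow> bump t = 1"
proof -
  assume "\<bar>t\<bar> \<le> 1/2"
  then have "t\<^sup>2 \<le> (1/2)\<^sup>2" using abs_le_square_iff[of t "1/2"] by simp
  then have "t\<^sup>2 \<le> 1/4" by (simp add: power2_eq_square)
  then have "expinv 0 (t\<^sup>2 - 1/4) = 0" "expinv 0 (1 - t\<^sup>2) > 0" by (auto simp: expinv_def)
  then show ?thesis by (simp add: bump_def)
qed

lemma bump_eq_0: "\<bar>t\<bar> \<ge> 1 \<Longrightarrow> bump t = 0"
proof -
  assume "\<bar>t\<bar> \<ge> 1"
  then have "1\<^sup>2 \<le> t\<^sup>2" using abs_le_square_iff[of 1 t] by simp
  then show ?thesis by (simp add: bump_def expinv_def)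
qed

lemma smooth_on_bump: "smooth_on bump UNIV"
proof -
  have 1: "smooth_on (\<lambda>t::real. expinv 0 (1 - t\<^sup>2)) UNIV" "smooth_on (\<lambda>t::real. expinv 0 (t\<^sup>2 - 1/4)) UNIV"
    by (rule smooth_on_compose[OF smooth_on_expinv];
        intro smooth_on_diff smooth_on_const smooth_on_power smooth_on_ident open_UNIV subset_UNIV)+
  have pos: "expinv 0 (1 - t\<^sup>2) + expinv 0 (t\<^sup>2 - 1/4) \<noteq> 0" for t
  proof (cases "t\<^sup>2 < 1")
    case True
    then have "expinv 0 (1 - t\<^sup>2) > 0" by (simp add: expinv_0_pos)
    then show ?thesis using expinv_0_nonneg[of "t\<^sup>2 - 1/4"] by linarith
  next
    case False
    then have "expinv 0 (t\<^sup>2 - 1/4) > 0" by (simp add: expinv_0_pos)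
    then show ?thesis using expinv_0_nonneg[of "1 - t\<^sup>2"] by linarith
  qed
  show ?thesis unfolding bump_def[abs_def]
    by (intro smooth_on_mult smooth_on_inverse smooth_on_add 1 open_UNIV pos)
qed

text \<open>The open set is a countable union of balls. Each ball carries a smooth function positive
  exactly on it, and these are summed after scaling by factors small enough for all derivatives to
  converge.\<close>

lemma exists_smooth_positive_exactly_on:
  fixes O' :: "'a::euclidean_space set"
  assumes "open O'"
  obtains h :: "'a \<Rightarrow> real" where "smooth_on h UNIV" "\<And>z. h z \<ge> 0" "\<And>z. h z > 0 \<longleftrightarrow> z \<in> O'"
proof (cases "O' = {}")
  case True
  then show ?thesis using that[of "\<lambda>_. 0"] smooth_on_const by auto
next
  case False
  define \<F> where "\<F> = {ball x r | x r. ball x r \<subseteq> O' \<and> r > 0}"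
  have U\<F>: "\<Union>\<F> = O'"
  proof
    show "O' \<subseteq> \<Union>\<F>"
    proof
      fix x assume "x \<in> O'"
      then obtain r where "r > 0" "ball x r \<subseteq> O'" using assms open_contains_ball by blast
      then show "x \<in> \<Union>\<F>" unfolding \<F>_def by (intro UnionI[of "ball x r"]) auto
    qed
  qed (auto simp: \<F>_def)
  obtain \<F>' where F': "\<F>' \<subseteq> \<F>" "countable \<F>'" "\<Union>\<F>' = O'"
    using Lindelof[of \<F>] U\<F> unfolding \<F>_def by (smt (verit, best) mem_Collect_eq open_ball)
  have "\<F>' \<noteq> {}" using F'(3) False by auto
  have "from_nat_into \<F>' n \<in> \<F>" for n using from_nat_into[OF \<open>\<F>' \<noteq> {}\<close>] F'(1) by blast
  then have "\<exists>x r. from_nat_into \<F>' n = ball x r \<and> r > 0" for n unfolding \<F>_def by blast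
  then obtain p r where pr: "\<And>n. from_nat_into \<F>' n = ball (p n) (r n)" "\<And>n. r n > 0" by metis
  define g where "g n z = expinv 0 ((r n)\<^sup>2 - (z - p n) \<bullet> (z - p n))" for n and z :: 'a
  have sg: "smooth_on (g n) UNIV" for n unfolding g_def[abs_def]
    by (rule smooth_on_compose[OF smooth_on_expinv])
      (intro smooth_on_diff smooth_on_const smooth_on_inner smooth_on_ident open_UNIV subset_UNIV)+
  have gpos: "g n z > 0 \<longleftrightarrow> z \<in> ball (p n) (r n)" for n z
  proof -
    have "g n z > 0 \<longleftrightarrow> (norm (z - p n))\<^sup>2 < (r n)\<^sup>2" by (simp add: g_def expinv_0_pos dot_square_norm)
    also have "\<dots> \<longleftrightarrow> norm (z - p n) < r n" using pr(2)[of n] 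
      by (auto intro: power2_less_imp_less power_strict_mono simp: less_imp_le)
    finally show ?thesis by (simp add: dist_norm norm_minus_commute)
  qed
  have "\<exists>l. (\<forall>n. l n \<ge> 1) \<and> smoothly_summable (\<lambda>n z. inverse (l n) *\<^sub>R g n z) UNIV"
  proof (rule smoothly_summable_choice[OF open_UNIV])
    show "smooth_on (\<lambda>z. inverse l *\<^sub>R g n z) UNIV" for n l
      by (intro smooth_on_scaleR smooth_on_const sg open_UNIV)
    fix n :: nat and K :: "'a set" and vs :: "'a list"
    assume K: "compact K"
    have "continuous_on K (ipd vs (g n))"
      using smooth_on_continuous_on[OF smooth_on_ipd[OF sg]] continuous_on_subset by blast
    then have "bounded (ipd vs (g n) ` K)" using K compact_continuous_image compact_imp_bounded by blast
    then obtain B where B: "\<forall>z\<in>K. norm (ipd vs (g n) z) \<le> B" by (auto simp: bounded_iff)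
    have i: "ipd vs (\<lambda>z. inverse l *\<^sub>R g n z) z = inverse l *\<^sub>R ipd vs (g n) z" for l z
      by (rule ipd_linear_comp[OF open_UNIV bounded_linear_scaleR_right sg]) simp
    have "((\<lambda>l. inverse l * B) \<longlongrightarrow> 0 * B) at_top"
      by (intro tendsto_mult tendsto_const tendsto_inverse_0_at_top filterlim_ident)
    then have "\<forall>\<^sub>F l in at_top. inverse l * B < (1/2) ^ n" by (intro order_tendstoD(2)) auto
    moreover have "\<forall>\<^sub>F l in at_top. l > (0::real)" by (rule eventually_gt_at_top)
    ultimately show "\<forall>\<^sub>F l in at_top. \<forall>z\<in>K. norm (ipd vs (\<lambda>z. inverse l *\<^sub>R g n z) z) \<le> (1/2) ^ n"
    proof eventually_elim
      case (elim l)
      show ?case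
      proof
        fix z assume "z \<in> K"
        then have "inverse l * norm (ipd vs (g n) z) \<le> inverse l * B" using B elim by (intro mult_left_mono) auto
        then show "norm (ipd vs (\<lambda>z. inverse l *\<^sub>R g n z) z) \<le> (1/2) ^ n" unfolding i norm_scaleR using elim(1) abs_of_pos[OF elim(2)]
            by (simp only: abs_inverse)
      qed
    qed
  qed
  then obtain l where l: "\<And>n. l n \<ge> 1" "smoothly_summable (\<lambda>n z. inverse (l n) *\<^sub>R g n z) UNIV" by blast
  define h where "h z = (\<Sum>n. inverse (l n) *\<^sub>R g n z)" for z
  have su: "summable (\<lambda>n. inverse (l n) *\<^sub>R g n z)" for z using smoothly_summable_summable[OF l(2)] by simp
  have nn: "0 \<le> inverse (l n) *\<^sub>R g n z" for n z
    using l(1)[of n] by (simp add: g_def expinv_0_nonneg)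
  have lp: "0 < inverse (l n) *\<^sub>R g n z \<longleftrightarrow> z \<in> ball (p n) (r n)" for n z
    using l(1)[of n] gpos[of n z] by (simp add: zero_less_mult_iff)
  have "h z > 0 \<longleftrightarrow> z \<in> O'" for z
  proof -
    have "h z > 0 \<longleftrightarrow> (\<exists>n. z \<in> ball (p n) (r n))" unfolding h_def suminf_pos_iff[OF su nn] lp ..
    also have "\<dots> \<longleftrightarrow> z \<in> \<Union>\<F>'"
      using range_from_nat_into[OF \<open>\<F>' \<noteq> {}\<close> F'(2)] pr(1) by (metis UN_iff rangeI Union_iff image_iff)
    finally show ?thesis by (simp add: F'(3))
  qed
  moreover have "h z \<ge> 0" for z unfolding h_def by (rule suminf_nonneg[OF su nn])
  moreover have "smooth_on h UNIV" unfolding h_def[abs_def] by (rule smoothly_summable_smooth[OF l(2) open_UNIV])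
  ultimately show ?thesis using that by blast
qed

text \<open>The distances to \<open>S\<close> and to \<open>X - U\<close> are not smooth. They serve
  only to single out open sets, which are then realised as positivity sets of smooth
  functions.\<close>

lemma smooth_cutoff:
  fixes S U X :: "'a::euclidean_space set"
  assumes X: "open X" and S: "closedin (top_of_set X) S" "S \<noteq> {}" and U: "open U" "S \<subseteq> U" "U \<subseteq> X" "U \<noteq> X"
  obtains \<psi> :: "'a \<Rightarrow> real" and V V' where "smooth_on \<psi> X" "open V" "S \<subseteq> V" "V \<subseteq> U" "\<And>z. z \<in> V \<Longrightarrow> \<psi> z = 1"
    "open V'" "X - U \<subseteq> V'" "\<And>z. z \<in> V' \<Longrightarrow> \<psi> z = 0"
proof -
  define A where "A = X - U"
  have A: "A \<noteq> {}" using U by (auto simp: A_def)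
  define d1 where "d1 z = infdist z S" for z
  define d2 where "d2 z = infdist z A" for z
  have c: "continuous_on UNIV d1" "continuous_on UNIV d2" unfolding d1_def[abs_def] d2_def[abs_def]
    by (intro continuous_intros)+
  have nn: "d1 z \<ge> 0" "d2 z \<ge> 0" for z by (simp_all add: d1_def d2_def infdist_nonneg)
  have SX: "S \<subseteq> X" using U by blast
  have d1_0: "d1 z = 0 \<longleftrightarrow> z \<in> S" if "z \<in> X" for z
  proof -
    obtain C where "closed C" "S = X \<inter> C" using S(1) closedin_closed by blast
    then have "z \<in> S" if "z \<in> closure S" using \<open>z \<in> X\<close> that closure_minimal[of S C] by blast
    then show ?thesis using in_closure_iff_infdist_zero[OF S(2), of z] closure_subset[of S]
      by (auto simp: d1_def)
  qed
  have d2_0: "d2 z = 0 \<longleftrightarrow> z \<in> A" if "z \<in> X" for z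
  proof -
    have "A = X \<inter> - U" "closed (- U)" using U by (auto simp: A_def)
    then have "z \<in> A" if "z \<in> closure A" using \<open>z \<in> X\<close> that closure_minimal[of A "- U"] by blast
    then show ?thesis using in_closure_iff_infdist_zero[OF A, of z] closure_subset[of A]
      by (auto simp: d2_def)
  qed
  have disj: "S \<inter> A = {}" using U by (auto simp: A_def)
  have lt: "open {z. f z < g z}" if "continuous_on UNIV f" "continuous_on UNIV g" for f g :: "'a \<Rightarrow> real"
    using that by (rule open_Collect_less)
  have m: "continuous_on UNIV (\<lambda>z. 2 * d1 z)" "continuous_on UNIV (\<lambda>z. 2 * d2 z)"
    using c by (auto intro: continuous_intros)
  \<comment> \<open>With the factor 2 the two positivity sets cover \<open>X\<close>, while
    \<open>h2\<close> still vanishes on a whole neighbourhood of \<open>S\<close> and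
    \<open>h1\<close> on one of \<open>X - U\<close>.\<close>
  obtain h1 :: "'a \<Rightarrow> real" where h1: "smooth_on h1 UNIV" "\<And>z. h1 z \<ge> 0" "\<And>z. h1 z > 0 \<longleftrightarrow> z \<in> {z. d1 z < 2 * d2 z}"
    using exists_smooth_positive_exactly_on[OF lt[OF c(1) m(2)]] by blast
  obtain h2 :: "'a \<Rightarrow> real" where h2: "smooth_on h2 UNIV" "\<And>z. h2 z \<ge> 0" "\<And>z. h2 z > 0 \<longleftrightarrow> z \<in> {z. d2 z < 2 * d1 z}"
    using exists_smooth_positive_exactly_on[OF lt[OF c(2) m(1)]] by blast
  define \<psi> where "\<psi> z = h1 z * inverse (h1 z + h2 z)" for z
  have pos: "h1 z + h2 z \<noteq> 0" if z: "z \<in> X" for z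
  proof
    assume "h1 z + h2 z = 0"
    then have "\<not> h1 z > 0" "\<not> h2 z > 0" using h1(2)[of z] h2(2)[of z] by linarith+
    then have "d1 z = 0" "d2 z = 0" using h1(3) h2(3) nn[of z] by auto
    then show False using d1_0[OF z] d2_0[OF z] disj by blast
  qed
  have h2_0: "h2 z = 0" if "\<not> d2 z < 2 * d1 z" for z using that h2(2,3)[of z] by fastforce
  have h1_0: "h1 z = 0" if "\<not> d1 z < 2 * d2 z" for z using that h1(2,3)[of z] by fastforce
  show ?thesis
  proof
    show "smooth_on \<psi> X" unfolding \<psi>_def[abs_def]
      using smooth_on_subset[OF h1(1), of X] smooth_on_subset[OF h2(1), of X]
      by (intro smooth_on_mult smooth_on_inverse smooth_on_add X pos) auto
    show "open ({z. 2 * d1 z < d2 z} \<inter> X)" using lt[OF m(1) c(2)] X by blast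
    show "open {z. 2 * d2 z < d1 z}" by (rule lt[OF m(2) c(1)])
    show "S \<subseteq> {z. 2 * d1 z < d2 z} \<inter> X"
    proof
      fix z assume z: "z \<in> S"
      then have "d1 z = 0" "d2 z \<noteq> 0" using d1_0 d2_0 SX disj by blast+
      then show "z \<in> {z. 2 * d1 z < d2 z} \<inter> X" using nn[of z] z SX by auto
    qed
    show "X - U \<subseteq> {z. 2 * d2 z < d1 z}"
    proof
      fix z assume "z \<in> X - U"
      then have "z \<in> A" "z \<in> X" by (auto simp: A_def)
      then have "d2 z = 0" "d1 z \<noteq> 0" using d1_0 d2_0 disj by blast+
      then show "z \<in> {z. 2 * d2 z < d1 z}" using nn[of z] by auto
    qed
    show "{z. 2 * d1 z < d2 z} \<inter> X \<subseteq> U"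
    proof
      fix z assume z: "z \<in> {z. 2 * d1 z < d2 z} \<inter> X"
      then have "d2 z \<noteq> 0" using nn[of z] by auto
      then show "z \<in> U" using z d2_0 by (auto simp: A_def)
    qed
    show "\<psi> z = 1" if "z \<in> {z. 2 * d1 z < d2 z} \<inter> X" for z
    proof -
      have "h2 z = 0" by (rule h2_0) (use that nn[of z] in auto)
      then show ?thesis using pos[of z] that by (simp add: \<psi>_def)
    qed
    show "\<psi> z = 0" if "z \<in> {z. 2 * d2 z < d1 z}" for z
    proof -
      have "h1 z = 0" by (rule h1_0) (use that nn[of z] in auto)
      then show ?thesis by (simp add: \<psi>_def)
    qed
  qed
qed

section \<open>Borel's theorem along a hypersurface\<close>

lemma smooth_compact_support_bounded:
  fixes \<theta> :: "real \<Rightarrow> real"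
  assumes "smooth_on \<theta> UNIV" "\<And>t. \<bar>t\<bar> > R \<Longrightarrow> \<theta> t = 0"
  obtains B where "\<And>t. norm (\<theta> t) \<le> B"
proof -
  have "continuous_on {-R..R} \<theta>" using smooth_on_continuous_on[OF assms(1)] continuous_on_subset by blast
  then have "bounded (\<theta> ` {-R..R})" using compact_continuous_image compact_imp_bounded by blast
  then obtain B where B: "\<forall>t\<in>{-R..R}. norm (\<theta> t) \<le> B" by (auto simp: bounded_iff)
  have "norm (\<theta> t) \<le> max B 0" for t
  proof (cases "\<bar>t\<bar> > R")
    case False
    then have "t \<in> {-R..R}" by (simp only: atLeastAtMost_iff) arith
    then have "norm (\<theta> t) \<le> B" using bspec[OF B, of t] by blast
    then show ?thesis by simp
  qed (use assms(2) in simp)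
  then show ?thesis using that by blast
qed

text \<open>Every derivative that falls on \<open>\<theta> (l * \<rho> z)\<close> costs one factor
  \<open>l\<close>, every other one costs nothing. The induction has to run over all
  \<open>\<theta>\<close> and \<open>c\<close>, since differentiation replaces them by
  \<open>pd 1 \<theta>\<close> and by \<open>pd v \<rho> z *\<^sub>R c z\<close> or
  \<open>pd v c\<close>.\<close>

lemma ipd_scaled_cutoff_bound:
  fixes U :: "'a::euclidean_space set" and c :: "'a \<Rightarrow> 'b::euclidean_space"
  assumes U: "open U" and \<rho>: "smooth_on \<rho> U" and K: "compact K" "K \<subseteq> U"
  shows "smooth_on \<theta> UNIV \<Longrightarrow> (\<And>t. \<bar>t\<bar> > R \<Longrightarrow> \<theta> t = 0) \<Longrightarrow> smooth_on c U \<Longrightarrow>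
    \<exists>C. \<forall>l\<ge>1. \<forall>z\<in>K. norm (ipd vs (\<lambda>z. \<theta> (l * \<rho> z :: real) *\<^sub>R c z) z) \<le> C * l ^ length vs"
proof (induction vs arbitrary: \<theta> c)
  case Nil
  obtain B where B: "\<And>t. norm (\<theta> t) \<le> B" using smooth_compact_support_bounded[OF Nil(1,2)] by blast
  have "bounded (c ` K)" using Nil(3) K smooth_on_continuous_on continuous_on_subset
    compact_continuous_image compact_imp_bounded by blast
  then obtain B' where B': "\<forall>z\<in>K. norm (c z) \<le> B'" by (auto simp: bounded_iff)
  have "norm (\<theta> (l * \<rho> z) *\<^sub>R c z) \<le> B * B'" if "z \<in> K" for l z
    unfolding norm_scaleR using B[of "l * \<rho> z"] bspec[OF B' that] by (intro mult_mono) (auto intro: order_trans[OF norm_ge_zero])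
  then show ?case by (intro exI[of _ "B * B'"]) auto
next
  case (Cons v vs)
  define \<theta>' where "\<theta>' = pd (1::real) \<theta>"
  have \<theta>': "smooth_on \<theta>' UNIV" unfolding \<theta>'_def by (rule smooth_on_pd[OF Cons.prems(1)])
  have \<theta>'0: "\<theta>' t = 0" if "\<bar>t\<bar> > R" for t
  proof -
    have "open {t. \<bar>t\<bar> > R}" by (intro open_Collect_less continuous_intros)
    then have "pd 1 \<theta> t = pd 1 (\<lambda>_. 0 :: real) t" by (rule pd_cong) (use that Cons.prems(2) in auto)
    then show ?thesis by (simp add: \<theta>'_def pd_const)
  qed
  have sc: "smooth_on (\<lambda>z. pd v \<rho> z *\<^sub>R c z) U" "smooth_on (pd v c) U"
    by (intro smooth_on_scaleR smooth_on_pd U \<rho> Cons.prems)+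
  obtain C1 where C1: "\<And>l z. l \<ge> 1 \<Longrightarrow> z \<in> K \<Longrightarrow>
      norm (ipd vs (\<lambda>z. \<theta>' (l * \<rho> z) *\<^sub>R (pd v \<rho> z *\<^sub>R c z)) z) \<le> C1 * l ^ length vs"
    using Cons.IH[OF \<theta>' \<theta>'0 sc(1)] by blast
  obtain C2 where C2: "\<And>l z. l \<ge> 1 \<Longrightarrow> z \<in> K \<Longrightarrow>
      norm (ipd vs (\<lambda>z. \<theta> (l * \<rho> z) *\<^sub>R pd v c z) z) \<le> C2 * l ^ length vs"
    using Cons.IH[OF Cons.prems(1,2) sc(2)] by blast
  have "norm (ipd (v # vs) (\<lambda>z. \<theta> (l * \<rho> z) *\<^sub>R c z) z) \<le> (\<bar>C1\<bar> + \<bar>C2\<bar>) * l ^ length (v # vs)"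
    if l: "l \<ge> 1" and z: "z \<in> K" for l z
  proof -
    have zU: "z \<in> U" using z K by blast
    have sl: "smooth_on (\<lambda>z. \<phi> (l * \<rho> z)) U" if "smooth_on \<phi> UNIV" for \<phi> :: "real \<Rightarrow> real"
      by (rule smooth_on_compose[OF that _ U open_UNIV]) (intro smooth_on_mult smooth_on_const U \<rho> subset_UNIV)+
    have 1: "smooth_on (\<lambda>z. \<theta>' (l * \<rho> z) *\<^sub>R (pd v \<rho> z *\<^sub>R c z)) U"
      "smooth_on (\<lambda>z. \<theta> (l * \<rho> z) *\<^sub>R pd v c z) U"
      by (intro smooth_on_scaleR[OF U] sl \<theta>' Cons.prems sc)+
    have "ipd vs (pd v (\<lambda>z. \<theta> (l * \<rho> z) *\<^sub>R c z)) z =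
        ipd vs (\<lambda>z. l *\<^sub>R (\<theta>' (l * \<rho> z) *\<^sub>R (pd v \<rho> z *\<^sub>R c z)) + \<theta> (l * \<rho> z) *\<^sub>R pd v c z) z"
    proof (rule ipd_cong[OF U _ zU])
      fix w assume w: "w \<in> U"
      have d: "\<rho> differentiable at w" "c differentiable at w" "\<theta> differentiable at (l * \<rho> w)"
        using \<rho> Cons.prems w by (auto intro: smooth_on_differentiable)
      have lin: "linear (\<lambda>v. pd v \<theta> (l * \<rho> w))" by (rule pd_linear[OF d(3)])
      have "((\<lambda>z. l * \<rho> z) has_derivative (\<lambda>v. l * pd v \<rho> w)) (at w)"
        by (intro has_derivative_mult_right pd_works d)
      from diff_chain_at[OF this pd_works[OF d(3)]]
      have e: "pd v (\<lambda>z. \<theta> (l * \<rho> z)) w = (l * pd v \<rho> w) *\<^sub>R \<theta>' (l * \<rho> w)"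
        using linear_scale[OF lin, of "l * pd v \<rho> w" 1] by (simp add: o_def pd_eqI \<theta>'_def)
      show "pd v (\<lambda>z. \<theta> (l * \<rho> z) *\<^sub>R c z) w =
        l *\<^sub>R (\<theta>' (l * \<rho> w) *\<^sub>R (pd v \<rho> w *\<^sub>R c w)) + \<theta> (l * \<rho> w) *\<^sub>R pd v c w"
        by (subst pd_scaleR[OF smooth_on_differentiable[OF sl[OF Cons.prems(1)] w] d(2)]) (simp add: e mult_ac)
    qed
    also have "\<dots> = l *\<^sub>R ipd vs (\<lambda>z. \<theta>' (l * \<rho> z) *\<^sub>R (pd v \<rho> z *\<^sub>R c z)) z + ipd vs (\<lambda>z. \<theta> (l * \<rho> z) *\<^sub>R pd v c z) z"
      by (subst ipd_add[OF U smooth_on_scaleR[OF U smooth_on_const 1(1)] 1(2) zU])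
        (simp only: ipd_linear_comp[OF U bounded_linear_scaleR_right 1(1) zU])
    also have "norm \<dots> \<le> l * (C1 * l ^ length vs) + C2 * l ^ length vs"
      using C1[OF l z] C2[OF l z] l by (intro norm_triangle_le add_mono) (auto intro: mult_left_mono)
    also have "\<dots> \<le> l * (\<bar>C1\<bar> * l ^ length vs) + l * (\<bar>C2\<bar> * l ^ length vs)"
    proof (intro add_mono mult_left_mono mult_right_mono)
      have "C2 * l ^ length vs \<le> 1 * (\<bar>C2\<bar> * l ^ length vs)" using l by (simp add: mult_right_mono)
      also have "\<dots> \<le> l * (\<bar>C2\<bar> * l ^ length vs)" using l by (intro mult_right_mono) auto
      finally show "C2 * l ^ length vs \<le> l * (\<bar>C2\<bar> * l ^ length vs)" .
    qed (use l in auto)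
    finally show ?thesis by (simp add: algebra_simps)
  qed
  then show ?case by blast
qed

text \<open>A formal power series in \<open>\<rho>\<close> with smooth coefficients is realised by
  cutting off the term of index \<open>n\<close> to the region where
  \<open>\<bar>\<rho>\<bar>\<close> is at most \<open>1 / l n\<close>, with \<open>l n\<close>
  growing fast enough for all derivatives to converge.\<close>

lemma borel_formal_sum:
  fixes c :: "nat \<Rightarrow> 'a::euclidean_space \<Rightarrow> 'b::euclidean_space"
  assumes U: "open U" "S \<subseteq> U" and \<rho>: "smooth_on \<rho> U" "\<And>z. z \<in> S \<Longrightarrow> \<rho> z = (0::real)"
    and c: "\<And>k. smooth_on (c k) U"
  obtains F where "smooth_on F U" "\<And>m. van (Suc m) S (\<lambda>z. F z - (\<Sum>k\<le>m. \<rho> z ^ k *\<^sub>R c k z))"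
proof -
  define f where "f n l z = (bump (l * \<rho> z) * \<rho> z ^ n) *\<^sub>R c n z" for n and l :: real and z
  define p where "p n z = \<rho> z ^ n *\<^sub>R c n z" for n z
  have sb: "smooth_on (\<lambda>z. bump (l * \<rho> z)) U" for l
    by (rule smooth_on_compose[OF smooth_on_bump _ U(1) open_UNIV]) (intro smooth_on_mult smooth_on_const U \<rho> subset_UNIV)+
  have sp: "smooth_on (p n) U" for n unfolding p_def[abs_def] by (intro smooth_on_scaleR smooth_on_power U \<rho> c)
  have sf: "smooth_on (f n l) U" for n l unfolding f_def[abs_def]
    by (intro smooth_on_scaleR smooth_on_mult smooth_on_power sb U \<rho> c)
  have "\<exists>l. (\<forall>n. l n \<ge> 1) \<and> smoothly_summable (\<lambda>n. f n (l n)) U"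
  proof (rule smoothly_summable_choice[OF U(1) sf])
    fix n :: nat and K :: "'a set" and vs :: "'a list"
    assume K: "compact K" "K \<subseteq> U" and len: "length vs < n"
    \<comment> \<open>The term of index \<open>n\<close> equals
      \<open>\<theta> (l * \<rho> z)\<close> times the coefficient, divided by \<open>l ^ n\<close>.
      Its derivatives of order less than \<open>n\<close> are thus bounded by a constant times
      \<open>1 / l\<close>.\<close>
    define \<theta> where "\<theta> t = bump t * t ^ n" for t
    have \<theta>: "smooth_on \<theta> UNIV" unfolding \<theta>_def[abs_def]
      by (intro smooth_on_mult smooth_on_bump smooth_on_power smooth_on_ident open_UNIV)
    have "\<theta> t = 0" if "\<bar>t\<bar> > 1" for t using bump_eq_0[of t] that by (simp add: \<theta>_def)
    then obtain C where C: "\<And>l z. l \<ge> 1 \<Longrightarrow> z \<in> K \<Longrightarrow>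
        norm (ipd vs (\<lambda>z. \<theta> (l * \<rho> z) *\<^sub>R c n z) z) \<le> C * l ^ length vs"
      using ipd_scaled_cutoff_bound[OF U(1) \<rho>(1) K \<theta>, of 1 "c n" vs] c by blast
    have "((\<lambda>l. inverse l * \<bar>C\<bar>) \<longlongrightarrow> 0 * \<bar>C\<bar>) at_top"
      by (intro tendsto_mult tendsto_const tendsto_inverse_0_at_top filterlim_ident)
    then have "\<forall>\<^sub>F l in at_top. inverse l * \<bar>C\<bar> < (1/2) ^ n" by (intro order_tendstoD(2)) auto
    moreover have "\<forall>\<^sub>F l in at_top. l \<ge> (1::real)" by (rule eventually_ge_at_top)
    ultimately show "\<forall>\<^sub>F l in at_top. \<forall>z\<in>K. norm (ipd vs (f n l) z) \<le> (1/2) ^ n"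
    proof eventually_elim
      case (elim l)
      have "norm (ipd vs (f n l) z) \<le> (1/2) ^ n" if z: "z \<in> K" for z
      proof -
        have "f n l = (\<lambda>z. inverse (l ^ n) *\<^sub>R (\<theta> (l * \<rho> z) *\<^sub>R c n z))"
          using elim by (auto simp: f_def \<theta>_def power_mult_distrib)
        moreover have "smooth_on (\<lambda>z. \<theta> (l * \<rho> z) *\<^sub>R c n z) U"
          by (intro smooth_on_scaleR U c smooth_on_compose[OF \<theta> _ U(1) open_UNIV])
            (intro smooth_on_mult smooth_on_const U \<rho> subset_UNIV)+
        ultimately have "ipd vs (f n l) z = inverse (l ^ n) *\<^sub>R ipd vs (\<lambda>z. \<theta> (l * \<rho> z) *\<^sub>R c n z) z"
          using ipd_linear_comp[OF U(1) bounded_linear_scaleR_right, of "\<lambda>z. \<theta> (l * \<rho> z) *\<^sub>R c n z" z vs "inverse (l ^ n)"] z K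
          by (simp add: subset_iff del: scaleR_scaleR)
        then have "norm (ipd vs (f n l) z) \<le> inverse (l ^ n) * (C * l ^ length vs)"
          using C[of l z] z elim by (simp add: mult_left_mono)
        also have "\<dots> \<le> inverse (l ^ n) * (\<bar>C\<bar> * l ^ (n - 1))"
          using elim len by (intro mult_left_mono mult_mono power_increasing) auto
        also have "\<dots> = inverse l * \<bar>C\<bar>"
          using elim len by (cases n) (auto simp: field_simps)
        finally show ?thesis using elim by simp
      qed
      then show ?case by blast
    qed
  qed
  then obtain l where l: "\<And>n. l n \<ge> (1::real)" "smoothly_summable (\<lambda>n. f n (l n)) U" by blast
  define F where "F z = (\<Sum>n. f n (l n) z)" for z
  have sF: "smooth_on F U" unfolding F_def[abs_def] by (rule smoothly_summable_smooth[OF l(2) U(1)])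
  have "van (Suc m) S (\<lambda>z. F z - (\<Sum>k\<le>m. \<rho> z ^ k *\<^sub>R c k z))" for m
  proof -
    \<comment> \<open>Close to \<open>S\<close> the cut-off is identically 1, so each term coincides
      with the uncut monomial there.\<close>
    have near: "van (Suc m) S (\<lambda>z. f k (l k) z - p k z)" for k
    proof (rule van_near_zero)
      have "continuous_on U (\<lambda>z. \<bar>l k * \<rho> z\<bar>)"
        using smooth_on_continuous_on[OF \<rho>(1)] by (intro continuous_intros)
      then show "open (U \<inter> (\<lambda>z. \<bar>l k * \<rho> z\<bar>) -` {..<1/2})"
        using U(1) continuous_on_open_vimage[OF U(1), of "\<lambda>z. \<bar>l k * \<rho> z\<bar>"] open_lessThan by (metis inf_commute)
      show "S \<subseteq> U \<inter> (\<lambda>z. \<bar>l k * \<rho> z\<bar>) -` {..<1/2}" using U(2) \<rho>(2) by auto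
      show "f k (l k) z - p k z = 0" if "z \<in> U \<inter> (\<lambda>z. \<bar>l k * \<rho> z\<bar>) -` {..<1/2}" for z
        using that bump_eq_1[of "l k * \<rho> z"] by (simp add: f_def p_def)
    qed
    \<comment> \<open>All terms of the tail contain at least \<open>m + 1\<close> factors
      \<open>\<rho>\<close>.\<close>
    have tail: "van (Suc m) S (f (n + Suc m) (l (n + Suc m)))" for n
    proof -
      have "van (n + Suc m) S (\<lambda>z. \<rho> z ^ (n + Suc m) *\<^sub>R (bump (l (n + Suc m) * \<rho> z) *\<^sub>R c (n + Suc m) z))"
        by (rule van_power_scaleR[OF U \<rho>]) (assumption | intro smooth_on_scaleR sb c U)+
      then have "van (n + Suc m) S (f (n + Suc m) (l (n + Suc m)))"
        by (rule van_eq[OF _ U]) (simp add: f_def mult_ac del: power_Suc)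
      then show ?thesis by (rule van_le) simp
    qed
    have cs: "smoothly_summable (\<lambda>n. f (n + Suc m) (l (n + Suc m))) U" using smoothly_summable_shift[OF l(2), of "Suc m"] .
    have v: "van (Suc m) S (\<lambda>z. (\<Sum>n. f (n + Suc m) (l (n + Suc m)) z) + (\<Sum>k\<le>m. f k (l k) z - p k z))"
      by (intro van_add[OF U] van_sum[OF U] near smoothly_summable_van[OF U cs tail] smoothly_summable_smooth[OF cs U(1)]
          smooth_on_sum smooth_on_diff U sf sp)
    show ?thesis
    proof (rule van_eq[OF v U])
      fix z assume "z \<in> U"
      then have "F z = (\<Sum>n. f (n + Suc m) (l (n + Suc m)) z) + (\<Sum>k<Suc m. f k (l k) z)"
        unfolding F_def using suminf_split_initial_segment[OF smoothly_summable_summable[OF l(2)], of z "Suc m"] by simp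
      then show "F z - (\<Sum>k\<le>m. \<rho> z ^ k *\<^sub>R c k z) =
        (\<Sum>n. f (n + Suc m) (l (n + Suc m)) z) + (\<Sum>k\<le>m. f k (l k) z - p k z)"
        by (simp add: sum_subtractf p_def lessThan_Suc_atMost)
    qed
  qed
  then show ?thesis using that sF by blast
qed

section \<open>The Newton kernel on quaternionic lines\<close>

lemma set_integrable_continuous_mult:
  fixes k :: "'w::euclidean_space \<Rightarrow> real" and g :: "'w \<Rightarrow> 'c::euclidean_space"
  assumes K: "compact K" and k: "set_integrable lborel K k" and g: "continuous_on K g"
  shows "set_integrable lborel K (\<lambda>w. k w *\<^sub>R g w)"
proof -
  have "bounded (g ` K)" by (rule compact_imp_bounded[OF compact_continuous_image[OF g K]])
  then obtain B where B: "\<forall>w\<in>K. norm (g w) \<le> B" unfolding bounded_iff by blast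
  have Ks: "K \<in> sets borel" by (rule borel_closed[OF compact_imp_closed[OF K]])
  have m: "(\<lambda>w. indicat_real K w *\<^sub>R g w) \<in> borel_measurable lborel"
    using borel_measurable_continuous_on_indicator[OF Ks g] by simp
  have eq: "indicat_real K w *\<^sub>R (k w *\<^sub>R g w) = (indicat_real K w *\<^sub>R k w) *\<^sub>R (indicat_real K w *\<^sub>R g w)" for w
    by (simp add: indicator_def)
  show ?thesis unfolding set_integrable_def eq
  proof (rule Bochner_Integration.integrable_bound)
    show "integrable lborel (\<lambda>w. B *\<^sub>R (indicat_real K w *\<^sub>R k w))"
      using k unfolding set_integrable_def by simp
    show "(\<lambda>w. (indicat_real K w *\<^sub>R k w) *\<^sub>R (indicat_real K w *\<^sub>R g w)) \<in> borel_measurable lborel"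
      by (rule borel_measurable_scaleR[OF borel_measurable_integrable[OF k[unfolded set_integrable_def]] m])
    show "AE w in lborel. norm ((indicat_real K w *\<^sub>R k w) *\<^sub>R (indicat_real K w *\<^sub>R g w))
        \<le> norm (B *\<^sub>R (indicat_real K w *\<^sub>R k w))"
    proof (rule AE_I2)
      fix w
      show "norm ((indicat_real K w *\<^sub>R k w) *\<^sub>R (indicat_real K w *\<^sub>R g w)) \<le> norm (B *\<^sub>R (indicat_real K w *\<^sub>R k w))"
      proof (cases "w \<in> K")
        case True
        then have "norm (g w) \<le> \<bar>B\<bar>" using B by force
        then have "\<bar>k w\<bar> * norm (g w) \<le> \<bar>k w\<bar> * \<bar>B\<bar>" by (rule mult_left_mono) simp
        then show ?thesis using True by (simp add: abs_mult mult.commute)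
      qed simp
    qed
  qed
qed

lemma set_integral_norm_le:
  fixes k :: "'w::euclidean_space \<Rightarrow> real" and g :: "'w \<Rightarrow> 'c::euclidean_space"
  assumes K: "compact K" and k: "set_integrable lborel K k" and g: "continuous_on K g"
    and B: "\<And>w. w \<in> K \<Longrightarrow> norm (g w) \<le> B"
  shows "norm (LINT w:K|lborel. k w *\<^sub>R g w) \<le> B * (LINT w:K|lborel. \<bar>k w\<bar>)"
proof -
  have "set_integrable lborel K (\<lambda>w. \<bar>k w\<bar>)" using set_integrable_abs[OF k] .
  then have i: "integrable lborel (\<lambda>w. B * (indicat_real K w *\<^sub>R \<bar>k w\<bar>))"
    unfolding set_integrable_def by simp
  have "norm (LINT w:K|lborel. k w *\<^sub>R g w) \<le> (LINT w|lborel. norm (indicat_real K w *\<^sub>R (k w *\<^sub>R g w)))"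
    unfolding set_lebesgue_integral_def by (rule integral_norm_bound)
  also have "\<dots> \<le> (LINT w|lborel. B * (indicat_real K w *\<^sub>R \<bar>k w\<bar>))"
  proof (rule integral_mono[OF _ i])
    show "integrable lborel (\<lambda>w. norm (indicat_real K w *\<^sub>R (k w *\<^sub>R g w)))"
      using set_integrable_continuous_mult[OF K k g] unfolding set_integrable_def by (rule integrable_norm)
    show "norm (indicat_real K w *\<^sub>R (k w *\<^sub>R g w)) \<le> B * (indicat_real K w *\<^sub>R \<bar>k w\<bar>)" for w
      using B[of w] mult_left_mono[of "norm (g w)" B "\<bar>k w\<bar>"] by (auto simp: indicator_def mult.commute)
  qed
  also have "\<dots> = B * (LINT w:K|lborel. \<bar>k w\<bar>)" by (simp add: set_lebesgue_integral_def)
  finally show ?thesis .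
qed

text \<open>The singularity sits in the integrable factor \<open>k\<close>, which is independent of
  the parameter. Only \<open>f\<close> is differentiated, and the remainder is controlled by uniform
  continuity of \<open>f'\<close> on a compact product.\<close>

lemma has_derivative_parametric_integral:
  fixes k :: "'w::euclidean_space \<Rightarrow> real" and f :: "'z::euclidean_space \<Rightarrow> 'w \<Rightarrow> 'c::euclidean_space"
  assumes K: "compact K" and k: "set_integrable lborel K k" and Z: "open Z" "z0 \<in> Z"
    and d: "\<And>z w. z \<in> Z \<Longrightarrow> w \<in> K \<Longrightarrow> ((\<lambda>z. f z w) has_derivative f' z w) (at z)"
    and cf: "\<And>z. z \<in> Z \<Longrightarrow> continuous_on K (f z)"
    and cf': "\<And>b. continuous_on (Z \<times> K) (\<lambda>(z, w). f' z w b)"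
  shows "((\<lambda>z. LINT w:K|lborel. k w *\<^sub>R f z w) has_derivative (\<lambda>v. LINT w:K|lborel. k w *\<^sub>R f' z0 w v)) (at z0)"
  unfolding has_derivative_at_alt
proof (intro conjI allI impI)
  have cf'0: "continuous_on K (\<lambda>w. f' z w v)" if "z \<in> Z" for z v
  proof -
    have "continuous_on K (\<lambda>w. (z, w))" "(\<lambda>w. (z, w)) ` K \<subseteq> Z \<times> K" using that by (auto intro!: continuous_intros)
    from continuous_on_compose2[OF cf'[of v] this] show ?thesis by simp
  qed
  have i': "set_integrable lborel K (\<lambda>w. k w *\<^sub>R f' z0 w v)" for v
    by (rule set_integrable_continuous_mult[OF K k cf'0[OF Z(2)]])
  have lin: "linear (f' z w)" if "z \<in> Z" "w \<in> K" for z w using d[OF that] has_derivative_linear by blast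
  have "linear (\<lambda>v. LINT w:K|lborel. k w *\<^sub>R f' z0 w v)"
  proof (rule linearI)
    fix u v :: 'z and r :: real
    have "(LINT w:K|lborel. k w *\<^sub>R f' z0 w (u + v)) = (LINT w:K|lborel. k w *\<^sub>R f' z0 w u + k w *\<^sub>R f' z0 w v)"
      by (rule set_lebesgue_integral_cong)
        (use borel_closed[OF compact_imp_closed[OF K]] in \<open>auto simp: linear_add[OF lin[OF Z(2)]] scaleR_add_right\<close>)
    then show "(LINT w:K|lborel. k w *\<^sub>R f' z0 w (u + v)) =
        (LINT w:K|lborel. k w *\<^sub>R f' z0 w u) + (LINT w:K|lborel. k w *\<^sub>R f' z0 w v)"
      using set_integral_add(2)[OF i' i'] by simp
    have "(LINT w:K|lborel. k w *\<^sub>R f' z0 w (r *\<^sub>R u)) = (LINT w:K|lborel. r *\<^sub>R (k w *\<^sub>R f' z0 w u))"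
      by (rule set_lebesgue_integral_cong)
        (use borel_closed[OF compact_imp_closed[OF K]] in \<open>auto simp: linear_scale[OF lin[OF Z(2)]]\<close>)
    then show "(LINT w:K|lborel. k w *\<^sub>R f' z0 w (r *\<^sub>R u)) = r *\<^sub>R (LINT w:K|lborel. k w *\<^sub>R f' z0 w u)"
      by (simp only: set_integral_scaleR_right)
  qed
  then show "bounded_linear (\<lambda>v. LINT w:K|lborel. k w *\<^sub>R f' z0 w v)" by (rule linear_conv_bounded_linear[THEN iffD1])
  fix e :: real assume e: "e > 0"
  define J where "J = (LINT w:K|lborel. \<bar>k w\<bar>)"
  have J: "J \<ge> 0" unfolding J_def set_lebesgue_integral_def by (intro integral_nonneg_AE AE_I2) simp
  define n where "n = real DIM('z)"
  have n: "n > 0" by (simp add: n_def)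
  \<comment> \<open>The operator norm is estimated over the \<open>n\<close> basis directions and
    the integral contributes \<open>J\<close>; using \<open>J + 1\<close> in the denominator covers
    the case \<open>J = 0\<close>.\<close>
  define e' where "e' = e / (n * (J + 1))"
  have e': "e' > 0" using e J n by (simp add: e'_def)
  obtain r where r: "r > 0" "cball z0 r \<subseteq> Z" using Z open_contains_cball by blast
  have "\<exists>\<delta>>0. \<forall>z\<in>cball z0 r. dist z z0 < \<delta> \<longrightarrow> (\<forall>w\<in>K. norm (f' z w b - f' z0 w b) \<le> e')" for b
  proof -
    have "continuous_on (cball z0 r \<times> K) (\<lambda>(z, w). f' z w b)"
      by (rule continuous_on_subset[OF cf']) (use r in auto)
    then have "uniformly_continuous_on (cball z0 r \<times> K) (\<lambda>(z, w). f' z w b)"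
      by (rule compact_uniformly_continuous) (intro compact_Times compact_cball K)
    from this[unfolded uniformly_continuous_on_def, rule_format, OF e']
    obtain \<delta> where \<delta>: "\<delta> > 0" "\<forall>x\<in>cball z0 r \<times> K. \<forall>y\<in>cball z0 r \<times> K. dist y x < \<delta> \<longrightarrow>
        dist ((\<lambda>(z, w). f' z w b) y) ((\<lambda>(z, w). f' z w b) x) < e'"
      by (elim exE conjE)
    show ?thesis
    proof (intro exI[of _ \<delta>] conjI \<delta>(1) ballI impI)
      fix z w assume "z \<in> cball z0 r" "dist z z0 < \<delta>" "w \<in> K"
      then show "norm (f' z w b - f' z0 w b) \<le> e'"
        using bspec[OF bspec[OF \<delta>(2), of "(z0, w)"], of "(z, w)"] r by (simp add: dist_Pair_Pair dist_norm less_imp_le)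
    qed
  qed
  then obtain \<delta> where \<delta>: "\<And>b. \<delta> b > 0"
    "\<And>b z w. z \<in> cball z0 r \<Longrightarrow> dist z z0 < \<delta> b \<Longrightarrow> w \<in> K \<Longrightarrow> norm (f' z w b - f' z0 w b) \<le> e'"
    by metis
  define s where "s = min r (Min (\<delta> ` Basis))"
  have s: "s > 0" "s \<le> r" "\<And>b. b \<in> Basis \<Longrightarrow> s \<le> \<delta> b" using \<delta>(1) r by (auto simp: s_def min_le_iff_disj)
  have "ball z0 s \<subseteq> cball z0 r" using s(2) by (meson ball_subset_cball order_trans subset_ball)
  then have sZ: "ball z0 s \<subseteq> Z" using r(2) by (rule order_trans)
  have est: "norm (f z w - f z0 w - f' z0 w (z - z0)) \<le> norm (z - z0) * (n * e')"
    if z: "dist z z0 < s" and w: "w \<in> K" for z w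
  proof (rule differentiable_bound_linearization[where S = "ball z0 s" and f' = "\<lambda>z. f' z w"])
    show "z0 + t *\<^sub>R (z - z0) \<in> ball z0 s" if "t \<in> {0..1}" for t
    proof -
      have "dist z0 (z0 + t *\<^sub>R (z - z0)) = t * dist z z0" using that by (simp add: dist_norm)
      also have "\<dots> \<le> dist z z0" using that by (simp add: mult_left_le_one_le)
      finally show ?thesis using z by simp
    qed
    show "((\<lambda>z. f z w) has_derivative f' x w) (at x within ball z0 s)" if "x \<in> ball z0 s" for x
      by (rule has_derivative_at_withinI[OF d[OF subsetD[OF sZ that] w]])
    show "onorm (f' x w - f' z0 w) \<le> n * e'" if x: "x \<in> ball z0 s" for x
    proof (rule onorm_le)
      fix v
      have xZ: "x \<in> Z" "x \<in> cball z0 r" "dist x z0 < s"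
        using x sZ \<open>ball z0 s \<subseteq> cball z0 r\<close> by (blast, blast, simp add: dist_commute)
      define T where "T v = f' x w v - f' z0 w v" for v
      have T: "linear T" unfolding T_def using lin[OF xZ(1) w] lin[OF Z(2) w] by (rule linear_compose_sub)
      have "T v = (\<Sum>b\<in>Basis. (v \<bullet> b) *\<^sub>R T b)"
        by (subst euclidean_representation[symmetric, of v]) (simp add: linear_sum[OF T] linear_scale[OF T] o_def)
      also have "norm \<dots> \<le> (\<Sum>b\<in>(Basis::'z set). norm v * e')"
      proof (rule sum_norm_le)
        fix b :: 'z assume b: "b \<in> Basis"
        have "norm (T b) \<le> e'" unfolding T_def using \<delta>(2)[OF xZ(2) _ w, of b] xZ(3) s(3)[OF b] by linarith
        then show "norm ((v \<bullet> b) *\<^sub>R T b) \<le> norm v * e'"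
          unfolding norm_scaleR using b by (intro mult_mono) (auto simp: Basis_le_norm)
      qed
      finally show "norm ((f' x w - f' z0 w) v) \<le> n * e' * norm v" by (simp add: T_def n_def mult_ac)
    qed
    show "z0 \<in> ball z0 s" using s by simp
  qed
  show "\<exists>d>0. \<forall>y. norm (y - z0) < d \<longrightarrow> norm ((LINT w:K|lborel. k w *\<^sub>R f y w) - (LINT w:K|lborel. k w *\<^sub>R f z0 w) -
      (LINT w:K|lborel. k w *\<^sub>R f' z0 w (y - z0))) \<le> e * norm (y - z0)"
  proof (intro exI[of _ s] conjI s(1) allI impI)
    fix y assume "norm (y - z0) < s"
    then have y: "dist y z0 < s" by (simp add: dist_norm)
    then have yZ: "y \<in> Z" using sZ by (simp add: subset_iff dist_commute)
    have i: "set_integrable lborel K (\<lambda>w. k w *\<^sub>R f z w)" if "z \<in> Z" for z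
      by (rule set_integrable_continuous_mult[OF K k cf[OF that]])
    have "(LINT w:K|lborel. k w *\<^sub>R f y w) - (LINT w:K|lborel. k w *\<^sub>R f z0 w) - (LINT w:K|lborel. k w *\<^sub>R f' z0 w (y - z0))
      = (LINT w:K|lborel. k w *\<^sub>R (f y w - f z0 w - f' z0 w (y - z0)))"
      using set_integral_diff[OF set_integral_diff(1)[OF i[OF yZ] i[OF Z(2)]] i'] set_integral_diff(2)[OF i[OF yZ] i[OF Z(2)]]
      by (simp add: scaleR_diff_right)
    also have "norm \<dots> \<le> (norm (y - z0) * (n * e')) * J" unfolding J_def
      by (rule set_integral_norm_le[OF K k]) (use cf[OF yZ] cf[OF Z(2)] cf'0[OF Z(2)] est[OF y] in \<open>auto intro: continuous_intros\<close>)
    also have "\<dots> \<le> e * norm (y - z0)"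
    proof -
      have "n * e' = e / (J + 1)" using n by (simp add: e'_def)
      then have "n * e' * J = e * (J / (J + 1))" by simp
      also have "\<dots> \<le> e * 1" using J e by (intro mult_left_mono) auto
      finally have "n * e' * J \<le> e * 1" .
      from mult_right_mono[OF this norm_ge_zero[of "y - z0"]] show ?thesis by (simp add: mult_ac)
    qed
    finally show "norm ((LINT w:K|lborel. k w *\<^sub>R f y w) - (LINT w:K|lborel. k w *\<^sub>R f z0 w) -
      (LINT w:K|lborel. k w *\<^sub>R f' z0 w (y - z0))) \<le> e * norm (y - z0)" .
  qed
qed

section \<open>Convolution along a linear slice\<close>

definition slice_conv :: "('w::euclidean_space \<Rightarrow> real) \<Rightarrow> ('w \<Rightarrow> 'z::euclidean_space) \<Rightarrow> ('z \<Rightarrow> 'c::euclidean_space) \<Rightarrow> 'z \<Rightarrow> 'c" where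
  "slice_conv k L H z = (LINT w|lborel. k w *\<^sub>R H (z + L w))"

text \<open>The slices through points of \<open>X\<close> stay in \<open>X\<close>, so a function
  given on \<open>X\<close> only can be convolved. The lower bound \<open>\<delta>\<close> confines
  the relevant \<open>w\<close> to a ball when \<open>H\<close> vanishes far from the origin; the
  support of \<open>H\<close> may still reach the boundary of \<open>X\<close>.\<close>

locale slice_kernel =
  fixes k :: "'w::euclidean_space \<Rightarrow> real" and L :: "'w \<Rightarrow> 'z::euclidean_space" and \<delta> :: real and X :: "'z set"
  assumes k: "\<And>R. set_integrable lborel (cball 0 R) k"
    and L: "bounded_linear L" and \<delta>: "\<delta> > 0" "\<And>w. norm (L w) \<ge> \<delta> * norm w"
    and X: "open X" "\<And>z w. z \<in> X \<Longrightarrow> z + L w \<in> X"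
begin

lemma slice_conv_eq_set_integral:
  assumes "\<And>z. z \<in> X \<Longrightarrow> norm z > R \<Longrightarrow> H z = 0" "z \<in> X" "norm z + R \<le> \<delta> * r"
  shows "slice_conv k L H z = (LINT w:cball 0 r|lborel. k w *\<^sub>R H (z + L w))"
  unfolding slice_conv_def set_lebesgue_integral_def
proof (rule Bochner_Integration.integral_cong[OF refl])
  fix w
  show "k w *\<^sub>R H (z + L w) = indicat_real (cball 0 r) w *\<^sub>R (k w *\<^sub>R H (z + L w))"
  proof (cases "norm w \<le> r")
    case False
    then have "\<delta> * r < \<delta> * norm w" using \<delta>(1) by simp
    also have "\<dots> \<le> norm (L w)" by (rule \<delta>(2))
    also have "\<dots> \<le> norm (z + L w) + norm z" by (metis add_diff_cancel_left' norm_triangle_ineq4)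
    finally have "norm (z + L w) > R" using assms(3) by linarith
    then show ?thesis using assms(1)[OF X(2)[OF assms(2)]] by simp
  qed simp
qed

lemma slice_conv_has_derivative:
  assumes H: "smooth_on H X" "\<And>z. z \<in> X \<Longrightarrow> norm z > R \<Longrightarrow> H z = 0" and z: "z \<in> X"
  shows "(slice_conv k L H has_derivative (\<lambda>v. slice_conv k L (pd v H) z)) (at z)"
proof -
  \<comment> \<open>A radius beyond which the integrand vanishes for all base points in the unit
    ball around \<open>z\<close>.\<close>
  define r where "r = (norm z + 1 + R) / \<delta>"
  have r: "\<delta> * r = norm z + 1 + R" using \<delta>(1) by (simp add: r_def)
  define Z where "Z = X \<inter> ball z 1"
  have Z: "open Z" "z \<in> Z" using X(1) z by (auto simp: Z_def)
  have Zr: "norm y + R \<le> \<delta> * r" if "y \<in> Z" for y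
    using that norm_triangle_sub[of y z] by (auto simp: Z_def dist_norm norm_minus_commute r)
  have cL: "continuous_on A L" for A using L by (simp add: linear_continuous_on)
  have d: "((\<lambda>z. LINT w:cball 0 r|lborel. k w *\<^sub>R H (z + L w)) has_derivative
      (\<lambda>v. LINT w:cball 0 r|lborel. k w *\<^sub>R pd v H (z + L w))) (at z)"
  proof (rule has_derivative_parametric_integral[OF compact_cball k Z])
    fix y w assume y: "y \<in> Z"
    have "((\<lambda>y. y + L w) has_derivative (\<lambda>v. v)) (at y)" by (auto intro!: derivative_eq_intros)
    from diff_chain_at[OF this smooth_on_has_derivative[OF H(1) X(2)]] y
    show "((\<lambda>y. H (y + L w)) has_derivative (\<lambda>v. pd v H (y + L w))) (at y)" by (auto simp: o_def Z_def)
  next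
    fix y assume "y \<in> Z"
    then show "continuous_on (cball 0 r) (\<lambda>w. H (y + L w))"
      by (intro continuous_on_compose2[OF smooth_on_continuous_on[OF H(1)]] continuous_intros cL)
        (auto simp: Z_def intro: X(2))
  next
    fix b
    have "continuous_on (Z \<times> cball 0 r) (\<lambda>p. pd b H (fst p + L (snd p)))"
      by (intro continuous_on_compose2[OF smooth_on_continuous_on[OF smooth_on_pd[OF H(1)]]] continuous_intros
          continuous_on_compose2[OF cL[of UNIV]])
        (auto simp: Z_def intro: X(2))
    then show "continuous_on (Z \<times> cball 0 r) (\<lambda>(y, w). pd b H (y + L w))" by (simp add: split_beta)
  qed
  have pd0: "pd v H y = 0" if "y \<in> X" "norm y > R" for v y
  proof -
    have "open (X \<inter> {y. norm y > R})" by (intro open_Int X open_Collect_less continuous_intros)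
    then have "pd v H y = pd v (\<lambda>_. 0) y" by (rule pd_cong) (use that H(2) in auto)
    then show ?thesis by (simp add: pd_const)
  qed
  have e: "slice_conv k L H y = (LINT w:cball 0 r|lborel. k w *\<^sub>R H (y + L w))" if "y \<in> Z" for y
    by (rule slice_conv_eq_set_integral[OF H(2) _ Zr[OF that]]) (use that in \<open>auto simp: Z_def\<close>)
  have "(\<lambda>v. LINT w:cball 0 r|lborel. k w *\<^sub>R pd v H (z + L w)) = (\<lambda>v. slice_conv k L (pd v H) z)"
    using slice_conv_eq_set_integral[OF pd0 z Zr[OF Z(2)]] by simp
  then show ?thesis using d by (subst has_derivative_cong_open[OF Z e]) simp_all
qed

lemma pd_slice_conv:
  assumes "smooth_on H X" "\<And>z. z \<in> X \<Longrightarrow> norm z > R \<Longrightarrow> H z = 0" "z \<in> X"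
  shows "pd v (slice_conv k L H) z = slice_conv k L (pd v H) z"
  using pd_eqI[OF slice_conv_has_derivative[OF assms]] by simp

lemma pd_eq_0_outside:
  assumes "\<And>z. z \<in> X \<Longrightarrow> norm z > R \<Longrightarrow> H z = 0" "z \<in> X" "norm z > R"
  shows "pd v H z = 0"
proof -
  have "open (X \<inter> {y. norm y > R})" by (intro open_Int X open_Collect_less continuous_intros)
  then have "pd v H z = pd v (\<lambda>_. 0) z" by (rule pd_cong) (use assms in auto)
  then show ?thesis by (simp add: pd_const)
qed

lemma smooth_on_slice_conv:
  assumes "smooth_on H X" "\<And>z. z \<in> X \<Longrightarrow> norm z > R \<Longrightarrow> H z = 0"
  shows "smooth_on (slice_conv k L H) X"
proof -
  have "Ck_on n (slice_conv k L H) X" for n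
    using assms
  proof (induction n arbitrary: H)
    case 0
    then show ?case using slice_conv_has_derivative[OF 0]
      by (auto intro!: continuous_at_imp_continuous_on has_derivative_continuous)
  next
    case (Suc n)
    have "Ck_on n (slice_conv k L (pd v H)) X" for v
      by (rule Suc.IH[OF smooth_on_pd[OF Suc.prems(1)] pd_eq_0_outside[OF Suc.prems(2)]])
    then have "Ck_on n (pd v (slice_conv k L H)) X" for v
      by (rule Ck_on_eq[OF _ X(1)]) (rule pd_slice_conv[OF Suc.prems])
    then show ?case unfolding Ck_on_Suc
      using slice_conv_has_derivative[OF Suc.prems] differentiable_def by blast
  qed
  then show ?thesis by (simp add: smooth_on_def)
qed

end

lemma set_integrable_continuous_cball:
  fixes k :: "'w::euclidean_space \<Rightarrow> real"
  assumes "continuous_on UNIV k"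
  shows "set_integrable lborel (cball 0 R) k"
  unfolding set_integrable_def
  by (rule borel_integrable_compact[OF compact_cball continuous_on_subset[OF assms subset_UNIV]])

lemma integral_translation:
  fixes h :: "'a::euclidean_space \<Rightarrow> 'c::euclidean_space"
  assumes "h \<in> borel_measurable borel"
  shows "(LINT w|lborel. h (z + w)) = (LINT w|lborel. h w)"
proof -
  have "(LINT w|lborel. h w) = (LINT w|distr lborel borel ((+) z). h w)" by (simp add: lborel_distr_plus)
  also have "\<dots> = (LINT w|lborel. h (z + w))" by (rule integral_distr) (use assms in auto)
  finally show ?thesis by simp
qed

text \<open>The integral of \<open>h (z + w)\<close> over \<open>w\<close> does not depend on
  \<open>z\<close>; its derivative in \<open>z\<close>, taken under the integral sign, is the
  asserted integral.\<close>

lemma integral_pd_eq_0: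
  fixes h :: "'a::euclidean_space \<Rightarrow> 'c::euclidean_space"
  assumes h: "smooth_on h UNIV" "\<And>z. norm z > R \<Longrightarrow> h z = 0"
  shows "(LINT w|lborel. pd v h w) = 0"
proof -
  interpret slice_kernel "\<lambda>_::'a. 1" "\<lambda>w::'a. w" 1 UNIV
    by (intro slice_kernel.intro set_integrable_continuous_cball bounded_linear_ident) auto
  have m: "h \<in> borel_measurable borel"
    using smooth_on_continuous_on[OF h(1)] by (rule borel_measurable_continuous_onI)
  have "slice_conv (\<lambda>_. 1) (\<lambda>w. w) h = (\<lambda>z. LINT w|lborel. h w)"
    by (auto simp: slice_conv_def integral_translation[OF m])
  then have "slice_conv (\<lambda>_. 1) (\<lambda>w. w) (pd v h) 0 = 0"
    using pd_slice_conv[where z = 0 and v = v, OF h] by (simp add: pd_const)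
  then show ?thesis by (simp add: slice_conv_def)
qed

section \<open>The Newton kernel in four real dimensions\<close>

lemma DIM_quat: "DIM(quat) = 4"
  by (simp add: Basis_quat_def)

lemma measure_quat_cball: "r \<ge> 0 \<Longrightarrow> measure lborel (cball (0::quat) r) = unit_ball_vol 4 * r ^ 4"
proof -
  assume r: "r \<ge> 0"
  show ?thesis using content_cball[OF r, of "0::quat"] DIM_quat by simp
qed

lemma power_2_power_4: "((2::real) ^ n) ^ 4 = 16 ^ n"
proof -
  have "(16::real) ^ n = (2 ^ 4) ^ n" by simp
  then show ?thesis by (simp only: power_mult[symmetric] mult.commute[of 4 n])
qed

lemma power_2_power_2: "((2::real) ^ n)\<^sup>2 = 4 ^ n"
proof -
  have "(4::real) ^ n = (2 ^ 2) ^ n" by simp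
  then show ?thesis by (simp only: power_mult[symmetric] mult.commute[of 2 n])
qed

lemma single_le_suminf:
  fixes f :: "nat \<Rightarrow> real"
  shows "summable f \<Longrightarrow> (\<And>n. 0 \<le> f n) \<Longrightarrow> f n \<le> suminf f"
  using sum_le_suminf[of f "{n}"] by simp

lemma emeasure_quat_cball_finite: "emeasure lborel (cball (0::quat) r) < \<infinity>"
  by (rule emeasure_compact_finite) simp

text \<open>Radial functions are majorised by sums of multiples of indicators of balls with dyadic
  radii; in real dimension four the volumes of these balls are proportional to
  \<open>r n ^ 4\<close>.\<close>

lemma integrable_dyadic:
  fixes c r :: "nat \<Rightarrow> real"
  assumes c: "\<And>n. c n \<ge> 0" and r: "\<And>n. r n \<ge> 0" and s: "summable (\<lambda>n. c n * r n ^ 4)"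
    and fin: "AE w in lborel. summable (\<lambda>n. c n * indicat_real (cball (0::quat) (r n)) w)"
  shows "integrable lborel (\<lambda>w. \<Sum>n. c n * indicat_real (cball (0::quat) (r n)) w)"
proof (rule integrable_suminf)
  show i: "integrable lborel (\<lambda>w. c n * indicat_real (cball (0::quat) (r n)) w)" for n
    using emeasure_quat_cball_finite[of "r n"] by (intro integrable_mult_right integrable_real_indicator) auto
  show "AE w in lborel. summable (\<lambda>n. norm (c n * indicat_real (cball (0::quat) (r n)) w))"
    using fin c by (simp add: abs_mult)
  have "(LINT w|lborel. norm (c n * indicat_real (cball (0::quat) (r n)) w)) = unit_ball_vol 4 * (c n * r n ^ 4)" for n
    using c[of n] measure_quat_cball[OF r[of n]] by (simp add: abs_mult)
  then show "summable (\<lambda>n. LINT w|lborel. norm (c n * indicat_real (cball (0::quat) (r n)) w))"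
    using summable_mult[OF s, of "unit_ball_vol 4"] by simp
qed

text \<open>The function 1/|w|^2, a constant multiple of the fundamental solution of the Laplacian
  in dimension four.\<close>

definition newton :: "quat \<Rightarrow> real" where "newton w = inverse (w \<bullet> w)"

lemma newton_measurable: "newton \<in> borel_measurable lborel"
  unfolding newton_def[abs_def] by (simp add: borel_measurable_inner)

lemma set_integrable_newton: "set_integrable lborel (cball 0 R) newton"
proof (cases "R > 0")
  case True
  \<comment> \<open>On the shell where \<open>norm w\<close> lies between
    \<open>R / 2 ^ Suc n\<close> and \<open>R / 2 ^ n\<close> the kernel is at most
    \<open>c n\<close>.\<close>
  define c where "c n = 4 ^ Suc n / R\<^sup>2" for n :: nat
  define r where "r n = R / 2 ^ n" for n :: nat
  have ev: "\<exists>m. R / 2 ^ m < norm w" if "w \<noteq> 0" for w :: quat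
  proof -
    obtain m where "R / norm w < 2 ^ m" using real_arch_pow[of 2 "R / norm w"] by auto
    then have "R / 2 ^ m < norm w" using that True by (simp add: field_simps)
    then show ?thesis by blast
  qed
  have fin: "summable (\<lambda>n. c n * indicat_real (cball (0::quat) (r n)) w)" if w: "w \<noteq> 0" for w
  proof -
    obtain m where m: "R / 2 ^ m < norm w" using ev[OF w] by blast
    have "c n * indicat_real (cball (0::quat) (r n)) w = 0" if "n \<ge> m" for n
    proof -
      have "R / 2 ^ n \<le> R / 2 ^ m" using that True by (intro divide_left_mono power_increasing) auto
      then show ?thesis using m by (simp add: r_def)
    qed
    then show ?thesis by (intro summable_finite[of "{..<m}"]) (auto simp: not_less)
  qed
  have nz: "AE w in lborel. w \<noteq> (0::quat)" by (rule AE_lborel_singleton)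
  have int: "integrable lborel (\<lambda>w. \<Sum>n. c n * indicat_real (cball (0::quat) (r n)) w)"
  proof (rule integrable_dyadic)
    have "c n * r n ^ 4 = 4 * R\<^sup>2 * (1/4) ^ n" for n
    proof -
      have "(16::real) ^ n = 4 ^ n * 4 ^ n" by (simp flip: power_mult_distrib)
      then show ?thesis unfolding c_def r_def power_divide power_2_power_4 using True
        by (simp add: field_simps power2_eq_square power4_eq_xxxx)
    qed
    then show "summable (\<lambda>n. c n * r n ^ 4)" by (simp add: summable_mult summable_geometric)
    show "AE w in lborel. summable (\<lambda>n. c n * indicat_real (cball (0::quat) (r n)) w)"
      using nz by eventually_elim (rule fin)
  qed (use True in \<open>auto simp: c_def r_def\<close>)
  show ?thesis unfolding set_integrable_def
  proof (rule Bochner_Integration.integrable_bound[OF int])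
    show "(\<lambda>w. indicat_real (cball 0 R) w *\<^sub>R newton w) \<in> borel_measurable lborel"
      using newton_measurable borel_closed[OF closed_cball]
      by (intro borel_measurable_scaleR borel_measurable_indicator) auto
    show "AE w in lborel. norm (indicat_real (cball 0 R) w *\<^sub>R newton w) \<le>
        norm (\<Sum>n. c n * indicat_real (cball (0::quat) (r n)) w)"
      using nz
    proof eventually_elim
      fix w :: quat assume w: "w \<noteq> 0"
      have nn: "c n * indicat_real (cball (0::quat) (r n)) w \<ge> 0" for n using True by (simp add: c_def)
      show "norm (indicat_real (cball 0 R) w *\<^sub>R newton w) \<le> norm (\<Sum>n. c n * indicat_real (cball (0::quat) (r n)) w)"
      proof (cases "norm w \<le> R")
        case wR: True
        define m where "m = (LEAST m. R / 2 ^ m < norm w)"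
        have m: "R / 2 ^ m < norm w" unfolding m_def using ev[OF w] by (rule LeastI_ex)
        have "m \<noteq> 0" using m wR by (cases m) auto
        then obtain n where n: "m = Suc n" by (cases m) auto
        have "\<not> R / 2 ^ n < norm w" using not_less_Least[of n "\<lambda>m. R / 2 ^ m < norm w"] n by (simp add: m_def)
        then have i: "indicat_real (cball (0::quat) (r n)) w = 1" by (simp add: r_def)
        have "(R / 2 ^ Suc n)\<^sup>2 \<le> (norm w)\<^sup>2" using m n True by (intro power_mono) auto
        then have "R\<^sup>2 / 4 ^ Suc n \<le> w \<bullet> w"
          by (simp add: power_divide dot_square_norm power_mult_distrib flip: power_mult)
            (simp add: power_mult mult.commute[of n 2])
        then have "newton w \<le> c n" unfolding newton_def c_def using True w
          by (simp add: field_simps)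
        also have "\<dots> = c n * indicat_real (cball (0::quat) (r n)) w" using i by simp
        also have "\<dots> \<le> (\<Sum>n. c n * indicat_real (cball (0::quat) (r n)) w)"
          by (rule single_le_suminf[OF fin[OF w] nn])
        finally show ?thesis using wR by (simp add: newton_def)
      qed simp
    qed
  qed
next
  case False
  have "cball (0::quat) R \<subseteq> {0}"
  proof
    fix x :: quat assume "x \<in> cball 0 R"
    then have "norm x \<le> R" by simp
    moreover have "R \<le> 0" using False by simp
    ultimately have "norm x \<le> 0" by (rule order_trans)
    then show "x \<in> {0}" by simp
  qed
  then have eq: "(\<lambda>w. indicat_real (cball 0 R) w *\<^sub>R newton w) = (\<lambda>_. 0)"
    by (intro ext) (auto simp: indicator_def newton_def)
  show ?thesis unfolding set_integrable_def eq by simp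
qed

definition newton_reg :: "real \<Rightarrow> quat \<Rightarrow> real" where "newton_reg \<epsilon> w = inverse (w \<bullet> w + \<epsilon>\<^sup>2)"

lemma integrable_newton_reg_cube: "integrable lborel (\<lambda>w. newton_reg 1 w ^ 3)"
proof -
  \<comment> \<open>The index is shifted by one: outside the ball of radius \<open>2 ^ n\<close> the
    function is at most (1/64)^n, which is \<open>c (Suc n)\<close>.\<close>
  define c :: "nat \<Rightarrow> real" where "c n = 64 * (1/64) ^ n" for n
  define r :: "nat \<Rightarrow> real" where "r n = 2 ^ n" for n
  have sc: "summable c" unfolding c_def[abs_def] by (intro summable_mult summable_geometric) simp
  have fin: "summable (\<lambda>n. c n * indicat_real (cball (0::quat) (r n)) w)" for w
    by (rule summable_comparison_test'[OF sc, of 0]) (auto simp: c_def indicator_def)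
  have int: "integrable lborel (\<lambda>w. \<Sum>n. c n * indicat_real (cball (0::quat) (r n)) w)"
  proof (rule integrable_dyadic)
    have "c n * r n ^ 4 = 64 * (1/4) ^ n" for n
    proof -
      have "(1/64) ^ n * (16::real) ^ n = (1/4) ^ n" by (simp flip: power_mult_distrib)
      then show ?thesis unfolding c_def r_def power_2_power_4 by simp
    qed
    then show "summable (\<lambda>n. c n * r n ^ 4)" by (simp add: summable_mult summable_geometric)
    show "AE w in lborel. summable (\<lambda>n. c n * indicat_real (cball (0::quat) (r n)) w)"
      by (rule AE_I2) (rule fin)
  qed (auto simp: c_def r_def)
  show ?thesis
  proof (rule Bochner_Integration.integrable_bound[OF int])
    have "continuous_on UNIV (\<lambda>w. newton_reg 1 w ^ 3)" unfolding newton_reg_def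
      by (intro continuous_intros) (simp add: add_nonneg_eq_0_iff)
    then show "(\<lambda>w. newton_reg 1 w ^ 3) \<in> borel_measurable lborel"
      using borel_measurable_continuous_onI by auto
    show "AE w in lborel. norm (newton_reg 1 w ^ 3) \<le> norm (\<Sum>n. c n * indicat_real (cball (0::quat) (r n)) w)"
    proof (rule AE_I2)
      fix w :: quat
      have nn: "c n * indicat_real (cball (0::quat) (r n)) w \<ge> 0" for n by (simp add: c_def)
      have "\<exists>m. norm w \<le> 2 ^ m" using real_arch_pow[of 2 "norm w"] by (auto intro: less_imp_le)
      define m where "m = (LEAST m. norm w \<le> 2 ^ m)"
      have m: "norm w \<le> 2 ^ m" unfolding m_def using \<open>\<exists>m. norm w \<le> 2 ^ m\<close> by (rule LeastI_ex)
      have "newton_reg 1 w ^ 3 \<le> c m"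
      proof (cases m)
        case 0
        have "newton_reg 1 w \<le> 1" unfolding newton_reg_def by (simp add: inverse_le_1_iff)
        moreover have "newton_reg 1 w \<ge> 0" by (simp add: newton_reg_def)
        ultimately have "newton_reg 1 w ^ 3 \<le> 1" by (intro power_le_one)
        then show ?thesis by (simp add: c_def 0)
      next
        case (Suc n)
        have "\<not> norm w \<le> 2 ^ n" using not_less_Least[of n "\<lambda>m. norm w \<le> 2 ^ m"] Suc by (simp add: m_def)
        then have "(2 ^ n)\<^sup>2 \<le> (norm w)\<^sup>2" by (intro power_mono) auto
        then have "(4::real) ^ n \<le> w \<bullet> w + 1"
          unfolding power_2_power_2 by (simp add: dot_square_norm)
        then have "newton_reg 1 w \<le> inverse (4 ^ n)" unfolding newton_reg_def by (intro le_imp_inverse_le) auto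
        moreover have "newton_reg 1 w \<ge> 0" by (simp add: newton_reg_def)
        ultimately have "newton_reg 1 w ^ 3 \<le> inverse (4 ^ n) ^ 3" by (intro power_mono)
        also have "\<dots> = c m"
        proof -
          have "(64::real) ^ n = (4 ^ 3) ^ n" by simp
          then have "((4::real) ^ n) ^ 3 = 64 ^ n" by (simp only: power_mult[symmetric] mult.commute[of 3 n])
          then show ?thesis by (simp add: c_def Suc power_inverse[symmetric] power_one_over field_simps)
        qed
        finally show ?thesis .
      qed
      also have "\<dots> = c m * indicat_real (cball (0::quat) (r m)) w" using m by (simp add: r_def)
      also have "\<dots> \<le> (\<Sum>n. c n * indicat_real (cball (0::quat) (r n)) w)"
        by (rule single_le_suminf[OF fin nn])
      finally show "norm (newton_reg 1 w ^ 3) \<le> norm (\<Sum>n. c n * indicat_real (cball (0::quat) (r n)) w)"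
        by (simp add: newton_reg_def)
    qed
  qed
qed

text \<open>Up to the factor -8 this is the integral of the Laplacian of
  \<open>newton_reg \<epsilon>\<close>, which by scaling is the same for all positive
  \<epsilon>.\<close>

definition newton_const :: real where "newton_const = (LINT w|lborel. newton_reg 1 w ^ 3)"

lemma newton_const_pos: "newton_const > 0"
proof -
  have pos: "newton_reg 1 w ^ 3 > 0" for w by (simp add: newton_reg_def add_nonneg_pos)
  have "newton_const \<noteq> 0"
  proof
    assume "newton_const = 0"
    then have "AE w in lborel. newton_reg 1 w ^ 3 = 0"
      unfolding newton_const_def using pos
      by (subst (asm) integral_nonneg_eq_0_iff_AE[OF integrable_newton_reg_cube]) (auto intro: less_imp_le)
    then have "AE w in (lborel :: quat measure). False"
      using pos by (simp add: less_imp_neq[THEN not_sym])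
    then have "emeasure lborel (UNIV :: quat set) = 0" by (simp add: AE_iff_measurable[of UNIV])
    then show False by simp
  qed
  moreover have "newton_const \<ge> 0" unfolding newton_const_def by (intro integral_nonneg_AE AE_I2 less_imp_le[OF pos])
  ultimately show ?thesis by simp
qed

definition laplace :: "('a::euclidean_space \<Rightarrow> 'c::euclidean_space) \<Rightarrow> 'a \<Rightarrow> 'c" where
  "laplace F z = (\<Sum>b\<in>Basis. pd b (pd b F) z)"

lemma smooth_on_laplace: "open U \<Longrightarrow> smooth_on F U \<Longrightarrow> smooth_on (laplace F) U"
  unfolding laplace_def[abs_def] by (intro smooth_on_sum smooth_on_pd)

text \<open>Dimension four is decisive: the two terms of the Laplacian have the coefficients -2 * 4
  and 8, and all that survives their cancellation carries the factor
  \<open>\<epsilon>\<^sup>2\<close>.\<close>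

lemma newton_reg_derivatives:
  assumes "\<epsilon> \<noteq> 0"
  shows "smooth_on (newton_reg \<epsilon>) UNIV" "laplace (newton_reg \<epsilon>) w = - 8 * \<epsilon>\<^sup>2 * newton_reg \<epsilon> w ^ 3"
proof -
  have nz: "w \<bullet> w + \<epsilon>\<^sup>2 \<noteq> 0" for w :: quat using assms by (simp add: add_nonneg_eq_0_iff)
  show s: "smooth_on (newton_reg \<epsilon>) UNIV" unfolding newton_reg_def[abs_def]
    by (intro smooth_on_inverse smooth_on_add smooth_on_inner smooth_on_ident smooth_on_const open_UNIV nz)
  have 1: "(newton_reg \<epsilon> has_derivative (\<lambda>v. - 2 * (w \<bullet> v) * newton_reg \<epsilon> w ^ 2)) (at w)" for w
    unfolding newton_reg_def[abs_def] using nz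
    by (auto intro!: derivative_eq_intros simp: inner_commute power2_eq_square fun_eq_iff field_simps)
  have p1: "pd v (newton_reg \<epsilon>) = (\<lambda>w. - 2 * (w \<bullet> v) * newton_reg \<epsilon> w ^ 2)" for v using pd_eqI[OF 1] by blast
  have 2: "pd v (pd v (newton_reg \<epsilon>)) w = - 2 * (v \<bullet> v) * newton_reg \<epsilon> w ^ 2 + 8 * (w \<bullet> v)\<^sup>2 * newton_reg \<epsilon> w ^ 3" for v
  proof -
    have "((\<lambda>w. - 2 * (w \<bullet> v) * newton_reg \<epsilon> w ^ 2) has_derivative
       (\<lambda>u. - 2 * (u \<bullet> v) * newton_reg \<epsilon> w ^ 2 + (- 2 * (w \<bullet> v)) * (2 * newton_reg \<epsilon> w * (- 2 * (w \<bullet> u) * newton_reg \<epsilon> w ^ 2)))) (at w)"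
      by (auto intro!: derivative_eq_intros 1 simp: fun_eq_iff)
    from pd_eqI[OF this, of v] show ?thesis unfolding p1 by (simp add: power2_eq_square power3_eq_cube algebra_simps)
  qed
  have "laplace (newton_reg \<epsilon>) w = (\<Sum>b\<in>Basis. - 2 * newton_reg \<epsilon> w ^ 2 + 8 * newton_reg \<epsilon> w ^ 3 * (w \<bullet> b)\<^sup>2)"
    unfolding laplace_def 2 by (intro sum.cong refl) (simp add: inner_Basis)
  also have "\<dots> = - 8 * newton_reg \<epsilon> w ^ 2 + 8 * newton_reg \<epsilon> w ^ 3 * (\<Sum>b\<in>Basis. (w \<bullet> b)\<^sup>2)"
    using DIM_quat by (simp add: sum.distrib sum_subtractf sum_distrib_left)
  also have "(\<Sum>b\<in>Basis. (w \<bullet> b)\<^sup>2) = w \<bullet> w"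
    by (simp add: euclidean_inner[of w w] power2_eq_square)
  also have "- 8 * newton_reg \<epsilon> w ^ 2 + 8 * newton_reg \<epsilon> w ^ 3 * (w \<bullet> w) = - 8 * \<epsilon>\<^sup>2 * newton_reg \<epsilon> w ^ 3"
  proof -
    have "newton_reg \<epsilon> w * (w \<bullet> w + \<epsilon>\<^sup>2) = 1" using nz by (simp add: newton_reg_def)
    then have "newton_reg \<epsilon> w ^ 2 = newton_reg \<epsilon> w ^ 3 * (w \<bullet> w + \<epsilon>\<^sup>2)" by (simp add: power3_eq_cube power2_eq_square)
    then show ?thesis by (simp add: algebra_simps)
  qed
  finally show "laplace (newton_reg \<epsilon>) w = - 8 * \<epsilon>\<^sup>2 * newton_reg \<epsilon> w ^ 3" .
qed

lemma pd_eq_0_outside_ball: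
  assumes "\<And>z. norm z > R \<Longrightarrow> h z = 0" "norm z > R"
  shows "pd v h z = 0"
proof -
  have "open {y. norm y > R}" by (intro open_Collect_less continuous_intros)
  then have "pd v h z = pd v (\<lambda>_. 0) z" by (rule pd_cong) (use assms in auto)
  then show ?thesis by (simp add: pd_const)
qed

lemma laplace_eq_0_outside_ball:
  assumes "\<And>z. norm z > R \<Longrightarrow> h z = 0" "norm z > R"
  shows "laplace h z = 0"
proof -
  have "pd b h z = 0" if "norm z > R" for b z by (rule pd_eq_0_outside_ball[OF assms(1) that])
  then have "pd b (pd b h) z = 0" for b by (rule pd_eq_0_outside_ball[OF _ assms(2)])
  then show ?thesis by (simp add: laplace_def)
qed

lemma integrable_compact_support:
  fixes h :: "'a::euclidean_space \<Rightarrow> 'c::euclidean_space"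
  assumes "continuous_on UNIV h" "\<And>z. norm z > R \<Longrightarrow> h z = 0"
  shows "integrable lborel h"
proof -
  have "integrable lborel (\<lambda>w. indicat_real (cball 0 R) w *\<^sub>R h w)"
    by (rule borel_integrable_compact[OF compact_cball continuous_on_subset[OF assms(1) subset_UNIV]])
  moreover have "(\<lambda>w. indicat_real (cball 0 R) w *\<^sub>R h w) = h"
    using assms(2) by (auto simp: indicator_def fun_eq_iff)
  ultimately show ?thesis by simp
qed

lemma green_identity:
  fixes g :: "'a::euclidean_space \<Rightarrow> real" and \<phi> :: "'a \<Rightarrow> 'c::euclidean_space"
  assumes g: "smooth_on g UNIV" and \<phi>: "smooth_on \<phi> UNIV" "\<And>z. norm z > R \<Longrightarrow> \<phi> z = 0"
  shows "(LINT w|lborel. g w *\<^sub>R laplace \<phi> w) = (LINT w|lborel. laplace g w *\<^sub>R \<phi> w)"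
proof -
  define V where "V b w = g w *\<^sub>R pd b \<phi> w - pd b g w *\<^sub>R \<phi> w" for b w
  have sV: "smooth_on (V b) UNIV" for b unfolding V_def[abs_def]
    by (intro smooth_on_diff smooth_on_scaleR smooth_on_pd g \<phi> open_UNIV)
  have V0: "V b z = 0" if "norm z > R" for b z
    using pd_eq_0_outside_ball[OF \<phi>(2) that] \<phi>(2)[OF that] by (simp add: V_def)
  have pV: "pd b (V b) w = g w *\<^sub>R pd b (pd b \<phi>) w - pd b (pd b g) w *\<^sub>R \<phi> w" for b w
  proof -
    have d: "h differentiable at w" if "smooth_on h UNIV" for h :: "'a \<Rightarrow> 'e::euclidean_space"
      using smooth_on_differentiable[OF that] by simp
    have "pd b (V b) w = pd b (\<lambda>w. g w *\<^sub>R pd b \<phi> w) w - pd b (\<lambda>w. pd b g w *\<^sub>R \<phi> w) w"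
      unfolding V_def[abs_def] by (intro pd_diff d smooth_on_scaleR smooth_on_pd g \<phi> open_UNIV)
    then show ?thesis
      by (simp add: pd_scaleR[OF d[OF g] d[OF smooth_on_pd[OF \<phi>(1)]]] pd_scaleR[OF d[OF smooth_on_pd[OF g]] d[OF \<phi>(1)]])
  qed
  have "(LINT w|lborel. (\<Sum>b\<in>Basis. pd b (V b) w)) = (\<Sum>b\<in>Basis. LINT w|lborel. pd b (V b) w)"
    by (rule Bochner_Integration.integral_sum)
      (rule integrable_compact_support[OF smooth_on_continuous_on[OF smooth_on_pd[OF sV]] pd_eq_0_outside_ball[OF V0]])
  then have "(LINT w|lborel. (\<Sum>b\<in>Basis. pd b (V b) w)) = 0" using integral_pd_eq_0[OF sV V0] by simp
  moreover have "(\<Sum>b\<in>Basis. pd b (V b) w) = g w *\<^sub>R laplace \<phi> w - laplace g w *\<^sub>R \<phi> w" for w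
    by (simp add: pV laplace_def sum_subtractf scaleR_sum_right scaleR_sum_left)
  moreover have "integrable lborel (\<lambda>w. g w *\<^sub>R laplace \<phi> w)"
  proof (rule integrable_compact_support)
    show "continuous_on UNIV (\<lambda>w. g w *\<^sub>R laplace \<phi> w)"
      by (rule smooth_on_continuous_on) (intro smooth_on_scaleR smooth_on_laplace g \<phi> open_UNIV)
    show "g z *\<^sub>R laplace \<phi> z = 0" if "norm z > R" for z
      using laplace_eq_0_outside_ball[OF \<phi>(2) that] by simp
  qed
  moreover have "integrable lborel (\<lambda>w. laplace g w *\<^sub>R \<phi> w)"
  proof (rule integrable_compact_support[where R = R])
    show "continuous_on UNIV (\<lambda>w. laplace g w *\<^sub>R \<phi> w)"
      by (rule smooth_on_continuous_on) (intro smooth_on_scaleR smooth_on_laplace g \<phi> open_UNIV)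
  qed (use \<phi>(2) in simp)
  ultimately show ?thesis by simp
qed

lemma integral_scaling_quat:
  fixes h :: "quat \<Rightarrow> 'c::euclidean_space"
  assumes "\<epsilon> > 0"
  shows "(LINT w|lborel. h w) = \<epsilon> ^ 4 *\<^sub>R (LINT w|lborel. h (\<epsilon> *\<^sub>R w))"
proof -
  show ?thesis
  proof (cases "h \<in> borel_measurable borel")
    case True
    have "(LINT w|lborel. h w) = (LINT w|density (distr lborel borel (\<lambda>x. 0 + \<epsilon> *\<^sub>R x)) (\<lambda>_. ennreal (\<bar>\<epsilon>\<bar> ^ DIM(quat))). h w)"
      using lborel_affine[of \<epsilon> "0::quat"] assms by simp
    also have "\<dots> = (LINT w|distr lborel borel (\<lambda>x. 0 + \<epsilon> *\<^sub>R x). (\<bar>\<epsilon>\<bar> ^ DIM(quat)) *\<^sub>R h w)"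
      by (rule integral_density) (use True assms in auto)
    also have "\<dots> = (LINT w|lborel. (\<bar>\<epsilon>\<bar> ^ DIM(quat)) *\<^sub>R h (0 + \<epsilon> *\<^sub>R w))"
      by (rule integral_distr) (use True in auto)
    finally show ?thesis using assms by (simp add: DIM_quat)
  next
    \<comment> \<open>For a non-measurable \<open>h\<close> both integrals have the default value
      0.\<close>
    case False
    have "(\<lambda>w. h (\<epsilon> *\<^sub>R w)) \<notin> borel_measurable borel"
    proof
      assume "(\<lambda>w. h (\<epsilon> *\<^sub>R w)) \<in> borel_measurable borel"
      then have "(\<lambda>w. h (\<epsilon> *\<^sub>R (inverse \<epsilon> *\<^sub>R w))) \<in> borel_measurable borel"
        by (rule measurable_compose[rotated]) (intro borel_measurable_continuous_onI continuous_intros)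
      then show False using False assms by simp
    qed
    then show ?thesis using False
      by (metis borel_measurable_integrable measurable_lborel2 not_integrable_integral_eq scaleR_zero_right)
  qed
qed

text \<open>The Laplacian of the regularised kernel is -8 times an approximate identity of mass
  \<open>newton_const\<close>. Green's identity moves the Laplacian from \<open>\<phi>\<close> to
  the smooth kernel, rescaling concentrates the integral at the origin, and dominated convergence
  justifies the limit on both sides.\<close>

lemma newton_potential:
  fixes \<phi> :: "quat \<Rightarrow> 'c::euclidean_space"
  assumes \<phi>: "smooth_on \<phi> UNIV" "\<And>z. norm z > R \<Longrightarrow> \<phi> z = 0"
  shows "(LINT w|lborel. newton w *\<^sub>R laplace \<phi> w) = (- 8 * newton_const) *\<^sub>R \<phi> 0"
proof -
  define e where "e n = inverse (real (Suc n))" for n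
  have e: "e n > 0" for n by (simp add: e_def)
  have e0: "e \<longlonglongrightarrow> 0" unfolding e_def[abs_def] by (rule LIMSEQ_inverse_real_of_nat)
  have c\<phi>: "continuous_on UNIV \<phi>" by (rule smooth_on_continuous_on[OF \<phi>(1)])
  have cl: "continuous_on UNIV (laplace \<phi>)"
    by (rule smooth_on_continuous_on[OF smooth_on_laplace[OF open_UNIV \<phi>(1)]])
  have l0: "laplace \<phi> z = 0" if "norm z > R" for z
    by (rule laplace_eq_0_outside_ball[OF \<phi>(2) that])
  have eq: "(LINT w|lborel. newton_reg (e n) w *\<^sub>R laplace \<phi> w) = - 8 *\<^sub>R (LINT w|lborel. newton_reg 1 w ^ 3 *\<^sub>R \<phi> (e n *\<^sub>R w))" for n
  proof -
    have en: "e n \<noteq> 0" using e[of n] by simp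
    have "(LINT w|lborel. newton_reg (e n) w *\<^sub>R laplace \<phi> w) = (LINT w|lborel. (- 8 * (e n)\<^sup>2 * newton_reg (e n) w ^ 3) *\<^sub>R \<phi> w)"
      using green_identity[OF newton_reg_derivatives(1)[OF en] \<phi>] newton_reg_derivatives(2)[OF en] by simp
    also have "\<dots> = (e n) ^ 4 *\<^sub>R (LINT w|lborel. (- 8 * (e n)\<^sup>2 * newton_reg (e n) (e n *\<^sub>R w) ^ 3) *\<^sub>R \<phi> (e n *\<^sub>R w))"
      by (rule integral_scaling_quat[OF e])
    also have "\<dots> = (LINT w|lborel. (e n) ^ 4 *\<^sub>R ((- 8 * (e n)\<^sup>2 * newton_reg (e n) (e n *\<^sub>R w) ^ 3) *\<^sub>R \<phi> (e n *\<^sub>R w)))"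
      by (simp only: integral_scaleR_right)
    also have "\<dots> = (LINT w|lborel. - 8 *\<^sub>R (newton_reg 1 w ^ 3 *\<^sub>R \<phi> (e n *\<^sub>R w)))"
    proof (rule Bochner_Integration.integral_cong[OF refl])
      fix w :: quat
      have "newton_reg (e n) (e n *\<^sub>R w) = inverse ((e n)\<^sup>2 * (w \<bullet> w + 1))"
        by (simp add: newton_reg_def power2_eq_square algebra_simps)
      then have "newton_reg (e n) (e n *\<^sub>R w) = inverse ((e n)\<^sup>2) * newton_reg 1 w" by (simp add: newton_reg_def)
      then have n1: "newton_reg 1 w = (e n)\<^sup>2 * newton_reg (e n) (e n *\<^sub>R w)" using en by simp
      have "(e n) ^ 4 * ((e n)\<^sup>2 * newton_reg (e n) (e n *\<^sub>R w) ^ 3) = newton_reg 1 w ^ 3"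
        unfolding n1 by (simp add: power_mult_distrib power2_eq_square power3_eq_cube power4_eq_xxxx)
      then show "(e n) ^ 4 *\<^sub>R ((- 8 * (e n)\<^sup>2 * newton_reg (e n) (e n *\<^sub>R w) ^ 3) *\<^sub>R \<phi> (e n *\<^sub>R w)) =
          - 8 *\<^sub>R (newton_reg 1 w ^ 3 *\<^sub>R \<phi> (e n *\<^sub>R w))"
        by (simp add: mult_ac)
    qed
    also have "\<dots> = - 8 *\<^sub>R (LINT w|lborel. newton_reg 1 w ^ 3 *\<^sub>R \<phi> (e n *\<^sub>R w))" by (simp only: integral_scaleR_right)
    finally show ?thesis .
  qed
  have lim1: "(\<lambda>n. LINT w|lborel. newton_reg (e n) w *\<^sub>R laplace \<phi> w) \<longlonglongrightarrow> (LINT w|lborel. newton w *\<^sub>R laplace \<phi> w)"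
  proof (rule integral_dominated_convergence[where w = "\<lambda>w. norm (indicat_real (cball 0 R) w *\<^sub>R (newton w *\<^sub>R laplace \<phi> w))"])
    show "(\<lambda>w. newton w *\<^sub>R laplace \<phi> w) \<in> borel_measurable lborel"
      using newton_measurable borel_measurable_continuous_onI[OF cl] by (intro borel_measurable_scaleR) auto
    show "(\<lambda>w. newton_reg (e n) w *\<^sub>R laplace \<phi> w) \<in> borel_measurable lborel" for n
      using borel_measurable_continuous_onI[OF cl] e[of n]
        borel_measurable_continuous_onI[OF smooth_on_continuous_on[OF newton_reg_derivatives(1), of "e n"]]
      by (intro borel_measurable_scaleR) auto
    show "integrable lborel (\<lambda>w. norm (indicat_real (cball 0 R) w *\<^sub>R (newton w *\<^sub>R laplace \<phi> w)))"
      by (rule integrable_norm[OF set_integrable_continuous_mult[OF compact_cball set_integrable_newton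
          continuous_on_subset[OF cl subset_UNIV], unfolded set_integrable_def]])
    have nz: "AE w in lborel. w \<noteq> (0::quat)" by (rule AE_lborel_singleton)
    show "AE w in lborel. (\<lambda>n. newton_reg (e n) w *\<^sub>R laplace \<phi> w) \<longlonglongrightarrow> newton w *\<^sub>R laplace \<phi> w"
      using nz
    proof eventually_elim
      fix w :: quat assume w: "w \<noteq> 0"
      have "(\<lambda>n. inverse (w \<bullet> w + (e n)\<^sup>2)) \<longlonglongrightarrow> inverse (w \<bullet> w + 0\<^sup>2)"
        using w by (intro tendsto_intros e0) auto
      then show "(\<lambda>n. newton_reg (e n) w *\<^sub>R laplace \<phi> w) \<longlonglongrightarrow> newton w *\<^sub>R laplace \<phi> w"
        by (intro tendsto_scaleR tendsto_const) (simp add: newton_def newton_reg_def)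
    qed
    show "AE w in lborel. norm (newton_reg (e n) w *\<^sub>R laplace \<phi> w) \<le>
        norm (indicat_real (cball 0 R) w *\<^sub>R (newton w *\<^sub>R laplace \<phi> w))" for n
      using nz
    proof eventually_elim
      fix w :: quat assume w: "w \<noteq> 0"
      show "norm (newton_reg (e n) w *\<^sub>R laplace \<phi> w) \<le> norm (indicat_real (cball 0 R) w *\<^sub>R (newton w *\<^sub>R laplace \<phi> w))"
      proof (cases "norm w \<le> R")
        case True
        have "newton_reg (e n) w \<le> newton w" unfolding newton_reg_def newton_def
          using w by (intro le_imp_inverse_le) auto
        moreover have "newton_reg (e n) w \<ge> 0" by (simp add: newton_reg_def)
        ultimately show ?thesis using True by (simp add: mult_right_mono)
      qed (simp add: l0)
    qed
  qed
  have "bounded (\<phi> ` cball 0 R)"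
    by (rule compact_imp_bounded[OF compact_continuous_image[OF continuous_on_subset[OF c\<phi> subset_UNIV] compact_cball]])
  then obtain B where B: "\<forall>w\<in>cball 0 R. norm (\<phi> w) \<le> B" unfolding bounded_iff by blast
  have B': "norm (\<phi> w) \<le> \<bar>B\<bar>" for w using B \<phi>(2)[of w] by (cases "norm w \<le> R") force+
  have lim2: "(\<lambda>n. LINT w|lborel. newton_reg 1 w ^ 3 *\<^sub>R \<phi> (e n *\<^sub>R w)) \<longlonglongrightarrow> (LINT w|lborel. newton_reg 1 w ^ 3 *\<^sub>R \<phi> 0)"
  proof (rule integral_dominated_convergence[where w = "\<lambda>w. newton_reg 1 w ^ 3 * \<bar>B\<bar>"])
    have m: "(\<lambda>w. newton_reg 1 w ^ 3) \<in> borel_measurable lborel"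
      by (rule borel_measurable_integrable[OF integrable_newton_reg_cube])
    show "(\<lambda>w. newton_reg 1 w ^ 3 *\<^sub>R \<phi> 0) \<in> borel_measurable lborel" using m by (intro borel_measurable_scaleR) auto
    have "continuous_on UNIV (\<lambda>w. \<phi> (e n *\<^sub>R w))" for n
      by (intro continuous_on_compose2[OF c\<phi>] continuous_intros) auto
    then show "(\<lambda>w. newton_reg 1 w ^ 3 *\<^sub>R \<phi> (e n *\<^sub>R w)) \<in> borel_measurable lborel" for n
      using m borel_measurable_continuous_onI by (intro borel_measurable_scaleR) auto
    show "integrable lborel (\<lambda>w. newton_reg 1 w ^ 3 * \<bar>B\<bar>)" using integrable_newton_reg_cube by simp
    show "AE w in lborel. (\<lambda>n. newton_reg 1 w ^ 3 *\<^sub>R \<phi> (e n *\<^sub>R w)) \<longlonglongrightarrow> newton_reg 1 w ^ 3 *\<^sub>R \<phi> 0"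
    proof (rule AE_I2)
      fix w :: quat
      have "(\<lambda>n. e n *\<^sub>R w) \<longlonglongrightarrow> 0 *\<^sub>R w" by (intro tendsto_scaleR e0 tendsto_const)
      then have "(\<lambda>n. \<phi> (e n *\<^sub>R w)) \<longlonglongrightarrow> \<phi> 0"
        using continuous_on_tendsto_compose[OF c\<phi>, of "\<lambda>n. e n *\<^sub>R w" 0] by simp
      then show "(\<lambda>n. newton_reg 1 w ^ 3 *\<^sub>R \<phi> (e n *\<^sub>R w)) \<longlonglongrightarrow> newton_reg 1 w ^ 3 *\<^sub>R \<phi> 0"
        by (intro tendsto_scaleR tendsto_const)
    qed
    show "AE w in lborel. norm (newton_reg 1 w ^ 3 *\<^sub>R \<phi> (e n *\<^sub>R w)) \<le> newton_reg 1 w ^ 3 * \<bar>B\<bar>" for n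
      using B' by (intro AE_I2) (simp add: newton_reg_def mult_left_mono)
  qed
  have "(LINT w|lborel. newton_reg 1 w ^ 3 *\<^sub>R \<phi> 0) = newton_const *\<^sub>R \<phi> 0"
    unfolding newton_const_def by (rule integral_scaleR_left) (simp add: integrable_newton_reg_cube)
  then have "(\<lambda>n. LINT w|lborel. newton_reg (e n) w *\<^sub>R laplace \<phi> w) \<longlonglongrightarrow> - 8 *\<^sub>R (newton_const *\<^sub>R \<phi> 0)"
    unfolding eq using lim2 by (intro tendsto_scaleR tendsto_const) simp
  from LIMSEQ_unique[OF lim1 this] show ?thesis by simp
qed

section \<open>Unique continuation of harmonic functions\<close>

text \<open>The radial derivative centred at \<open>p\<close>. Being a sum over a basis, it is
  visibly smooth together with \<open>F\<close>.\<close>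

definition euler :: "'a::euclidean_space \<Rightarrow> ('a \<Rightarrow> 'c::euclidean_space) \<Rightarrow> 'a \<Rightarrow> 'c" where
  "euler p F y = (\<Sum>b\<in>Basis. ((y - p) \<bullet> b) *\<^sub>R pd b F y)"

lemma euler_eq_pd: "F differentiable (at y) \<Longrightarrow> euler p F y = pd (y - p) F y"
  unfolding euler_def using pd_expand[of F y "y - p"] by simp

lemma smooth_on_euler: "open U \<Longrightarrow> smooth_on F U \<Longrightarrow> smooth_on (euler p F) U"
  unfolding euler_def[abs_def]
  by (intro smooth_on_sum smooth_on_scaleR smooth_on_inner smooth_on_diff smooth_on_ident smooth_on_const smooth_on_pd)

lemma pd_euler:
  assumes U: "open U" "y \<in> U" and F: "smooth_on F U" and b: "b \<in> Basis"
  shows "pd b (euler p F) y = pd b F y + euler p (pd b F) y"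
proof -
  have d: "pd c F differentiable at y" for c using smooth_on_differentiable[OF smooth_on_pd[OF F] U(2)] .
  have dl: "(\<lambda>y. (y - p) \<bullet> c) differentiable at y" for c
    by (rule smooth_on_differentiable[of _ UNIV])
      (intro smooth_on_inner smooth_on_diff smooth_on_ident smooth_on_const open_UNIV, simp)
  have pl: "pd b (\<lambda>y. (y - p) \<bullet> c) y = b \<bullet> c" for c
    by (rule pd_eqI) (auto intro!: derivative_eq_intros)
  have "pd b (euler p F) y = (\<Sum>c\<in>Basis. pd b (\<lambda>y. ((y - p) \<bullet> c) *\<^sub>R pd c F y) y)"
    unfolding euler_def[abs_def]
    by (rule pd_sum) (rule smooth_on_differentiable[OF _ U(2)], intro smooth_on_scaleR smooth_on_inner smooth_on_diff smooth_on_ident smooth_on_const smooth_on_pd U F)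
  also have "\<dots> = (\<Sum>c\<in>Basis. ((y - p) \<bullet> c) *\<^sub>R pd b (pd c F) y + (b \<bullet> c) *\<^sub>R pd c F y)"
    by (simp add: pd_scaleR[OF dl d] pl)
  also have "\<dots> = (\<Sum>c\<in>Basis. ((y - p) \<bullet> c) *\<^sub>R pd c (pd b F) y) + (\<Sum>c\<in>Basis. (b \<bullet> c) *\<^sub>R pd c F y)"
    using pd_symmetric[OF U F, of b] by (simp add: sum.distrib)
  also have "(\<Sum>c\<in>Basis. (b \<bullet> c) *\<^sub>R pd c F y) = pd b F y"
    using pd_expand[OF smooth_on_differentiable[OF F U(2)], of b] by simp
  finally show ?thesis by (simp add: euler_def[abs_def] add.commute)
qed

text \<open>The commutator of the Laplacian with the Euler operator is twice the Laplacian, so the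
  radial derivative of a harmonic function is harmonic.\<close>

lemma laplace_euler:
  assumes U: "open U" "y \<in> U" and F: "smooth_on F U" and h: "\<And>y. y \<in> U \<Longrightarrow> laplace F y = 0"
  shows "laplace (euler p F) y = 0"
proof -
  have 1: "pd b (pd b (euler p F)) y = 2 *\<^sub>R pd b (pd b F) y + euler p (pd b (pd b F)) y" if b: "b \<in> Basis" for b
  proof -
    have "pd b (pd b (euler p F)) y = pd b (\<lambda>y. pd b F y + euler p (pd b F) y) y"
      by (rule pd_cong[OF U pd_euler[OF U(1) _ F b]])
    also have "\<dots> = pd b (pd b F) y + pd b (euler p (pd b F)) y"
      by (intro pd_add smooth_on_differentiable[OF _ U(2)] smooth_on_pd smooth_on_euler U F)
    also have "pd b (euler p (pd b F)) y = pd b (pd b F) y + euler p (pd b (pd b F)) y"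
      by (rule pd_euler[OF U smooth_on_pd[OF F] b])
    finally show ?thesis by (simp add: scaleR_2)
  qed
  have "laplace (euler p F) y = 2 *\<^sub>R laplace F y + (\<Sum>b\<in>Basis. euler p (pd b (pd b F)) y)"
    unfolding laplace_def by (simp add: 1 sum.distrib scaleR_sum_right)
  also have "(\<Sum>b\<in>Basis. euler p (pd b (pd b F)) y) = (\<Sum>c\<in>Basis. ((y - p) \<bullet> c) *\<^sub>R (\<Sum>b\<in>Basis. pd c (pd b (pd b F)) y))"
    unfolding euler_def by (subst sum.swap) (simp add: scaleR_sum_right)
  also have "\<dots> = (\<Sum>c\<in>Basis. ((y - p) \<bullet> c) *\<^sub>R pd c (laplace F) y)"
    unfolding laplace_def[abs_def]
    by (intro sum.cong refl arg_cong2[of _ _ _ _ scaleR] pd_sum[symmetric] smooth_on_differentiable[OF _ U(2)] smooth_on_pd F)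
  also have "\<dots> = 0"
  proof -
    have "pd c (laplace F) y = pd c (\<lambda>_. 0) y" for c by (rule pd_cong[OF U h])
    then show ?thesis by (simp add: pd_const)
  qed
  finally show ?thesis using h[OF U(2)] by simp
qed

text \<open>\<open>wt\<close> and \<open>wt_int\<close> are tied together by
  \<open>pd_wt_int\<close>: the gradient of \<open>wt_int\<close> at \<open>x\<close> is
  \<open>- 2 * wt x\<close> times \<open>x\<close>. Both vanish to infinite order at the unit
  sphere, so integration by parts leaves no boundary term.\<close>

definition wt :: "'a::euclidean_space \<Rightarrow> real" where "wt x = expinv 2 (1 - x \<bullet> x)"
definition wt_int :: "'a::euclidean_space \<Rightarrow> real" where "wt_int x = expinv 0 (1 - x \<bullet> x)"

lemma smooth_on_wt: "smooth_on wt UNIV" "smooth_on wt_int UNIV"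
  unfolding wt_def[abs_def] wt_int_def[abs_def]
  by (rule smooth_on_compose[OF smooth_on_expinv];
      intro smooth_on_diff smooth_on_inner smooth_on_const smooth_on_ident open_UNIV subset_UNIV)+

lemma wt_nonneg: "wt x \<ge> 0" and wt_pos: "norm x < 1 \<Longrightarrow> wt x > 0"
proof -
  show "wt x \<ge> 0" by (auto simp: wt_def expinv_def)
  assume "norm x < 1"
  then have "(norm x)\<^sup>2 < 1" by (simp add: power_less_one_iff)
  then show "wt x > 0" by (simp add: wt_def expinv_def dot_square_norm)
qed

lemma wt_int_eq_0: "norm x \<ge> 1 \<Longrightarrow> wt_int x = 0"
proof -
  assume "norm x \<ge> 1"
  then have "1 \<le> (norm x)\<^sup>2" by simp
  then show ?thesis by (simp add: wt_int_def expinv_def dot_square_norm)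
qed

lemma pd_wt_int: "pd b wt_int x = - 2 * (x \<bullet> b) * wt x"
proof -
  have "((\<lambda>x. 1 - x \<bullet> x) has_derivative (\<lambda>v. - 2 * (x \<bullet> v))) (at x)"
    by (auto intro!: derivative_eq_intros simp: inner_commute fun_eq_iff)
  from diff_chain_at[OF this expinv_has_derivative[of 0]]
  have "(wt_int has_derivative (\<lambda>v. - 2 * (x \<bullet> v) * expinv 2 (1 - x \<bullet> x))) (at x)"
    by (simp add: o_def wt_int_def[abs_def] numeral_2_eq_2)
  from pd_eqI[OF this] show ?thesis by (simp add: wt_def)
qed

text \<open>A weighted scalar product of functions on the ball of radius \<open>s\<close> around
  \<open>p\<close>, pulled back to the unit ball so that \<open>s\<close> enters only through the
  integrand.\<close>

definition wprod :: "'a::euclidean_space \<Rightarrow> ('a \<Rightarrow> 'c::euclidean_space) \<Rightarrow> ('a \<Rightarrow> 'c) \<Rightarrow> real \<Rightarrow> real" where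
  "wprod p f g s = (LINT x:cball 0 1|lborel. wt x *\<^sub>R (f (p + s *\<^sub>R x) \<bullet> g (p + s *\<^sub>R x)))"

section \<open>Radial growth of harmonic functions in the weighted norm\<close>

context
  fixes p :: "'a::euclidean_space" and R :: real
begin

lemma in_ball: "0 < s \<Longrightarrow> s < R \<Longrightarrow> norm x \<le> 1 \<Longrightarrow> p + s *\<^sub>R x \<in> ball p R"
proof -
  assume "0 < s" "s < R" "norm x \<le> 1"
  then have "s * norm x \<le> s * 1" by (intro mult_left_mono) auto
  then have "s * norm x < R" using \<open>s < R\<close> by linarith
  then show ?thesis using \<open>0 < s\<close> by (simp add: dist_norm)
qed

lemma wt_integrable: "set_integrable lborel (cball 0 1) wt"
  by (rule set_integrable_continuous_cball[OF smooth_on_continuous_on[OF smooth_on_wt(1)]])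

lemma wprod_integrable:
  assumes f: "continuous_on (ball p R) f" and g: "continuous_on (ball p R) g" and s: "0 < s" "s < R"
  shows "set_integrable lborel (cball 0 1) (\<lambda>x. wt x *\<^sub>R (f (p + s *\<^sub>R x) \<bullet> g (p + s *\<^sub>R x)))"
  by (rule set_integrable_continuous_mult[OF compact_cball wt_integrable])
    (intro continuous_on_inner continuous_on_compose2[OF f] continuous_on_compose2[OF g] continuous_intros;
      use in_ball[OF s] in auto)

lemma wprod_commute: "wprod p f g s = wprod p g f s"
  by (simp add: wprod_def inner_commute)

text \<open>Applied to \<open>h (p + s *\<^sub>R x)\<close>, the operator s d/ds is the Euler
  operator.\<close>

lemma wprod_has_derivative:
  assumes f: "smooth_on f (ball p R)" and g: "smooth_on g (ball p R)" and s: "0 < s" "s < R"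
  shows "(wprod p f g has_real_derivative (wprod p (euler p f) g s + wprod p f (euler p g) s) / s) (at s)"
proof -
  let ?Z = "{0<..<R}"
  let ?f' = "\<lambda>s x d. (d / s) * (euler p f (p + s *\<^sub>R x) \<bullet> g (p + s *\<^sub>R x) + f (p + s *\<^sub>R x) \<bullet> euler p g (p + s *\<^sub>R x))"
  have line: "((\<lambda>s. h (p + s *\<^sub>R x)) has_derivative (\<lambda>d. (d / s) *\<^sub>R euler p h (p + s *\<^sub>R x))) (at s)"
    if h: "smooth_on h (ball p R)" and "s \<in> ?Z" "norm x \<le> 1" for h :: "'a \<Rightarrow> 'b" and s x
  proof -
    have y: "p + s *\<^sub>R x \<in> ball p R" using in_ball that by simp
    note d = smooth_on_differentiable[OF h y]
    have "((\<lambda>s. h (p + s *\<^sub>R x)) has_derivative (\<lambda>d. pd (d *\<^sub>R x) h (p + s *\<^sub>R x))) (at s)"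
      using has_derivative_along_line[of h "\<lambda>d. pd d h (p + s *\<^sub>R x)" p s x 0] pd_works[OF d] by simp
    moreover have "pd (d *\<^sub>R x) h (p + s *\<^sub>R x) = (d / s) *\<^sub>R euler p h (p + s *\<^sub>R x)" for d
      using linear_scale[OF pd_linear[OF d], of "d / s" "s *\<^sub>R x"] that by (simp add: euler_eq_pd[OF d])
    ultimately show ?thesis by simp
  qed
  have c: "continuous_on (ball p R) h" if "smooth_on h (ball p R)" for h :: "'a \<Rightarrow> 'b"
    using smooth_on_continuous_on[OF that] .
  note se = smooth_on_euler[OF open_ball f, of p] smooth_on_euler[OF open_ball g, of p]
  have D: "((\<lambda>s. LINT x:cball 0 1|lborel. wt x *\<^sub>R (f (p + s *\<^sub>R x) \<bullet> g (p + s *\<^sub>R x))) has_derivative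
      (\<lambda>d. LINT x:cball 0 1|lborel. wt x *\<^sub>R ?f' s x d)) (at s)"
  proof (rule has_derivative_parametric_integral[OF compact_cball wt_integrable, of ?Z])
    show "open ?Z" "s \<in> ?Z" using s by auto
    show "((\<lambda>s. f (p + s *\<^sub>R x) \<bullet> g (p + s *\<^sub>R x)) has_derivative ?f' t x) (at t)"
      if "t \<in> ?Z" "x \<in> cball 0 1" for t x
    proof -
      have x: "norm x \<le> 1" using that by simp
      show ?thesis
        by (rule has_derivative_eq_rhs[OF has_derivative_inner[OF line[OF f that(1) x] line[OF g that(1) x]]])
          (auto simp: fun_eq_iff distrib_left)
    qed
    show "continuous_on (cball 0 1) (\<lambda>x. f (p + t *\<^sub>R x) \<bullet> g (p + t *\<^sub>R x))" if "t \<in> ?Z" for t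
      by (intro continuous_on_inner continuous_on_compose2[OF c[OF f]] continuous_on_compose2[OF c[OF g]] continuous_intros;
          use in_ball that in auto)
    have cc: "continuous_on (?Z \<times> cball 0 1) (\<lambda>q. h (p + fst q *\<^sub>R snd q))" if "smooth_on h (ball p R)" for h :: "'a \<Rightarrow> 'b"
      by (intro continuous_on_compose2[OF c[OF that]] continuous_intros) (use in_ball in auto)
    have "continuous_on (?Z \<times> cball 0 1) (\<lambda>q. ?f' (fst q) (snd q) d)" for d
      by (intro continuous_intros cc f g se) auto
    then show "continuous_on (?Z \<times> cball 0 1) (\<lambda>(t, x). ?f' t x d)" for d by (simp add: split_beta)
  qed
  have I: "(LINT x:cball 0 1|lborel. wt x *\<^sub>R ?f' s x d) = (wprod p (euler p f) g s + wprod p f (euler p g) s) / s * d" for d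
  proof -
    have "(LINT x:cball 0 1|lborel. wt x *\<^sub>R ?f' s x d) = (LINT x:cball 0 1|lborel. (d / s) *\<^sub>R
       (wt x *\<^sub>R (euler p f (p + s *\<^sub>R x) \<bullet> g (p + s *\<^sub>R x)) + wt x *\<^sub>R (f (p + s *\<^sub>R x) \<bullet> euler p g (p + s *\<^sub>R x))))"
      by (simp add: distrib_left mult_ac)
    also have "\<dots> = (d / s) *\<^sub>R (wprod p (euler p f) g s + wprod p f (euler p g) s)"
      unfolding wprod_def set_integral_scaleR_right
      by (subst set_integral_add(2)[OF wprod_integrable[OF c[OF se(1)] c[OF g] s] wprod_integrable[OF c[OF f] c[OF se(2)] s]]) simp
    finally show ?thesis by (simp add: mult.commute)
  qed
  have D': "(wprod p f g has_derivative (\<lambda>d. LINT x:cball 0 1|lborel. wt x *\<^sub>R ?f' s x d)) (at s)"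
    using D unfolding wprod_def[abs_def] .
  show ?thesis unfolding has_field_derivative_def
    by (rule has_derivative_eq_rhs[OF D' ext[OF I]])
qed

text \<open>Green's identity with the weight \<open>wt_int\<close>. The divergence of
  \<open>V\<close> consists of the Laplacians of \<open>f\<close> and \<open>g\<close>, which
  vanish, and of the gradient of \<open>wt_int\<close>, which is radial and so produces the Euler
  derivatives with the weight \<open>wt\<close>.\<close>

lemma wprod_euler_symmetric:
  assumes f: "smooth_on f (ball p R)" and g: "smooth_on g (ball p R)" and s: "0 < s" "s < R"
    and hf: "\<And>y. y \<in> ball p R \<Longrightarrow> laplace f y = 0" and hg: "\<And>y. y \<in> ball p R \<Longrightarrow> laplace g y = 0"
  shows "wprod p (euler p f) g s = wprod p f (euler p g) s"
proof -
  define Y where "Y = {x::'a. norm (s *\<^sub>R x) < R}"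
  have Yo: "open Y" unfolding Y_def by (intro open_Collect_less continuous_intros)
  have Yb: "p + s *\<^sub>R x \<in> ball p R" if "x \<in> Y" for x using that by (simp add: Y_def dist_norm)
  have Y1: "x \<in> Y" if "norm x \<le> 1" for x
    using in_ball[OF s that] by (simp add: Y_def dist_norm)
  have sl: "smooth_on (\<lambda>x. h (p + s *\<^sub>R x)) Y" if "smooth_on h (ball p R)" for h :: "'a \<Rightarrow> 'b"
    by (rule smooth_on_compose[OF that _ Yo open_ball])
      (use Yb in \<open>auto intro!: smooth_on_add smooth_on_const smooth_on_scaleR smooth_on_ident Yo\<close>)
  have pl: "pd b (\<lambda>x. h (p + s *\<^sub>R x)) x = s *\<^sub>R pd b h (p + s *\<^sub>R x)" if h: "smooth_on h (ball p R)" and x: "x \<in> Y"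
    for h :: "'a \<Rightarrow> 'b" and b x
  proof -
    note d = smooth_on_differentiable[OF h Yb[OF x]]
    have "((\<lambda>x. p + s *\<^sub>R x) has_derivative (\<lambda>v. s *\<^sub>R v)) (at x)" by (auto intro!: derivative_eq_intros)
    from pd_eqI[OF diff_chain_at[OF this pd_works[OF d]], of b] show ?thesis
      by (simp add: o_def linear_scale[OF pd_linear[OF d]])
  qed
  define Q where "Q b x = pd b f (p + s *\<^sub>R x) \<bullet> g (p + s *\<^sub>R x) - f (p + s *\<^sub>R x) \<bullet> pd b g (p + s *\<^sub>R x)" for b x
  define V where "V b x = wt_int x * Q b x" for b x
  have sQ: "smooth_on (Q b) Y" for b unfolding Q_def[abs_def]
    by (intro smooth_on_diff smooth_on_inner sl smooth_on_pd f g Yo)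
  have V0: "V b x = 0" if "norm x > 1" for b x using wt_int_eq_0[of x] that by (simp add: V_def)
  have sV: "smooth_on (V b) UNIV" for b
  proof (rule smooth_on_local_cong)
    fix x :: 'a
    show "\<exists>A G. open A \<and> x \<in> A \<and> smooth_on G A \<and> (\<forall>w\<in>A. V b w = G w)"
    proof (cases "norm x \<le> 1")
      case True
      have "smooth_on (V b) Y" unfolding V_def[abs_def]
        by (intro smooth_on_mult Yo sQ smooth_on_subset[OF smooth_on_wt(2)]) auto
      then show ?thesis using Yo Y1[OF True] by blast
    next
      case False
      then show ?thesis using V0
        by (intro exI[of _ "{x. norm x > 1}"] exI[of _ "\<lambda>_. 0"])
          (auto intro!: open_Collect_less continuous_intros smooth_on_const)
    qed
  qed
  have pV: "(\<Sum>b\<in>Basis. pd b (V b) x) = indicat_real (cball 0 1) x *\<^sub>R ((- 2 / s) *\<^sub>R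
      (wt x *\<^sub>R (euler p f (p + s *\<^sub>R x) \<bullet> g (p + s *\<^sub>R x)) - wt x *\<^sub>R (f (p + s *\<^sub>R x) \<bullet> euler p g (p + s *\<^sub>R x))))" for x
  proof (cases "norm x \<le> 1")
    case False
    then have "pd b (V b) x = 0" for b using pd_eq_0_outside_ball[where z = x, OF V0] by simp
    then show ?thesis using False by simp
  next
    case True
    then have x: "x \<in> Y" by (rule Y1)
    let ?y = "p + s *\<^sub>R x"
    have dd: "(\<lambda>x. h (p + s *\<^sub>R x)) differentiable at x" if "smooth_on h (ball p R)" for h :: "'a \<Rightarrow> 'b"
      using smooth_on_differentiable[OF sl[OF that] x] .
    have pQ: "pd b (Q b) x = s * (pd b (pd b f) ?y \<bullet> g ?y - f ?y \<bullet> pd b (pd b g) ?y)" for b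
    proof -
      have "pd b (Q b) x = pd b (\<lambda>x. pd b f (p + s *\<^sub>R x) \<bullet> g (p + s *\<^sub>R x)) x - pd b (\<lambda>x. f (p + s *\<^sub>R x) \<bullet> pd b g (p + s *\<^sub>R x)) x"
        unfolding Q_def[abs_def] by (intro pd_diff smooth_on_differentiable[OF _ x] smooth_on_inner sl smooth_on_pd f g Yo)
      then show ?thesis
        by (simp add: pd_inner[OF dd[OF smooth_on_pd[OF f]] dd[OF g]] pd_inner[OF dd[OF f] dd[OF smooth_on_pd[OF g]]]
            pl[OF f x] pl[OF g x] pl[OF smooth_on_pd[OF f] x] pl[OF smooth_on_pd[OF g] x] algebra_simps)
    qed
    have "pd b (V b) x = wt_int x * pd b (Q b) x + pd b wt_int x * Q b x" for b
      unfolding V_def[abs_def]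
      by (rule pd_mult[OF smooth_on_differentiable[OF smooth_on_wt(2)] smooth_on_differentiable[OF sQ x]]) simp
    then have "(\<Sum>b\<in>Basis. pd b (V b) x) = wt_int x * s * (laplace f ?y \<bullet> g ?y - f ?y \<bullet> laplace g ?y)
       - 2 * wt x * (\<Sum>b\<in>Basis. (x \<bullet> b) * Q b x)"
      by (simp add: pQ pd_wt_int laplace_def sum.distrib sum_subtractf inner_sum_left inner_sum_right sum_distrib_left
          right_diff_distrib mult_ac sum_negf)
    also have "\<dots> = - 2 * wt x * (\<Sum>b\<in>Basis. (x \<bullet> b) * Q b x)" using hf[OF Yb[OF x]] hg[OF Yb[OF x]] by simp
    also have "(\<Sum>b\<in>Basis. (x \<bullet> b) * Q b x) = (euler p f ?y \<bullet> g ?y - f ?y \<bullet> euler p g ?y) / s"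
    proof -
      have "s * (\<Sum>b\<in>Basis. (x \<bullet> b) * Q b x) = euler p f ?y \<bullet> g ?y - f ?y \<bullet> euler p g ?y"
        by (simp add: Q_def euler_def inner_sum_left inner_sum_right sum_distrib_left right_diff_distrib sum_subtractf mult_ac)
      then show ?thesis using s by (simp add: field_simps)
    qed
    finally show ?thesis using True by (simp add: right_diff_distrib diff_divide_distrib mult_ac)
  qed
  have "(LINT x|lborel. (\<Sum>b\<in>Basis. pd b (V b) x)) = (\<Sum>b\<in>Basis. LINT x|lborel. pd b (V b) x)"
    by (rule Bochner_Integration.integral_sum)
      (rule integrable_compact_support[OF smooth_on_continuous_on[OF smooth_on_pd[OF sV]] pd_eq_0_outside_ball[OF V0]])
  also have "\<dots> = 0" using integral_pd_eq_0[OF sV V0] by simp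
  finally have "(LINT x:cball 0 1|lborel. (- 2 / s) *\<^sub>R
      (wt x *\<^sub>R (euler p f (p + s *\<^sub>R x) \<bullet> g (p + s *\<^sub>R x)) - wt x *\<^sub>R (f (p + s *\<^sub>R x) \<bullet> euler p g (p + s *\<^sub>R x)))) = 0"
    unfolding pV set_lebesgue_integral_def .
  moreover have c: "continuous_on (ball p R) h" if "smooth_on h (ball p R)" for h :: "'a \<Rightarrow> 'b"
    using smooth_on_continuous_on[OF that] .
  note se = smooth_on_euler[OF open_ball f, of p] smooth_on_euler[OF open_ball g, of p]
  ultimately have "(- 2 / s) * (wprod p (euler p f) g s - wprod p f (euler p g) s) = 0"
    unfolding wprod_def set_integral_scaleR_right
    by (subst (asm) set_integral_diff(2)[OF wprod_integrable[OF c[OF se(1)] c[OF g] s] wprod_integrable[OF c[OF f] c[OF se(2)] s]]) simp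
  then show ?thesis using s by simp
qed

lemma wprod_nonneg: "wprod p f f s \<ge> 0"
  unfolding wprod_def set_lebesgue_integral_def
  by (intro integral_nonneg_AE AE_I2) (simp add: indicator_def wt_nonneg)

lemma wprod_Cauchy_Schwarz:
  assumes f: "continuous_on (ball p R) f" and g: "continuous_on (ball p R) g" and s: "0 < s" "s < R"
  shows "(wprod p f g s)\<^sup>2 \<le> wprod p f f s * wprod p g g s"
proof -
  let ?a = "wprod p f f s" and ?b = "wprod p f g s" and ?c = "wprod p g g s"
  have q: "wprod p (\<lambda>y. u *\<^sub>R f y + v *\<^sub>R g y) (\<lambda>y. u *\<^sub>R f y + v *\<^sub>R g y) s = u\<^sup>2 * ?a + 2 * u * v * ?b + v\<^sup>2 * ?c" for u v
  proof -
    note i = wprod_integrable[OF f f s] wprod_integrable[OF f g s] wprod_integrable[OF g g s]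
    have "wprod p (\<lambda>y. u *\<^sub>R f y + v *\<^sub>R g y) (\<lambda>y. u *\<^sub>R f y + v *\<^sub>R g y) s =
      (LINT x:cball 0 1|lborel. (u\<^sup>2 *\<^sub>R (wt x *\<^sub>R (f (p + s *\<^sub>R x) \<bullet> f (p + s *\<^sub>R x))) +
        (2 * u * v) *\<^sub>R (wt x *\<^sub>R (f (p + s *\<^sub>R x) \<bullet> g (p + s *\<^sub>R x)))) +
        v\<^sup>2 *\<^sub>R (wt x *\<^sub>R (g (p + s *\<^sub>R x) \<bullet> g (p + s *\<^sub>R x))))"
      unfolding wprod_def set_lebesgue_integral_def
      by (intro Bochner_Integration.integral_cong refl)
        (simp add: inner_add_left inner_add_right inner_commute power2_eq_square algebra_simps)
    also have "\<dots> = u\<^sup>2 * ?a + 2 * u * v * ?b + v\<^sup>2 * ?c"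
      unfolding wprod_def
      by (subst set_integral_add(2), intro set_integral_add(1) set_integrable_scaleR_right i, intro set_integrable_scaleR_right i,
          subst set_integral_add(2), intro set_integrable_scaleR_right i, intro set_integrable_scaleR_right i,
          simp only: set_integral_scaleR_right) simp
    finally show ?thesis .
  qed
  have nn: "u\<^sup>2 * ?a + 2 * u * v * ?b + v\<^sup>2 * ?c \<ge> 0" for u v unfolding q[symmetric] by (rule wprod_nonneg)
  show ?thesis
  proof (cases "?c = 0")
    case True
    have "?b = 0"
    proof (rule ccontr)
      assume b: "?b \<noteq> 0"
      \<comment> \<open>For \<open>?c = 0\<close> the quadratic form is affine in \<open>v\<close>,
        and this \<open>v\<close> gives it the value -1.\<close>
      have "1\<^sup>2 * ?a + 2 * 1 * (- (?a + 1) / (2 * ?b)) * ?b + (- (?a + 1) / (2 * ?b))\<^sup>2 * ?c \<ge> 0" by (rule nn)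
      then show False using b True by (simp add: field_simps)
    qed
    then show ?thesis using True by simp
  next
    case False
    then have "?c > 0" using wprod_nonneg[of g s] by simp
    moreover have "?c * (?a * ?c - ?b\<^sup>2) \<ge> 0"
      using nn[of "?c" "- ?b"] by (simp add: power2_eq_square algebra_simps)
    ultimately show ?thesis by (simp add: zero_le_mult_iff)
  qed
qed

end

text \<open>\<open>h = B / M\<close> is a form of Almgren's frequency function, and the inequality
  between \<open>M\<close>, \<open>B\<close> and \<open>C\<close> makes it non-decreasing. A bound
  on the frequency bounds the logarithmic derivative of \<open>M\<close> by \<open>n / s\<close>, so
  \<open>M s / s ^ n\<close> does not increase and \<open>M\<close> cannot leave the value
  0.\<close>

lemma differential_inequality_vanishes:
  fixes M :: "real \<Rightarrow> real"
  assumes d: "\<And>s. 0 < s \<Longrightarrow> s < R \<Longrightarrow> (M has_real_derivative 2 * B s / s) (at s)"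
    and dB: "\<And>s. 0 < s \<Longrightarrow> s < R \<Longrightarrow> (B has_real_derivative 2 * C s / s) (at s)"
    and CS: "\<And>s. 0 < s \<Longrightarrow> s < R \<Longrightarrow> (B s)\<^sup>2 \<le> M s * C s"
    and nn: "\<And>s. M s \<ge> 0"
    and s0: "0 < s0" "M s0 = 0" and s2: "s0 \<le> s2" "s2 < R"
  shows "M s2 = 0"
proof (rule ccontr)
  assume "M s2 \<noteq> 0"
  then have M2: "M s2 > 0" using nn[of s2] by simp
  define Z where "Z = {s \<in> {s0..s2}. M s = 0}"
  have cM: "continuous_on {s0..s2} M"
  proof (rule continuous_at_imp_continuous_on, rule ballI)
    fix x assume "x \<in> {s0..s2}"
    then show "isCont M x" using d[of x] s0 s2 by (intro DERIV_isCont) auto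
  qed
  have "closed Z" unfolding Z_def
    using continuous_closed_preimage_constant[OF cM closed_atLeastAtMost, of 0] by simp
  moreover have "Z \<noteq> {}" "bdd_above Z" using s0 s2 by (auto simp: Z_def bdd_above_def)
  ultimately have s1Z: "Sup Z \<in> Z" by (simp add: closed_contains_Sup)
  \<comment> \<open>The last zero before \<open>s2\<close>; to the right of it the quotient
    \<open>h\<close> is defined.\<close>
  define s1 where "s1 = Sup Z"
  have s1: "s0 \<le> s1" "s1 \<le> s2" "M s1 = 0" using s1Z by (auto simp: Z_def s1_def)
  have s12: "s1 < s2" using s1 M2 by (cases "s1 = s2") auto
  have pos: "M s > 0" if "s1 < s" "s \<le> s2" for s
  proof -
    have "s \<notin> Z" using that cSup_upper[OF _ \<open>bdd_above Z\<close>, of s] by (auto simp: s1_def)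
    then have "M s \<noteq> 0" using that s1 by (auto simp: Z_def)
    then show ?thesis using nn[of s] by simp
  qed
  define h where "h s = B s / M s" for s
  have h_mono: "h s \<le> h s2" if s: "s1 < s" "s \<le> s2" for s
  proof (rule DERIV_nonneg_imp_nondecreasing[OF s(2)])
    fix t assume t: "s \<le> t" "t \<le> s2"
    then have t': "0 < t" "t < R" "M t > 0" using s s0 s1 s2 pos[of t] by auto
    have "(h has_real_derivative (2 * C t / t * M t - B t * (2 * B t / t)) / (M t * M t)) (at t)"
      unfolding h_def[abs_def] by (rule DERIV_divide[OF dB d]) (use t' in auto)
    moreover have "(2 * C t / t * M t - B t * (2 * B t / t)) / (M t * M t) = 2 / t * (M t * C t - (B t)\<^sup>2) / (M t * M t)"
      using t' by (simp add: power2_eq_square algebra_simps)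
    moreover have "2 / t * (M t * C t - (B t)\<^sup>2) / (M t * M t) \<ge> 0" using CS[of t] t' by simp
    ultimately show "\<exists>y. (h has_real_derivative y) (at t) \<and> 0 \<le> y" by metis
  qed
  obtain n :: nat where n: "2 * h s2 \<le> real n" using real_arch_simple by blast
  define g where "g s = M s / s ^ n" for s
  have g_mono: "g s \<ge> g s2" if s: "s1 < s" "s \<le> s2" for s
  proof (rule DERIV_nonpos_imp_nonincreasing[OF s(2)])
    fix t assume t: "s \<le> t" "t \<le> s2"
    then have t': "0 < t" "t < R" "M t > 0" "h t \<le> h s2" using s s0 s1 s2 pos[of t] h_mono[of t] by auto
    have dp: "((\<lambda>s. s ^ n) has_real_derivative real n * t ^ (n - Suc 0)) (at t)"
      using DERIV_pow[of n t UNIV] by simp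
    have "(g has_real_derivative (2 * B t / t * t ^ n - M t * (real n * t ^ (n - Suc 0))) / (t ^ n * t ^ n)) (at t)"
      unfolding g_def[abs_def] by (rule DERIV_divide[OF d dp]) (use t' in auto)
    moreover have "2 * B t / t * t ^ n - M t * (real n * t ^ (n - Suc 0)) = (2 * B t - real n * M t) * t ^ n / t"
      using t' by (cases n) (auto simp: field_simps)
    moreover have "2 * B t \<le> real n * M t"
    proof -
      have "B t = h t * M t" using t' by (simp add: h_def)
      moreover have "2 * h t \<le> real n" using t' n by simp
      ultimately show ?thesis using t' mult_right_mono[of "2 * h t" "real n" "M t"] by simp
    qed
    then have "(2 * B t - real n * M t) * t ^ n / t / (t ^ n * t ^ n) \<le> 0"
      using t' by (intro divide_nonpos_nonneg mult_nonpos_nonneg) auto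
    ultimately show "\<exists>y. (g has_real_derivative y) (at t) \<and> y \<le> 0" by metis
  qed
  have g2: "g s2 > 0" using M2 s0 s2 by (simp add: g_def)
  have "isCont g s1" unfolding g_def[abs_def]
    using DERIV_isCont[OF d[of s1]] s1 s0 s2 by (intro continuous_intros) auto
  then have "(g \<longlongrightarrow> g s1) (at_right s1)" unfolding isCont_def by (rule filterlim_at_split[THEN iffD1, THEN conjunct2])
  moreover have "\<forall>\<^sub>F s in at_right s1. g s2 \<le> g s"
    unfolding eventually_at_right[OF s12] using g_mono s12 by (intro exI[of _ s2]) auto
  ultimately have "g s2 \<le> g s1" by (intro tendsto_lowerbound) auto
  then show False using g2 s1 by (simp add: g_def)
qed

text \<open>Applied with \<open>M\<close>, \<open>B\<close>, \<open>C\<close> the weighted products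
  of \<open>u\<close> and its Euler derivative. Symmetry of the Euler operator on harmonic functions
  is what turns the derivative of \<open>B\<close> into \<open>2 * C s / s\<close>.\<close>

lemma harmonic_vanishing_ball:
  fixes u :: "'a::euclidean_space \<Rightarrow> 'c::euclidean_space"
  assumes u: "smooth_on u (ball p R)" and h: "\<And>y. y \<in> ball p R \<Longrightarrow> laplace u y = 0"
    and r: "r > 0" "\<And>y. y \<in> ball p r \<Longrightarrow> u y = 0" and y: "y \<in> ball p R"
  shows "u y = 0"
proof (rule ccontr)
  assume uy: "u y \<noteq> 0"
  let ?E = "euler p u"
  have sE: "smooth_on ?E (ball p R)" by (rule smooth_on_euler[OF open_ball u])
  have hE: "laplace ?E y = 0" if "y \<in> ball p R" for y by (rule laplace_euler[OF open_ball that u h])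
  define M where "M = wprod p u u"
  define B where "B = wprod p u ?E"
  define C where "C = wprod p ?E ?E"
  have dM: "(M has_real_derivative 2 * B s / s) (at s)" if s: "0 < s" "s < R" for s
    using wprod_has_derivative[OF u u s] wprod_commute[of p ?E u s] by (simp add: M_def B_def)
  have dB: "(B has_real_derivative 2 * C s / s) (at s)" if s: "0 < s" "s < R" for s
    using wprod_has_derivative[OF u sE s] wprod_euler_symmetric[OF u sE s h hE] by (simp add: B_def C_def)
  have CS: "(B s)\<^sup>2 \<le> M s * C s" if "0 < s" "s < R" for s
    unfolding M_def B_def C_def by (rule wprod_Cauchy_Schwarz[OF smooth_on_continuous_on[OF u] smooth_on_continuous_on[OF sE] that])
  have ypR: "dist p y < R" using y by simp
  obtain s2 where s2: "dist p y < s2" "s2 < R" using dense[OF ypR] by blast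
  have s2p: "s2 > 0" using s2 zero_le_dist[of p y] by linarith
  define s0 where "s0 = min (r / 2) s2"
  have s0: "s0 > 0" "s0 \<le> s2" "s0 < r" using r s2p by (auto simp: s0_def)
  have "wt x *\<^sub>R (u (p + s0 *\<^sub>R x) \<bullet> u (p + s0 *\<^sub>R x)) = 0" if "x \<in> cball 0 1" for x
  proof -
    have "s0 * norm x \<le> s0 * 1" using that s0 by (intro mult_left_mono) auto
    then have "s0 * norm x < r" using s0 by linarith
    then have "p + s0 *\<^sub>R x \<in> ball p r" using s0 by (simp add: dist_norm)
    then show ?thesis using r(2) by simp
  qed
  then have M0: "M s0 = 0" unfolding M_def wprod_def
    by (subst set_lebesgue_integral_cong[where g = "\<lambda>_. 0"]) auto
  have "M s2 = 0"
    by (rule differential_inequality_vanishes[OF dM dB CS _ s0(1) M0 s0(2) s2(2)]) (auto simp: M_def wprod_nonneg)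
  define \<phi> where "\<phi> x = indicat_real (cball 0 1) x *\<^sub>R (wt x *\<^sub>R (u (p + s2 *\<^sub>R x) \<bullet> u (p + s2 *\<^sub>R x)))" for x
  have i: "integrable lborel \<phi>"
    using wprod_integrable[OF smooth_on_continuous_on[OF u] smooth_on_continuous_on[OF u] s2p s2(2)]
    by (simp add: \<phi>_def[abs_def] set_integrable_def)
  have nn: "\<phi> x \<ge> 0" for x by (simp add: \<phi>_def indicator_def wt_nonneg)
  have "(LINT x|lborel. \<phi> x) = 0" using \<open>M s2 = 0\<close> by (simp add: M_def wprod_def \<phi>_def set_lebesgue_integral_def)
  then have ae: "AE x in lborel. \<phi> x = 0" using integral_nonneg_eq_0_iff_AE[OF i] nn by simp
  define x0 where "x0 = (y - p) /\<^sub>R s2"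
  have "norm x0 = dist p y / s2"
    using s2p by (simp add: x0_def dist_norm norm_minus_commute[of y] divide_inverse mult.commute)
  then have x0: "norm x0 < 1" "p + s2 *\<^sub>R x0 = y" using s2 s2p by (simp_all add: x0_def)
  \<comment> \<open>An open set on which the integrand is positive; it contains \<open>x0\<close>,
    so it is not a null set, contrary to the vanishing integral.\<close>
  define A where "A = ball 0 1 \<inter> (\<lambda>x. u (p + s2 *\<^sub>R x)) -` (- {0})"
  have "p + s2 *\<^sub>R x \<in> ball p R" if "x \<in> ball 0 1" for x
    using in_ball[OF s2p s2(2), where x = x and p = p] that by simp
  then have "continuous_on (ball 0 1) (\<lambda>x. u (p + s2 *\<^sub>R x))"
    by (intro continuous_on_compose2[OF smooth_on_continuous_on[OF u]] continuous_intros) blast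
  then have "open A" unfolding A_def by (rule continuous_open_preimage) auto
  moreover have "x0 \<in> A" using x0 uy by (simp add: A_def)
  ultimately obtain e where e: "e > 0" "ball x0 e \<subseteq> A" using open_contains_ball by blast
  have "\<phi> x \<noteq> 0" if "x \<in> ball x0 e" for x
  proof -
    have "x \<in> A" using that e by blast
    then have "norm x < 1" "u (p + s2 *\<^sub>R x) \<noteq> 0" by (auto simp: A_def)
    then show ?thesis using wt_pos[of x] by (simp add: \<phi>_def)
  qed
  then have "AE x in lborel. x \<notin> ball x0 e" using ae by (auto elim!: eventually_mono)
  then have "ball x0 e \<in> null_sets lborel" by (subst AE_iff_null_sets) auto
  then have "measure lborel (ball x0 e) = 0" by (simp add: null_sets_def measure_def)
  then show False using content_ball_pos[OF e(1), of x0] by simp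
qed

text \<open>The set of points near which \<open>u\<close> vanishes is open by construction; the
  previous lemma makes its complement in \<open>W\<close> open as well.\<close>

lemma harmonic_unique_continuation:
  fixes u :: "'a::euclidean_space \<Rightarrow> 'c::euclidean_space"
  assumes W: "open W" "connected W" and u: "smooth_on u W" and h: "\<And>y. y \<in> W \<Longrightarrow> laplace u y = 0"
    and V: "open V" "V \<subseteq> W" "V \<noteq> {}" "\<And>y. y \<in> V \<Longrightarrow> u y = 0" and y: "y \<in> W"
  shows "u y = 0"
proof -
  define Z where "Z = {x. \<exists>e>0. ball x e \<subseteq> W \<and> (\<forall>y\<in>ball x e. u y = 0)}"
  have ZW: "Z \<subseteq> W" by (auto simp: Z_def)
  have Zo: "open Z" unfolding open_contains_ball
  proof
    fix x assume "x \<in> Z"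
    then obtain e where e: "e > 0" "ball x e \<subseteq> W" "\<forall>y\<in>ball x e. u y = 0" by (auto simp: Z_def)
    have "ball x (e/2) \<subseteq> Z"
    proof
      fix z assume z: "z \<in> ball x (e/2)"
      have "ball z (e/2) \<subseteq> ball x e"
      proof
        fix w assume "w \<in> ball z (e/2)"
        then show "w \<in> ball x e" using z dist_triangle[of x w z] by (simp add: dist_commute)
      qed
      then show "z \<in> Z" unfolding Z_def using e by (intro CollectI exI[of _ "e/2"]) auto
    qed
    then show "\<exists>e>0. ball x e \<subseteq> Z" using e by (intro exI[of _ "e/2"]) auto
  qed
  have "open (W - Z)" unfolding open_contains_ball
  proof
    fix x assume x: "x \<in> W - Z"
    then obtain R where R: "R > 0" "ball x R \<subseteq> W" using W open_contains_ball by blast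
    \<comment> \<open>The radii are chosen so that for \<open>z\<close> within \<open>R/4\<close> of
      \<open>x\<close> the ball of radius \<open>R/2\<close> around \<open>z\<close> lies in
      \<open>W\<close> and contains \<open>ball x (R/4)\<close>: vanishing near \<open>z\<close>
      would spread to a neighbourhood of \<open>x\<close>.\<close>
    have "ball x (R/4) \<subseteq> W - Z"
    proof
      fix z assume z: "z \<in> ball x (R/4)"
      have sub: "ball z (R/2) \<subseteq> ball x R"
      proof
        fix w assume "w \<in> ball z (R/2)"
        then show "w \<in> ball x R" using z dist_triangle[of x w z] R(1) by (simp add: dist_commute)
      qed
      have "z \<notin> Z"
      proof
        assume "z \<in> Z"
        then obtain e where e: "e > 0" "\<forall>y\<in>ball z e. u y = 0" by (auto simp: Z_def)
        have sW: "ball z (R/2) \<subseteq> W" using sub R by blast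
        have all0: "u w = 0" if "w \<in> ball z (R/2)" for w
          by (rule harmonic_vanishing_ball[OF smooth_on_subset[OF u sW] _ e(1) _ that]) (use h sW e in auto)
        have "ball x (R/4) \<subseteq> ball z (R/2)"
        proof
          fix w assume "w \<in> ball x (R/4)"
          then show "w \<in> ball z (R/2)" using z dist_triangle[of z w x] R(1) by (simp add: dist_commute)
        qed
        then have "x \<in> Z" unfolding Z_def using all0 R sW by (intro CollectI exI[of _ "R/4"]) auto
        then show False using x by blast
      qed
      moreover have "z \<in> W" using z R by (auto simp: subset_iff)
      ultimately show "z \<in> W - Z" by blast
    qed
    then show "\<exists>e>0. ball x e \<subseteq> W - Z" using R by (intro exI[of _ "R/4"]) auto
  qed
  moreover have "Z \<noteq> {}"
  proof -
    obtain v where "v \<in> V" using V by blast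
    then obtain e where "e > 0" "ball v e \<subseteq> V" using V open_contains_ball by blast
    then have "v \<in> Z" unfolding Z_def using V by (intro CollectI exI[of _ e]) auto
    then show ?thesis by blast
  qed
  ultimately have "W - Z = {}"
    using W(2) Zo ZW unfolding connected_def by blast
  then have "y \<in> Z" using y by blast
  then obtain e where "e > 0" "\<forall>w\<in>ball y e. u w = 0" by (auto simp: Z_def)
  then show ?thesis by simp
qed

section \<open>Sides of a hypersurface and cut-offs of flat functions\<close>

text \<open>\<open>N\<close> is a thin tube around a segment through \<open>p\<close> in a direction
  \<open>v\<close> along which \<open>\<rho>\<close> increases. Points of the tube with positive
  \<open>\<rho>\<close> can be moved parallel to \<open>v\<close> into a fixed ball on the positive
  side, so they form a connected set.\<close>

lemma local_side:
  assumes def: "defining_function S U \<rho>" and p: "p \<in> S"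
  obtains N where "open N" "p \<in> N" "N \<subseteq> U" "connected (N \<inter> {z. \<rho> z > 0})" "S \<inter> N \<subseteq> closure (N \<inter> {z. \<rho> z > 0})"
proof -
  have U: "open U" "smooth_on \<rho> U" and S: "S = {z \<in> U. \<rho> z = 0}"
    using def unfolding defining_function_def by auto
  have pU: "p \<in> U" "\<rho> p = 0" using p S by auto
  have lin: "linear (\<lambda>v. pd v \<rho> w)" if "w \<in> U" for w
    using U(2) smooth_on_differentiable[OF _ that] pd_linear by blast
  obtain v0 where v0: "pd v0 \<rho> p \<noteq> 0" using def p unfolding defining_function_def pd_def by blast
  define v where "v = (if pd v0 \<rho> p > 0 then v0 else - v0)"
  have v: "pd v \<rho> p > 0" using v0 linear_neg[OF lin[OF pU(1)]] by (auto simp: v_def)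
  have "isCont (pd v \<rho>) p"
    using smooth_on_continuous_on[OF smooth_on_pd[OF U(2)]] U(1) pU continuous_on_eq_continuous_at by blast
  then have "\<forall>\<^sub>F w in nhds p. pd v \<rho> w > 0"
    using order_tendstoD(1)[OF _ v] by (simp add: isCont_def eventually_nhds_conv_at v)
  moreover have "\<forall>\<^sub>F w in nhds p. w \<in> U" using U(1) pU(1) by (simp add: eventually_nhds_in_open)
  ultimately have "\<forall>\<^sub>F w in nhds p. w \<in> U \<and> pd v \<rho> w > 0" by eventually_elim simp
  then obtain r where r: "r > 0" and inr: "\<And>w. dist w p < r \<Longrightarrow> w \<in> U \<and> pd v \<rho> w > 0"
    unfolding eventually_nhds_metric by blast
  have inc: "\<rho> z < \<rho> (z + h *\<^sub>R v)" if z: "z \<in> ball p r" "z + h *\<^sub>R v \<in> ball p r" and h: "h > 0" for z h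
  proof -
    have seg: "z + t *\<^sub>R v \<in> ball p r" if "0 \<le> t" "t \<le> h" for t
    proof -
      have "z + t *\<^sub>R v = (1 - t / h) *\<^sub>R z + (t / h) *\<^sub>R (z + h *\<^sub>R v)" using h by (simp add: algebra_simps)
      then show ?thesis using convexD_alt[OF convex_ball z, of "t / h"] that h by simp
    qed
    have d: "((\<lambda>t. \<rho> (z + t *\<^sub>R v)) has_derivative (\<lambda>d. pd (d *\<^sub>R v) \<rho> (z + t *\<^sub>R v))) (at t within {0..h})"
      if "0 \<le> t" "t \<le> h" for t
    proof -
      have "z + t *\<^sub>R v \<in> U" using inr seg[OF that] by (simp add: dist_commute)
      then show ?thesis
        using has_derivative_along_line[of \<rho> "\<lambda>d. pd d \<rho> (z + t *\<^sub>R v)" z t v 0] smooth_on_has_derivative[OF U(2)]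
        by (simp add: has_derivative_at_withinI)
    qed
    obtain t where t: "t \<in> {0<..<h}" "\<rho> (z + h *\<^sub>R v) - \<rho> (z + 0 *\<^sub>R v) = pd ((h - 0) *\<^sub>R v) \<rho> (z + t *\<^sub>R v)"
      using mvt_simple[OF h, of "\<lambda>t. \<rho> (z + t *\<^sub>R v)", OF d] by blast
    have "z + t *\<^sub>R v \<in> U" "pd v \<rho> (z + t *\<^sub>R v) > 0" using inr seg[of t] t by (auto simp: dist_commute)
    then have "pd (h *\<^sub>R v) \<rho> (z + t *\<^sub>R v) > 0" using linear_scale[OF lin] h by simp
    then show ?thesis using t by simp
  qed
  define \<tau> where "\<tau> = r / (4 * (norm v + 1))"
  have nv: "norm v + 1 > 0" by (simp add: add_nonneg_pos)
  have \<tau>: "\<tau> > 0" using r nv by (simp add: \<tau>_def)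
  have \<tau>v: "\<tau> * norm v \<le> r / 4"
  proof -
    have "r / (4 * m) * m = r / 4" if "m > 0" for m :: real using that by simp
    note scale = this[OF nv]
    have "\<tau> * norm v \<le> \<tau> * (norm v + 1)" using \<tau> by simp
    also have "\<dots> = r / 4" unfolding \<tau>_def by (rule scale)
    finally show ?thesis .
  qed
  have tv: "norm (s *\<^sub>R v) \<le> r / 2" if "\<bar>s\<bar> \<le> 2 * \<tau>" for s
  proof -
    have "norm (s *\<^sub>R v) \<le> (2 * \<tau>) * norm v" using that by (simp add: mult_right_mono)
    then show ?thesis using \<tau>v by simp
  qed
  have q: "p + \<tau> *\<^sub>R v \<in> ball p r" using tv[of \<tau>] \<tau> r by (simp add: dist_norm)
  have "\<rho> (p + \<tau> *\<^sub>R v) > 0" using inc[OF _ q \<tau>] r pU by simp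
  moreover have "isCont \<rho> (p + \<tau> *\<^sub>R v)"
    using smooth_on_continuous_on[OF U(2)] U(1) inr[of "p + \<tau> *\<^sub>R v"] q continuous_on_eq_continuous_at
    by (auto simp: dist_commute)
  ultimately have "\<forall>\<^sub>F w in nhds (p + \<tau> *\<^sub>R v). \<rho> w > 0"
    using order_tendstoD(1)[of \<rho> "\<rho> (p + \<tau> *\<^sub>R v)"] by (simp add: isCont_def eventually_nhds_conv_at)
  then obtain d0 where d0: "d0 > 0" "\<And>w. dist w (p + \<tau> *\<^sub>R v) < d0 \<Longrightarrow> \<rho> w > 0"
    unfolding eventually_nhds_metric by blast
  \<comment> \<open>The tube is so thin that its cross-section around
    \<open>p + \<tau> *\<^sub>R v\<close> lies where \<open>\<rho>\<close> is positive.\<close>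
  define \<delta> where "\<delta> = min d0 (r / 2)"
  have \<delta>: "\<delta> > 0" "\<delta> \<le> d0" "\<delta> \<le> r / 2" using d0 r by (auto simp: \<delta>_def)
  define N where "N = (\<Union>s\<in>{-2*\<tau><..<2*\<tau>}. ball (p + s *\<^sub>R v) \<delta>)"
  have N_D: "\<exists>s. \<bar>s\<bar> < 2 * \<tau> \<and> dist (p + s *\<^sub>R v) z < \<delta>" if z: "z \<in> N" for z
  proof -
    obtain s where "s \<in> {-2*\<tau><..<2*\<tau>}" "z \<in> ball (p + s *\<^sub>R v) \<delta>" using z unfolding N_def by (rule UN_E)
    then show ?thesis by (intro exI[of _ s]) auto
  qed
  have Nr: "N \<subseteq> ball p r"
  proof
    fix z assume "z \<in> N"
    then obtain s where s: "\<bar>s\<bar> < 2 * \<tau>" "dist (p + s *\<^sub>R v) z < \<delta>" using N_D by blast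
    have "dist p z \<le> dist p (p + s *\<^sub>R v) + dist (p + s *\<^sub>R v) z" by (rule dist_triangle)
    then show "z \<in> ball p r" using tv[of s] s \<delta> by (simp add: dist_norm)
  qed
  have No: "open N" unfolding N_def by blast
  have sh: "dist (p + s *\<^sub>R v) (z + (s - s') *\<^sub>R v) = dist (p + s' *\<^sub>R v) z" for s s' z
    by (simp add: dist_norm algebra_simps)
  let ?A = "N \<inter> {z. \<rho> z > 0}"
  let ?c = "p + \<tau> *\<^sub>R v"
  have B: "ball ?c \<delta> \<subseteq> ?A"
    unfolding N_def using \<tau> d0(2) \<delta> by (auto simp: dist_commute intro!: bexI[of _ \<tau>])
  have conn: "connected_component ?A z ?c" if z: "z \<in> ?A" for z
  proof -
    obtain s where s: "\<bar>s\<bar> < 2 * \<tau>" "dist (p + s *\<^sub>R v) z < \<delta>" using N_D z by blast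
    define y where "y = z + (\<tau> - s) *\<^sub>R v"
    have y: "y \<in> ball ?c \<delta>" using s sh[of \<tau> z s] by (simp add: y_def)
    \<comment> \<open>Along the segment \<open>\<rho>\<close> is monotone and it is positive at both
      ends; which end carries the minimum depends on whether \<open>s\<close> is below or above
      \<open>\<tau>\<close>.\<close>
    have seg: "closed_segment z y \<subseteq> ?A"
    proof
      fix w assume "w \<in> closed_segment z y"
      then obtain u where u: "0 \<le> u" "u \<le> 1" "w = (1 - u) *\<^sub>R z + u *\<^sub>R y" by (auto simp: in_segment)
      define h where "h = u * (\<tau> - s)"
      have w: "w = z + h *\<^sub>R v" using u by (simp add: y_def h_def algebra_simps)
      have sh2: "\<bar>s + h\<bar> < 2 * \<tau>"
      proof -
        have "s + h = (1 - u) * s + u * \<tau>" by (simp add: h_def algebra_simps)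
        moreover have "\<bar>(1 - u) * s\<bar> \<le> (1 - u) * max \<bar>s\<bar> \<tau>" "\<bar>u * \<tau>\<bar> \<le> u * max \<bar>s\<bar> \<tau>"
          using u \<tau> by (auto simp: abs_mult intro!: mult_left_mono)
        ultimately have "\<bar>s + h\<bar> \<le> (1 - u) * max \<bar>s\<bar> \<tau> + u * max \<bar>s\<bar> \<tau>" by linarith
        also have "\<dots> = max \<bar>s\<bar> \<tau>" by (simp add: algebra_simps)
        finally show ?thesis using s \<tau> by linarith
      qed
      have wN: "w \<in> N" unfolding N_def
        using sh2 s sh[of "s + h" z s] by (auto simp: w intro!: bexI[of _ "s + h"])
      have br: "z \<in> ball p r" "w \<in> ball p r" "y \<in> ball p r" using Nr z wN y B by blast+
      have "\<rho> w > 0"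
      proof (cases "s \<le> \<tau>")
        case True
        then have "h \<ge> 0" using u by (simp add: h_def)
        then show ?thesis using inc[OF br(1) br(2)[unfolded w]] z w by (cases "h = 0") auto
      next
        case False
        define k where "k = (1 - u) * (s - \<tau>)"
        have wk: "w = y + k *\<^sub>R v" by (simp add: w y_def k_def h_def algebra_simps)
        have "k \<ge> 0" using u False by (simp add: k_def)
        moreover have "\<rho> y > 0" using y B by blast
        ultimately show ?thesis using inc[OF br(3) br(2)[unfolded wk]] wk by (cases "k = 0") auto
      qed
      then show "w \<in> ?A" using wN by simp
    qed
    have "connected_component ?A z y"
      using seg by (intro connected_componentI[of "closed_segment z y"]) auto
    moreover have "connected_component ?A y ?c"
      using y B \<delta> by (intro connected_componentI[of "ball ?c \<delta>"]) auto
    ultimately show ?thesis by (rule connected_component_trans)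
  qed
  have "connected ?A" unfolding connected_iff_connected_component
    using conn by (meson connected_component_sym connected_component_trans)
  moreover have "p \<in> N" unfolding N_def using \<tau> \<delta> by (intro UN_I[of 0]) auto
  moreover have "N \<subseteq> U" using Nr inr by (auto simp: dist_commute)
  moreover have "S \<inter> N \<subseteq> closure ?A"
  proof
    fix z assume z: "z \<in> S \<inter> N"
    show "z \<in> closure ?A" unfolding closure_approachable
    proof (intro allI impI)
      fix e :: real assume e: "e > 0"
      obtain e1 where e1: "e1 > 0" "ball z e1 \<subseteq> N" using No z open_contains_ball by blast
      define h where "h = min e e1 / (2 * (norm v + 1))"
      have h: "h > 0" using e e1 nv by (simp add: h_def)
      have "h * norm v \<le> h * (norm v + 1)" using h by simp
      also have "\<dots> = min e e1 / 2"
      proof -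
        have "m / (2 * n) * n = m / 2" if "n > 0" for m n :: real using that by simp
        then show ?thesis unfolding h_def using nv by blast
      qed
      also have "\<dots> < min e e1" using e e1(1) by linarith
      finally have hv: "dist (z + h *\<^sub>R v) z < min e e1" using h by (simp add: dist_norm)
      then have "z + h *\<^sub>R v \<in> N" using e1 by (auto simp: dist_commute)
      moreover have "\<rho> z = 0" using z S by simp
      moreover have "z \<in> ball p r" "z + h *\<^sub>R v \<in> ball p r" using calculation z Nr by blast+
      ultimately have "z + h *\<^sub>R v \<in> ?A" using inc[OF _ _ h, of z] by simp
      then show "\<exists>y\<in>?A. dist y z < e" using hv by (intro bexI[of _ "z + h *\<^sub>R v"]) auto
    qed
  qed
  ultimately show ?thesis using that No by blast
qed

lemma defining_function_uminus: "defining_function S U \<rho> \<Longrightarrow> defining_function S U (\<lambda>z. - \<rho> z)"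
proof -
  assume def: "defining_function S U \<rho>"
  have "\<exists>v. pd v (\<lambda>z. - \<rho> z) z \<noteq> 0" if z: "z \<in> S" for z
  proof -
    obtain v where "pd v \<rho> z \<noteq> 0" using def z unfolding defining_function_def pd_def by blast
    moreover have "\<rho> differentiable at z"
      using def z unfolding defining_function_def by (auto intro: smooth_on_differentiable)
    ultimately have "pd v (\<lambda>z. - \<rho> z) z \<noteq> 0"
      using pd_linear_comp[OF bounded_linear_minus[OF bounded_linear_ident], of \<rho> z v] by simp
    then show ?thesis by blast
  qed
  moreover have "open U" "smooth_on \<rho> U" "S = {z \<in> U. \<rho> z = 0}" using def unfolding defining_function_def by blast+
  ultimately show ?thesis unfolding defining_function_def pd_def[symmetric] by (simp add: smooth_on_uminus)
qed

text \<open>The points of \<open>S\<close> in the closure of \<open>C\<close> form an open and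
  closed subset of \<open>S\<close>. It is used for both components: for \<open>D\<close> it bounds
  \<open>S\<close>, and for \<open>W\<close> it carries vanishing on \<open>W\<close> over to
  \<open>S\<close>.\<close>

lemma hypersurface_subset_closure_component:
  assumes X: "open X" "connected X" and S: "closedin (top_of_set X) S" "connected S" "S \<noteq> {}"
    and def: "defining_function S U \<rho>" and U: "U \<subseteq> X" and C: "C \<in> components (X - S)"
  shows "S \<subseteq> closure C"
proof -
  have SX: "S \<subseteq> X" using S(1) closedin_imp_subset by blast
  have oXS: "open (X - S)"
  proof -
    have "openin (top_of_set X) (X - S)" using S(1) by (simp add: closedin_def)
    then show ?thesis using X(1) openin_open_eq by blast
  qed
  have Co: "open C" using open_components[OF oXS C] .
  have CX: "C \<subseteq> X - S" "C \<noteq> {}" "connected C"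
    using C in_components_subset in_components_nonempty in_components_connected by auto
  have side: "q \<in> closure C" if "z \<in> C" "z \<in> N \<inter> {z. \<sigma> z > 0}" "N \<subseteq> X" "connected (N \<inter> {z. \<sigma> z > 0})"
    "\<And>z. z \<in> S \<Longrightarrow> \<sigma> z = 0" "q \<in> closure (N \<inter> {z. \<sigma> z > 0})" for z q N and \<sigma> :: "quat2 \<Rightarrow> real"
  proof -
    have "N \<inter> {z. \<sigma> z > 0} \<subseteq> X - S" using that(3,5) by fastforce
    then have "N \<inter> {z. \<sigma> z > 0} \<subseteq> C" using components_maximal[OF C that(4)] that(1,2) by blast
    then show ?thesis using that(6) closure_mono by blast
  qed
  have \<rho>0: "\<rho> z = 0" if "z \<in> S" for z using def that unfolding defining_function_def by auto
  \<comment> \<open>Near \<open>p\<close> the component contains a point on one side of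
    \<open>S\<close>, hence by connectedness that whole side, and all nearby points of
    \<open>S\<close> are limits of it.\<close>
  have op: "\<exists>N. open N \<and> p \<in> N \<and> S \<inter> N \<subseteq> closure C" if p: "p \<in> S" "p \<in> closure C" for p
  proof -
    obtain N1 where N1: "open N1" "p \<in> N1" "N1 \<subseteq> U" "connected (N1 \<inter> {z. \<rho> z > 0})"
      "S \<inter> N1 \<subseteq> closure (N1 \<inter> {z. \<rho> z > 0})" using local_side[OF def p(1)] by blast
    obtain N2 where N2: "open N2" "p \<in> N2" "N2 \<subseteq> U" "connected (N2 \<inter> {z. - \<rho> z > 0})"
      "S \<inter> N2 \<subseteq> closure (N2 \<inter> {z. - \<rho> z > 0})"
      using local_side[OF defining_function_uminus[OF def] p(1)] by blast
    have "open (N1 \<inter> N2)" "p \<in> N1 \<inter> N2" using N1 N2 by auto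
    then obtain z where z: "z \<in> C" "z \<in> N1" "z \<in> N2"
      using p(2) open_Int_closure_eq_empty[of "N1 \<inter> N2" C] by blast
    have "\<rho> z \<noteq> 0"
    proof
      assume "\<rho> z = 0"
      then have "z \<in> S" using def z N1(3) unfolding defining_function_def by auto
      then show False using z CX by blast
    qed
    then consider "\<rho> z > 0" | "- \<rho> z > 0" by linarith
    then show ?thesis
    proof cases
      case 1
      have "q \<in> closure C" if "q \<in> S \<inter> N1" for q
        by (rule side[OF z(1) _ _ N1(4) \<rho>0]) (use 1 z N1 U that in auto)
      then show ?thesis using N1 by blast
    next
      case 2
      have "q \<in> closure C" if "q \<in> S \<inter> N2" for q
        by (rule side[OF z(1) _ _ N2(4)]) (use 2 z N2 U that \<rho>0 in auto)
      then show ?thesis using N2 by blast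
    qed
  qed
  define T where "T = S \<inter> closure C"
  have "openin (top_of_set S) T" unfolding openin_contains_ball
  proof (intro conjI ballI)
    show "T \<subseteq> S" by (simp add: T_def)
    fix x assume "x \<in> T"
    then obtain N where N: "open N" "x \<in> N" "S \<inter> N \<subseteq> closure C" using op[of x] by (auto simp: T_def)
    then obtain e where "e > 0" "ball x e \<subseteq> N" using open_contains_ball by blast
    then show "\<exists>e>0. ball x e \<inter> S \<subseteq> T" using N by (intro exI[of _ e]) (auto simp: T_def)
  qed
  moreover have "closedin (top_of_set S) T" unfolding T_def by (auto simp: closedin_closed)
  ultimately have "T = {} \<or> T = S" using S(2) connected_clopen by blast
  \<comment> \<open>If the closure of \<open>C\<close> missed \<open>S\<close>, then
    \<open>C\<close> would be open and closed in the connected set \<open>X\<close>.\<close>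
  moreover have "T \<noteq> {}"
  proof
    assume T: "T = {}"
    have "closure C \<inter> X \<subseteq> C"
    proof
      fix x assume x: "x \<in> closure C \<inter> X"
      then have xXS: "x \<in> X - S" using T by (auto simp: T_def)
      have "closedin (top_of_set (X - S)) C" by (rule closedin_component[OF C])
      then obtain K where "closed K" "C = (X - S) \<inter> K" using closedin_closed by blast
      then show "x \<in> C" using x xXS closure_minimal[of C K] by blast
    qed
    then have "C = X \<inter> closure C" using CX closure_subset by blast
    then have "closedin (top_of_set X) C" using closedin_closed closed_closure by blast
    moreover have "openin (top_of_set X) C" using Co CX openin_open_eq[OF X(1)] by blast
    ultimately have "C = X" using X(2) CX(2) connected_clopen by blast
    then show False using CX SX S(3) by blast
  qed
  ultimately show ?thesis by (auto simp: T_def)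
qed

section \<open>Extension by zero across the hypersurface\<close>

lemma cut_flat_has_derivative:
  assumes D: "open D" and W: "open W" and z: "z \<in> D \<union> S \<union> W" and disj: "D \<inter> S = {}" "D \<inter> W = {}"
    and h: "h differentiable (at z)" and flat: "z \<in> S \<Longrightarrow> h z = 0" "\<And>v. z \<in> S \<Longrightarrow> pd v h z = 0"
  shows "((\<lambda>z. if z \<in> D then h z else 0) has_derivative (\<lambda>v. if z \<in> D then pd v h z else 0)) (at z)"
proof -
  consider "z \<in> D" | "z \<in> W" "z \<notin> D" | "z \<in> S" "z \<notin> D" using z by blast
  then show ?thesis
  proof cases
    case 1
    then show ?thesis using pd_works[OF h] by (subst has_derivative_cong_open[OF D 1, of _ h]) simp_all
  next
    case 2
    then show ?thesis
      by (subst has_derivative_cong_open[OF W 2(1), of _ "\<lambda>_. 0"]) (use disj in auto)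
  next
    case 3
    have "(h has_derivative (\<lambda>v. 0)) (at z)" using pd_works[OF h] flat(2)[OF 3(1)] by simp
    then have "\<forall>e>0. \<exists>d>0. \<forall>y. norm (y - z) < d \<longrightarrow> norm (h y - h z - 0) \<le> e * norm (y - z)"
      unfolding has_derivative_at_alt by blast
    then have "\<forall>e>0. \<exists>d>0. \<forall>y. norm (y - z) < d \<longrightarrow> norm ((if y \<in> D then h y else 0) - 0 - 0) \<le> e * norm (y - z)"
      using flat(1)[OF 3(1)] by (smt (verit) diff_zero norm_ge_zero norm_zero zero_le_mult_iff)
    then show ?thesis using 3 unfolding has_derivative_at_alt by (simp add: bounded_linear_zero)
  qed
qed

text \<open>Cutting off commutes with differentiation when \<open>h\<close> is flat on
  \<open>S\<close>, and the derivatives of \<open>h\<close> are flat again, so the induction on the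
  order runs over all flat functions.\<close>

lemma cut_flat:
  assumes X: "open X" "X = D \<union> S \<union> W" and D: "open D" and W: "open W" and disj: "D \<inter> S = {}" "D \<inter> W = {}"
    and h: "smooth_on h X" "\<And>k. van k S h"
  shows "smooth_on (\<lambda>z. if z \<in> D then h z else 0) X"
    and "z \<in> X \<Longrightarrow> pd v (\<lambda>z. if z \<in> D then h z else 0) z = (if z \<in> D then pd v h z else 0)"
proof -
  have der: "((\<lambda>z. if z \<in> D then h z else 0) has_derivative (\<lambda>v. if z \<in> D then pd v h z else 0)) (at z)"
    if h: "smooth_on h X" "\<And>k. van k S h" and z: "z \<in> X" for h z
  proof (rule cut_flat_has_derivative[OF D W _ disj smooth_on_differentiable[OF h(1) z]])
    show "z \<in> D \<union> S \<union> W" using z X by blast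
    show "h z = 0" if "z \<in> S" using h(2)[of 1] that by simp
    have "van (Suc (Suc 0)) S h" by (rule h(2))
    then show "pd v h z = 0" if "z \<in> S" for v
      using that unfolding van.simps(2)[of "Suc 0"] van.simps(2)[of 0] by blast
  qed
  then show "z \<in> X \<Longrightarrow> pd v (\<lambda>z. if z \<in> D then h z else 0) z = (if z \<in> D then pd v h z else 0)"
    using pd_eqI[OF der] h by blast
  have "Ck_on k (\<lambda>z. if z \<in> D then h z else 0) X" for k
    using h
  proof (induction k arbitrary: h)
    case 0
    then show ?case using der[OF 0]
      by (auto intro!: continuous_at_imp_continuous_on has_derivative_continuous)
  next
    case (Suc k)
    have vp: "van j S (pd v h)" for j v using Suc.prems(2)[of "Suc j"] unfolding van.simps(2) by blast
    have "Ck_on k (\<lambda>z. if z \<in> D then pd v h z else 0) X" for v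
      by (rule Suc.IH[OF smooth_on_pd[OF Suc.prems(1)] vp])
    then have "Ck_on k (pd v (\<lambda>z. if z \<in> D then h z else 0)) X" for v
      by (rule Ck_on_eq[OF _ X(1)]) (rule pd_eqI[OF der[OF Suc.prems]])
    then show ?case unfolding Ck_on_Suc using der[OF Suc.prems] differentiable_def by blast
  qed
  then show "smooth_on (\<lambda>z. if z \<in> D then h z else 0) X" by (simp add: smooth_on_def)
qed

lemma van_dop:
  assumes U: "open U" "S \<subseteq> U" and F: "smooth_on F U" "van (Suc k) S F"
  shows "van k S (dop c e F)"
proof -
  have "van k S (pd v F)" for v using F(2) unfolding van.simps(2) by blast
  then show ?thesis unfolding dop_def[abs_def]
    by (intro van_sum[OF U] van_bilinear'[OF bounded_bilinear_mult U] smooth_on_mult U smooth_on_const smooth_on_pd F)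
qed

section \<open>Quaternionic lines and the operators along them\<close>

definition slice :: "quat \<Rightarrow> quat \<Rightarrow> quat \<Rightarrow> quat2" where "slice c1 c2 w = (c1 * w, c2 * w)"

lemma bounded_linear_slice: "bounded_linear (slice c1 c2)"
  unfolding slice_def[abs_def] by (intro bounded_linear_Pair bounded_linear_mult_right)

lemma norm_slice: "norm (slice c1 c2 w) = norm (c1, c2) * norm w"
  by (simp add: slice_def norm_Pair norm_quat_mult power_mult_distrib real_sqrt_mult flip: distrib_right)

text \<open>The constants of \<open>slice\<close> multiply from the left. With this order the left
  Fueter operator along the line is a combination of the two components of \<open>dbar\<close> with
  constant left coefficients, so it is known as soon as \<open>dbar F\<close> is.\<close>

lemma dop_slice:
  assumes "F differentiable (at z)"
  shows "dop qunit (\<lambda>\<alpha>. slice c1 c2 (qunit \<alpha>)) F z = qcnj c1 * dop qunit e_x F z + qcnj c2 * dop qunit e_y F z"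
proof -
  note lin = pd_linear[OF assms]
  have px: "(q, 0) = qRe q *\<^sub>R e_x 0 + qIm1 q *\<^sub>R e_x (Suc 0) + qIm2 q *\<^sub>R e_x 2 + qIm3 q *\<^sub>R e_x 3"
    and py: "(0, q) = qRe q *\<^sub>R e_y 0 + qIm1 q *\<^sub>R e_y (Suc 0) + qIm2 q *\<^sub>R e_y 2 + qIm3 q *\<^sub>R e_y 3" for q
    by (simp_all add: e_x_def e_y_def qunit_simps prod_eq_iff quat_eq_iff)
  have s: "pd (slice c1 c2 w) F z = pd (c1 * w, 0) F z + pd (0, c2 * w) F z" for w
    using linear_add[OF lin, of "(c1 * w, 0)" "(0, c2 * w)"] by (simp add: slice_def)
  show ?thesis
    unfolding dop_def s px[of "c1 * _"] py[of "c2 * _"] lessThan_4 linear_add[OF lin] linear_scale[OF lin]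
    by (simp add: qunit_simps quat_eq_iff) (simp add: algebra_simps)
qed

text \<open>Orthogonality for all \<open>w\<close> is the single quaternionic equation
  \<open>qcnj (fst a) * c1 + qcnj (snd a) * c2 = 0\<close> in two unknowns; in the second case it is
  solved with a real \<open>c1\<close>.\<close>

lemma exists_tangent_slice:
  assumes "a \<noteq> (0 :: quat2)"
  obtains c1 c2 where "(c1, c2) \<noteq> (0 :: quat2)" "\<And>w. a \<bullet> slice c1 c2 w = 0"
proof (cases "snd a = 0")
  case True
  then show ?thesis by (intro that[of 0 1]) (auto simp: slice_def inner_prod_def zero_prod_def)
next
  case False
  define c1 where "c1 = (of_real ((norm (snd a))\<^sup>2) :: quat)"
  define c2 where "c2 = - snd a * qcnj (fst a)"
  have "c1 \<noteq> 0" unfolding c1_def of_real_eq_0_iff using False by simp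
  moreover have "a \<bullet> slice c1 c2 w = 0" for w
    by (simp add: slice_def inner_prod_def c1_def c2_def inner_quat_def norm_quat_def of_real_def algebra_simps)
  ultimately show ?thesis using that[of c1 c2] by (simp add: zero_prod_def)
qed

lemma sum_Basis_quat: "(\<Sum>b\<in>Basis. f b) = (\<Sum>\<alpha><4. f (qunit \<alpha>))"
  unfolding lessThan_4 by (simp add: Basis_quat_def qunit_def add_ac)

lemma laplace_quat2: "laplace F z = lap e_x F z + lap e_y F z"
proof -
  have "laplace F z = (\<Sum>b\<in>(\<lambda>u. (u, 0)) ` Basis. pd b (pd b F) z) + (\<Sum>b\<in>(\<lambda>u. (0, u)) ` Basis. pd b (pd b F) z)"
    unfolding laplace_def Basis_prod_def by (rule sum.union_disjoint) auto
  also have "\<dots> = (\<Sum>b\<in>Basis. pd (b, 0) (pd (b, 0) F) z) + (\<Sum>b\<in>Basis. pd (0, b) (pd (0, b) F) z)"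
    by (simp add: sum.reindex inj_on_def)
  finally show ?thesis unfolding sum_Basis_quat lap_def e_x_def e_y_def .
qed

lemma laplace_along_slice:
  assumes X: "open X" "\<And>z w. z \<in> X \<Longrightarrow> z + slice c1 c2 w \<in> X" and g: "smooth_on g X" and z: "z \<in> X"
  shows "smooth_on (\<lambda>w. g (z + slice c1 c2 w)) UNIV"
    and "laplace (\<lambda>w. g (z + slice c1 c2 w)) w = lap (\<lambda>\<alpha>. slice c1 c2 (qunit \<alpha>)) g (z + slice c1 c2 w)"
proof -
  let ?L = "slice c1 c2"
  show sm: "smooth_on (\<lambda>w. g (z + ?L w)) UNIV"
    by (rule smooth_on_compose[OF g _ open_UNIV X(1)])
      (use X(2)[OF z] smooth_on_add[OF open_UNIV smooth_on_const smooth_on_linear[OF bounded_linear_slice]] in auto)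
  have p: "pd b (\<lambda>w. h (z + ?L w)) w = pd (?L b) h (z + ?L w)" if h: "smooth_on h X" for h :: "quat2 \<Rightarrow> quat" and b w
  proof -
    have "((\<lambda>w. z + ?L w) has_derivative ?L) (at w)"
      using bounded_linear_imp_has_derivative[OF bounded_linear_slice] by (auto intro!: derivative_eq_intros)
    from pd_eqI[OF diff_chain_at[OF this smooth_on_has_derivative[OF h X(2)[OF z]]], of b]
    show ?thesis by (simp add: o_def)
  qed
  have "pd b (pd b (\<lambda>w. g (z + ?L w))) w = pd (?L b) (pd (?L b) g) (z + ?L w)" for b
  proof -
    have "pd b (\<lambda>w. g (z + ?L w)) = (\<lambda>w. pd (?L b) g (z + ?L w))" using p[OF g] by blast
    then show ?thesis using p[OF smooth_on_pd[OF g]] by simp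
  qed
  then show "laplace (\<lambda>w. g (z + ?L w)) w = lap (\<lambda>\<alpha>. ?L (qunit \<alpha>)) g (z + ?L w)"
    by (simp add: laplace_def lap_def sum_Basis_quat)
qed

context slice_kernel
begin

lemma slice_conv_integrable:
  fixes H :: "'z \<Rightarrow> 'c::euclidean_space"
  assumes H: "continuous_on X H" "\<And>z. z \<in> X \<Longrightarrow> norm z > R \<Longrightarrow> H z = 0" and z: "z \<in> X"
  shows "integrable lborel (\<lambda>w. k w *\<^sub>R H (z + L w))"
proof -
  define r where "r = (norm z + R) / \<delta>"
  have r: "\<delta> * r = norm z + R" using \<delta>(1) by (simp add: r_def)
  have "continuous_on (cball 0 r) (\<lambda>w. H (z + L w))"
    by (intro continuous_on_compose2[OF H(1)] continuous_intros linear_continuous_on L) (use X(2)[OF z] in auto)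
  from set_integrable_continuous_mult[OF compact_cball k[of r] this]
  have "integrable lborel (\<lambda>w. indicat_real (cball 0 r) w *\<^sub>R (k w *\<^sub>R H (z + L w)))"
    unfolding set_integrable_def .
  moreover have "indicat_real (cball 0 r) w *\<^sub>R (k w *\<^sub>R H (z + L w)) = k w *\<^sub>R H (z + L w)" for w
  proof (cases "norm w \<le> r")
    case False
    then have "\<delta> * r < \<delta> * norm w" using \<delta>(1) by simp
    also have "\<dots> \<le> norm (L w)" by (rule \<delta>(2))
    also have "\<dots> \<le> norm (z + L w) + norm z" by (metis add_diff_cancel_left' norm_triangle_ineq4)
    finally have "norm (z + L w) > R" using r by linarith
    then show ?thesis using H(2)[OF X(2)[OF z]] by simp
  qed simp
  ultimately show ?thesis by (simp only:)
qed

end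

lemma dop_slice_conv:
  assumes "slice_kernel k L \<delta> X" and H: "smooth_on H X" "\<And>z. z \<in> X \<Longrightarrow> norm z > R \<Longrightarrow> H z = 0" and z: "z \<in> X"
  shows "dop c e (slice_conv k L H) z = slice_conv k L (dop c e H) z"
proof -
  interpret slice_kernel k L \<delta> X by fact
  have i: "integrable lborel (\<lambda>w. k w *\<^sub>R pd v H (z + L w))" for v
    by (rule slice_conv_integrable[OF smooth_on_continuous_on[OF smooth_on_pd[OF H(1)]] pd_eq_0_outside[OF H(2)] z])
  have p: "pd v (slice_conv k L H) z = (LINT w|lborel. k w *\<^sub>R pd v H (z + L w))" for v
    by (rule trans[OF pd_slice_conv[OF H z] slice_conv_def])
  have "dop c e (slice_conv k L H) z = (\<Sum>\<alpha><4. c \<alpha> * (LINT w|lborel. k w *\<^sub>R pd (e \<alpha>) H (z + L w)))"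
    unfolding dop_def p ..
  also have "\<dots> = (\<Sum>\<alpha><4. LINT w|lborel. c \<alpha> * (k w *\<^sub>R pd (e \<alpha>) H (z + L w)))"
    using integral_bounded_linear[OF bounded_linear_mult_right i] by simp
  also have "\<dots> = (LINT w|lborel. (\<Sum>\<alpha><4. c \<alpha> * (k w *\<^sub>R pd (e \<alpha>) H (z + L w))))"
    by (rule Bochner_Integration.integral_sum[symmetric]) (intro integrable_mult_right i)
  finally show ?thesis by (simp add: slice_conv_def dop_def scaleR_sum_right)
qed

section \<open>Extension of admissible functions\<close>

lemma dop_add:
  assumes "F differentiable (at z)" "G differentiable (at z)"
  shows "dop c e (\<lambda>z. F z + G z) z = dop c e F z + dop c e G z"
  unfolding dop_def pd_add[OF assms] by (simp add: distrib_left sum.distrib)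

lemma dop_diff:
  assumes "F differentiable (at z)" "G differentiable (at z)"
  shows "dop c e (\<lambda>z. F z - G z) z = dop c e F z - dop c e G z"
  unfolding dop_def pd_diff[OF assms] by (simp add: right_diff_distrib sum_subtractf)

lemma dop_scaleR_const:
  assumes "F differentiable (at z)"
  shows "dop c e (\<lambda>z. r *\<^sub>R F z) z = r *\<^sub>R dop c e F z"
  unfolding dop_def pd_linear_comp[OF bounded_linear_scaleR_right assms] by (simp add: scaleR_sum_right)

lemma dop_scaleR:
  assumes "g differentiable (at z)" "F differentiable (at z)"
  shows "dop qunit e (\<lambda>z. g z *\<^sub>R F z) z = g z *\<^sub>R dop qunit e F z + grad_q g e z * F z"
  unfolding dop_def grad_q_def pd_scaleR[OF assms]
  by (simp add: distrib_left sum.distrib scaleR_sum_right sum_distrib_right)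

lemma grad_q_nonzero:
  assumes \<rho>: "\<rho> differentiable (at z)" and v: "pd v \<rho> z \<noteq> 0"
  shows "(norm (grad_q \<rho> e_x z))\<^sup>2 + (norm (grad_q \<rho> e_y z))\<^sup>2 \<noteq> 0"
proof
  assume z: "(norm (grad_q \<rho> e_x z))\<^sup>2 + (norm (grad_q \<rho> e_y z))\<^sup>2 = 0"
  have "(\<Sum>\<alpha><4. (pd (e_x \<alpha>) \<rho> z)\<^sup>2) = 0" "(\<Sum>\<alpha><4. (pd (e_y \<alpha>) \<rho> z)\<^sup>2) = 0"
    unfolding norm_grad_q[symmetric] using z by (simp_all add: sum_power2_eq_zero_iff)
  then have e: "pd (e_x \<alpha>) \<rho> z = 0" "pd (e_y \<alpha>) \<rho> z = 0" if "\<alpha> < 4" for \<alpha>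
    using that by (simp_all add: sum_nonneg_eq_0_iff)
  have "pd b \<rho> z = 0" if "b \<in> Basis" for b
  proof -
    have B: "\<exists>\<alpha><4. q = qunit \<alpha>" if "q \<in> Basis" for q
      using that unfolding Basis_quat_def qunit_def
      by (elim insertE emptyE) (auto intro: exI[of _ 0] exI[of _ 1] exI[of _ 2] exI[of _ 3])
    from that have "b \<in> (\<lambda>u. (u, 0)) ` Basis \<or> b \<in> (\<lambda>u. (0, u)) ` Basis" unfolding Basis_prod_def by blast
    then show ?thesis
    proof
      assume "b \<in> (\<lambda>u. (u, 0)) ` Basis"
      then obtain q where "b = (q, 0)" "q \<in> Basis" by (rule imageE)
      then show ?thesis using e(1) B[of q] unfolding e_x_def by blast
    next
      assume "b \<in> (\<lambda>u. (0, u)) ` Basis"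
      then obtain q where "b = (0, q)" "q \<in> Basis" by (rule imageE)
      then show ?thesis using e(2) B[of q] unfolding e_y_def by blast
    qed
  qed
  then show False using v pd_expand[OF \<rho>, of v] by simp
qed

text \<open>Normalised so that \<open>\<rho>\<close> itself has \<open>normal_dbar\<close> equal to \<open>1\<close>.\<close>

definition normal_dbar :: "(quat2 \<Rightarrow> real) \<Rightarrow> (quat2 \<Rightarrow> quat) \<Rightarrow> quat2 \<Rightarrow> quat" where
  "normal_dbar \<rho> F z = inverse ((norm (grad_q \<rho> e_x z))\<^sup>2 + (norm (grad_q \<rho> e_y z))\<^sup>2) *\<^sub>R
     (qcnj (grad_q \<rho> e_x z) * dop qunit e_x F z + qcnj (grad_q \<rho> e_y z) * dop qunit e_y F z)"

lemma normal_dbar_add: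
  assumes "F differentiable (at z)" "G differentiable (at z)"
  shows "normal_dbar \<rho> (\<lambda>z. F z + G z) z = normal_dbar \<rho> F z + normal_dbar \<rho> G z"
  unfolding normal_dbar_def dop_add[OF assms] by (simp add: algebra_simps)

text \<open>The commutator of \<open>normal_dbar \<rho>\<close> with multiplication by
  \<open>\<rho>\<close> is the identity, so this operator acts on formal power series in
  \<open>\<rho>\<close> like a derivative with respect to \<open>\<rho>\<close>.\<close>

lemma normal_dbar_mult:
  assumes "\<rho> differentiable (at z)" "F differentiable (at z)"
    and "(norm (grad_q \<rho> e_x z))\<^sup>2 + (norm (grad_q \<rho> e_y z))\<^sup>2 \<noteq> 0"
  shows "normal_dbar \<rho> (\<lambda>z. \<rho> z *\<^sub>R F z) z = F z + \<rho> z *\<^sub>R normal_dbar \<rho> F z"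
proof -
  let ?n1 = "grad_q \<rho> e_x z" and ?n2 = "grad_q \<rho> e_y z"
  have "qcnj ?n1 * (?n1 * F z) + qcnj ?n2 * (?n2 * F z) = ((norm ?n1)\<^sup>2 + (norm ?n2)\<^sup>2) *\<^sub>R F z"
    unfolding mult.assoc[symmetric] qcnj_mult_self by (simp only: of_real_def scaleR_add_left) simp
  then have "F z = inverse ((norm ?n1)\<^sup>2 + (norm ?n2)\<^sup>2) *\<^sub>R (qcnj ?n1 * (?n1 * F z) + qcnj ?n2 * (?n2 * F z))"
    using assms(3) by simp
  moreover have "normal_dbar \<rho> (\<lambda>z. \<rho> z *\<^sub>R F z) z =
      inverse ((norm ?n1)\<^sup>2 + (norm ?n2)\<^sup>2) *\<^sub>R (qcnj ?n1 * (?n1 * F z) + qcnj ?n2 * (?n2 * F z)) +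
      \<rho> z *\<^sub>R normal_dbar \<rho> F z"
    unfolding normal_dbar_def dop_scaleR[OF assms(1,2)] by (simp add: algebra_simps)
  ultimately show ?thesis by simp
qed

text \<open>A formal Cauchy problem: the equation is transversal to \<open>S\<close>, so a power
  series in \<open>\<rho>\<close> with prescribed value \<open>F0\<close> on \<open>S\<close> solves
  it, and Borel summation turns the series into a function.\<close>

lemma exists_flat_normal_dbar:
  assumes def: "defining_function S U \<rho>" and F0: "smooth_on F0 U"
    and nz: "\<And>z. z \<in> U \<Longrightarrow> (norm (grad_q \<rho> e_x z))\<^sup>2 + (norm (grad_q \<rho> e_y z))\<^sup>2 \<noteq> 0"
  obtains F where "smooth_on F U" "\<And>z. z \<in> S \<Longrightarrow> F z = F0 z"
    "\<And>k. van k S (\<lambda>z. qcnj (grad_q \<rho> e_x z) * dop qunit e_x F z + qcnj (grad_q \<rho> e_y z) * dop qunit e_y F z)"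
proof -
  have U: "open U" "S \<subseteq> U" and \<rho>: "smooth_on \<rho> U" "\<And>z. z \<in> S \<Longrightarrow> \<rho> z = 0"
    using def unfolding defining_function_def by auto
  let ?M = "normal_dbar \<rho>"
  define nn where "nn z = (norm (grad_q \<rho> e_x z))\<^sup>2 + (norm (grad_q \<rho> e_y z))\<^sup>2" for z
  have nn: "smooth_on nn U" unfolding nn_def power2_norm_eq_inner
    by (intro smooth_on_add smooth_on_inner smooth_on_grad_q U \<rho>)
  have nni: "smooth_on (\<lambda>z. inverse (nn z)) U" by (rule smooth_on_inverse[OF U(1) nn]) (use nz in \<open>simp add: nn_def\<close>)
  have q: "smooth_on (\<lambda>z. qcnj (grad_q \<rho> e z)) U" for e
    by (intro smooth_on_linear_comp[OF bounded_linear_qcnj] smooth_on_grad_q U \<rho>)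
  have smN: "smooth_on (\<lambda>z. qcnj (grad_q \<rho> e_x z) * dop qunit e_x F z + qcnj (grad_q \<rho> e_y z) * dop qunit e_y F z) U"
    if "smooth_on F U" for F
    by (intro smooth_on_add smooth_on_mult q smooth_on_dop U that)
  have smM: "smooth_on (?M F) U" if "smooth_on F U" for F
    unfolding normal_dbar_def[abs_def] nn_def[symmetric] by (intro smooth_on_scaleR nni smN U that)
  have vanM: "van m S (?M F)" if F: "smooth_on F U" "van (Suc m) S F" for m F
    unfolding normal_dbar_def[abs_def] nn_def[symmetric]
    by (intro van_bilinear'[OF bounded_bilinear_scaleR U nni] smN van_add[OF U] smooth_on_mult q
        smooth_on_dop van_bilinear'[OF bounded_bilinear_mult U q] van_dop[OF U] F U)
  have smp: "smooth_on (\<lambda>z. \<rho> z ^ k *\<^sub>R F z) U" if "smooth_on F U" for F :: "quat2 \<Rightarrow> quat" and k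
    by (intro smooth_on_scaleR smooth_on_power U \<rho> that)
  note D = smooth_on_differentiable
  have Mp: "?M (\<lambda>z. \<rho> z ^ k *\<^sub>R F z) z = (real k * \<rho> z ^ (k - 1)) *\<^sub>R F z + \<rho> z ^ k *\<^sub>R ?M F z"
    if F: "smooth_on F U" and z: "z \<in> U" for F z k
  proof (induction k)
    case (Suc k)
    have "?M (\<lambda>z. \<rho> z ^ Suc k *\<^sub>R F z) z = ?M (\<lambda>z. \<rho> z *\<^sub>R (\<rho> z ^ k *\<^sub>R F z)) z" by simp
    also have "\<dots> = \<rho> z ^ k *\<^sub>R F z + \<rho> z *\<^sub>R ?M (\<lambda>z. \<rho> z ^ k *\<^sub>R F z) z"
      by (rule normal_dbar_mult[OF D[OF \<rho>(1) z] D[OF smp[OF F] z] nz[OF z]])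
    also have "\<dots> = (\<rho> z ^ k + real k * (\<rho> z * \<rho> z ^ (k - 1))) *\<^sub>R F z + \<rho> z ^ Suc k *\<^sub>R ?M F z"
      unfolding Suc by (simp add: algebra_simps)
    also have "real k * (\<rho> z * \<rho> z ^ (k - 1)) = real k * \<rho> z ^ k" by (cases k) auto
    finally show ?case by (simp add: algebra_simps)
  qed simp
  \<comment> \<open>The formal solution \<open>\<Sum>\<^sub>k (-\<rho>)\<^sup>k / k! \<cdot> M\<^sup>k F0\<close> of \<open>M F = 0\<close>: the partial sums telescope.\<close>
  define c where "c = rec_nat F0 (\<lambda>k c. \<lambda>z. (- 1 / (real k + 1)) *\<^sub>R ?M c z)"
  have c0: "c 0 = F0" and cS: "c (Suc k) = (\<lambda>z. (- 1 / (real k + 1)) *\<^sub>R ?M (c k) z)" for k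
    by (simp_all add: c_def)
  have c: "smooth_on (c k) U" for k
    by (induction k) (simp_all only: c0 cS F0 smooth_on_scaleR[OF U(1) smooth_on_const smM])
  have sms: "smooth_on (\<lambda>z. \<Sum>k\<le>m. \<rho> z ^ k *\<^sub>R c k z) U" for m
    by (intro smooth_on_sum smp c U)
  have Ms: "?M (\<lambda>z. \<Sum>k\<le>m. \<rho> z ^ k *\<^sub>R c k z) z = \<rho> z ^ m *\<^sub>R ?M (c m) z" if z: "z \<in> U" for z m
  proof (induction m)
    case (Suc m)
    have "?M (\<lambda>z. \<Sum>k\<le>Suc m. \<rho> z ^ k *\<^sub>R c k z) z = ?M (\<lambda>z. (\<Sum>k\<le>m. \<rho> z ^ k *\<^sub>R c k z) + \<rho> z ^ Suc m *\<^sub>R c (Suc m) z) z"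
      by simp
    also have "\<dots> = \<rho> z ^ m *\<^sub>R ?M (c m) z + ((real (Suc m) * \<rho> z ^ m) *\<^sub>R c (Suc m) z + \<rho> z ^ Suc m *\<^sub>R ?M (c (Suc m)) z)"
      unfolding normal_dbar_add[OF D[OF sms z] D[OF smp[OF c] z]] Suc Mp[OF c z] by simp
    also have "(real (Suc m) * \<rho> z ^ m) *\<^sub>R c (Suc m) z = - (\<rho> z ^ m *\<^sub>R ?M (c m) z)"
    proof -
      have "real (Suc m) * \<rho> z ^ m * (- 1 / (real m + 1)) = - (\<rho> z ^ m)" by (simp add: field_simps)
      then show ?thesis unfolding cS by (simp only: scaleR_scaleR) simp
    qed
    finally show ?case by simp
  qed (simp add: c0)
  have "\<exists>F. smooth_on F U \<and> (\<forall>m. van (Suc m) S (\<lambda>z. F z - (\<Sum>k\<le>m. \<rho> z ^ k *\<^sub>R c k z)))"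
  proof (rule borel_formal_sum[where c = c, OF U \<rho> c])
    fix F assume "smooth_on F U" "\<And>m. van (Suc m) S (\<lambda>z. F z - (\<Sum>k\<le>m. \<rho> z ^ k *\<^sub>R c k z))"
    then show ?thesis by (intro exI[of _ F] conjI allI)
  qed
  then obtain F where F: "smooth_on F U" and FS: "\<And>m. van (Suc m) S (\<lambda>z. F z - (\<Sum>k\<le>m. \<rho> z ^ k *\<^sub>R c k z))"
    by (elim exE conjE) (rule that, simp only:, simp only:)
  \<comment> \<open>The difference of \<open>F\<close> and a partial sum vanishes to order
    \<open>m + 1\<close> and \<open>?M\<close> costs one order; on the partial sum itself
    \<open>?M\<close> leaves a multiple of \<open>\<rho> z ^ m\<close>.\<close>
  have vM: "van m S (?M F)" for m
  proof -
    let ?s = "\<lambda>z. \<Sum>k\<le>m. \<rho> z ^ k *\<^sub>R c k z"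
    have d: "smooth_on (\<lambda>z. F z - ?s z) U" by (intro smooth_on_diff F sms U)
    have "van m S (\<lambda>z. ?M (\<lambda>z. F z - ?s z) z + \<rho> z ^ m *\<^sub>R ?M (c m) z)"
      by (intro van_add[OF U] smM d smp c vanM FS van_power_scaleR[OF U \<rho>])
    then show ?thesis
    proof (rule van_eq[OF _ U])
      fix z assume z: "z \<in> U"
      show "?M F z = ?M (\<lambda>z. F z - ?s z) z + \<rho> z ^ m *\<^sub>R ?M (c m) z"
        using normal_dbar_add[OF D[OF d z] D[OF sms[of m] z], of \<rho>] Ms[OF z, of m] by simp
    qed
  qed
  show ?thesis
  proof (rule that[OF F])
    show "F z = F0 z" if "z \<in> S" for z
      using FS[of 0] that unfolding van.simps(2)[of 0] by (simp add: c0)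
    show "van k S (\<lambda>z. qcnj (grad_q \<rho> e_x z) * dop qunit e_x F z + qcnj (grad_q \<rho> e_y z) * dop qunit e_y F z)" for k
      by (rule van_eq[OF van_bilinear'[OF bounded_bilinear_scaleR U nn smM[OF F] vM] U])
        (use nz in \<open>simp add: normal_dbar_def nn_def\<close>)
  qed
qed

lemma exists_smooth_extension:
  fixes S U X :: "'a::euclidean_space set" and F :: "'a \<Rightarrow> 'b::euclidean_space"
  assumes X: "open X" and S: "closedin (top_of_set X) S" "S \<noteq> {}" and U: "open U" "S \<subseteq> U" "U \<subseteq> X" and F: "smooth_on F U"
  obtains G V where "smooth_on G X" "open V" "S \<subseteq> V" "V \<subseteq> U" "\<And>z. z \<in> V \<Longrightarrow> G z = F z"
proof (cases "U = X")
  case True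
  then show ?thesis using that F U by blast
next
  case False
  obtain \<psi> :: "'a \<Rightarrow> real" and V V' where \<psi>: "smooth_on \<psi> X" and V: "open V" "S \<subseteq> V" "V \<subseteq> U" "\<And>z. z \<in> V \<Longrightarrow> \<psi> z = 1"
    and V': "open V'" "X - U \<subseteq> V'" "\<And>z. z \<in> V' \<Longrightarrow> \<psi> z = 0"
    using smooth_cutoff[OF X S U False] by blast
  define G where "G z = (if z \<in> U then \<psi> z *\<^sub>R F z else 0)" for z
  have "smooth_on G X"
  proof (rule smooth_on_local_cong)
    fix z assume z: "z \<in> X"
    show "\<exists>V G'. open V \<and> z \<in> V \<and> smooth_on G' V \<and> (\<forall>w\<in>V. G w = G' w)"
    proof (cases "z \<in> U")
      case True
      have "smooth_on (\<lambda>z. \<psi> z *\<^sub>R F z) U" by (intro smooth_on_scaleR smooth_on_subset[OF \<psi>] F U)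
      then show ?thesis using True U by (intro exI[of _ U] exI[of _ "\<lambda>z. \<psi> z *\<^sub>R F z"]) (simp add: G_def)
    next
      case False
      then have "z \<in> V'" using V' z by blast
      then show ?thesis using V' by (intro exI[of _ V'] exI[of _ "\<lambda>_. 0"]) (simp add: G_def smooth_on_const)
    qed
  qed
  then show ?thesis
    by (rule that[OF _ V(1-3)]) (use V in \<open>auto simp: G_def\<close>)
qed

lemma cut_flat_lap:
  assumes X: "open X" "X = D \<union> S \<union> W" and D: "open D" and W: "open W" and disj: "D \<inter> S = {}" "D \<inter> W = {}"
    and h: "smooth_on h X" "\<And>k. van k S h" and z: "z \<in> X"
  shows "lap e (\<lambda>z. if z \<in> D then h z else 0) z = (if z \<in> D then lap e h z else 0)"
proof -
  have "pd v (pd v (\<lambda>z. if z \<in> D then h z else 0)) z = (if z \<in> D then pd v (pd v h) z else 0)" for v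
  proof -
    have vp: "van j S (pd v h)" for j v using h(2)[of "Suc j"] unfolding van.simps(2) by blast
    have "pd v (pd v (\<lambda>z. if z \<in> D then h z else 0)) z = pd v (\<lambda>z. if z \<in> D then pd v h z else 0) z"
      by (rule pd_cong[OF X(1) z cut_flat(2)[OF X D W disj h]])
    then show ?thesis using cut_flat(2)[OF X D W disj smooth_on_pd[OF h(1)] vp z] by simp
  qed
  then show ?thesis by (simp add: lap_def)
qed

text \<open>The jump of \<open>dbar F\<close> across \<open>S\<close> is removed by a fundamental solution that integrates over
  quaternionic lines parallel to the boundary of the half-space: these stay inside the half-space,
  so nothing has to be known about \<open>F\<close> outside it.\<close>

lemma exists_dbar_solution:
  assumes a: "a \<noteq> 0" and half: "X = {z. a \<bullet> z < b}" "X = D \<union> S \<union> W" and D: "open D" "\<And>z. z \<in> D \<Longrightarrow> norm z \<le> R" and W: "open W"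
    and disj: "D \<inter> S = {}" "D \<inter> W = {}" and F: "smooth_on F X"
    and flat: "\<And>k. van k S (dop qunit e_x F)" "\<And>k. van k S (dop qunit e_y F)"
  obtains u where "smooth_on u X"
    "\<And>z. z \<in> X \<Longrightarrow> dop qunit e_x u z = (if z \<in> D then dop qunit e_x F z else 0)"
    "\<And>z. z \<in> X \<Longrightarrow> dop qunit e_y u z = (if z \<in> D then dop qunit e_y F z else 0)"
    "\<And>z. a \<bullet> z < b \<Longrightarrow> a \<bullet> z < - (R * norm a) \<Longrightarrow> u z = 0"
proof -
  have oX: "open X" unfolding half(1) by (rule open_halfspace_lt)
  have SX: "S \<subseteq> X" using half(2) by blast
  note cf = cut_flat[OF oX half(2) D(1) W disj]
  obtain c1 c2 where c: "(c1, c2) \<noteq> (0 :: quat2)" "\<And>w. a \<bullet> slice c1 c2 w = 0"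
    using exists_tangent_slice[OF a] by blast
  let ?L = "slice c1 c2"
  define ec where "ec \<alpha> = ?L (qunit \<alpha>)" for \<alpha>
  have LX: "z + ?L w \<in> X" if "z \<in> X" for z w using that c(2) by (simp add: half(1) inner_add_right)
  have sk: "slice_kernel newton ?L (norm (c1, c2)) X"
    by (rule slice_kernel.intro[OF set_integrable_newton bounded_linear_slice _ _ oX LX])
      (use c(1) in \<open>simp_all add: norm_slice\<close>)
  interpret slice_kernel newton ?L "norm (c1, c2)" X by (rule sk)
  \<comment> \<open>This second-order expression depends on \<open>dbar F\<close> only: it is the
    conjugate Fueter operator along the line applied to a combination of the components of
    \<open>dbar F\<close>. It is therefore flat on \<open>S\<close>.\<close>
  define h where "h = lap ec F"
  have hsm: "smooth_on h X" unfolding h_def by (rule smooth_on_lap[OF oX F])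
  have dsm: "smooth_on (dop qunit e F) X" for e by (rule smooth_on_dop[OF oX F])
  have hflat: "van k S h" for k
  proof -
    have "van (Suc k) S (\<lambda>z. qcnj c1 * dop qunit e_x F z + qcnj c2 * dop qunit e_y F z)"
      by (intro van_add[OF oX SX] smooth_on_mult smooth_on_const dsm oX flat van_bilinear'[OF bounded_bilinear_mult oX SX])
    then have "van (Suc k) S (dop qunit ec F)"
      by (rule van_eq[OF _ oX SX]) (simp add: ec_def[abs_def] dop_slice[OF smooth_on_differentiable[OF F]])
    then have "van k S (dop cunit ec (dop qunit ec F))" by (rule van_dop[OF oX SX dsm])
    then show ?thesis unfolding h_def by (rule van_eq[OF _ oX SX]) (simp add: dop_cunit_qunit[OF oX F])
  qed
  define H where "H z = (if z \<in> D then h z else 0)" for z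
  have H: "smooth_on H X" unfolding H_def[abs_def] by (rule cf(1)[OF hsm hflat])
  have H0: "H z = 0" if "z \<in> X" "norm z > R" for z using D(2)[of z] that by (auto simp: H_def)
  \<comment> \<open>Cancels the constant in \<open>newton_potential\<close>.\<close>
  define r where "r = - 1 / (8 * newton_const)"
  define u where "u z = r *\<^sub>R slice_conv newton ?L H z" for z
  have sc: "smooth_on (slice_conv newton ?L H) X" by (rule smooth_on_slice_conv[OF H H0])
  have du: "dop qunit e u z = (if z \<in> D then dop qunit e F z else 0)" if e: "\<And>k. van k S (dop qunit e F)" and z: "z \<in> X" for e z
  proof -
    define g where "g z = (if z \<in> D then dop qunit e F z else 0)" for z
    have g: "smooth_on g X" unfolding g_def[abs_def] by (rule cf(1)[OF dsm e])
    have gs: "smooth_on (\<lambda>w. g (z + ?L w)) UNIV" by (rule laplace_along_slice(1)[OF oX LX g z])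
    have la: "laplace (\<lambda>w. g (z + ?L w)) w = lap ec g (z + ?L w)" for w
      unfolding ec_def[abs_def] by (rule laplace_along_slice(2)[OF oX LX g z])
    \<comment> \<open>The compatibility condition for the cut-off data: \<open>dop qunit e\<close>
      commutes with the Laplacian along the line, and flatness lets both operators pass through the
      cut.\<close>
    have dH: "dop qunit e H y = lap ec g y" if y: "y \<in> X" for y
    proof -
      have "dop qunit e H y = (if y \<in> D then dop qunit e h y else 0)"
        unfolding dop_def H_def[abs_def] cf(2)[OF hsm hflat y] by simp
      also have "\<dots> = (if y \<in> D then lap ec (dop qunit e F) y else 0)"
        unfolding h_def lap_dop[OF oX F y] ..
      also have "\<dots> = lap ec g y"
        unfolding g_def[abs_def] by (rule cut_flat_lap[OF oX half(2) D(1) W disj dsm e y, symmetric])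
      finally show ?thesis .
    qed
    have g0: "g (z + ?L w) = 0" if "norm w > (norm z + R) / norm (c1, c2)" for w
    proof -
      have "norm z + R < norm (?L w)" using that c(1) by (simp add: norm_slice divide_less_eq mult.commute)
      also have "norm (?L w) \<le> norm (z + ?L w) + norm z" by (metis add_diff_cancel_left' norm_triangle_ineq4)
      finally have "norm (z + ?L w) > R" by simp
      then show ?thesis using D(2) unfolding g_def by fastforce
    qed
    have sd: "dop qunit e (slice_conv newton ?L H) z = slice_conv newton ?L (dop qunit e H) z"
      by (rule dop_slice_conv[OF sk H H0 z])
    have "dop qunit e u z = r *\<^sub>R slice_conv newton ?L (dop qunit e H) z"
      unfolding u_def[abs_def] dop_scaleR_const[OF smooth_on_differentiable[OF sc z]] sd ..
    also have "slice_conv newton ?L (dop qunit e H) z = (LINT w|lborel. newton w *\<^sub>R laplace (\<lambda>w. g (z + ?L w)) w)"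
      unfolding slice_conv_def la dH[OF LX[OF z]] ..
    also have "\<dots> = (- 8 * newton_const) *\<^sub>R g (z + ?L 0)" by (rule newton_potential[OF gs g0])
    also have "r *\<^sub>R \<dots> = g z" using newton_const_pos by (simp add: r_def slice_def flip: zero_prod_def)
    finally show ?thesis unfolding g_def .
  qed
  \<comment> \<open>The whole line through \<open>z\<close> stays on the level of \<open>z\<close>
    under \<open>a\<close>, which by the Cauchy-Schwarz inequality is too low to meet
    \<open>D\<close>.\<close>
  have "u z = 0" if "a \<bullet> z < - (R * norm a)" for z
  proof -
    have "H (z + ?L w) = 0" for w
    proof -
      have "z + ?L w \<notin> D"
      proof
        assume "z + ?L w \<in> D"
        then have "norm a * norm (z + ?L w) \<le> norm a * R" using D(2) by (simp add: mult_left_mono)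
        moreover have "a \<bullet> (z + ?L w) = a \<bullet> z" using c(2) by (simp add: inner_add_right)
        ultimately show False
          using that Cauchy_Schwarz_ineq2[of a "z + ?L w"] by (simp add: mult.commute abs_le_iff)
      qed
      then show ?thesis by (simp add: H_def)
    qed
    then show ?thesis by (simp add: u_def slice_conv_def)
  qed
  moreover have "smooth_on u X" unfolding u_def[abs_def] by (intro smooth_on_scaleR smooth_on_const sc oX)
  ultimately show ?thesis using that du[OF flat(1)] du[OF flat(2)] by blast
qed

theorem theorem2p11:
  fixes \<Sigma> S D W :: "quat2 set" and f :: "quat2 \<Rightarrow> quat" and a :: quat2 and b :: real
  assumes "a \<noteq> 0" and "\<Sigma> = {z. a \<bullet> z < b}"
    and "smooth_hypersurface S" and "connected S" and "closedin (top_of_set \<Sigma>) S"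
    and "components (\<Sigma> - S) = {D, W}" and "D \<noteq> W" and "bounded D"
    and "admissible S f"
  shows "\<exists>F. H_holomorphic_on F D \<and> smooth_map_on F (D \<union> S) \<and> (\<forall>z\<in>S. F z = f z)"
proof -
  have oX: "open \<Sigma>" and conX: "connected \<Sigma>"
    unfolding assms(2) by (auto intro: open_halfspace_lt convex_connected convex_halfspace_lt)
  have SX: "S \<subseteq> \<Sigma>" using assms(5) closedin_imp_subset by blast
  \<comment> \<open>The half-space is connected, so removing the empty set could not leave two
    components.\<close>
  have S0: "S \<noteq> {}"
  proof
    assume "S = {}"
    then have "components \<Sigma> = {D, W}" using assms(6) by simp
    moreover have "components \<Sigma> = {\<Sigma>}"
      using calculation conX by (subst components_eq_sing_iff) auto
    ultimately show False using assms(7) by (metis insertCI singletonD)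
  qed
  have oXS: "open (\<Sigma> - S)"
    using assms(5) oX openin_open_eq unfolding closedin_def by fastforce
  have DW: "D \<in> components (\<Sigma> - S)" "W \<in> components (\<Sigma> - S)" using assms(6) by auto
  have oD: "open D" and oW: "open W" using open_components[OF oXS] DW by auto
  have DWu: "D \<union> W = \<Sigma> - S" using Union_components[of "\<Sigma> - S"] assms(6) by simp
  then have Xu: "\<Sigma> = D \<union> S \<union> W" and disj: "D \<inter> S = {}" using SX by blast+
  have disj2: "D \<inter> W = {}" using components_nonoverlap[OF DW] assms(7) by blast
  obtain U0 \<rho> F0 A0 B0 where def0: "defining_function S U0 \<rho>" and F0: "smooth_on F0 U0" "\<forall>z\<in>S. F0 z = f z"
    using assms(9) unfolding admissible_def CRF_def by blast
  have U0: "open U0" "smooth_on \<rho> U0" "S = {z \<in> U0. \<rho> z = 0}" using def0 unfolding defining_function_def by blast+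
  define nn where "nn z = (norm (grad_q \<rho> e_x z))\<^sup>2 + (norm (grad_q \<rho> e_y z))\<^sup>2" for z
  \<comment> \<open>The gradient of \<open>\<rho>\<close> is known to be non-zero on
    \<open>S\<close> only; \<open>U\<close> is a neighbourhood of \<open>S\<close> in the half-space
    on which one may divide by its square.\<close>
  define U where "U = (U0 \<inter> \<Sigma>) \<inter> nn -` (- {0})"
  have "smooth_on nn U0" unfolding nn_def power2_norm_eq_inner
    by (intro smooth_on_add smooth_on_inner smooth_on_grad_q U0)
  then have "continuous_on (U0 \<inter> \<Sigma>) nn" using smooth_on_continuous_on continuous_on_subset by blast
  then have oU: "open U" unfolding U_def using U0(1) oX by (intro continuous_open_preimage) auto
  have nz: "nn z \<noteq> 0" if z: "z \<in> S" for z
  proof -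
    obtain v where "pd v \<rho> z \<noteq> 0" using def0 z unfolding defining_function_def pd_def by blast
    then show ?thesis
      unfolding nn_def using grad_q_nonzero smooth_on_differentiable[OF U0(2)] U0(3) z by blast
  qed
  have SU: "S \<subseteq> U" using nz SX U0(3) unfolding U_def by blast
  have UX: "U \<subseteq> \<Sigma>" "U \<subseteq> U0" unfolding U_def by blast+
  have def: "defining_function S U \<rho>"
  proof -
    have "S = {z \<in> U. \<rho> z = 0}" using SU UX U0(3) by blast
    then show ?thesis
      using def0 oU smooth_on_subset[OF U0(2) UX(2)] unfolding defining_function_def by blast
  qed
  have nzU: "(norm (grad_q \<rho> e_x z))\<^sup>2 + (norm (grad_q \<rho> e_y z))\<^sup>2 \<noteq> 0" if "z \<in> U" for z
    using that unfolding U_def nn_def by blast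
  obtain F1 where F1: "smooth_on F1 U" "\<And>z. z \<in> S \<Longrightarrow> F1 z = F0 z"
    and N: "\<And>k. van k S (\<lambda>z. qcnj (grad_q \<rho> e_x z) * dop qunit e_x F1 z + qcnj (grad_q \<rho> e_y z) * dop qunit e_y F1 z)"
    using exists_flat_normal_dbar[OF def smooth_on_subset[OF F0(1) UX(2)] nzU] by blast
  have F1f: "F1 z = f z" if "z \<in> S" for z using F1(2) F0(2) that by simp
  note v2 = admissible_dbar_van_2[OF def assms(9) F1(1) F1f nzU N]
  have F1flat: "van k S (dop qunit e_x F1) \<and> van k S (dop qunit e_y F1)" for k
    by (rule dbar_flat[OF def F1(1) nzU v2 N])
  \<comment> \<open>The flat extension exists only near \<open>S\<close>. A cut-off carries it to
    the whole half-space without changing it close to \<open>S\<close>, so its \<open>dbar\<close>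
    remains flat.\<close>
  obtain G V where G: "smooth_on G \<Sigma>" and V: "open V" "S \<subseteq> V" "V \<subseteq> U" "\<And>z. z \<in> V \<Longrightarrow> G z = F1 z"
    using exists_smooth_extension[OF oX assms(5) S0 oU SU UX(1) F1(1)] by blast
  have DG: "dop qunit e G z = dop qunit e F1 z" if "z \<in> V" for e z
    by (rule dop_cong[OF V(1) that V(4)])
  have Gflat: "van k S (dop qunit e_x G)" "van k S (dop qunit e_y G)" for k
    using F1flat[of k] by (auto intro: van_eq[OF _ V(1,2) DG])
  obtain R where R: "\<And>z. z \<in> D \<Longrightarrow> norm z \<le> R" using assms(8) unfolding bounded_iff by blast
  obtain u where u: "smooth_on u \<Sigma>"
    and ux: "\<And>z. z \<in> \<Sigma> \<Longrightarrow> dop qunit e_x u z = (if z \<in> D then dop qunit e_x G z else 0)"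
    and uy: "\<And>z. z \<in> \<Sigma> \<Longrightarrow> dop qunit e_y u z = (if z \<in> D then dop qunit e_y G z else 0)"
    and u0: "\<And>z. a \<bullet> z < b \<Longrightarrow> a \<bullet> z < - (R * norm a) \<Longrightarrow> u z = 0"
    using exists_dbar_solution[OF assms(1,2) Xu oD R oW disj disj2 G Gflat] by blast
  note clo = hypersurface_subset_closure_component[OF oX conX assms(5,4) S0 def UX(1)]
  have "closure D \<subseteq> cball 0 R" by (rule closure_minimal) (use R in auto)
  then have RS: "norm z \<le> R" if "z \<in> D \<union> S" for z using that R clo[OF DW(1)] by fastforce
  \<comment> \<open>Points below the level \<open>- (R * norm a)\<close> are too far from the origin
    to lie in \<open>D\<close> or \<open>S\<close>; they provide the open subset of \<open>W\<close>
    on which \<open>u\<close> is known to vanish.\<close>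
  define V1 where "V1 = {z. a \<bullet> z < min b (- (R * norm a))}"
  have V1W: "V1 \<subseteq> W"
  proof
    fix z assume z: "z \<in> V1"
    have "z \<notin> D \<union> S"
    proof
      assume "z \<in> D \<union> S"
      then have "norm a * norm z \<le> norm a * R" using RS by (simp add: mult_left_mono)
      then show False using z Cauchy_Schwarz_ineq2[of a z] by (simp add: V1_def mult.commute abs_le_iff)
    qed
    moreover have "z \<in> \<Sigma>" using z by (simp add: V1_def assms(2))
    ultimately show "z \<in> W" using Xu by blast
  qed
  have V1ne: "V1 \<noteq> {}"
  proof -
    define m where "m = min b (- (R * norm a)) - 1"
    have "a \<bullet> ((m / (a \<bullet> a)) *\<^sub>R a) = m" using assms(1) by simp
    moreover have "m < min b (- (R * norm a))" by (simp only: m_def)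
    ultimately have "(m / (a \<bullet> a)) *\<^sub>R a \<in> V1" unfolding V1_def mem_Collect_eq by (simp only:)
    then show ?thesis by blast
  qed
  have WX: "W \<subseteq> \<Sigma>" using Xu by blast
  have uW: "smooth_on u W" by (rule smooth_on_subset[OF u WX])
  have uW0: "u y = 0" if y: "y \<in> W" for y
  proof (rule harmonic_unique_continuation[OF oW in_components_connected[OF DW(2)] uW _ _ V1W V1ne _ y])
    show "open V1" unfolding V1_def by (rule open_halfspace_lt)
    show "u y = 0" if "y \<in> V1" for y using u0 that by (simp add: V1_def)
    \<comment> \<open>On \<open>W\<close> both components of \<open>dbar u\<close> vanish, and the
      full Laplacian is the sum of the two conjugate Fueter operators applied to them.\<close>
    show "laplace u y = 0" if y: "y \<in> W" for y
    proof -
      have "lap e u y = 0" if "\<And>z. z \<in> W \<Longrightarrow> dop qunit e u z = 0" for e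
      proof -
        have "lap e u y = dop cunit e (dop qunit e u) y" by (rule dop_cunit_qunit[OF oW uW y, symmetric])
        also have "\<dots> = dop cunit e (\<lambda>_. 0) y" by (rule dop_cong[OF oW y that])
        finally show ?thesis by (simp add: dop_def pd_const)
      qed
      moreover have "dop qunit e_x u z = 0 \<and> dop qunit e_y u z = 0" if "z \<in> W" for z
      proof -
        have "z \<in> \<Sigma>" "z \<notin> D" using that WX disj2 by blast+
        then show ?thesis using ux uy by simp
      qed
      ultimately show ?thesis unfolding laplace_quat2 by simp
    qed
  qed
  have uS0: "u z = 0" if z: "z \<in> S" for z
  proof -
    have "closure W \<inter> \<Sigma> \<inter> u -` {0} = closure W \<inter> \<Sigma>"
    proof -
      have "closedin (top_of_set \<Sigma>) (\<Sigma> \<inter> u -` {0})"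
        by (rule continuous_closedin_preimage[OF smooth_on_continuous_on[OF u]]) simp
      then obtain K where K: "closed K" "\<Sigma> \<inter> u -` {0} = \<Sigma> \<inter> K" using closedin_closed by metis
      have "W \<subseteq> K" using uW0 WX K(2) by blast
      then have "closure W \<subseteq> K" using K(1) closure_minimal by blast
      then show ?thesis using K(2) by blast
    qed
    then show ?thesis using clo[OF DW(2)] z SX by blast
  qed
  \<comment> \<open>Inside \<open>D\<close> the two \<open>dbar\<close> agree, and on
    \<open>S\<close> the correction \<open>u\<close> vanishes.\<close>
  define F where "F z = G z - u z" for z
  have F: "smooth_on F \<Sigma>" unfolding F_def by (intro smooth_on_diff oX G u)
  have DX: "D \<subseteq> \<Sigma>" using Xu by blast
  have "dbar F z = 0" if z: "z \<in> D" for z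
  proof -
    have zX: "z \<in> \<Sigma>" using z DX by blast
    have "dop qunit e F z = dop qunit e G z - dop qunit e u z" for e
      unfolding F_def[abs_def] by (rule dop_diff[OF smooth_on_differentiable[OF G zX] smooth_on_differentiable[OF u zX]])
    then show ?thesis unfolding dbar_dop by (simp add: ux[OF zX] uy[OF zX] z zero_prod_def)
  qed
  moreover have "Ck_on 1 F D" using smooth_on_subset[OF F DX] unfolding smooth_on_def by blast
  moreover have "smooth_map_on F (D \<union> S)"
    unfolding smooth_map_on_def using oX F SX DX by blast
  moreover have "F z = f z" if "z \<in> S" for z
    using uS0[OF that] V(4)[OF subsetD[OF V(2) that]] F1f[OF that] by (simp add: F_def)
  ultimately show ?thesis unfolding H_holomorphic_on_def by blast
qed

end
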